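(* Given strings $P$ and $S$, there is a data structure from which $\lambda\geq 2$, the length of a longest common scattered subsequence of $P$ and $S$, can be obtained, which uses $O(\ell)$ space, where $\ell$ is the number of matches between $P$ and $S$. The structure can be updated to represent the strings $P.c$ and $S$ in $O(\lambda+|S|)$ time, where $c$ is any letter; it can be updated to represent the strings $P$ and $S'$, where $S=c.S'$, in $O(\lambda(1+\log(\ell/\lambda)))$ time. A sequence of operations that starts with an empty string and appends letters to form the string $P$ requires $O(|P|\lambda+\ell)$ time in total. A sequence of operations that removes the first letter of $S$ repeatedly until it becomes empty requires $O\big(\min\{|S|,\ell\}\,\lambda\,(1+\log(\min\{\lambda,\ell/\lambda\}))+|S|\big)$ time in total.
   Context: For strings $X,Y$, $X.Y$ denotes concatenation and $|X|$ the length. A common scattered subsequence of $P$ and $S$ is a string obtainable from both $P$ and $S$ by deleting letters (not necessarily contiguous); equivalently a set of pairs $(i_1,j_1),\dots,(i_k,j_k)$ with $i_1<\dots<i_k$, $j_1<\dots<j_k$ and $P(i_t)=S(j_t)$. A match between $P$ and $S$ is a pair of positions $(i,j)$ with $P(i)=S(j)$, where $P(i)$ denotes the $i$-th letter of $P$.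
   Formalization: The input S is assumed to come with its match lists (last occurrence of the appended letter, previous occurrence of the same letter), readable in unit time and not counted in the O(ℓ) space; without them the O(|P|λ+ℓ) total for appends fails, since finding few matches in S needs |S| time. *)

theory Defs
  imports Complex_Main "HOL-Library.Sublist"
begin

section \<open>Longest common scattered subsequences and matches\<close>

definition lcs_length :: "'a list \<Rightarrow> 'a list \<Rightarrow> nat" where
  "lcs_length P S = Max {length X |X. subseq X P \<and> subseq X S}"

definition num_matches :: "'a list \<Rightarrow> 'a list \<Rightarrow> nat" where
  "num_matches P S = card {(i, j). i < length P \<and> j < length S \<and> P ! i = S ! j}"


section \<open>The machine model\<close>

text \<open>
  A unit-cost random access machine with words of logarithmic size. A machine state consists of
  a store of word variables (a program mentions only finitely many of them) and a heap of
  allocated blocks of words, addressed by a block name and an offset. Letters are opaque: they are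
  not words, and the only access to them is through the read-only input described below.

  The input consists of a text \<open>T\<close> and, during an append operation, of the letter that is appended.
  Positions in \<open>T\<close> are numbered from 1, and 0 stands for ``no position''. Besides comparisons of
  letters the input offers the match lists that the Hunt--Szymanski algorithm works with: the last
  occurrence in \<open>T\<close> of the appended letter, and for every position the previous position that holds
  the same letter. The input does not count as part of the space of a data structure.
\<close>

type_synonym 'a input = "'a list \<times> 'a option"

definition last_occ :: "'a list \<Rightarrow> 'a \<Rightarrow> nat" where
  "last_occ T c = Max (insert 0 {i. 1 \<le> i \<and> i \<le> length T \<and> T ! (i - 1) = c})"

definition prev_occ :: "'a list \<Rightarrow> nat \<Rightarrow> nat" where
  "prev_occ T j =
     Max (insert 0 {i. 1 \<le> i \<and> i < j \<and> j \<le> length T \<and> T ! (i - 1) = T ! (j - 1)})"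

type_synonym vname = nat

datatype aexp =
    Const nat
  | Var vname
  | Plus aexp aexp
  | Minus aexp aexp
  | Times aexp aexp
  | Div aexp aexp
  | TextLength
  | LastOcc
  | PrevOcc aexp

datatype bexp =
    Less aexp aexp
  | Equal aexp aexp
  | Neg bexp
  | Conj bexp bexp
  | SameLetter aexp aexp
  | IsAppended aexp

datatype com =
    Skip
  | Assign vname aexp
  | New vname aexp
  | Read vname aexp aexp
  | Write aexp aexp aexp
  | Free aexp
  | Seq com com
  | If bexp com com
  | While bexp com

primrec aval :: "'a input \<Rightarrow> (vname \<Rightarrow> nat) \<Rightarrow> aexp \<Rightarrow> nat" where
  "aval I v (Const n) = n"
| "aval I v (Var x) = v x"
| "aval I v (Plus a b) = aval I v a + aval I v b"
| "aval I v (Minus a b) = aval I v a - aval I v b"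
| "aval I v (Times a b) = aval I v a * aval I v b"
| "aval I v (Div a b) = aval I v a div aval I v b"
| "aval I v TextLength = length (fst I)"
| "aval I v LastOcc = (case snd I of None \<Rightarrow> 0 | Some c \<Rightarrow> last_occ (fst I) c)"
| "aval I v (PrevOcc a) = prev_occ (fst I) (aval I v a)"

definition position :: "'a list \<Rightarrow> nat \<Rightarrow> bool" where
  "position T i \<longleftrightarrow> 1 \<le> i \<and> i \<le> length T"

primrec bval :: "'a input \<Rightarrow> (vname \<Rightarrow> nat) \<Rightarrow> bexp \<Rightarrow> bool" where
  "bval I v (Less a b) \<longleftrightarrow> aval I v a < aval I v b"
| "bval I v (Equal a b) \<longleftrightarrow> aval I v a = aval I v b"
| "bval I v (Neg b) \<longleftrightarrow> \<not> bval I v b"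
| "bval I v (Conj b b') \<longleftrightarrow> bval I v b \<and> bval I v b'"
| "bval I v (SameLetter a b) \<longleftrightarrow>
     position (fst I) (aval I v a) \<and> position (fst I) (aval I v b) \<and>
     fst I ! (aval I v a - 1) = fst I ! (aval I v b - 1)"
| "bval I v (IsAppended a) \<longleftrightarrow>
     position (fst I) (aval I v a) \<and> snd I = Some (fst I ! (aval I v a - 1))"

record state =
  vars :: "vname \<Rightarrow> nat"
  heap :: "nat \<rightharpoonup> nat list"
  fresh :: nat

definition empty_state :: state where
  "empty_state = \<lparr>vars = (\<lambda>_. 0), heap = Map.empty, fresh = 1\<rparr>"

text \<open>
  \<open>exec I N p s t s'\<close>: on input \<open>I\<close> and with words ranging over \<open>{0..N}\<close>, program \<open>p\<close> started in
  \<open>s\<close> halts in \<open>s'\<close> after \<open>t\<close> steps. There is no derivation for a run that does not terminate, that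
  accesses memory outside the allocated blocks, or that produces a value exceeding \<open>N\<close>. Every
  elementary step costs one unit of time; allocating a block also costs its length.
  Block names are never reused, so they carry no information about the blocks already freed.
\<close>

inductive exec :: "'a input \<Rightarrow> nat \<Rightarrow> com \<Rightarrow> state \<Rightarrow> nat \<Rightarrow> state \<Rightarrow> bool"
  for I :: "'a input" and N :: nat where
  Skip: "exec I N Skip s 1 s"
| Assign: "aval I (vars s) a \<le> N \<Longrightarrow>
     exec I N (Assign x a) s 1 (s\<lparr>vars := (vars s)(x := aval I (vars s) a)\<rparr>)"
| New: "n = aval I (vars s) a \<Longrightarrow> n \<le> N \<Longrightarrow> fresh s \<le> N \<Longrightarrow>
     exec I N (New x a) s (1 + n)
       \<lparr>vars = (vars s)(x := fresh s), heap = (heap s)(fresh s \<mapsto> replicate n 0),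
        fresh = Suc (fresh s)\<rparr>"
| Read: "heap s (aval I (vars s) b) = Some ws \<Longrightarrow> aval I (vars s) i < length ws \<Longrightarrow>
     exec I N (Read x b i) s 1 (s\<lparr>vars := (vars s)(x := ws ! aval I (vars s) i)\<rparr>)"
| Write: "heap s (aval I (vars s) b) = Some ws \<Longrightarrow> aval I (vars s) i < length ws \<Longrightarrow>
     aval I (vars s) a \<le> N \<Longrightarrow>
     exec I N (Write b i a) s 1
       (s\<lparr>heap := (heap s)(aval I (vars s) b \<mapsto>
            ws[aval I (vars s) i := aval I (vars s) a])\<rparr>)"
| Free: "heap s (aval I (vars s) b) = Some ws \<Longrightarrow>
     exec I N (Free b) s 1 (s\<lparr>heap := (heap s)(aval I (vars s) b := None)\<rparr>)"
| Seq: "exec I N p s t s' \<Longrightarrow> exec I N q s' t' s'' \<Longrightarrow> exec I N (Seq p q) s (t + t') s''"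
| IfTrue: "bval I (vars s) b \<Longrightarrow> exec I N p s t s' \<Longrightarrow> exec I N (If b p q) s (1 + t) s'"
| IfFalse: "\<not> bval I (vars s) b \<Longrightarrow> exec I N q s t s' \<Longrightarrow> exec I N (If b p q) s (1 + t) s'"
| WhileFalse: "\<not> bval I (vars s) b \<Longrightarrow> exec I N (While b p) s 1 s"
| WhileTrue: "bval I (vars s) b \<Longrightarrow> exec I N p s t s' \<Longrightarrow> exec I N (While b p) s' t' s'' \<Longrightarrow>
     exec I N (While b p) s (1 + t + t') s''"

inductive_cases SkipE: "exec I N Skip s t s'"
inductive_cases AssignE: "exec I N (Assign x a) s t s'"
inductive_cases NewE: "exec I N (New x a) s t s'"
inductive_cases ReadE: "exec I N (Read x b i) s t s'"
inductive_cases WriteE: "exec I N (Write b i a) s t s'"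
inductive_cases FreeE: "exec I N (Free b) s t s'"
inductive_cases SeqE: "exec I N (Seq p q) s t s'"
inductive_cases IfE: "exec I N (If b p q) s t s'"
inductive_cases WhileE: "exec I N (While b p) s t s'"

lemma exec_deterministic:
  "exec I N p s t s' \<Longrightarrow> exec I N p s u s'' \<Longrightarrow> t = u \<and> s' = s''"
proof (induction arbitrary: u s'' rule: exec.induct)
  case (Seq p s t s' q t' s3)
  from Seq.prems obtain t1 s1 t2 where
    "exec I N p s t1 s1" "exec I N q s1 t2 s''" "u = t1 + t2"
    by (rule SeqE)
  with Seq.IH show ?case by metis
next
  case (IfTrue s b p t s' q)
  from IfTrue.prems obtain t1 where "exec I N p s t1 s''" "u = 1 + t1"
    by (rule IfE) (use IfTrue.hyps in auto)
  with IfTrue.IH show ?case by metis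
next
  case (IfFalse s b q t s' p)
  from IfFalse.prems obtain t1 where "exec I N q s t1 s''" "u = 1 + t1"
    by (rule IfE) (use IfFalse.hyps in auto)
  with IfFalse.IH show ?case by metis
next
  case (WhileTrue s b p t s' t' s3)
  from WhileTrue.prems obtain t1 s1 t2 where
    "exec I N p s t1 s1" "exec I N (While b p) s1 t2 s''" "u = 1 + t1 + t2"
    by (rule WhileE) (use WhileTrue.hyps(1) in auto)
  with WhileTrue.IH show ?case by metis
next
  case (WhileFalse s b p)
  from WhileFalse.prems show ?case
    by (rule WhileE) (use WhileFalse.hyps in auto)
next
  case (Skip s)
  then show ?case by (rule SkipE) simp
next
  case (Assign s a x)
  from Assign.prems show ?case by (rule AssignE) simp
next
  case (New n s a x)
  from New.prems show ?case by (rule NewE) (use New.hyps in auto)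
next
  case (Read s b ws i x)
  from Read.prems show ?case by (rule ReadE) (use Read.hyps in auto)
next
  case (Write s b ws i a)
  from Write.prems show ?case by (rule WriteE) (use Write.hyps in auto)
next
  case (Free s b ws)
  from Free.prems show ?case by (rule FreeE) (use Free.hyps in auto)
qed

text \<open>One extra word per allocated block accounts for its name.\<close>

definition space :: "state \<Rightarrow> nat" where
  "space s = (\<Sum>b\<in>dom (heap s). 1 + length (the (heap s b)))"


section \<open>Data structures for a pair of strings\<close>

record lcs_structure =
  append_prog :: com
  remove_prog :: com
  query_prog :: com
  result_var :: vname
  word_exponent :: nat

text \<open>Words of \<open>O(log (|P| + |T|))\<close> bits hold the numbers up to a fixed power of \<open>|P| + |T| + 2\<close>.\<close>

definition word_bound :: "lcs_structure \<Rightarrow> 'a list \<Rightarrow> 'a list \<Rightarrow> nat" where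
  "word_bound D T P = (length P + length T + 2) ^ word_exponent D"

definition append_step ::
    "lcs_structure \<Rightarrow> 'a list \<Rightarrow> 'a list \<Rightarrow> 'a \<Rightarrow> state \<Rightarrow> nat \<Rightarrow> state \<Rightarrow> bool" where
  "append_step D T P c = exec (T, Some c) (word_bound D T (P @ [c])) (append_prog D)"

definition remove_step ::
    "lcs_structure \<Rightarrow> 'a list \<Rightarrow> 'a list \<Rightarrow> state \<Rightarrow> nat \<Rightarrow> state \<Rightarrow> bool" where
  "remove_step D T P = exec (T, None) (word_bound D T P) (remove_prog D)"

definition query_step ::
    "lcs_structure \<Rightarrow> 'a list \<Rightarrow> 'a list \<Rightarrow> state \<Rightarrow> nat \<Rightarrow> state \<Rightarrow> bool" where
  "query_step D T P = exec (T, None) (word_bound D T P) (query_prog D)"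

text \<open>
  \<open>represents D T P S s\<close>: the state \<open>s\<close> represents the strings \<open>P\<close> and \<open>S\<close>, having been obtained by
  operations that started with the empty string and the input text \<open>T\<close>, of which \<open>S\<close> is a suffix.
\<close>

inductive represents ::
    "lcs_structure \<Rightarrow> 'a list \<Rightarrow> 'a list \<Rightarrow> 'a list \<Rightarrow> state \<Rightarrow> bool"
  for D :: lcs_structure and T :: "'a list" where
  empty: "represents D T [] T empty_state"
| append: "represents D T P S s \<Longrightarrow> append_step D T P c s t s' \<Longrightarrow>
     represents D T (P @ [c]) S s'"
| remove: "represents D T P (c # S) s \<Longrightarrow> remove_step D T P s t s' \<Longrightarrow>
     represents D T P S s'"
| query: "represents D T P S s \<Longrightarrow> query_step D T P s t s' \<Longrightarrow>
     represents D T P S s'"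

text \<open>\<open>append_run D T P cs\<close>: the letters of \<open>cs\<close> are appended to \<open>P\<close> one after the other;
  \<open>remove_run D T P n\<close>: the first letter of the second string is removed \<open>n\<close> times.\<close>

fun append_run ::
    "lcs_structure \<Rightarrow> 'a list \<Rightarrow> 'a list \<Rightarrow> 'a list \<Rightarrow> state \<Rightarrow> nat \<Rightarrow> state \<Rightarrow> bool" where
  "append_run D T P [] s t s' \<longleftrightarrow> t = 0 \<and> s' = s"
| "append_run D T P (c # cs) s t s' \<longleftrightarrow>
     (\<exists>t1 s1 t2. append_step D T P c s t1 s1 \<and> append_run D T (P @ [c]) cs s1 t2 s' \<and>
        t = t1 + t2)"

fun remove_run ::
    "lcs_structure \<Rightarrow> 'a list \<Rightarrow> 'a list \<Rightarrow> nat \<Rightarrow> state \<Rightarrow> nat \<Rightarrow> state \<Rightarrow> bool" where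
  "remove_run D T P 0 s t s' \<longleftrightarrow> t = 0 \<and> s' = s"
| "remove_run D T P (Suc n) s t s' \<longleftrightarrow>
     (\<exists>t1 s1 t2. remove_step D T P s t1 s1 \<and> remove_run D T P n s1 t2 s' \<and> t = t1 + t2)"

end

theory Submission
  imports Defs "HOL-Library.Multiset" "HOL-Library.Discrete_Functions"
begin

text \<open>
  For \<open>S\<close> the suffix of \<open>T\<close> after position \<open>k\<close>, the structure keeps one sorted list of positions for
  every \<open>r < \<lambda>\<close>, the \<^emph>\<open>level\<close> \<open>r\<close>, whose head is the least \<open>j\<close> such that \<open>P\<close> and the positions
  \<open>k + 1, \<dots>, j\<close> of \<open>T\<close> have a common subsequence of length \<open>r + 1\<close>; the positions behind the head are
  those that can become the head once letters of \<open>S\<close> are removed. Appending \<open>c\<close> to \<open>P\<close> puts in front of every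
  level the occurrences of \<open>c\<close> between the heads of the previous level and of this one, so that the total
  length of the levels is at most \<open>\<ell>\<close>. Removing position \<open>k + 1\<close> drops the head of level \<open>0\<close>; what
  remains of a level takes over those positions of the next level that precede its new head, and the
  next level is repaired in the same way.

  A level is stored as a one-sided finger tree with a buffer in front of it. Cutting off the \<open>m\<close> first
  keys costs \<open>O(1 + log m)\<close> amortized time, and concavity of the logarithm turns the sum over all levels
  into \<open>\<lambda> (1 + log (\<ell> / \<lambda>))\<close>. For a sequence of removals the sum of the \<open>m\<close>s is bounded by the potential
  \<open>\<Sum> r |L\<^sub>r|\<close>, because a key that is cut off moves to the previous level; this gives the bound with
  \<open>log \<lambda>\<close>. Appending only pushes keys on the buffers. Buffers are emptied into their finger trees either by
  an append, which pays for it with the keys that it has inserted, or by a removal, for which they are short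
  enough since their total length never exceeds the number of digits of the finger trees.
\<close>

section \<open>Levels\<close>

text \<open>\<open>levels\<close> is built by appends alone, and the keys behind the heads are never
  characterized directly. That a removal gives the levels of the shorter suffix is
  \<open>levels_Suc\<close>, whose core is that the repair \<open>remq\<close> commutes with an
  append (\<open>remq_app\<close>).

  Cutting is cheap only in the amortized sense, yet the bound for one removal is worst case. It
  holds because the whole potential of the finger trees is at most four per digit and the digits of
  a level are logarithmic in its length, so one removal may spend all of it. An append cannot rely
  on such credit, since its bound has no logarithmic term. It therefore empties a buffer only if
  this is longer than the spine of its tree, so that the keys emptied also pay for the potential,
  and it stops when as many keys have been emptied as were inserted.

  A run is legal only if no word gets too large. Instead of carrying a bound through every program,
  correctness is shown for some word size; since a step raises the largest word by at most one, the
  running time then yields a polynomial bound.\<close>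

text \<open>\<open>q\<close> is what is left of a level that has lost its head, and \<open>Ls\<close> are the levels behind it.\<close>

fun remq :: "nat list \<Rightarrow> nat list list \<Rightarrow> nat list list" where
  "remq q [] = [q]"
| "remq q (L # Ls) =
    (if hd q < hd L then q # L # Ls
     else (filter (\<lambda>x. x < hd q) L @ q) #
       (let r = filter (\<lambda>x. hd q < x) L in if r = [] then Ls else remq r Ls))"

definition drop_head :: "nat list list \<Rightarrow> nat list list" where
  "drop_head Ls = (if tl (hd Ls) = [] then tl Ls else remq (tl (hd Ls)) (tl Ls))"

text \<open>A match equal to the head of a level is stored nowhere: it neither improves that head
  nor lies beyond it.\<close>

fun app :: "nat \<Rightarrow> nat list list \<Rightarrow> nat list \<Rightarrow> nat list list" where
  "app p [] M = (let A = filter (\<lambda>m. p < m) M in if A = [] then [] else [A])"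
| "app p (L # Ls) M = (filter (\<lambda>m. p < m \<and> m < hd L) M @ L) # app (hd L) Ls M"

text \<open>Only the heads are ordered across levels. The second key of a level may lie beyond the
  head of the next level, and then the loss of the first key calls for a repair.\<close>

fun lok :: "nat \<Rightarrow> nat list list \<Rightarrow> bool" where
  "lok p [] \<longleftrightarrow> True"
| "lok p (L # Ls) \<longleftrightarrow> L \<noteq> [] \<and> p < hd L \<and> sorted_wrt (<) L \<and> lok (hd L) Ls"

lemma lok_mono: "lok p Ls \<Longrightarrow> p' \<le> p \<Longrightarrow> lok p' Ls"
  by (cases Ls) auto

lemma hd_filter_sat: "filter Q xs \<noteq> [] \<Longrightarrow> Q (hd (filter Q xs))"
  by (induction xs) auto

lemma hd_filter_mem: "filter Q xs \<noteq> [] \<Longrightarrow> hd (filter Q xs) \<in> set xs"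
  by (induction xs) auto

lemma filter_all: "(\<And>x. x \<in> set xs \<Longrightarrow> Q x) \<Longrightarrow> filter Q xs = xs"
  by (induction xs) auto

lemma filter_none: "(\<And>x. x \<in> set xs \<Longrightarrow> \<not> Q x) \<Longrightarrow> filter Q xs = []"
  by (induction xs) auto

lemma hd_le: "sorted_wrt (<) L \<Longrightarrow> x \<in> set L \<Longrightarrow> hd L \<le> (x::nat)"
  by (cases L) auto

lemma hd_filter_append:
  "p < hd L \<Longrightarrow> hd (filter (\<lambda>m. p < m \<and> m < hd L) M @ L) > (p::nat)"
  "hd (filter (\<lambda>m. p < m \<and> m < hd L) M @ L) \<le> (hd L::nat)"
  using hd_filter_sat[of "\<lambda>m. p < m \<and> m < hd L" M] by (auto simp: hd_append)

lemma lok_app: "lok p Ls \<Longrightarrow> sorted_wrt (<) M \<Longrightarrow> lok p (app p Ls M)"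
proof (induction p Ls M rule: app.induct)
  case (1 p M)
  then show ?case
    using hd_filter_sat[of "\<lambda>m. p < m" M] by (auto simp: Let_def sorted_wrt_filter)
next
  case (2 p L Ls M)
  let ?A = "filter (\<lambda>m. p < m \<and> m < hd L) M"
  have L: "L \<noteq> []" "p < hd L" "sorted_wrt (<) L" "lok (hd L) Ls" using 2 by auto
  have s: "sorted_wrt (<) (?A @ L)"
    using L 2(3) by (auto simp: sorted_wrt_append sorted_wrt_filter dest: hd_le)
  from 2 s L hd_filter_append[of p L M] show ?case by (auto intro: lok_mono)
qed

text \<open>The key \<open>hd L\<close> either precedes \<open>hd q\<close> and is taken over, or
  equals it. So during a repair every level inherits the old head of its successor.\<close>

lemma hd_filter_less:
  assumes "L \<noteq> []" "sorted_wrt (<) L" "hd L \<le> hd q"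
  shows "hd (filter (\<lambda>x. x < hd q) L @ q) = (hd L :: nat)"
proof (cases "hd L < hd q")
  case True
  with assms show ?thesis by (cases L) auto
next
  case False
  then have "filter (\<lambda>x. x < hd q) L = []"
    using assms by (intro filter_none) (auto dest!: hd_le)
  with assms False show ?thesis by simp
qed

lemma remq_stop: "lok (hd q) Ls \<Longrightarrow> remq q Ls = q # Ls"
  by (cases Ls) auto

text \<open>Both sides separate the new matches at the same points. If \<open>hd q < hd L\<close>,
  the append on the left pushes the matches below \<open>hd L\<close> on \<open>L\<close>, and the
  repair then hands those below \<open>hd q\<close> to \<open>q\<close>, where the append on the
  right puts them at once; a match equal to \<open>hd q\<close> is lost on both sides. If
  \<open>hd L \<le> hd q\<close>, all of them are handed to \<open>q\<close>, whose head has become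
  \<open>hd L\<close>.\<close>

lemma remq_app:
  "lok p Ls \<Longrightarrow> q \<noteq> [] \<Longrightarrow> sorted_wrt (<) q \<Longrightarrow> p < hd q \<Longrightarrow> sorted_wrt (<) M \<Longrightarrow>
   remq q (app p Ls M) = app p (remq q Ls) M"
proof (induction q Ls arbitrary: p rule: remq.induct)
  case (1 q)
  let ?f = "filter (\<lambda>m. p < m) M"
  let ?j = "hd q"
  show ?case
  proof (cases "?f = []")
    case True
    then have "\<forall>m\<in>set M. \<not> p < m" by (auto simp: filter_empty_conv)
    then have "filter (\<lambda>m. p < m \<and> m < ?j) M = []" "filter (\<lambda>m. ?j < m) M = []"
      using 1 by (auto simp: filter_empty_conv)
    with True show ?thesis by simp
  next
    case False
    show ?thesis
    proof (cases "?j < hd ?f")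
      case True
      have m: "m \<in> set ?f \<Longrightarrow> hd ?f \<le> m" for m
        using 1 by (intro hd_le) (auto simp: sorted_wrt_filter)
      have "filter (\<lambda>m. p < m \<and> m < ?j) M = []"
        using m True by (fastforce simp: filter_empty_conv)
      moreover have "filter (\<lambda>m. ?j < m) M = ?f"
        using m True 1 by (intro filter_cong) fastforce+
      ultimately show ?thesis using False True by simp
    next
      case F: False
      have a: "filter (\<lambda>x. x < ?j) ?f = filter (\<lambda>m. p < m \<and> m < ?j) M"
        by (auto intro!: filter_cong)
      have b: "filter (\<lambda>x. ?j < x) ?f = filter (\<lambda>m. ?j < m) M"
        using 1 by (auto intro!: filter_cong)
      show ?thesis using False F by (simp add: a b Let_def del: filter_filter)
    qed
  qed
next
  case (2 q L Ls)
  let ?j = "hd q" and ?A = "filter (\<lambda>m. p < m \<and> m < hd L) M"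
  have L: "L \<noteq> []" "p < hd L" "sorted_wrt (<) L" "lok (hd L) Ls" using 2 by auto
  have hL: "x \<in> set L \<Longrightarrow> hd L \<le> x" for x using L by (simp add: hd_le)
  have sA: "sorted_wrt (<) (?A @ L)"
    using L 2 by (auto simp: sorted_wrt_append sorted_wrt_filter dest: hd_le)
  show ?case
  proof (cases "?j < hd L")
    case True
    \<comment> \<open>What remains of this level above \<open>hd q\<close> begins at
      \<open>hd L\<close> or before, hence below the next head: the repair goes no further.\<close>
    have stop: "remq (filter (\<lambda>m. ?j < m \<and> m < hd L) M @ L) (app (hd L) Ls M) =
      (filter (\<lambda>m. ?j < m \<and> m < hd L) M @ L) # app (hd L) Ls M"
      using hd_filter_append(2)[of ?j L M] lok_app[OF L(4), of M] 2
      by (intro remq_stop) (auto intro: lok_mono)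
    have tL: "filter (\<lambda>x. x < ?j) L = []" "filter (\<lambda>x. ?j < x) L = L"
      using hL True by (fastforce intro!: filter_none filter_all)+
    have a: "filter (\<lambda>x. x < ?j) ?A = filter (\<lambda>m. p < m \<and> m < ?j) M"
      using True by (auto intro!: filter_cong)
    have b: "filter (\<lambda>x. ?j < x) ?A = filter (\<lambda>m. ?j < m \<and> m < hd L) M"
      using 2 by (auto intro!: filter_cong)
    show ?thesis
    proof (cases "?j < hd (?A @ L)")
      case T2: True
      have m: "m \<in> set ?A \<Longrightarrow> ?j < m" for m
        using T2 hd_le[OF sA, of m] by auto
      have "filter (\<lambda>m. p < m \<and> m < ?j) M = []"
        using m True by (fastforce simp: filter_empty_conv)
      moreover have "filter (\<lambda>m. ?j < m \<and> m < hd L) M = ?A"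
        using m 2 by (intro filter_cong) fastforce+
      ultimately show ?thesis using True T2 by simp
    next
      case F2: False
      show ?thesis using True F2 L stop
        by (simp add: tL a b Let_def del: filter_filter)
    qed
  next
    case False
    have F2: "\<not> ?j < hd (?A @ L)" using False hd_filter_append(2)[of p L M] by simp
    have a: "filter (\<lambda>x. x < ?j) ?A = ?A" using False by (intro filter_all) auto
    have b: "filter (\<lambda>x. ?j < x) ?A = []" using False by (intro filter_none) auto
    let ?t = "filter (\<lambda>x. x < ?j) L" and ?r = "filter (\<lambda>x. ?j < x) L"
    have h: "hd (?t @ q) = hd L" using False L by (intro hd_filter_less) auto
    have ih: "remq ?r (app (hd L) Ls M) = app (hd L) (remq ?r Ls) M" if "?r \<noteq> []"
      using 2(1)[OF False refl that, of "hd L"] L that False 2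
        hd_filter_sat[of "\<lambda>x. hd q < x" L] by (auto simp: sorted_wrt_filter)
    show ?thesis using False F2 ih h
      by (simp add: a b Let_def del: filter_filter)
  qed
qed

section \<open>The levels of two strings, and the removal of one position\<close>

definition occs :: "'a list \<Rightarrow> nat \<Rightarrow> 'a \<Rightarrow> nat list" where
  "occs T k c = filter (\<lambda>j. T ! (j - 1) = c) [Suc k..<Suc (length T)]"

definition levels :: "'a list \<Rightarrow> nat \<Rightarrow> 'a list \<Rightarrow> nat list list" where
  "levels T k P = fold (\<lambda>c X. app k X (occs T k c)) P []"

lemma levels_Nil [simp]: "levels T k [] = []"
  by (simp add: levels_def)

lemma levels_snoc [simp]: "levels T k (P @ [c]) = app k (levels T k P) (occs T k c)"
  by (simp add: levels_def)

lemma sorted_occs: "sorted_wrt (<) (occs T k c)"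
  unfolding occs_def by (intro sorted_wrt_filter sorted_wrt_upt)

lemma set_occs: "set (occs T k c) = {j. k < j \<and> j \<le> length T \<and> T ! (j - 1) = c}"
  by (auto simp: occs_def)

lemma lok_levels: "lok k (levels T k P)"
  by (induction P rule: rev_induct) (auto simp: lok_app sorted_occs)

lemma occs_Suc: "occs T (Suc k) c = filter (\<lambda>j. Suc k < j) (occs T k c)"
proof (cases "Suc k < Suc (length T)")
  case True
  have "filter (\<lambda>j. Suc k < j) [Suc k..<Suc (length T)] = [Suc (Suc k)..<Suc (length T)]"
    using True by (subst upt_conv_Cons) (auto intro!: filter_all)
  then show ?thesis unfolding occs_def by (metis (no_types, lifting) filter_filter filter_cong conj_commute)
next
  case False
  then show ?thesis by (simp add: occs_def)
qed

lemma app_shift: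
  assumes "Suc p \<notin> set M"
  shows "app p Ls M = app (Suc p) Ls M"
proof -
  have "filter (\<lambda>m. p < m) M = filter (\<lambda>m. Suc p < m) M"
    using assms by (intro filter_cong) (auto intro: Suc_lessI)
  moreover have "filter (\<lambda>m. p < m \<and> m < x) M = filter (\<lambda>m. Suc p < m \<and> m < x) M" for x
    using assms by (intro filter_cong) (auto intro: Suc_lessI)
  ultimately show ?thesis by (cases Ls) auto
qed

lemma app_filter_ge: "lok x Ls \<Longrightarrow> p \<le> x \<Longrightarrow> app x Ls (filter (\<lambda>j. p < j) M) = app x Ls M"
proof (induction Ls arbitrary: x)
  case Nil
  then have "filter (\<lambda>m. p < m \<and> x < m) M = filter (\<lambda>m. x < m) M" by (intro filter_cong) auto
  then show ?case by simp
next
  case (Cons L Ls)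
  then have "filter (\<lambda>m. p < m \<and> x < m \<and> m < hd L) M = filter (\<lambda>m. x < m \<and> m < hd L) M"
    by (intro filter_cong) auto
  with Cons show ?case by (auto intro: lok_mono)
qed

text \<open>By induction over the appended letters. If \<open>Suc k\<close> was a head before the
  append, \<open>remq_app\<close> applies to the levels behind it. If the append itself brings
  \<open>Suc k\<close>, this key is pushed in front of level 0 and taken away again, and the repair
  stops at once because the heads were in order before. In the remaining case the append does not
  see the difference between \<open>k\<close> and \<open>Suc k\<close>.\<close>

lemma levels_Suc:
  "levels T (Suc k) P =
    (if levels T k P \<noteq> [] \<and> hd (hd (levels T k P)) = Suc k then drop_head (levels T k P)
     else levels T k P)"
proof (induction P rule: rev_induct)
  case Nil
  then show ?case by simp
next
  case (snoc c P)
  define X where "X = levels T k P"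
  define X' where "X' = levels T (Suc k) P"
  define M where "M = occs T k c"
  have X: "lok k X" and X'0: "lok (Suc k) X'" and M: "sorted_wrt (<) M"
    by (simp_all add: X_def X'_def M_def lok_levels sorted_occs)
  have M0: "m \<in> set M \<Longrightarrow> k < m" for m by (simp add: M_def set_occs)
  have ih: "X' = (if X \<noteq> [] \<and> hd (hd X) = Suc k then drop_head X else X)"
    using snoc by (simp add: X_def X'_def)
  have goal': "app (Suc k) X' (filter (\<lambda>j. Suc k < j) M) = app (Suc k) X' M"
    using app_filter_ge[OF X'0] by simp
  have "app (Suc k) X' M = (if app k X M \<noteq> [] \<and> hd (hd (app k X M)) = Suc k
      then drop_head (app k X M) else app k X M)"
  proof (cases "X \<noteq> [] \<and> hd (hd X) = Suc k")
    case True
    then obtain q Ls where XX: "X = (Suc k # q) # Ls"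
      using X by (cases X; cases "hd X") auto
    \<comment> \<open>No position lies strictly between \<open>k\<close> and \<open>Suc k\<close>,
      so the append leaves this level alone.\<close>
    have e: "filter (\<lambda>m. k < m \<and> m < Suc k) M = []" by (intro filter_none) auto
    have Y: "app k X M = (Suc k # q) # app (Suc k) Ls M" using XX e by simp
    have "remq q (app (Suc k) Ls M) = app (Suc k) (remq q Ls) M" if "q \<noteq> []"
      using X XX that M by (intro remq_app) auto
    with Y XX show ?thesis by (auto simp: ih drop_head_def)
  next
    case False
    then have X': "X' = X" using ih by auto
    show ?thesis
    proof (cases "Suc k \<in> set M")
      case F: False
      have eq: "app k X M = app (Suc k) X M"
        using F by (rule app_shift)
      have "lok (Suc k) (app (Suc k) X M)" using lok_app[of "Suc k" X M] X'0 X' M by simp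
      then have "app (Suc k) X M \<noteq> [] \<Longrightarrow> hd (hd (app (Suc k) X M)) \<noteq> Suc k"
        by (cases "app (Suc k) X M") auto
      with eq X' show ?thesis by auto
    next
      case T: True
      then obtain M' where MM: "M = Suc k # M'"
      proof -
        from T have "M \<noteq> []" by auto
        moreover have "hd M \<le> Suc k" using hd_le[OF M T] .
        moreover have "k < hd M" using M0[of "hd M"] \<open>M \<noteq> []\<close> by simp
        ultimately show ?thesis using that by (cases M) auto
      qed
      have M': "m \<in> set M' \<Longrightarrow> Suc k < m" for m using M MM by simp
      show ?thesis
      proof (cases X)
        case Nil
        have "filter (\<lambda>m. k < m) M' = M'" "filter (\<lambda>m. Suc k < m) M' = M'"
          using M' by (fastforce intro!: filter_all)+
        with Nil X' MM show ?thesis by (auto simp: drop_head_def)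
      next
        case (Cons L Ls)
        have L: "L \<noteq> []" "Suc k < hd L" "lok (hd L) Ls" using X'0 X' Cons by auto
        have a: "filter (\<lambda>m. k < m \<and> m < hd L) M' = filter (\<lambda>m. Suc k < m \<and> m < hd L) M'"
          using M' by (intro filter_cong) fastforce+
        let ?A = "filter (\<lambda>m. Suc k < m \<and> m < hd L) M'"
        have Y: "app k X M = (Suc k # ?A @ L) # app (hd L) Ls M"
          using Cons MM L a by simp
        have "remq (?A @ L) (app (hd L) Ls M) = (?A @ L) # app (hd L) Ls M"
          using hd_filter_append(2)[of "Suc k" L M'] lok_app[OF L(3) M]
          by (intro remq_stop) (auto intro: lok_mono)
        then have "drop_head (app k X M) = (?A @ L) # app (hd L) Ls M"
          using L by (simp add: Y drop_head_def)
        with Cons X' MM Y show ?thesis by simp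
      qed
    qed
  qed
  with goal' show ?case by (simp add: occs_Suc X_def X'_def M_def)
qed

text \<open>The Hunt-Szymanski recurrence for the heads. Stating it as a condition on all thresholds
  \<open>j\<close> avoids minima and treats a missing level like one whose head is infinite.\<close>

lemma app_hd_le:
  "(r < length (app p Ls M) \<and> hd (app p Ls M ! r) \<le> j) \<longleftrightarrow>
   (r < length Ls \<and> hd (Ls ! r) \<le> j) \<or>
   (\<exists>m\<in>set M. m \<le> j \<and> (case r of 0 \<Rightarrow> p < m | Suc i \<Rightarrow> i < length Ls \<and> hd (Ls ! i) < m))"
  if "lok p Ls" "sorted_wrt (<) M"
  using that
proof (induction p Ls M arbitrary: r rule: app.induct)
  case (1 p M)
  let ?A = "filter (\<lambda>m. p < m) M"
  have s: "sorted_wrt (<) ?A" using 1 by (simp add: sorted_wrt_filter)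
  have "?A \<noteq> [] \<and> hd ?A \<le> j \<longleftrightarrow> (\<exists>m\<in>set M. m \<le> j \<and> p < m)"
  proof
    assume "?A \<noteq> [] \<and> hd ?A \<le> j"
    then show "\<exists>m\<in>set M. m \<le> j \<and> p < m"
      using hd_filter_mem[of "\<lambda>m. p < m" M] hd_filter_sat[of "\<lambda>m. p < m" M] by blast
  next
    assume "\<exists>m\<in>set M. m \<le> j \<and> p < m"
    then obtain m where m: "m \<in> set ?A" "m \<le> j" by auto
    then show "?A \<noteq> [] \<and> hd ?A \<le> j" using hd_le[OF s m(1)] by (auto simp: filter_empty_conv)
  qed
  then show ?case by (cases r) (auto simp: Let_def)
next
  case (2 p L Ls M)
  show ?case
  proof (cases r)
    case 0
    let ?A = "filter (\<lambda>m. p < m \<and> m < hd L) M"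
    have s: "sorted_wrt (<) ?A" using 2 by (simp add: sorted_wrt_filter)
    have "hd (?A @ L) \<le> j \<longleftrightarrow> hd L \<le> j \<or> (\<exists>m\<in>set M. m \<le> j \<and> p < m)"
    proof (cases "?A = []")
      case True
      then show ?thesis by (force simp: filter_empty_conv)
    next
      case False
      then show ?thesis
        using hd_le[OF s] hd_filter_mem[OF False] hd_filter_sat[OF False]
        by (auto simp: hd_append) (meson le_trans less_imp_le not_le)
    qed
    with 0 show ?thesis by simp
  next
    case (Suc i)
    have "lok (hd L) Ls" "sorted_wrt (<) M" using 2 by auto
    note ih = 2(1)[OF this, of i]
    show ?thesis using ih by (cases i) (auto simp: Suc)
  qed
qed

section \<open>Common subsequences and the heads of the levels\<close>

definition common :: "'a list \<Rightarrow> 'a list \<Rightarrow> nat \<Rightarrow> bool" where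
  "common P S r \<longleftrightarrow> (\<exists>X. length X = r \<and> subseq X P \<and> subseq X S)"

text \<open>Either the appended letter does not take part, or it is matched at some position
  \<open>i\<close> of \<open>S\<close>; then the other letters are matched before
  \<open>i\<close>.\<close>

lemma common_snoc:
  "common (P @ [c]) S (Suc r) \<longleftrightarrow>
   common P S (Suc r) \<or> (\<exists>i < length S. S ! i = c \<and> common P (take i S) r)"
proof
  assume "common (P @ [c]) S (Suc r)"
  then obtain X where X: "length X = Suc r" "subseq X (P @ [c])" "subseq X S"
    by (auto simp: common_def)
  from X(2) obtain X1 X2 where X12: "X = X1 @ X2" "subseq X1 P" "subseq X2 [c]"
    by (auto elim: subseq_appendE)
  show "common P S (Suc r) \<or> (\<exists>i < length S. S ! i = c \<and> common P (take i S) r)"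
  proof (cases X2)
    case Nil
    with X X12 show ?thesis by (auto simp: common_def)
  next
    case (Cons d ds)
    with X12(3) have X2: "X2 = [c]" by (auto split: if_splits)
    from X(3) X12(1) obtain S1 S2 where S12: "S = S1 @ S2" "subseq X1 S1" "subseq [c] S2"
      using X2 by (auto dest: list_emb_appendD)
    then obtain S3 S4 where S34: "S2 = S3 @ c # S4" by (auto simp: subseq_singleton_left in_set_conv_decomp)
    let ?i = "length (S1 @ S3)"
    have "?i < length S" "S ! ?i = c" "take ?i S = S1 @ S3"
      using S12 S34 by (simp_all add: nth_append)
    moreover have "common P (S1 @ S3) r"
      using X X12 X2 S12 by (auto simp: common_def intro!: exI[of _ X1])
    ultimately show ?thesis by metis
  qed
next
  assume "common P S (Suc r) \<or> (\<exists>i < length S. S ! i = c \<and> common P (take i S) r)"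
  then show "common (P @ [c]) S (Suc r)"
  proof
    assume "common P S (Suc r)"
    then show ?thesis by (auto simp: common_def)
  next
    assume "\<exists>i < length S. S ! i = c \<and> common P (take i S) r"
    then obtain i X where i: "i < length S" "S ! i = c" "length X = r" "subseq X P"
      "subseq X (take i S)" by (auto simp: common_def)
    have "S = take i S @ c # drop (Suc i) S" using i by (metis id_take_nth_drop)
    moreover have "subseq (X @ [c]) (take i S @ c # drop (Suc i) S)"
      using i by (intro list_emb_append_mono) auto
    ultimately have "subseq (X @ [c]) S" by simp
    moreover have "subseq (X @ [c]) (P @ [c])" using i by simp
    ultimately show ?thesis using i by (auto simp: common_def intro!: exI[of _ "X @ [c]"])
  qed
qed

text \<open>\<open>common_snoc\<close> and \<open>app_hd_le\<close> are the same recurrence. The end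
  \<open>j\<close> must be arbitrary in the induction because the recurrence shortens the second
  string at its end. Positions count from 1, so a match at \<open>m\<close> leaves the prefix of
  length \<open>m - 1\<close>.\<close>

lemma common_levels:
  "j \<le> length T \<Longrightarrow> common P (drop k (take j T)) (Suc r) \<longleftrightarrow>
     r < length (levels T k P) \<and> hd (levels T k P ! r) \<le> j"
proof (induction P arbitrary: r j rule: rev_induct)
  case Nil
  then show ?case by (auto simp: common_def)
next
  case (snoc c P)
  let ?S = "drop k (take j T)"
  let ?X = "levels T k P"
  have "common (P @ [c]) ?S (Suc r) \<longleftrightarrow>
    common P ?S (Suc r) \<or> (\<exists>i < length ?S. ?S ! i = c \<and> common P (take i ?S) r)"
    by (rule common_snoc)
  also have "(\<exists>i < length ?S. ?S ! i = c \<and> common P (take i ?S) r) \<longleftrightarrow>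
    (\<exists>m. k < m \<and> m \<le> j \<and> T ! (m - 1) = c \<and> common P (drop k (take (m - 1) T)) r)"
  proof
    assume "\<exists>i < length ?S. ?S ! i = c \<and> common P (take i ?S) r"
    then obtain i where i: "i < length ?S" "?S ! i = c" "common P (take i ?S) r" by auto
    have "k + i < j" using i snoc.prems by auto
    then have "take i ?S = drop k (take (k + i) T)" by (simp add: take_drop min_def add.commute)
    with i snoc show "\<exists>m. k < m \<and> m \<le> j \<and> T ! (m - 1) = c \<and> common P (drop k (take (m - 1) T)) r"
      by (intro exI[of _ "Suc (k + i)"]) auto
  next
    assume "\<exists>m. k < m \<and> m \<le> j \<and> T ! (m - 1) = c \<and> common P (drop k (take (m - 1) T)) r"
    then obtain m where m: "k < m" "m \<le> j" "T ! (m - 1) = c"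
      "common P (drop k (take (m - 1) T)) r" by auto
    have "take (m - 1 - k) ?S = drop k (take (m - 1) T)" using m snoc by (simp add: take_drop min_def)
    with m snoc show "\<exists>i < length ?S. ?S ! i = c \<and> common P (take i ?S) r"
      by (intro exI[of _ "m - 1 - k"]) auto
  qed
  also have "\<dots> \<longleftrightarrow> (\<exists>m\<in>set (occs T k c). m \<le> j \<and>
      (case r of 0 \<Rightarrow> k < m | Suc i \<Rightarrow> i < length ?X \<and> hd (?X ! i) < m))"
  proof -
    have "common P (drop k (take (m - 1) T)) r \<longleftrightarrow>
        (case r of 0 \<Rightarrow> k < m | Suc i \<Rightarrow> i < length ?X \<and> hd (?X ! i) < m)" if "k < m" "m \<le> j" for m
    proof (cases r)
      case 0
      then show ?thesis using that by (simp add: common_def)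
    next
      case (Suc i)
      then show ?thesis using that snoc.IH[of "m - 1" i] snoc.prems by auto
    qed
    then show ?thesis using snoc.prems by (auto simp: set_occs)
  qed
  also have "common P ?S (Suc r) \<longleftrightarrow> r < length ?X \<and> hd (?X ! r) \<le> j"
    using snoc by simp
  finally show ?case by (simp add: app_hd_le[OF lok_levels sorted_occs])
qed

lemma app_subset: "\<Union> (set ` set (app p Ls M)) \<subseteq> \<Union> (set ` set Ls) \<union> set M"
  by (induction p Ls M rule: app.induct) (auto simp: Let_def split: if_splits)

text \<open>The removals that reach one of these positions are the only ones with more than constant
  cost. Their number is bounded both by the length of the suffix and by the number of matches, which
  is the source of the first minimum in the last bound.\<close>

definition matched :: "'a list \<Rightarrow> nat \<Rightarrow> 'a list \<Rightarrow> nat set" where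
  "matched T k P = {j. k < j \<and> j \<le> length T \<and> T ! (j - 1) \<in> set P}"

lemma finite_matched [simp]: "finite (matched T k P)"
  by (rule finite_subset[of _ "{..length T}"]) (auto simp: matched_def)

lemma levels_matched: "L \<in> set (levels T k P) \<Longrightarrow> set L \<subseteq> matched T k P"
proof (induction P arbitrary: L rule: rev_induct)
  case (snoc c P)
  have "set L \<subseteq> \<Union> (set ` set (levels T k P)) \<union> set (occs T k c)"
    using snoc.prems app_subset[of k "levels T k P" "occs T k c"] by auto
  with snoc.IH show ?case by (fastforce simp: matched_def set_occs)
qed simp

lemma hd_levels_0:
  assumes "matched T k P \<noteq> {}"
  shows "levels T k P \<noteq> [] \<and> hd (hd (levels T k P)) \<le> Min (matched T k P)"
proof -
  let ?j = "Min (matched T k P)"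
  have "?j \<in> matched T k P" using assms by simp
  then have j: "k < ?j" "?j \<le> length T" "T ! (?j - 1) \<in> set P" by (auto simp: matched_def)
  have "T ! (?j - 1) \<in> set (drop k (take ?j T))"
    using j by (auto simp: in_set_conv_nth intro!: exI[of _ "?j - 1 - k"])
  then have "common P (drop k (take ?j T)) 1"
    using j(3) by (auto simp: common_def subseq_singleton_left intro!: exI[of _ "[T ! (?j - 1)]"])
  then show ?thesis using common_levels[OF j(2), of P k 0] by (auto simp: hd_conv_nth)
qed

text \<open>Lets a removal find out in constant time, by looking at the first head only, whether
  anything changes.\<close>

lemma hd_levels_iff:
  assumes "k < length T"
  shows "levels T k P \<noteq> [] \<and> hd (hd (levels T k P)) = Suc k \<longleftrightarrow> Suc k \<in> matched T k P"
proof
  assume a: "levels T k P \<noteq> [] \<and> hd (hd (levels T k P)) = Suc k"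
  then have "hd (levels T k P) \<in> set (levels T k P)" by simp
  moreover have "hd (levels T k P) \<noteq> []" using lok_levels[of k T P] a by (cases "levels T k P") auto
  ultimately show "Suc k \<in> matched T k P" using levels_matched a by (metis hd_in_set subsetD)
next
  assume a: "Suc k \<in> matched T k P"
  then have "Min (matched T k P) \<le> Suc k" by (intro Min_le) auto
  then show "levels T k P \<noteq> [] \<and> hd (hd (levels T k P)) = Suc k"
    using hd_levels_0[of T k P] a lok_levels[of k T P] by (cases "levels T k P") force+
qed

text \<open>A common subsequence can be shortened at its end, so the lengths that occur form an
  initial segment of the natural numbers.\<close>

lemma lcs_length_eqI:
  assumes "common P S r" "\<not> common P S (Suc r)"
  shows "lcs_length P S = r"
proof -
  let ?A = "{length X |X. subseq X P \<and> subseq X S}"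
  have down: "common P S n" if "common P S m" "n \<le> m" for m n
  proof -
    from that obtain X where "length X = m" "subseq X P" "subseq X S" by (auto simp: common_def)
    moreover have "subseq (take n X) X" by (simp add: prefix_imp_subseq take_is_prefix)
    ultimately show ?thesis using that
      by (auto simp: common_def intro!: exI[of _ "take n X"] intro: subseq_order.trans)
  qed
  have A: "?A = {..r}"
  proof
    show "?A \<subseteq> {..r}"
    proof
      fix n assume "n \<in> ?A"
      then have "common P S n" by (auto simp: common_def)
      then show "n \<in> {..r}" using down[of n "Suc r"] assms(2) by (cases "n \<le> r") auto
    qed
    show "{..r} \<subseteq> ?A"
    proof
      fix n assume "n \<in> {..r}"
      then have "common P S n" using down[OF assms(1)] by simp
      then show "n \<in> ?A" unfolding common_def by blast
    qed
  qed
  have "Max {..r} = r" by (intro Max_eqI) auto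
  then show ?thesis unfolding lcs_length_def A by simp
qed

lemma lcs_length_levels:
  shows "lcs_length P (drop k T) = length (levels T k P)"
proof (rule lcs_length_eqI)
  let ?X = "levels T k P"
  have e: "drop k (take (length T) T) = drop k T" by simp
  have c: "common P (drop k T) (Suc r) \<longleftrightarrow> r < length ?X \<and> hd (?X ! r) \<le> length T" for r
    using common_levels[of "length T" T P k r] by simp
  have "hd (?X ! r) \<le> length T" if r: "r < length ?X" for r
  proof -
    have L: "?X ! r \<in> set ?X" using r by simp
    have "?X ! r \<noteq> []" using lok_levels[of k T P] L
    proof -
      have "lok p Ls \<Longrightarrow> L \<in> set Ls \<Longrightarrow> L \<noteq> []" for p Ls L
        by (induction p Ls rule: lok.induct) auto
      with lok_levels L show ?thesis by blast
    qed
    with levels_matched[OF L] show ?thesis by (auto simp: matched_def dest!: hd_in_set)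
  qed
  then show "common P (drop k T) (length ?X)"
    using c[of "length ?X - 1"] by (cases "length ?X") (auto simp: common_def)
  show "\<not> common P (drop k T) (Suc (length ?X))" using c by simp
qed

text \<open>The intervals between consecutive heads are disjoint, so every match is pushed at most
  once.\<close>

lemma app_sum_length: "sum_list (map length (app p Ls M)) \<le> sum_list (map length Ls) + length (filter (\<lambda>m. p < m) M)"
  if "lok p Ls"
  using that
proof (induction p Ls M rule: app.induct)
  case (1 p M)
  then show ?case by (simp add: Let_def)
next
  case (2 p L Ls M)
  have "length (filter (\<lambda>m. p < m) M) \<ge>
      length (filter (\<lambda>m. p < m \<and> m < hd L) M) + length (filter (\<lambda>m. hd L < m) M)"
    using 2(2) by (induction M) auto
  with 2 show ?case by simp
qed

section \<open>Counting the matches letter by letter\<close>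

lemma num_matches_Nil [simp]: "num_matches [] S = 0"
  by (simp add: num_matches_def)

lemma num_matches_snoc:
  "num_matches (P @ [c]) S = num_matches P S + card {j. j < length S \<and> S ! j = c}"
proof -
  let ?A = "{(i, j). i < length P \<and> j < length S \<and> P ! i = S ! j}"
  let ?B = "Pair (length P) ` {j. j < length S \<and> S ! j = c}"
  have e: "{(i, j). i < length (P @ [c]) \<and> j < length S \<and> (P @ [c]) ! i = S ! j} = ?A \<union> ?B"
    by (auto simp: nth_append less_Suc_eq)
  have "finite ?A" by (rule finite_subset[of _ "{..<length P} \<times> {..<length S}"]) auto
  moreover have "?A \<inter> ?B = {}" by auto
  ultimately have "card (?A \<union> ?B) = card ?A + card ?B" by (intro card_Un_disjoint) auto
  moreover have "card ?B = card {j. j < length S \<and> S ! j = c}" by (intro card_image) (auto simp: inj_on_def)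
  ultimately show ?thesis unfolding num_matches_def e by simp
qed

lemma length_occs: "length (occs T k c) = card {j. j < length (drop k T) \<and> drop k T ! j = c}"
proof -
  have "distinct (occs T k c)" by (simp add: occs_def)
  then have "length (occs T k c) = card (set (occs T k c))" by (simp add: distinct_card)
  also have "set (occs T k c) = (\<lambda>j. Suc (k + j)) ` {j. j < length (drop k T) \<and> drop k T ! j = c}"
  proof (intro equalityI subsetI)
    fix x assume "x \<in> set (occs T k c)"
    then show "x \<in> (\<lambda>j. Suc (k + j)) ` {j. j < length (drop k T) \<and> drop k T ! j = c}"
      by (intro image_eqI[of _ _ "x - Suc k"]) (auto simp: set_occs)
  qed (auto simp: set_occs)
  also have "card \<dots> = card {j. j < length (drop k T) \<and> drop k T ! j = c}"
    by (intro card_image) (auto simp: inj_on_def)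
  finally show ?thesis .
qed

lemma num_matches_occs: "num_matches (P @ [c]) (drop k T) = num_matches P (drop k T) + length (occs T k c)"
  by (simp add: num_matches_snoc length_occs)

lemma levels_size: "sum_list (map length (levels T k P)) \<le> num_matches P (drop k T)"
proof (induction P rule: rev_induct)
  case (snoc c P)
  have "length (filter (\<lambda>m. k < m) (occs T k c)) \<le> length (occs T k c)"
    by (rule length_filter_le)
  with snoc app_sum_length[OF lok_levels, of k T P "occs T k c"] show ?case
    unfolding num_matches_occs levels_snoc by linarith
qed simp

lemma app_length_mono: "length Ls \<le> length (app p Ls M)"
  by (induction p Ls M rule: app.induct) (auto simp: Let_def)

section \<open>A program logic with time\<close>

type_synonym cells = "(nat \<times> nat list) multiset"

text \<open>The heap as a multiset of cells makes the disjoint union of structures a plain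
  \<open>+\<close>, in the manner of separation logic; the condition on \<open>count\<close> makes
  addresses unique. Address 0 is never allocated and serves as the null pointer.\<close>

definition st :: "state \<Rightarrow> (vname \<Rightarrow> nat) \<Rightarrow> cells \<Rightarrow> bool" where
  "st s v M \<longleftrightarrow> vars s = v \<and> (\<forall>a ws. heap s a = Some ws \<longleftrightarrow> (a, ws) \<in># M) \<and>
     (\<forall>a. count (image_mset fst M) a \<le> 1) \<and> 0 < fresh s \<and>
     (\<forall>a ws. (a, ws) \<in># M \<longrightarrow> 0 < a \<and> a < fresh s)"

text \<open>Total correctness with the running time as first argument of the postcondition. The word size is
  left open here: it is recovered from the running time in \<open>exec_tame\<close>.\<close>

definition ok :: "'a input \<Rightarrow> com \<Rightarrow> (vname \<Rightarrow> nat) \<Rightarrow> cells \<Rightarrow>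
    (nat \<Rightarrow> (vname \<Rightarrow> nat) \<Rightarrow> cells \<Rightarrow> bool) \<Rightarrow> bool" where
  "ok I p v M Q \<longleftrightarrow> (\<forall>s. st s v M \<longrightarrow>
     (\<exists>N t s' v' M'. exec I N p s t s' \<and> st s' v' M' \<and> Q t v' M'))"

lemma exec_mono: "exec I N p s t s' \<Longrightarrow> N \<le> N' \<Longrightarrow> exec I N' p s t s'"
  by (induction rule: exec.induct) (blast intro: exec.intros order_trans)+

lemma ok_mono: "ok I p v M Q \<Longrightarrow> (\<And>t v' M'. Q t v' M' \<Longrightarrow> R t v' M') \<Longrightarrow> ok I p v M R"
  unfolding ok_def by blast

text \<open>The programs test pointers against 0. That real addresses are positive is part of
  \<open>st\<close> and may therefore be assumed in any proof of \<open>ok\<close>.\<close>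

lemma ok_addr: "((\<And>a ws. (a, ws) \<in># M \<Longrightarrow> 0 < a) \<Longrightarrow> ok I p v M Q) \<Longrightarrow> ok I p v M Q"
  unfolding ok_def st_def by blast

lemma ok_Skip: "Q 1 v M \<Longrightarrow> ok I Skip v M Q"
  unfolding ok_def by (blast intro: exec.Skip)

lemma ok_Assign: "Q 1 (v(x := aval I v a)) M \<Longrightarrow> ok I (Assign x a) v M Q"
  unfolding ok_def
proof (intro allI impI)
  fix s assume q: "Q 1 (v(x := aval I v a)) M" and s: "st s v M"
  have "exec I (aval I v a) (Assign x a) s 1 (s\<lparr>vars := (vars s)(x := aval I (vars s) a)\<rparr>)"
    using s by (intro exec.Assign) (simp add: st_def)
  moreover have "st (s\<lparr>vars := (vars s)(x := aval I (vars s) a)\<rparr>) (v(x := aval I v a)) M"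
    using s by (auto simp: st_def)
  ultimately show "\<exists>N t s' v' M'. exec I N (Assign x a) s t s' \<and> st s' v' M' \<and> Q t v' M'"
    using q by blast
qed

lemma ok_Read:
  assumes "(aval I v b, ws) \<in># M" "aval I v i < length ws" "Q 1 (v(x := ws ! aval I v i)) M"
  shows "ok I (Read x b i) v M Q"
  unfolding ok_def
proof (intro allI impI)
  fix s assume s: "st s v M"
  have "exec I 0 (Read x b i) s 1 (s\<lparr>vars := (vars s)(x := ws ! aval I (vars s) i)\<rparr>)"
    using s assms by (intro exec.Read) (auto simp: st_def)
  moreover have "st (s\<lparr>vars := (vars s)(x := ws ! aval I (vars s) i)\<rparr>) (v(x := ws ! aval I v i)) M"
    using s by (auto simp: st_def)
  ultimately show "\<exists>N t s' v' M'. exec I N (Read x b i) s t s' \<and> st s' v' M' \<and> Q t v' M'"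
    using assms by blast
qed

lemma ok_New:
  assumes "\<And>a. 0 < a \<Longrightarrow>
    Q (1 + aval I v e) (v(x := a)) (add_mset (a, replicate (aval I v e) 0) M)"
  shows "ok I (New x e) v M Q"
  unfolding ok_def
proof (intro allI impI)
  fix s assume s: "st s v M"
  let ?n = "aval I v e"
  let ?s = "\<lparr>vars = (vars s)(x := fresh s), heap = (heap s)(fresh s \<mapsto> replicate ?n 0),
        fresh = Suc (fresh s)\<rparr>"
  have v: "vars s = v" and p: "0 < fresh s" using s by (simp_all add: st_def)
  have "exec I (max ?n (fresh s)) (New x e) s (1 + ?n) ?s"
    using v by (intro exec.New) auto
  moreover have "st ?s (v(x := fresh s)) (add_mset (fresh s, replicate ?n 0) M)"
  proof -
    have "fresh s \<notin># image_mset fst M" using s by (force simp: st_def)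
    then have "count (image_mset fst M) (fresh s) = 0" by (rule not_in_iff[THEN iffD1])
    then show ?thesis using s by (auto simp: st_def less_Suc_eq)
  qed
  ultimately show "\<exists>N t s' v' M'. exec I N (New x e) s t s' \<and> st s' v' M' \<and> Q t v' M'"
    using assms[OF p] by blast
qed

lemma cells_unique:
  assumes "\<And>a. count (image_mset fst (add_mset (a0, ws0) M)) a \<le> 1"
  shows "(a0, ws) \<notin># (M :: cells)"
proof
  assume "(a0, ws) \<in># M"
  then have "a0 \<in># image_mset fst M" by force
  then have "count (image_mset fst M) a0 \<noteq> 0" by (metis not_in_iff)
  moreover have "count (image_mset fst (add_mset (a0, ws0) M)) a0 = Suc (count (image_mset fst M) a0)"
    by simp
  ultimately show False using assms[of a0] by linarith
qed

lemma st_dest: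
  assumes "st s v M" "(a0, ws0) \<in># M"
  obtains M0 where "M = add_mset (a0, ws0) M0" "\<And>ws. (a0, ws) \<notin># M0"
    "\<And>a. count (image_mset fst M0) a \<le> 1" "count (image_mset fst M0) a0 = 0"
proof -
  obtain M0 where M0: "M = add_mset (a0, ws0) M0" using assms(2) by (metis mset_add)
  have u: "\<And>a. count (image_mset fst (add_mset (a0, ws0) M0)) a \<le> 1"
    using assms M0 by (simp add: st_def)
  have n: "\<And>ws. (a0, ws) \<notin># M0" using cells_unique[OF u] by blast
  then have "a0 \<notin># image_mset fst M0" by auto
  then have c0: "count (image_mset fst M0) a0 = 0" by (rule not_in_iff[THEN iffD1])
  have "count (image_mset fst M0) a \<le> 1" for a
    using u[of a] c0 by (simp split: if_splits)
  with that M0 n c0 show ?thesis by blast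
qed

lemma ok_Write:
  assumes "(aval I v b, ws) \<in># M" "aval I v i < length ws"
    "Q 1 v (add_mset (aval I v b, ws[aval I v i := aval I v e]) (M - {#(aval I v b, ws)#}))"
  shows "ok I (Write b i e) v M Q"
  unfolding ok_def
proof (intro allI impI)
  fix s assume s: "st s v M"
  have v: "vars s = v" using s by (simp add: st_def)
  let ?a = "aval I v b" and ?ws = "ws[aval I v i := aval I v e]"
  let ?s = "s\<lparr>heap := (heap s)(?a \<mapsto> ?ws)\<rparr>"
  have "exec I (aval I v e) (Write b i e) s 1 ?s"
    using s assms v exec.Write[of s I b ws i e "aval I v e"] by (auto simp: st_def)
  moreover have "st ?s v (add_mset (?a, ?ws) (M - {#(?a, ws)#}))"
  proof -
    obtain M0 where M0: "M = add_mset (?a, ws) M0" "\<And>ws. (?a, ws) \<notin># M0"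
      "\<And>a. count (image_mset fst M0) a \<le> 1" "count (image_mset fst M0) ?a = 0"
      using st_dest[OF s assms(1)] by metis
    have h: "heap s a = Some w \<longleftrightarrow> (a, w) \<in># add_mset (?a, ws) M0" for a w
      using s M0(1) by (simp add: st_def)
    show ?thesis using s M0 h by (auto simp: st_def split: if_splits)
  qed
  ultimately show "\<exists>N t s' v' M'. exec I N (Write b i e) s t s' \<and> st s' v' M' \<and> Q t v' M'"
    using assms by blast
qed

lemma ok_Free:
  assumes "(aval I v b, ws) \<in># M" "Q 1 v (M - {#(aval I v b, ws)#})"
  shows "ok I (Free b) v M Q"
  unfolding ok_def
proof (intro allI impI)
  fix s assume s: "st s v M"
  have v: "vars s = v" using s by (simp add: st_def)
  let ?a = "aval I v b"
  let ?s = "s\<lparr>heap := (heap s)(?a := None)\<rparr>"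
  have "exec I 0 (Free b) s 1 ?s"
    using s assms v exec.Free[of s I b ws] by (auto simp: st_def)
  moreover have "st ?s v (M - {#(?a, ws)#})"
  proof -
    obtain M0 where M0: "M = add_mset (?a, ws) M0" "\<And>ws. (?a, ws) \<notin># M0"
      "\<And>a. count (image_mset fst M0) a \<le> 1" "count (image_mset fst M0) ?a = 0"
      using st_dest[OF s assms(1)] by metis
    have h: "heap s a = Some w \<longleftrightarrow> (a, w) \<in># add_mset (?a, ws) M0" for a w
      using s M0(1) by (simp add: st_def)
    show ?thesis using s M0 h by (auto simp: st_def split: if_splits)
  qed
  ultimately show "\<exists>N t s' v' M'. exec I N (Free b) s t s' \<and> st s' v' M' \<and> Q t v' M'"
    using assms by blast
qed

lemma ok_Seq:
  assumes "ok I p v M (\<lambda>t v' M'. ok I q v' M' (\<lambda>t'. Q (t + t')))"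
  shows "ok I (Seq p q) v M Q"
  unfolding ok_def
proof (intro allI impI)
  fix s assume "st s v M"
  then obtain N t s' v' M' where 1: "exec I N p s t s'" "st s' v' M'" "ok I q v' M' (\<lambda>t'. Q (t + t'))"
    using assms unfolding ok_def by blast
  then obtain N' t' s'' v'' M'' where 2: "exec I N' q s' t' s''" "st s'' v'' M''" "Q (t + t') v'' M''"
    unfolding ok_def by blast
  have "exec I (max N N') (Seq p q) s (t + t') s''"
    using 1 2 by (intro exec.Seq[of _ _ _ _ _ s']) (auto intro: exec_mono)
  with 2 show "\<exists>N t s' v' M'. exec I N (Seq p q) s t s' \<and> st s' v' M' \<and> Q t v' M'" by blast
qed

lemma ok_If:
  assumes "bval I v b \<Longrightarrow> ok I p v M (\<lambda>t. Q (1 + t))"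
    and "\<not> bval I v b \<Longrightarrow> ok I q v M (\<lambda>t. Q (1 + t))"
  shows "ok I (If b p q) v M Q"
  unfolding ok_def
proof (intro allI impI)
  fix s assume s: "st s v M"
  then have v: "vars s = v" by (simp add: st_def)
  show "\<exists>N t s' v' M'. exec I N (If b p q) s t s' \<and> st s' v' M' \<and> Q t v' M'"
  proof (cases "bval I v b")
    case True
    with assms(1) s v show ?thesis unfolding ok_def by (blast intro: exec.IfTrue)
  next
    case False
    with assms(2) s v show ?thesis unfolding ok_def by (blast intro: exec.IfFalse)
  qed
qed

lemma ok_While:
  assumes "bval I v b \<Longrightarrow> ok I p v M (\<lambda>t v' M'. ok I (While b p) v' M' (\<lambda>t'. Q (1 + t + t')))"
    and "\<not> bval I v b \<Longrightarrow> Q 1 v M"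
  shows "ok I (While b p) v M Q"
  unfolding ok_def
proof (intro allI impI)
  fix s assume s: "st s v M"
  then have v: "vars s = v" by (simp add: st_def)
  show "\<exists>N t s' v' M'. exec I N (While b p) s t s' \<and> st s' v' M' \<and> Q t v' M'"
  proof (cases "bval I v b")
    case True
    with assms(1) s obtain N t s' v' M' where 1: "exec I N p s t s'" "st s' v' M'"
      "ok I (While b p) v' M' (\<lambda>t'. Q (1 + t + t'))" unfolding ok_def by blast
    then obtain N' t' s'' v'' M'' where 2: "exec I N' (While b p) s' t' s''" "st s'' v'' M''"
      "Q (1 + t + t') v'' M''" unfolding ok_def by blast
    have "exec I (max N N') (While b p) s (1 + t + t') s''"
      using True 1 2 v by (intro exec.WhileTrue[of _ _ _ _ _ _ s']) (auto intro: exec_mono)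
    with 2 show ?thesis by blast
  next
    case False
    with assms(2) s v show ?thesis by (blast intro: exec.WhileFalse)
  qed
qed

lemma ok_seqI:
  assumes "ok I p v M R" "\<And>t v' M'. R t v' M' \<Longrightarrow> ok I q v' M' (\<lambda>t'. Q (t + t'))"
  shows "ok I (Seq p q) v M Q"
  using assms by (blast intro: ok_Seq ok_mono)

fun seqs :: "com list \<Rightarrow> com" where
  "seqs [] = Skip"
| "seqs (p # ps) = Seq p (seqs ps)"

section \<open>Symbolic execution of one command in front of a continuation\<close>

lemma ok_A:
  "aval I v a = y \<Longrightarrow> ok I q (v(x := y)) M (\<lambda>t. Q (Suc t)) \<Longrightarrow> ok I (Seq (Assign x a) q) v M Q"
  by (intro ok_Seq ok_Assign) simp

lemma ok_R:
  "(aval I v b, ws) \<in># M \<Longrightarrow> aval I v i < length ws \<Longrightarrow> ws ! aval I v i = y \<Longrightarrow>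
   ok I q (v(x := y)) M (\<lambda>t. Q (Suc t)) \<Longrightarrow> ok I (Seq (Read x b i) q) v M Q"
  by (intro ok_Seq ok_Read[where ws=ws]) simp_all

lemma ok_W:
  "(aval I v b, ws) \<in># M \<Longrightarrow> aval I v i < length ws \<Longrightarrow>
   add_mset (aval I v b, ws[aval I v i := aval I v e]) (M - {#(aval I v b, ws)#}) = M' \<Longrightarrow>
   ok I q v M' (\<lambda>t. Q (Suc t)) \<Longrightarrow> ok I (Seq (Write b i e) q) v M Q"
  by (intro ok_Seq ok_Write[where ws=ws]) simp_all

lemma ok_N:
  "aval I v e = n \<Longrightarrow> replicate n 0 = ws \<Longrightarrow>
   (\<And>a. 0 < a \<Longrightarrow> ok I q (v(x := a)) (add_mset (a, ws) M) (\<lambda>t. Q (Suc (n + t)))) \<Longrightarrow>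
   ok I (Seq (New x e) q) v M Q"
  by (intro ok_Seq ok_New) simp_all

lemma ok_F:
  "(aval I v b, ws) \<in># M \<Longrightarrow> M - {#(aval I v b, ws)#} = M' \<Longrightarrow>
   ok I q v M' (\<lambda>t. Q (Suc t)) \<Longrightarrow> ok I (Seq (Free b) q) v M Q"
  by (intro ok_Seq ok_Free[where ws=ws]) simp_all

text \<open>A branch is itself a sequence. Reassociation allows its commands to be executed one by
  one in front of what follows the conditional.\<close>

lemma ok_assoc: "ok I (Seq p (Seq q r)) v M Q \<Longrightarrow> ok I (Seq (Seq p q) r) v M Q"
  unfolding ok_def
proof (intro allI impI)
  fix s assume a: "\<forall>s. st s v M \<longrightarrow> (\<exists>N t s' v' M'. exec I N (Seq p (Seq q r)) s t s' \<and> st s' v' M' \<and> Q t v' M')"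
    and "st s v M"
  then obtain N t s' v' M' where 1: "exec I N (Seq p (Seq q r)) s t s'" "st s' v' M'" "Q t v' M'" by blast
  from 1(1) obtain t1 s1 t2 where 2: "exec I N p s t1 s1" "exec I N (Seq q r) s1 t2 s'" "t = t1 + t2"
    by (rule SeqE)
  from 2(2) obtain t3 s3 t4 where 3: "exec I N q s1 t3 s3" "exec I N r s3 t4 s'" "t2 = t3 + t4"
    by (elim SeqE)
  from exec.Seq[OF exec.Seq[OF 2(1) 3(1)] 3(2)] have "exec I N (Seq (Seq p q) r) s t s'"
    using 2(3) 3(3) by (simp add: add.assoc)
  with 1 show "\<exists>N t s' v' M'. exec I N (Seq (Seq p q) r) s t s' \<and> st s' v' M' \<and> Q t v' M'" by blast
qed

lemma ok_S: "ok I q v M (\<lambda>t. Q (Suc t)) \<Longrightarrow> ok I (Seq Skip q) v M Q"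
  by (intro ok_Seq ok_Skip) simp

lemma ok_IT: "bval I v b \<Longrightarrow> ok I (Seq p r) v M (\<lambda>t. Q (Suc t)) \<Longrightarrow> ok I (Seq (If b p q) r) v M Q"
  unfolding ok_def
proof (intro allI impI)
  fix s assume b: "bval I v b" and a: "\<forall>s. st s v M \<longrightarrow> (\<exists>N t s' v' M'. exec I N (Seq p r) s t s' \<and> st s' v' M' \<and> Q (Suc t) v' M')"
    and s: "st s v M"
  then obtain N t s' v' M' where 1: "exec I N (Seq p r) s t s'" "st s' v' M'" "Q (Suc t) v' M'" by blast
  from 1(1) obtain t1 s1 t2 where 2: "exec I N p s t1 s1" "exec I N r s1 t2 s'" "t = t1 + t2" by (elim SeqE)
  from 2(1) b s have "exec I N (If b p q) s (1 + t1) s1" by (intro exec.IfTrue) (simp_all add: st_def)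
  from exec.Seq[OF this 2(2)] 2(3) have "exec I N (Seq (If b p q) r) s (Suc t) s'" by simp
  with 1 show "\<exists>N t s' v' M'. exec I N (Seq (If b p q) r) s t s' \<and> st s' v' M' \<and> Q t v' M'" by blast
qed

lemma ok_IF: "\<not> bval I v b \<Longrightarrow> ok I (Seq q r) v M (\<lambda>t. Q (Suc t)) \<Longrightarrow> ok I (Seq (If b p q) r) v M Q"
  unfolding ok_def
proof (intro allI impI)
  fix s assume b: "\<not> bval I v b" and a: "\<forall>s. st s v M \<longrightarrow> (\<exists>N t s' v' M'. exec I N (Seq q r) s t s' \<and> st s' v' M' \<and> Q (Suc t) v' M')"
    and s: "st s v M"
  then obtain N t s' v' M' where 1: "exec I N (Seq q r) s t s'" "st s' v' M'" "Q (Suc t) v' M'" by blast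
  from 1(1) obtain t1 s1 t2 where 2: "exec I N q s t1 s1" "exec I N r s1 t2 s'" "t = t1 + t2" by (elim SeqE)
  from 2(1) b s have "exec I N (If b p q) s (1 + t1) s1" by (intro exec.IfFalse) (simp_all add: st_def)
  from exec.Seq[OF this 2(2)] 2(3) have "exec I N (Seq (If b p q) r) s (Suc t) s'" by simp
  with 1 show "\<exists>N t s' v' M'. exec I N (Seq (If b p q) r) s t s' \<and> st s' v' M' \<and> Q t v' M'" by blast
qed

lemma ok_conseq:
  "ok I p v0 M0 R \<Longrightarrow> v0 = v \<Longrightarrow> M0 = M \<Longrightarrow> (\<And>t v' M'. R t v' M' \<Longrightarrow> Q t v' M') \<Longrightarrow> ok I p v M Q"
  by (hypsubst, rule ok_mono)

lemma ok_C:
  "ok I p v0 M0 R \<Longrightarrow> v0 = v \<Longrightarrow> M0 = M \<Longrightarrow>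
   (\<And>t v' M'. R t v' M' \<Longrightarrow> ok I q v' M' (\<lambda>t'. Q (t + t'))) \<Longrightarrow> ok I (Seq p q) v M Q"
  by (hypsubst, rule ok_seqI)

text \<open>Trees carry the address of their block; the words of a block are the least key, the first
  child and the next sibling.\<close>

datatype tr = Tr (adr: nat) (key: nat) (kids: "tr list")

fun hdp :: "tr list \<Rightarrow> nat \<Rightarrow> nat" where
  "hdp [] p = p"
| "hdp (t # ts) p = adr t"

text \<open>A chain of siblings whose last one points to \<open>p\<close> instead of 0, so that
  chains can be cut and spliced at any point (\<open>fseg_append\<close>). The chains of children
  end in 0.\<close>

fun fseg :: "tr list \<Rightarrow> nat \<Rightarrow> cells" where
  "fseg [] p = {#}"
| "fseg (Tr a k cs # ts) p = add_mset (a, [k, hdp cs 0, hdp ts p]) (fseg cs 0 + fseg ts p)"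

lemma hdp_append: "hdp (xs @ ys) p = hdp xs (hdp ys p)"
  by (cases xs) auto

lemma fseg_append: "fseg (xs @ ys) p = fseg xs (hdp ys p) + fseg ys p"
proof (induction xs)
  case (Cons x xs)
  then show ?case by (cases x) (auto simp: hdp_append)
qed simp

text \<open>Program variables are numbered such that a subprogram changes only variables below some bound.\<close>

definition same :: "nat \<Rightarrow> (nat \<Rightarrow> nat) \<Rightarrow> (nat \<Rightarrow> nat) \<Rightarrow> bool" where
  "same n v v' \<longleftrightarrow> (\<forall>x\<ge>n. v' x = v x)"

lemma same_refl [simp]: "same n v v" by (simp add: same_def)

lemma same_trans: "same n v v' \<Longrightarrow> same n v' v'' \<Longrightarrow> same n v v''" by (simp add: same_def)

lemma same_upd [simp]: "x < n \<Longrightarrow> same n v (v'(x := y)) = same n v v'" by (auto simp: same_def)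

section \<open>Finger trees\<close>

text \<open>Trees of uniform height whose inner nodes have two or three children. If \<open>b\<close> is false, the nodes
  on the right spine may have a single child.\<close>

primrec tok :: "nat \<Rightarrow> bool \<Rightarrow> tr \<Rightarrow> bool" where
  "tok 0 b t \<longleftrightarrow> kids t = []"
| "tok (Suc h) b t \<longleftrightarrow> kids t \<noteq> [] \<and> length (kids t) \<le> 3 \<and> (b \<longrightarrow> 2 \<le> length (kids t)) \<and>
     key (hd (kids t)) = key t \<and>
     (\<forall>c\<in>set (butlast (kids t)). tok h True c) \<and> tok h b (last (kids t))"

text \<open>In a row of siblings only the last tree can touch the right spine; all others have no
  unary nodes.\<close>

definition fok :: "nat \<Rightarrow> bool \<Rightarrow> tr list \<Rightarrow> bool" where
  "fok h b f \<longleftrightarrow> (\<forall>c\<in>set (butlast f). tok h True c) \<and> (f \<noteq> [] \<longrightarrow> tok h b (last f))"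

fun lv :: "tr \<Rightarrow> nat list" where
  "lv (Tr a k cs) = (if cs = [] then [k] else concat (map lv cs))"

definition flv :: "tr list \<Rightarrow> nat list" where
  "flv f = concat (map lv f)"

lemma flv_simps [simp]: "flv [] = []" "flv (t # f) = lv t @ flv f" "flv (f @ g) = flv f @ flv g"
  by (simp_all add: flv_def)

lemma lv_kids: "kids t \<noteq> [] \<Longrightarrow> lv t = flv (kids t)" "kids t = [] \<Longrightarrow> lv t = [key t]"
  by (cases t; simp add: flv_def)+

abbreviation (input) "xE \<equiv> 10::nat"
abbreviation (input) "xBD \<equiv> 11::nat"
abbreviation (input) "xPE \<equiv> 12::nat"
abbreviation (input) "xNX \<equiv> 13::nat"
abbreviation (input) "xKX \<equiv> 14::nat"
abbreviation (input) "xCN \<equiv> 15::nat"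

text \<open>A missing sibling is given the bound itself as its key, which makes the loop condition
  fail without a second test.\<close>

definition "KEYOR = If (Equal (Var xNX) (Const 0)) (Assign xKX (Var xBD)) (Read xKX (Var xNX) (Const 0))"

definition "WALKLOOP = While (Less (Var xKX) (Var xBD))
   (seqs [Assign xPE (Var xE), Assign xE (Var xNX), Assign xCN (Plus (Var xCN) (Const 1)),
      Read xNX (Var xE) (Const 2), KEYOR])"

text \<open>The first tree is passed without a test, so the part walked over is never empty, and the
  counter \<open>xCN\<close> is increased for the later trees only.\<close>

definition "WALK = seqs [Assign xPE (Const 0), Read xNX (Var xE) (Const 2), KEYOR, WALKLOOP]"

lemma ok_KEYOR:
  assumes "v xNX = hdp us 0" "M = fseg us 0 + F"
    "Q 2 (v(xKX := (if us = [] then v xBD else key (hd us)))) M"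
  shows "ok I KEYOR v M Q"
  unfolding KEYOR_def
proof (rule ok_addr)
  assume pos: "\<And>a ws. (a, ws) \<in># M \<Longrightarrow> 0 < a"
  show "ok I (If (Equal (Var xNX) (Const 0)) (Assign xKX (Var xBD)) (Read xKX (Var xNX) (Const 0))) v M Q"
  proof (cases us)
    case Nil
    then show ?thesis using assms by (intro ok_If ok_Assign) (auto simp: numeral_2_eq_2)
  next
    case (Cons t us')
    obtain a k cs where t: "t = Tr a k cs" by (cases t)
    have m: "(a, [k, hdp cs 0, hdp us' 0]) \<in># M" using assms Cons t by simp
    with pos have "a \<noteq> 0" by fastforce
    with assms Cons t m show ?thesis
      by (intro ok_If ok_Assign ok_Read[where ws="[k, hdp cs 0, hdp us' 0]"]) (auto simp: numeral_2_eq_2)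
  qed
qed

lemma ok_WALKLOOP:
  assumes "v xE = adr t" "v xNX = hdp us 0" "v xKX = (if us = [] then v xBD else key (hd us))"
    "M = fseg us 0 + F"
  shows "ok I WALKLOOP v M (\<lambda>\<tau> v' M'. M' = M \<and> (\<exists>as bs. us = as @ bs \<and>
     (\<forall>x\<in>set as. key x < v xBD) \<and> (bs \<noteq> [] \<longrightarrow> v xBD \<le> key (hd bs)) \<and>
     v' xE = adr (last (t # as)) \<and>
     v' xPE = (if as = [] then v xPE else adr (last (butlast (t # as)))) \<and> v' xNX = hdp bs 0 \<and>
     v' xCN = v xCN + length as \<and> same 16 v v' \<and> \<tau> \<le> 8 * length as + 1))"
  using assms
proof (induction us arbitrary: v t F)
  case Nil
  then show ?case unfolding WALKLOOP_def by (intro ok_While) auto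
next
  case (Cons u us)
  obtain a k cs where u: "u = Tr a k cs" by (cases u)
  show ?case
  proof (cases "k < v xBD")
    case False
    then show ?thesis unfolding WALKLOOP_def using Cons.prems u
      by (intro ok_While) (auto intro!: exI[of _ "[]"])
  next
    case True
    let ?v = "v(xPE := adr t, xE := a, xCN := v xCN + 1, xNX := hdp us 0,
        xKX := (if us = [] then v xBD else key (hd us)))"
    have ih: "ok I WALKLOOP ?v M
       (\<lambda>\<tau> v' M'. M' = M \<and> (\<exists>as bs. us = as @ bs \<and>
     (\<forall>x\<in>set as. key x < ?v xBD) \<and> (bs \<noteq> [] \<longrightarrow> ?v xBD \<le> key (hd bs)) \<and>
     v' xE = adr (last (u # as)) \<and>
     v' xPE = (if as = [] then ?v xPE else adr (last (butlast (u # as)))) \<and> v' xNX = hdp bs 0 \<and>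
     v' xCN = ?v xCN + length as \<and> same 16 ?v v' \<and> \<tau> \<le> 8 * length as + 1))"
      using Cons.prems u by (intro Cons.IH[where F="add_mset (a, [k, hdp cs 0, hdp us 0]) (fseg cs 0 + F)"]) auto
    have body: "ok I (seqs [Assign xPE (Var xE), Assign xE (Var xNX), Assign xCN (Plus (Var xCN) (Const 1)),
      Read xNX (Var xE) (Const 2), KEYOR]) v M (\<lambda>\<tau> v' M'. \<tau> = 7 \<and> v' = ?v \<and> M' = M)"
      apply (simp only: seqs.simps)
      apply (rule ok_A, simp)+
      apply (rule ok_R[where ws="[k, hdp cs 0, hdp us 0]"], simp add: Cons.prems u, simp, simp)
      apply (rule ok_Seq, rule ok_KEYOR[where us = us and F="add_mset (a, [k, hdp cs 0, hdp us 0]) (fseg cs 0 + F)"])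
      using Cons.prems u by (auto intro!: ok_Skip)
    have step: "ok I WALKLOOP ?v M (\<lambda>t' v' M'. M' = M \<and> (\<exists>as bs. u # us = as @ bs \<and>
     (\<forall>x\<in>set as. key x < v xBD) \<and> (bs \<noteq> [] \<longrightarrow> v xBD \<le> key (hd bs)) \<and>
     v' xE = adr (last (t # as)) \<and>
     v' xPE = (if as = [] then v xPE else adr (last (butlast (t # as)))) \<and> v' xNX = hdp bs 0 \<and>
     v' xCN = v xCN + length as \<and> same 16 v v' \<and> 1 + 7 + t' \<le> 8 * length as + 1))"
      apply (rule ok_mono[OF ih], elim conjE exE, intro conjI, assumption)
      subgoal for \<tau> v' M' as bs
        using True u by (intro exI[of _ "u # as"] exI[of _ bs]) (auto simp: same_def)
      done
    show ?thesis
      unfolding WALKLOOP_def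
      apply (rule ok_While)
       apply (rule ok_mono[OF body])
       apply (elim conjE, hypsubst, rule step[unfolded WALKLOOP_def])
      using True Cons.prems(3) u by simp
  qed
qed

lemma ok_WALK:
  assumes "f \<noteq> []" "v xE = hdp f 0" "M = fseg f 0 + F"
  shows "ok I WALK v M (\<lambda>\<tau> v' M'. M' = M \<and> (\<exists>as bs. f = as @ bs \<and> as \<noteq> [] \<and>
     (\<forall>x\<in>set (tl as). key x < v xBD) \<and> (bs \<noteq> [] \<longrightarrow> v xBD \<le> key (hd bs)) \<and>
     v' xE = adr (last as) \<and>
     v' xPE = (if butlast as = [] then 0 else adr (last (butlast as))) \<and> v' xNX = hdp bs 0 \<and>
     v' xCN + 1 = v xCN + length as \<and> same 16 v v' \<and> \<tau> \<le> 8 * length as))"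
proof -
  obtain a k cs us where f: "f = Tr a k cs # us" using assms(1) by (metis list.exhaust tr.exhaust)
  let ?v = "v(xPE := 0, xNX := hdp us 0, xKX := (if us = [] then v xBD else key (hd us)))"
  have 1: "ok I WALKLOOP ?v M (\<lambda>\<tau> v' M'. M' = M \<and> (\<exists>as bs. f = as @ bs \<and> as \<noteq> [] \<and>
     (\<forall>x\<in>set (tl as). key x < v xBD) \<and> (bs \<noteq> [] \<longrightarrow> v xBD \<le> key (hd bs)) \<and>
     v' xE = adr (last as) \<and>
     v' xPE = (if butlast as = [] then 0 else adr (last (butlast as))) \<and> v' xNX = hdp bs 0 \<and>
     v' xCN + 1 = v xCN + length as \<and> same 16 v v' \<and> 5 + \<tau> \<le> 8 * length as))"
    apply (rule ok_mono, rule ok_WALKLOOP[where us=us and t="Tr a k cs" and F="add_mset (a, [k, hdp cs 0, hdp us 0]) (fseg cs 0 + F)"])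
    using assms f apply simp_all[4]
    apply (elim conjE exE, intro conjI, assumption)
    subgoal for \<tau> v' M' as bs
      using f by (intro exI[of _ "Tr a k cs # as"] exI[of _ bs]) (auto simp: same_def)
    done
  show ?thesis
    unfolding WALK_def
    apply (simp only: seqs.simps)
    apply (rule ok_A, simp)
    apply (rule ok_R[where ws="[k, hdp cs 0, hdp us 0]"], simp add: assms f, simp, simp)
    apply (rule ok_Seq, rule ok_KEYOR[where us = us and F="add_mset (a, [k, hdp cs 0, hdp us 0]) (fseg cs 0 + F)"])
      apply simp
     apply (simp add: assms f)
    apply (rule ok_C[OF 1])
      apply (simp add: assms f)
     apply (simp add: assms f)
    apply (rule ok_Skip)
    apply (elim conjE exE, intro conjI exI)
             apply (assumption | linarith)+
    done
qed

text \<open>Pairs, except that the last group takes up to three elements. A group of one element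
  arises only from a list of length one.\<close>

fun groups :: "'x list \<Rightarrow> 'x list list" where
  "groups [] = []"
| "groups (a # b # c # d # r) = [a, b] # groups (c # d # r)"
| "groups f = [f]"

lemma fok_Nil [simp]: "fok h b []"
  by (simp add: fok_def)

lemma fok_Cons: "f \<noteq> [] \<Longrightarrow> fok h b (t # f) \<longleftrightarrow> tok h True t \<and> fok h b f"
  by (auto simp: fok_def)

lemma fok_single: "fok h b [t] \<longleftrightarrow> tok h b t"
  by (simp add: fok_def)

lemma fok_append: "g \<noteq> [] \<Longrightarrow> fok h b (f @ g) \<longleftrightarrow> fok h True f \<and> fok h b g"
proof (induction f)
  case (Cons t f)
  then show ?case by (cases "f = []") (auto simp: fok_Cons fok_single)
qed simp

lemma adr_in_fseg: "t \<in> set f \<Longrightarrow> \<exists>ws. (adr t, ws) \<in># fseg f p"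
proof (induction f)
  case (Cons x f)
  then show ?case by (cases x) auto
qed simp

definition grouped :: "tr list \<Rightarrow> tr list \<Rightarrow> bool" where
  "grouped f g \<longleftrightarrow> map kids g = groups f \<and> map key g = map (\<lambda>xs. key (hd xs)) (groups f)"

lemma length_groups: "2 \<le> length f \<Longrightarrow> 2 * length (groups f) \<le> length f"
  by (induction f rule: groups.induct) auto

lemma length_groups': "length f \<le> 3 * length (groups f)" "length (groups f) \<le> length f"
  by (induction f rule: groups.induct) auto

lemma groups_eq_Nil [simp]: "groups f = [] \<longleftrightarrow> f = []"
  by (induction f rule: groups.induct) auto

text \<open>A list of length one becomes a unary node, which is allowed on the right spine only;
  hence the proviso in the second part.\<close>

lemma grouped_props:
  assumes "grouped f g"
  shows "flv g = flv f" "fok h b f \<Longrightarrow> b \<longrightarrow> length f \<noteq> 1 \<Longrightarrow> fok (Suc h) b g"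
    "length g = length (groups f)"
proof -
  show "length g = length (groups f)" using assms by (metis grouped_def length_map)
  have "flv g = flv f \<and> (fok h b f \<longrightarrow> (b \<longrightarrow> length f \<noteq> 1) \<longrightarrow> fok (Suc h) b g)" using assms
  proof (induction "length f" arbitrary: f g rule: less_induct)
    case less
    have "f = [] \<or> (f \<noteq> [] \<and> length f \<le> 3 \<and> groups f = [f]) \<or> (\<exists>x y c d r. f = x # y # c # d # r)"
      by (rule groups.cases[of f]) simp_all
    then consider "f = []" | "f \<noteq> []" "length f \<le> 3" "groups f = [f]"
      | x y c d r where "f = x # y # c # d # r" by blast
    then show ?case
    proof cases
      case 1
      with less.prems show ?thesis by (simp add: grouped_def fok_def)
    next
      case 2
      then obtain n where n: "g = [n]" "kids n = f" "key n = key (hd f)"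
        using less.prems by (auto simp: grouped_def)
      have "flv g = flv f" using n 2 by (simp add: lv_kids)
      moreover have "fok (Suc h) b g" if "fok h b f" "b \<longrightarrow> length f \<noteq> 1"
      proof -
        have "b \<longrightarrow> 2 \<le> length f" using that(2) 2(1) by (cases f; cases "tl f") auto
        with n 2 that(1) show ?thesis by (simp add: fok_def)
      qed
      ultimately show ?thesis by blast
    next
      case (3 x y c d r)
      then obtain n g' where g: "g = n # g'" "kids n = [x, y]" "grouped (c # d # r) g'" "key n = key x"
        using less.prems by (auto simp: grouped_def)
      have ne: "g' \<noteq> []" using g(3) by (metis grouped_def groups_eq_Nil list.map_disc_iff list.distinct(1))
      note ih = less.hyps[of "c # d # r" g']
      have ih1: "flv g' = flv (c # d # r)" "fok h b (c # d # r) \<Longrightarrow> fok (Suc h) b g'"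
        using ih g(3) 3 by simp_all
      have "flv g = flv f" using ih1(1) g(1,2) 3 by (simp add: lv_kids)
      moreover have "fok (Suc h) b g" if a: "fok h b f"
      proof -
        have "fok h b (c # d # r)" "tok h True x" "tok h True y"
          using a 3 by (simp_all add: fok_Cons)
        moreover have "tok (Suc h) True n" using calculation(2,3) g(2,4) by simp
        ultimately show ?thesis using ih1(2) ne g(1) fok_Cons by metis
      qed
      ultimately show ?thesis by blast
    qed
  qed
  then show "flv g = flv f" "fok h b f \<Longrightarrow> b \<longrightarrow> length f \<noteq> 1 \<Longrightarrow> fok (Suc h) b g" by blast+
qed

section \<open>A program that groups siblings into nodes\<close>

abbreviation (input) "xF \<equiv> 20::nat"
abbreviation (input) "xOH \<equiv> 21::nat"
abbreviation (input) "xOT \<equiv> 22::nat"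
abbreviation (input) "xP2 \<equiv> 23::nat"
abbreviation (input) "xP3 \<equiv> 24::nat"
abbreviation (input) "xP4 \<equiv> 25::nat"
abbreviation (input) "xN \<equiv> 26::nat"
abbreviation (input) "xK \<equiv> 27::nat"

definition SIB :: "nat \<Rightarrow> nat \<Rightarrow> com" where
  "SIB x y = If (Equal (Var y) (Const 0)) (Assign x (Const 0)) (Read x (Var y) (Const 2))"

lemma ok_SIB:
  assumes "v y = hdp us 0" "M = fseg us 0 + F" "Q 2 (v(x := hdp (tl us) 0)) M"
  shows "ok I (SIB x y) v M Q"
  unfolding SIB_def
proof (rule ok_addr)
  assume pos: "\<And>a ws. (a, ws) \<in># M \<Longrightarrow> 0 < a"
  show "ok I (If (Equal (Var y) (Const 0)) (Assign x (Const 0)) (Read x (Var y) (Const 2))) v M Q"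
  proof (cases us)
    case Nil
    then show ?thesis using assms by (intro ok_If ok_Assign) (auto simp: numeral_2_eq_2)
  next
    case (Cons t us')
    obtain a k cs where t: "t = Tr a k cs" by (cases t)
    have m: "(a, [k, hdp cs 0, hdp us' 0]) \<in># M" using assms Cons t by simp
    with pos have "a \<noteq> 0" by fastforce
    with assms Cons t m show ?thesis
      by (intro ok_If ok_Assign ok_Read[where ws="[k, hdp cs 0, hdp us' 0]"]) (auto simp: numeral_2_eq_2)
  qed
qed

text \<open>The chain is cut after its second tree exactly if there is a fourth one, as in the
  recursion of \<open>groups\<close>. The new node goes to the end of the output chain, whose last
  block is \<open>xOT\<close>.\<close>

definition "GBODY = seqs [Read xP2 (Var xF) (Const 2), SIB xP3 xP2, SIB xP4 xP3,
   Read xK (Var xF) (Const 0), New xN (Const 3), Write (Var xN) (Const 0) (Var xK),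
   Write (Var xN) (Const 1) (Var xF),
   If (Less (Const 0) (Var xP4)) (Seq (Write (Var xP2) (Const 2) (Const 0)) (Assign xF (Var xP3)))
     (Assign xF (Const 0)),
   If (Equal (Var xOT) (Const 0)) (Assign xOH (Var xN)) (Write (Var xOT) (Const 2) (Var xN)),
   Assign xOT (Var xN)]"

definition "GROUP = seqs [Assign xOH (Const 0), Assign xOT (Const 0),
   While (Less (Const 0) (Var xF)) GBODY]"

lemma ok_LINK:
  assumes "v xOT = (if out = [] then 0 else adr (last out))" "v xOH = hdp out 0"
    "M = fseg out 0 + F" "0 < v xN"
    "Q 2 (v(xOH := hdp out (v xN))) (fseg out (v xN) + F)"
  shows "ok I (If (Equal (Var xOT) (Const 0)) (Assign xOH (Var xN)) (Write (Var xOT) (Const 2) (Var xN))) v M Q"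
proof (rule ok_addr)
  assume pos: "\<And>a ws. (a, ws) \<in># M \<Longrightarrow> 0 < a"
  show ?thesis
  proof (cases out rule: rev_cases)
    case Nil
    then show ?thesis using assms by (intro ok_If ok_Assign) (auto simp: numeral_2_eq_2)
  next
    case (snoc out' t)
    obtain a k cs where t: "t = Tr a k cs" by (cases t)
    have m: "(a, [k, hdp cs 0, 0]) \<in># M" using assms snoc t by (simp add: fseg_append)
    with pos have p: "a \<noteq> 0" by fastforce
    have "v(xOH := hdp out (v xN)) = v" using assms(2) snoc by (auto simp: hdp_append fun_eq_iff)
    then have q: "Q 2 v (fseg out (v xN) + F)" using assms(5) by simp
    show ?thesis using assms(1-4) snoc t m p q
      by (intro ok_If ok_Assign ok_Write[where ws="[k, hdp cs 0, 0]"])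
        (auto simp: numeral_2_eq_2 fseg_append)
  qed
qed

lemma ok_GBODY:
  assumes "v xF = hdp f 0" "f \<noteq> []" "v xOT = (if out = [] then 0 else adr (last out))"
    "v xOH = hdp out 0" "M = fseg out 0 + fseg f 0 + F"
  shows "ok I GBODY v M (\<lambda>\<tau> v' M'. \<tau> \<le> 20 \<and> (\<exists>n g r. v' xF = hdp r 0 \<and>
     groups f = g # groups r \<and> length r < length f \<and>
     kids n = g \<and> key n = key (hd f) \<and> hd g = hd f \<and>
     M' = fseg (out @ [n]) 0 + fseg r 0 + F \<and> v' xOT = adr n \<and>
     v' xOH = hdp (out @ [n]) 0 \<and> same 28 v v'))"
proof (rule ok_addr)
  assume pos: "\<And>a ws. (a, ws) \<in># M \<Longrightarrow> 0 < a"
  obtain a k cs us where f: "f = Tr a k cs # us" using assms(2) by (metis list.exhaust tr.exhaust)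
  let ?G = "add_mset (a, [k, hdp cs 0, hdp us 0]) (fseg cs 0 + fseg out 0 + F)"
  have M: "M = fseg us 0 + ?G" using assms f by simp
  have M2: "M = fseg (tl us) 0 + (M - fseg (tl us) 0)"
    using M by (cases us; cases "hd us") auto
  define v1 where "v1 = v(xP2 := hdp us 0, xP3 := hdp (tl us) 0, xP4 := hdp (tl (tl us)) 0, xK := k)"
  have v1: "v1 xP2 = hdp us 0" "v1 xP3 = hdp (tl us) 0" "v1 xP4 = hdp (tl (tl us)) 0" "v1 xK = k"
    "v1 xF = a" "v1 xOT = v xOT" "v1 xOH = v xOH" "same 28 v v1"
    using assms f by (auto simp: v1_def same_def)
  obtain g r where gr: "groups f = g # groups r" "length r < length f" "hd g = hd f"
      "if tl (tl us) = [] then r = [] \<and> g = f else (\<exists>y. us = y # r \<and> g = [Tr a k cs, y])"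
  proof (cases "tl (tl us) = []")
    case True
    then have "us = [] \<or> (\<exists>y. us = [y]) \<or> (\<exists>y z. us = [y, z])"
      by (metis list.collapse)
    then have "groups f = [f]" using f by auto
    with that[of f "[]"] True f show ?thesis by simp
  next
    case False
    then obtain y z w r' where us: "us = y # z # w # r'" by (metis list.collapse tl_Nil)
    with that[of "[Tr a k cs, y]" "z # w # r'"] f show ?thesis by simp
  qed
  have r: "tl (tl us) \<noteq> [] \<Longrightarrow> hdp (tl us) 0 = hdp r 0" using gr by (auto split: if_splits)
  have hg: "hdp g 0 = a" using gr(4) f by (auto split: if_splits)
  define v2 where "v2 = v1(xF := hdp r 0)"
  have blk: "ok I (If (Less (Const 0) (Var xP4)) (Seq (Write (Var xP2) (Const 2) (Const 0)) (Assign xF (Var xP3)))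
     (Assign xF (Const 0))) (v1(xN := n)) (add_mset (n, [k, a, 0]) M)
     (\<lambda>\<tau> v' M'. \<tau> \<le> 3 \<and> v' = v2(xN := n) \<and>
         M' = add_mset (n, [k, a, 0]) (fseg out 0 + fseg g 0 + fseg r 0 + F))" for n
  proof (cases "tl (tl us) = []")
    case True
    then show ?thesis using assms gr v1 by (intro ok_If ok_Assign) (auto simp: v2_def fun_eq_iff)
  next
    case False
    then obtain y z w r' where us: "us = y # z # w # r'" by (metis list.collapse tl_Nil)
    obtain ya yk yc where y: "y = Tr ya yk yc" by (cases y)
    obtain wa wk wc where w: "w = Tr wa wk wc" by (cases w)
    have "w \<in> set f" using f us by simp
    then obtain ws where "(adr w, ws) \<in># fseg f 0" using adr_in_fseg by blast
    then have "0 < wa" using pos[of wa ws] assms(5) w by simp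
    then show ?thesis using assms f gr v1 us y w
      by (intro ok_If ok_Seq ok_Write[where ws="[yk, hdp yc 0, adr z]"] ok_Assign)
        (auto simp: v2_def fun_eq_iff)
  qed
  have v2: "v2 xF = hdp r 0" "v2 xOT = v xOT" "v2 xOH = v xOH" "same 28 v v2"
    using v1 by (auto simp: v2_def same_def)
  show ?thesis
    unfolding GBODY_def seqs.simps
    apply (rule ok_R[where ws="[k, hdp cs 0, hdp us 0]"], simp add: assms f, simp, simp)
    apply (rule ok_Seq, rule ok_SIB[where us=us and F="?G"], simp, rule M)
    apply (rule ok_Seq, rule ok_SIB[OF _ M2], simp)
    apply (rule ok_R[where ws="[k, hdp cs 0, hdp us 0]"], simp add: assms f, simp, simp)
    apply (fold v1_def)
    apply (rule ok_N, simp, simp add: numeral_3_eq_3)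
    subgoal for n
      apply (rule ok_W[where ws="[0,0,0]"], simp, simp, simp add: v1)
      apply (rule ok_W[where ws="[k,0,0]"], simp, simp, simp add: v1)
      apply (rule ok_C[OF blk], simp, simp)
      apply (elim conjE)
      apply (rule ok_Seq, rule ok_LINK[where out=out and F="add_mset (n, [k, a, 0]) (fseg g 0 + fseg r 0 + F)"])
          apply (simp add: v2 assms)
         apply (simp add: v2 assms)
        apply simp
       apply simp
      apply (rule ok_A, simp)
      apply (rule ok_Skip)
      apply (rule conjI, simp)
      apply (rule exI[of _ "Tr n k g"], rule exI[of _ g], rule exI[of _ r])
      using gr(1-3) f v2 hg by (auto simp: fseg_append hdp_append same_def)
    done
qed

lemma ok_GLOOP:
  assumes "v xF = hdp f 0" "v xOT = (if out = [] then 0 else adr (last out))"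
    "v xOH = hdp out 0" "M = fseg out 0 + fseg f 0 + F"
  shows "ok I (While (Less (Const 0) (Var xF)) GBODY) v M (\<lambda>\<tau> v' M'. \<tau> \<le> 21 * length (groups f) + 1 \<and>
     (\<exists>g. grouped f g \<and> M' = fseg (out @ g) 0 + F \<and> v' xOH = hdp (out @ g) 0 \<and> same 28 v v'))"
  using assms
proof (induction "length f" arbitrary: f v out M rule: less_induct)
  case less
  show ?case
  proof (cases "f = []")
    case True
    with less show ?thesis by (intro ok_While) (auto simp: grouped_def)
  next
    case False
    show ?thesis
    proof (rule ok_addr)
      assume pos: "\<And>a ws. (a, ws) \<in># M \<Longrightarrow> 0 < a"
      have p: "0 < v xF" using pos[of "v xF"] False less.prems by (cases f; cases "hd f") auto
      show "ok I (While (Less (Const 0) (Var xF)) GBODY) v M (\<lambda>\<tau> v' M'. \<tau> \<le> 21 * length (groups f) + 1 \<and>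
     (\<exists>g. grouped f g \<and> M' = fseg (out @ g) 0 + F \<and> v' xOH = hdp (out @ g) 0 \<and> same 28 v v'))"
        apply (rule ok_While)
         apply (rule ok_mono, rule ok_GBODY[OF less.prems(1) False less.prems(2-4)])
         apply (elim conjE exE)
        subgoal for \<tau> v' M' n g r
          apply (rule ok_mono, rule less.hyps[of r _ "out @ [n]"])
               apply assumption
              apply assumption
             apply simp
            apply simp
           apply simp
          apply (elim conjE exE)
          subgoal for t v2 M2 gs
            apply (intro conjI exI[of _ "n # gs"])
                apply simp
               apply (simp add: grouped_def)
              apply simp
             apply simp
            apply (erule (1) same_trans)
            done
          done
        using p by simp
    qed
  qed
qed

lemma ok_GROUP:
  assumes "v xF = hdp f 0" "M = fseg f 0 + F"
  shows "ok I GROUP v M (\<lambda>\<tau> v' M'. \<tau> \<le> 21 * length f + 4 \<and>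
     (\<exists>g. grouped f g \<and> M' = fseg g 0 + F \<and> v' xOH = hdp g 0 \<and> same 28 v v'))"
proof -
  have 1: "ok I (While (Less (Const 0) (Var xF)) GBODY) (v(xOH := 0, xOT := 0)) M (\<lambda>\<tau> v' M'. \<tau> \<le> 21 * length (groups f) + 1 \<and>
     (\<exists>g. grouped f g \<and> M' = fseg ([] @ g) 0 + F \<and> v' xOH = hdp ([] @ g) 0 \<and> same 28 (v(xOH := 0, xOT := 0)) v'))"
    using assms by (intro ok_GLOOP) auto
  show ?thesis
    unfolding GROUP_def seqs.simps
    apply (rule ok_A, simp)+
    apply (rule ok_C[OF 1], simp, simp)
    apply (rule ok_Skip)
    apply (elim conjE exE)
    subgoal for t v' M' g
      using length_groups'(2)[of f] by (intro conjI exI[of _ g]) (auto simp: same_def)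
    done
qed

section \<open>Spines of digits and their potential\<close>

type_synonym spine = "(nat \<times> tr list) list"

fun gp :: "spine \<Rightarrow> nat \<Rightarrow> nat" where
  "gp [] p = p"
| "gp ((a, d) # ds) p = a"

fun gseg :: "spine \<Rightarrow> nat \<Rightarrow> cells" where
  "gseg [] p = {#}"
| "gseg ((a, d) # ds) p = add_mset (a, [hdp d 0, gp ds p]) (fseg d 0 + gseg ds p)"

lemma gp_append: "gp (xs @ ys) p = gp xs (gp ys p)"
  by (cases xs) auto

lemma gseg_append: "gseg (xs @ ys) p = gseg xs (gp ys p) + gseg ys p"
  by (induction xs) (auto simp: gp_append)

text \<open>The trees of a digit have the height at which the digit stands, so the smallest keys are
  the cheapest to reach. Only the last digit may touch the right spine. All digits before it consist
  of strict trees and hold exponentially many keys, see \<open>pok_leaves\<close>.\<close>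

fun dok :: "nat \<Rightarrow> spine \<Rightarrow> bool" where
  "dok h [] \<longleftrightarrow> True"
| "dok h ((a, d) # ds) \<longleftrightarrow> d \<noteq> [] \<and> length d \<le> 4 \<and> fok h (ds \<noteq> []) d \<and> dok (Suc h) ds"

definition dlv :: "spine \<Rightarrow> nat list" where
  "dlv ds = concat (map (flv \<circ> snd) ds)"

lemma dlv_simps [simp]: "dlv [] = []" "dlv ((a, d) # ds) = flv d @ dlv ds"
  "dlv (xs @ ys) = dlv xs @ dlv ys"
  by (simp_all add: dlv_def)

text \<open>A digit of length 1 carries extra potential for being refilled.\<close>

definition phi :: "nat \<Rightarrow> nat" where
  "phi n = (if n = 1 then 4 else n)"

definition pot :: "spine \<Rightarrow> nat" where
  "pot ds = sum_list (map (phi \<circ> length \<circ> snd) ds)"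

lemma pot_simps [simp]: "pot [] = 0" "pot ((a, d) # ds) = phi (length d) + pot ds"
  "pot (xs @ ys) = pot xs + pot ys"
  by (simp_all add: pot_def)

lemma tok_key: "tok h b t \<Longrightarrow> \<exists>ls. lv t = key t # ls"
proof (induction h arbitrary: b t)
  case 0
  then show ?case by (simp add: lv_kids)
next
  case (Suc h)
  obtain c cs where cs: "kids t = c # cs" using Suc.prems by (cases "kids t") auto
  have "\<exists>b'. tok h b' c" using Suc.prems cs by (auto split: if_splits)
  then obtain ls where "lv c = key c # ls" using Suc.IH by blast
  then show ?case using cs Suc.prems by (auto simp: lv_kids)
qed

lemma fok_tok: "fok h b f \<Longrightarrow> t \<in> set f \<Longrightarrow> \<exists>b'. tok h b' t"
proof (induction f)
  case (Cons x f)
  then show ?case by (cases "f = []") (auto simp: fok_single fok_Cons)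
qed simp

lemma tok_mono: "tok h b t \<Longrightarrow> tok h False t"
  by (induction h arbitrary: b t) auto

lemma fok_mono: "fok h b f \<Longrightarrow> fok h False f"
  using tok_mono by (auto simp: fok_def)

lemma fok_key_in: "fok h b f \<Longrightarrow> t \<in> set f \<Longrightarrow> key t \<in> set (flv f)"
proof -
  assume a: "fok h b f" "t \<in> set f"
  then obtain ls where "lv t = key t # ls" using fok_tok tok_key by blast
  with a(2) show ?thesis by (auto simp: flv_def intro!: bexI[of _ t])
qed

lemma flv_hd: "fok h b f \<Longrightarrow> f \<noteq> [] \<Longrightarrow> \<exists>ls. flv f = key (hd f) # ls"
proof -
  assume a: "fok h b f" "f \<noteq> []"
  then obtain ls where "lv (hd f) = key (hd f) # ls" using fok_tok[of h b f "hd f"] tok_key by fastforce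
  with a(2) show ?thesis by (cases f) auto
qed

section \<open>Inserting a forest in front of a spine\<close>

abbreviation (input) "xC \<equiv> 30::nat"
abbreviation (input) "xPC \<equiv> 31::nat"
abbreviation (input) "xHD \<equiv> 32::nat"
abbreviation (input) "xFF \<equiv> 33::nat"
abbreviation (input) "xZ \<equiv> 34::nat"
abbreviation (input) "xD \<equiv> 35::nat"
abbreviation (input) "xQ2 \<equiv> 36::nat"
abbreviation (input) "xQ3 \<equiv> 37::nat"
abbreviation (input) "xQ4 \<equiv> 38::nat"
abbreviation (input) "xQ5 \<equiv> 39::nat"

definition "NEWCELL = If (Equal (Var xC) (Const 0))
  (seqs [New xC (Const 2), Assign xZ (Plus (Var xZ) (Const 1)),
     If (Equal (Var xPC) (Const 0)) (Assign xHD (Var xC)) (Write (Var xPC) (Const 1) (Var xC))]) Skip"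

lemma ok_NEWCELL:
  assumes "v xC = gp ds 0" "v xPC = (if pre = [] then 0 else fst (last pre))" "v xHD = gp (pre @ ds) 0"
    "M = gseg (pre @ ds) 0 + F"
  shows "ok I NEWCELL v M (\<lambda>\<tau> v' M'. \<tau> \<le> 9 \<and> (\<exists>a d ds'. (if ds = [] then d = [] \<and> ds' = [] else ds = (a, d) # ds') \<and>
     v' xC = a \<and> v' xHD = gp (pre @ (a, d) # ds') 0 \<and> M' = gseg (pre @ (a, d) # ds') 0 + F \<and>
     v' xZ + length ds = v xZ + Suc (length ds') \<and> v' xPC = v xPC \<and> v' xFF = v xFF \<and> same 40 v v'))"
proof (rule ok_addr)
  assume pos: "\<And>a ws. (a, ws) \<in># M \<Longrightarrow> 0 < a"
  show ?thesis
  proof (cases ds)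
    case (Cons c ds')
    obtain a d where c: "c = (a, d)" by force
    have "0 < a" using pos[of a] assms Cons c by (auto simp: gseg_append)
    with assms Cons c show ?thesis unfolding NEWCELL_def
      by (intro ok_If ok_Skip) auto
  next
    case Nil
    show ?thesis
    proof (cases pre rule: rev_cases)
      case N: Nil
      show ?thesis
        unfolding NEWCELL_def seqs.simps
        apply (rule ok_If)
         apply (rule ok_N, simp, simp add: numeral_2_eq_2)
         apply (rule ok_A, simp)
         apply (rule ok_IT, simp add: assms N)
         apply (rule ok_A, simp)
         apply (rule ok_Skip)
        using assms Nil N by (auto simp: same_def)
    next
      case (snoc pre' c)
      obtain a d where c: "c = (a, d)" by force
      have m: "(a, [hdp d 0, 0]) \<in># M" using assms snoc c Nil by (auto simp: gseg_append)
      then have "0 < a" using pos by blast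
      then show ?thesis
        unfolding NEWCELL_def seqs.simps
        apply (intro ok_If)
         apply (rule ok_N, simp, simp add: numeral_2_eq_2)
         apply (rule ok_A, simp)
         apply (rule ok_IF, simp add: assms snoc c)
         apply (rule ok_W[where ws="[hdp d 0, 0]"], simp add: assms snoc c Nil gseg_append, simp, simp)
         apply (rule ok_Skip)
        using assms Nil snoc c by (auto simp: same_def gseg_append gp_append)
    qed
  qed
qed

lemma hdp_eq_0: "(\<And>a ws. (a, ws) \<in># fseg f p + F \<Longrightarrow> 0 < a) \<Longrightarrow> (hdp f 0 = 0) = (f = [])"
proof (cases f)
  case (Cons t f')
  assume a: "\<And>a ws. (a, ws) \<in># fseg f p + F \<Longrightarrow> 0 < a"
  obtain ws where "(adr t, ws) \<in># fseg f p" using adr_in_fseg[of t f p] Cons by auto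
  with a have "0 < adr t" by auto
  with Cons show ?thesis by simp
qed simp

text \<open>All keys are positions of the text, so with the bound \<open>TextLength + 1\<close> the
  walk runs to the last tree of the chain, where the second chain is attached.\<close>

definition "JOIN = seqs [Assign xE (Var xFF), Assign xBD (Plus TextLength (Const 1)), WALK,
   Write (Var xE) (Const 2) (Var xD)]"

lemma ok_JOIN:
  assumes "fok h b f" "f \<noteq> []" "\<forall>x\<in>set (flv f). x \<le> length (fst I)"
    "v xFF = hdp f 0" "v xD = hdp d 0" "M = fseg f 0 + fseg d 0 + F"
  shows "ok I JOIN v M (\<lambda>\<tau> v' M'. \<tau> \<le> 8 * length f + 4 \<and> M' = fseg (f @ d) 0 + F \<and> same 16 v v')"
proof -
  let ?v = "v(xE := v xFF, xBD := Suc (length (fst I)))"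
  have wk: "ok I WALK ?v M (\<lambda>\<tau> v' M'. M' = M \<and> (\<exists>as bs. f = as @ bs \<and> as \<noteq> [] \<and>
     (\<forall>x\<in>set (tl as). key x < ?v xBD) \<and> (bs \<noteq> [] \<longrightarrow> ?v xBD \<le> key (hd bs)) \<and>
     v' xE = adr (last as) \<and>
     v' xPE = (if butlast as = [] then 0 else adr (last (butlast as))) \<and> v' xNX = hdp bs 0 \<and>
     v' xCN + 1 = ?v xCN + length as \<and> same 16 ?v v' \<and> \<tau> \<le> 8 * length as))"
    by (rule ok_WALK[where F="fseg d 0 + F"]) (use assms in auto)
  show ?thesis
    unfolding JOIN_def seqs.simps
    apply (rule ok_A, simp)
    apply (rule ok_A, simp)
    apply (rule ok_C[OF wk], simp, simp)
    apply (elim conjE exE)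
    subgoal premises q for \<tau>2 v2 M2 as bs
    proof -
      have "bs = []"
      proof (rule ccontr)
        assume "bs \<noteq> []"
        then have "key (hd bs) \<in> set (flv f)" "Suc (length (fst I)) \<le> key (hd bs)"
          using q fok_key_in[OF assms(1), of "hd bs"] by auto
        with assms(3) show False by auto
      qed
      then have E: "v2 xE = adr (last f)" and t2: "\<tau>2 \<le> 8 * length f" using q by auto
      obtain f0 fl where f: "f = f0 @ [fl]" using assms(2) by (metis rev_exhaust)
      obtain la lk lc where fl: "fl = Tr la lk lc" by (cases fl)
      have v2: "v2 xD = hdp d 0" "same 16 v v2" using q assms by (auto simp: same_def)
      have M2: "M2 = fseg (f0 @ [fl]) 0 + fseg d 0 + F" using q(1) assms(6) f by simp
      show ?thesis
        apply (rule ok_W[where ws="[lk, hdp lc 0, 0]"], simp add: M2 E f fl fseg_append, simp, simp)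
        apply (rule ok_Skip)
        using t2 v2 by (simp add: M2 E f fl fseg_append)
    qed
    done
qed

lemma fseg_tl: "fseg (tl us) p \<subseteq># fseg us p"
proof (cases us)
  case (Cons t us')
  then show ?thesis by (cases t) (simp add: subseteq_mset_def)
qed simp

text \<open>On a fifth tree all but the first two are grouped and carried to the next digit. Two
  trees are the nonempty digit of least potential.\<close>

definition "OVERFLOW = If (Equal (Var xQ5) (Const 0)) (Assign xFF (Const 0))
     (seqs [Write (Var xQ2) (Const 2) (Const 0), Assign xF (Var xQ3), GROUP, Assign xFF (Var xOH)])"

definition "NSPLIT = seqs [Read xQ2 (Var xFF) (Const 2), SIB xQ3 xQ2, SIB xQ4 xQ3, SIB xQ5 xQ4, OVERFLOW]"

lemma ok_NSPLIT:
  assumes "g \<noteq> []" "v xFF = hdp g 0" "M = fseg g 0 + F"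
  shows "ok I NSPLIT v M (\<lambda>\<tau> v' M'. \<tau> \<le> 18 + 21 * (length g - 2) \<and> (\<exists>d' f'.
     (if length g \<le> 4 then d' = g \<and> f' = [] else d' = take 2 g \<and> grouped (drop 2 g) f') \<and>
     M' = fseg d' 0 + fseg f' 0 + F \<and> v' xFF = hdp f' 0 \<and> v' xC = v xC \<and> v' xPC = v xPC \<and>
     v' xHD = v xHD \<and> v' xZ = v xZ \<and> same 40 v v'))"
proof (rule ok_addr)
  assume pos: "\<And>a ws. (a, ws) \<in># M \<Longrightarrow> 0 < a"
  obtain a k cs us where g: "g = Tr a k cs # us" using assms(1) by (metis list.exhaust tr.exhaust)
  define v1 where "v1 = v(xQ2 := hdp us 0, xQ3 := hdp (tl us) 0, xQ4 := hdp (tl (tl us)) 0,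
     xQ5 := hdp (tl (tl (tl us))) 0)"
  have MM: "M = fseg us 0 + (add_mset (a, [k, hdp cs 0, hdp us 0]) (fseg cs 0 + F))" using g assms by simp
  have sb: "fseg (tl us) 0 \<subseteq># M" "fseg (tl (tl us)) 0 \<subseteq># M" "fseg (tl (tl (tl us))) 0 \<subseteq># M"
    unfolding MM using fseg_tl[of us 0] fseg_tl[of "tl us" 0] fseg_tl[of "tl (tl us)" 0]
    by (meson mset_subset_eq_add_left subset_mset.order_trans)+
  have MM1: "M = fseg (tl us) 0 + (M - fseg (tl us) 0)"
    and MM2: "M = fseg (tl (tl us)) 0 + (M - fseg (tl (tl us)) 0)"
    and MM3: "M = fseg (tl (tl (tl us))) 0 + (M - fseg (tl (tl (tl us))) 0)"
    using sb by (simp_all add: subset_mset.add_diff_inverse)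
  have z: "(hdp (tl (tl (tl us))) 0 = 0) = (tl (tl (tl us)) = [])"
    by (rule hdp_eq_0[where p = 0 and F="M - fseg (tl (tl (tl us))) 0"]) (use pos MM3 in metis)
  have hd: "ok I NSPLIT v M Q" if "ok I OVERFLOW v1 M (\<lambda>t. Q (8 + t))" for Q
    unfolding NSPLIT_def seqs.simps
    apply (rule ok_R[where ws="[k, hdp cs 0, hdp us 0]"], simp add: assms g, simp, simp)
    apply (rule ok_Seq, rule ok_SIB[OF _ MM], simp)
    apply (rule ok_Seq, rule ok_SIB[OF _ MM1], simp)
    apply (rule ok_Seq, rule ok_SIB[OF _ MM2], simp)
    apply (rule ok_C[OF that], simp add: v1_def, simp)
    apply (rule ok_Skip)
    apply (simp add: eval_nat_numeral)
    done
  show "ok I NSPLIT v M (\<lambda>\<tau> v' M'. \<tau> \<le> 18 + 21 * (length g - 2) \<and> (\<exists>d' f'.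
     (if length g \<le> 4 then d' = g \<and> f' = [] else d' = take 2 g \<and> grouped (drop 2 g) f') \<and>
     M' = fseg d' 0 + fseg f' 0 + F \<and> v' xFF = hdp f' 0 \<and> v' xC = v xC \<and> v' xPC = v xPC \<and>
     v' xHD = v xHD \<and> v' xZ = v xZ \<and> same 40 v v'))"
  proof (cases "length g \<le> 4")
    case True
    then have "length (tl (tl (tl us))) = 0" using g by simp
    then have "tl (tl (tl us)) = []" by (simp only: length_0_conv)
    then have "v1 xQ5 = 0" by (simp add: v1_def)
    then show ?thesis
      using assms True by (intro hd, unfold OVERFLOW_def, intro ok_If ok_Assign) (auto simp: v1_def same_def)
  next
    case False
    then have l: "4 \<le> length us" using g by simp
    then obtain y u1 where 1: "us = y # u1" by (cases us) auto
    then obtain z u2 where 2: "u1 = z # u2" using l by (cases u1) auto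
    then obtain w r' where 3: "u2 = w # r'" using l 1 by (cases u2) auto
    then have us: "us = y # z # w # r'" "r' \<noteq> []" using 1 2 l by auto
    obtain ya yk yc where y: "y = Tr ya yk yc" by (cases y)
    have z: "v1 xQ5 \<noteq> 0" using z us by (simp add: v1_def)
    let ?F = "add_mset (a, [k, hdp cs 0, ya]) (fseg cs 0 + add_mset (ya, [yk, hdp yc 0, 0]) (fseg yc 0 + F))"
    let ?v = "v1(xF := adr z)"
    have gr: "ok I GROUP ?v (fseg (z # w # r') 0 + ?F) (\<lambda>\<tau> v' M'. \<tau> \<le> 21 * length (z # w # r') + 4 \<and>
     (\<exists>g. grouped (z # w # r') g \<and> M' = fseg g 0 + ?F \<and> v' xOH = hdp g 0 \<and> same 28 ?v v'))"
      by (rule ok_GROUP) auto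
    show ?thesis
      apply (rule hd)
      unfolding OVERFLOW_def seqs.simps
      apply (rule ok_If)
      using z apply simp
      apply (rule ok_W[where ws="[yk, hdp yc 0, adr z]"], simp add: v1_def us y g assms, simp, simp add: v1_def us y g assms)
      apply (rule ok_A, simp)
      apply (rule ok_C[OF gr], simp add: v1_def us, simp)
      apply (elim conjE exE)
      apply (rule ok_A, simp)
      apply (rule ok_Skip)
      subgoal for \<tau> v' M' gs
        apply (rule conjI)
         apply (simp add: g us)
        apply (rule exI[of _ "take 2 g"], rule exI[of _ gs])
        using False g us y by (auto simp: v1_def same_def)
      done
  qed
qed

definition "NBODY = seqs [NEWCELL, Read xD (Var xC) (Const 0), JOIN, Write (Var xC) (Const 0) (Var xFF), NSPLIT,
   Assign xPC (Var xC), Read xC (Var xC) (Const 1)]"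

definition "NORM = While (Less (Const 0) (Var xFF)) NBODY"

lemma ok_NBODY:
  assumes "fok h b f" "f \<noteq> []" "\<forall>x\<in>set (flv f). x \<le> length (fst I)"
    "v xFF = hdp f 0"
    "v xC = gp ds 0" "v xPC = (if pre = [] then 0 else fst (last pre))" "v xHD = gp (pre @ ds) 0"
    "M = gseg (pre @ ds) 0 + fseg f 0 + F"
  shows "ok I NBODY v M (\<lambda>\<tau> v' M'. (\<exists>a d ds' d' f'. (if ds = [] then d = [] \<and> ds' = [] else ds = (a, d) # ds') \<and>
     \<tau> \<le> 36 + 8 * length f + 21 * (length (f @ d) - 2) \<and>
     (if length (f @ d) \<le> 4 then d' = f @ d \<and> f' = [] else d' = take 2 (f @ d) \<and> grouped (drop 2 (f @ d)) f') \<and>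
     v' xFF = hdp f' 0 \<and> v' xC = gp ds' 0 \<and> v' xPC = a \<and>
     v' xHD = gp (pre @ (a, d') # ds') 0 \<and> M' = gseg (pre @ (a, d') # ds') 0 + fseg f' 0 + F \<and>
     v' xZ + length ds = v xZ + Suc (length ds') \<and> same 40 v v'))"
proof -
  have nc: "ok I NEWCELL v M (\<lambda>\<tau> v' M'. \<tau> \<le> 9 \<and> (\<exists>a d ds'. (if ds = [] then d = [] \<and> ds' = [] else ds = (a, d) # ds') \<and>
     v' xC = a \<and> v' xHD = gp (pre @ (a, d) # ds') 0 \<and> M' = gseg (pre @ (a, d) # ds') 0 + (fseg f 0 + F) \<and>
     v' xZ + length ds = v xZ + Suc (length ds') \<and> v' xPC = v xPC \<and> v' xFF = v xFF \<and> same 40 v v'))"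
    using assms by (intro ok_NEWCELL) auto
  show ?thesis
    unfolding NBODY_def seqs.simps
    apply (rule ok_C[OF nc], simp, simp)
    apply (elim conjE exE)
    subgoal premises p for \<tau>1 v1 M1 a d ds'
    proof -
      let ?F = "gseg pre a + gseg ds' 0 + F"
      have M1: "M1 = add_mset (a, [hdp d 0, gp ds' 0]) (fseg d 0 + fseg f 0 + ?F)"
        using p by (simp add: gseg_append)
      have v1: "v1 xC = a" using p by simp
      have jn: "ok I JOIN (v1(xD := hdp d 0)) M1 (\<lambda>\<tau> v' M'. \<tau> \<le> 8 * length f + 4 \<and>
         M' = fseg (f @ d) 0 + (add_mset (a, [hdp d 0, gp ds' 0]) ?F) \<and> same 16 (v1(xD := hdp d 0)) v')"
        by (rule ok_JOIN[OF assms(1-3)]) (use p assms M1 in auto)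
      show ?thesis
        apply (rule ok_R[where ws="[hdp d 0, gp ds' 0]"], simp add: v1 M1, simp, simp)
        apply (rule ok_C[OF jn], simp, simp)
        apply (elim conjE exE)
        subgoal premises q for \<tau>2 v2 M2
        proof -
          have v2: "v2 xFF = hdp (f @ d) 0" "v2 xC = a" "v2 xHD = v1 xHD" "v2 xPC = v xPC" "v2 xZ = v1 xZ" "same 40 v v2"
            using q(3) p assms(2,4) by (auto simp: same_def hdp_append neq_Nil_conv)
          have sp: "ok I NSPLIT v2 (fseg (f @ d) 0 + add_mset (a, [v2 xFF, gp ds' 0]) ?F)
            (\<lambda>\<tau> v' M'. \<tau> \<le> 18 + 21 * (length (f @ d) - 2) \<and> (\<exists>d' f'.
     (if length (f @ d) \<le> 4 then d' = f @ d \<and> f' = [] else d' = take 2 (f @ d) \<and> grouped (drop 2 (f @ d)) f') \<and>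
     M' = fseg d' 0 + fseg f' 0 + add_mset (a, [v2 xFF, gp ds' 0]) ?F \<and> v' xFF = hdp f' 0 \<and> v' xC = v2 xC \<and> v' xPC = v2 xPC \<and>
     v' xHD = v2 xHD \<and> v' xZ = v2 xZ \<and> same 40 v2 v'))"
            by (rule ok_NSPLIT) (use assms v2 in auto)
          show ?thesis
            apply (rule ok_W[where ws="[hdp d 0, gp ds' 0]"], simp add: q(2) v2, simp, simp)
            apply (rule ok_C[OF sp], simp)
             apply (simp add: q(2) v2(2))
            apply (elim conjE exE)
            subgoal premises r for \<tau>3 v3 M3 d' f'
            proof -
              have h: "hdp d' 0 = v2 xFF"
                using r(2) v2(1) assms(2) by (cases f; cases d) (auto split: if_splits simp: take_Cons')
              show ?thesis
                apply (rule ok_A, simp)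
                apply (rule ok_R[where ws="[v2 xFF, gp ds' 0]"], simp add: r(3,5) v2(2), simp, simp)
                apply (rule ok_Skip)
                apply (rule exI[of _ a], rule exI[of _ d], rule exI[of _ ds'], rule exI[of _ d'], rule exI[of _ f'])
                using r p q v2 h by (auto simp: same_def gseg_append gp_append)
            qed
            done
        qed
        done
    qed
    done
qed

text \<open>A digit that has grown to \<open>n > 4\<close> trees keeps two and passes on at most
  half of \<open>n - 2\<close>. The number of trees not yet placed plus the potential therefore
  drops with every round; this drop gives termination and pays for the round.\<close>

lemma ok_NORM:
  assumes "fok h (ds \<noteq> []) f" "dok h ds" "\<forall>x\<in>set (flv f @ dlv ds). x \<le> length (fst I)"
    "v xFF = hdp f 0"
    "v xC = gp ds 0" "v xPC = (if pre = [] then 0 else fst (last pre))" "v xHD = gp (pre @ ds) 0"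
    "M = gseg (pre @ ds) 0 + fseg f 0 + F"
  shows "ok I NORM v M (\<lambda>\<tau> v' M'. (\<exists>ds'. dok h ds' \<and> dlv ds' = flv f @ dlv ds \<and>
     \<tau> + 100 * pot ds' \<le> 100 * (length f + pot ds) + 500 \<and> length ds \<le> length ds' \<and> (f \<noteq> [] \<longrightarrow> ds' \<noteq> []) \<and>
     v' xHD = gp (pre @ ds') 0 \<and> M' = gseg (pre @ ds') 0 + F \<and>
     v' xZ + length ds = v xZ + length ds' \<and> same 40 v v'))"
  using assms
proof (induction "length f + pot ds" arbitrary: h f ds pre v M rule: less_induct)
  case less
  show ?case
  proof (cases "f = []")
    case True
    with less.prems show ?thesis unfolding NORM_def by (intro ok_While) (auto intro!: exI[of _ ds])
  next
    case False
    have kf: "\<forall>x\<in>set (flv f). x \<le> length (fst I)" using less.prems by auto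
    show ?thesis
    proof (rule ok_addr)
      assume pos: "\<And>a ws. (a, ws) \<in># M \<Longrightarrow> 0 < a"
      have p: "0 < v xFF" using hdp_eq_0[of f 0 "gseg (pre @ ds) 0 + F"] pos False less.prems
        by (simp add: add.commute add.left_commute)
      show "ok I NORM v M (\<lambda>\<tau> v' M'. (\<exists>ds'. dok h ds' \<and> dlv ds' = flv f @ dlv ds \<and>
     \<tau> + 100 * pot ds' \<le> 100 * (length f + pot ds) + 500 \<and> length ds \<le> length ds' \<and> (f \<noteq> [] \<longrightarrow> ds' \<noteq> []) \<and>
     v' xHD = gp (pre @ ds') 0 \<and> M' = gseg (pre @ ds') 0 + F \<and>
     v' xZ + length ds = v xZ + length ds' \<and> same 40 v v'))"
        unfolding NORM_def
        apply (rule ok_While)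
         apply (rule ok_mono, rule ok_NBODY[OF less.prems(1) False kf less.prems(4-8)])
         apply (elim conjE exE)
        subgoal premises q0 for \<tau> v' M' a d ds' d' f'
        proof -
          define g where "g = f @ d"
          note q = q0[folded g_def]
          have gn: "g \<noteq> []" "length f \<le> length g" using False by (auto simp: g_def)
          have fok: "fok h (ds' \<noteq> []) g"
            unfolding g_def using q(2) less.prems(1,2) by (cases "d = []") (auto simp: fok_append split: if_splits)
          have dok: "dok (Suc h) ds'" using q(2) less.prems(2) by (auto split: if_splits)
          have lv: "flv f @ dlv ds = flv g @ dlv ds'" unfolding g_def using q(2) by (auto split: if_splits)
          \<comment> \<open>The digit \<open>d\<close> leaves the spine and joins \<open>f\<close>;
            its length is at most its potential.\<close>
          have pt: "length g + pot ds' \<le> length f + pot ds" "length d \<le> 4"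
            unfolding g_def using q(2) less.prems(2) by (auto simp: phi_def split: if_splits)
          show ?thesis
          proof (cases "length g \<le> 4")
            case True
            then have df: "d' = g" "f' = []" using q by auto
            have ph: "phi (length g) \<le> length g + 3" by (simp add: phi_def)
            show ?thesis
              apply (rule ok_While)
              using df q(5) apply simp
              apply (rule exI[of _ "(a, d') # ds'"])
              using q df fok dok lv pt ph True False gn by (auto split: if_splits)
          next
            case F2: False
            then have df: "d' = take 2 g" "grouped (drop 2 g) f'" using q by auto
            have ld2: "length (drop 2 g) = length g - 2" by (rule length_drop)
            have "0 < length f'"
              using grouped_props(3)[OF df(2)] length_groups'(1)[of "drop 2 g"] ld2 F2 by linarith
            moreover have "2 * length f' \<le> length g - 2"
              using grouped_props(3)[OF df(2)] length_groups[of "drop 2 g"] F2 ld2 by linarith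
            ultimately have len: "2 * length f' \<le> length g - 2" "f' \<noteq> []" by auto
            have g2: "g = take 2 g @ drop 2 g" "drop 2 g \<noteq> []" using F2 by simp_all
            have fk: "fok h True (take 2 g)" "fok h (ds' \<noteq> []) (drop 2 g)"
              using fok fok_append[OF g2(2), of h "ds' \<noteq> []" "take 2 g"] g2(1) by auto
            have fk2: "fok (Suc h) (ds' \<noteq> []) f'"
              by (rule grouped_props(2)[OF df(2) fk(2)]) (use F2 in auto)
            have lv2: "flv g = flv d' @ flv f'"
              using grouped_props(1)[OF df(2)] g2(1) df(1) by (metis flv_simps(3))
            have bd: "\<forall>x\<in>set (flv f' @ dlv ds'). x \<le> length (fst I)"
              using less.prems(3) lv lv2 by (metis Un_iff append.assoc set_append)
            have ld: "length d' = 2" using df F2 by simp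
            have pd: "length f' + pot ds' < length f + pot ds" using pt len F2 by linarith
            have ih: "ok I NORM v' M' (\<lambda>\<tau> v'' M''. (\<exists>ds''. dok (Suc h) ds'' \<and> dlv ds'' = flv f' @ dlv ds' \<and>
     \<tau> + 100 * pot ds'' \<le> 100 * (length f' + pot ds') + 500 \<and> length ds' \<le> length ds'' \<and> (f' \<noteq> [] \<longrightarrow> ds'' \<noteq> []) \<and>
     v'' xHD = gp ((pre @ [(a, d')]) @ ds'') 0 \<and> M'' = gseg ((pre @ [(a, d')]) @ ds'') 0 + F \<and>
     v'' xZ + length ds' = v' xZ + length ds'' \<and> same 40 v' v''))"
              by (rule less.hyps[OF pd fk2 dok bd]) (use q in auto)
            show ?thesis
              apply (rule ok_mono, rule ih[unfolded NORM_def])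
              apply (elim conjE exE)
              subgoal premises r for t v'' M'' ds''
              proof (rule exI[of _ "(a, d') # ds''"], intro conjI)
                show "dok h ((a, d') # ds'')" using r fk(1) ld df len(2) by auto
                show "dlv ((a, d') # ds'') = flv f @ dlv ds" using r lv lv2 by simp
                \<comment> \<open>With \<open>n = length g\<close> the round costs at most
                  \<open>29 * n - 5\<close>, while the potential falls by at least
                  \<open>50 * n - 100\<close>. This suffices from \<open>n = 5\<close> on.\<close>
                show "1 + \<tau> + t + 100 * pot ((a, d') # ds'') \<le> 100 * (length f + pot ds) + 500"
                  using r(3) q(3) pt(1) len(1) F2 ld gn by (simp add: phi_def)
                show "length ds \<le> length ((a, d') # ds'')" using r q(2) by (auto split: if_splits)
                show "v'' xZ + length ds = v xZ + length ((a, d') # ds'')" using r q by auto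
                show "same 40 v v''" using r q same_trans by blast
              qed (use r in auto)
              done
          qed
        qed
        using p by simp
    qed
  qed
qed

section \<open>Refilling an empty first digit\<close>

abbreviation (input) "xRH \<equiv> 40::nat"
abbreviation (input) "xRZ \<equiv> 41::nat"
abbreviation (input) "xRP \<equiv> 42::nat"
abbreviation (input) "xRN \<equiv> 43::nat"
abbreviation (input) "xRX \<equiv> 44::nat"
abbreviation (input) "xRD \<equiv> 45::nat"

definition frame :: "nat \<Rightarrow> nat \<Rightarrow> (nat \<Rightarrow> nat) \<Rightarrow> (nat \<Rightarrow> nat) \<Rightarrow> bool" where
  "frame m n v v' \<longleftrightarrow> (\<forall>x. x < m \<or> n \<le> x \<longrightarrow> v' x = v x)"

lemma frame_refl [simp]: "frame m n v v" by (simp add: frame_def)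

lemma frame_upd [simp]: "m \<le> x \<Longrightarrow> x < n \<Longrightarrow> frame m n v (v'(x := y)) = frame m n v v'"
  by (auto simp: frame_def)

lemma tok_Suc: "tok (Suc h) b t \<longleftrightarrow> kids t \<noteq> [] \<and> length (kids t) \<le> 3 \<and> (b \<longrightarrow> 2 \<le> length (kids t)) \<and>
     key (hd (kids t)) = key t \<and> fok h b (kids t)"
  by (auto simp: fok_def)

text \<open>The first tree of the next digit is dissolved: its children become the empty digit and
  its block is freed.\<close>

definition "RPRE = [Read xRN (Var xRP) (Const 1), Read xRX (Var xRN) (Const 0), Read xRD (Var xRX) (Const 1),
   Write (Var xRP) (Const 0) (Var xRD), Read xRD (Var xRX) (Const 2), Write (Var xRN) (Const 0) (Var xRD), Free (Var xRX)]"

definition "RPOST = If (Equal (Var xRD) (Const 0))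
    (seqs [Read xRX (Var xRN) (Const 1),
      If (Equal (Var xRX) (Const 0))
        (seqs [Write (Var xRP) (Const 1) (Const 0), Free (Var xRN), Assign xRZ (Minus (Var xRZ) (Const 1)),
           Assign xRP (Const 0)])
        (Assign xRP (Var xRN))])
    (Assign xRP (Const 0))"

definition "RLOOP = While (Less (Const 0) (Var xRP)) (seqs (RPRE @ [RPOST]))"

lemma gp_eq_0: "(\<And>a ws. (a, ws) \<in># gseg ds p + F \<Longrightarrow> 0 < a) \<Longrightarrow> (gp ds 0 = 0) = (ds = [])"
  by (cases ds) force+

text \<open>The refill passes on only through a digit of length one. The potential 4 of such a digit
  gives way to that of the two or three children of its tree, at most 3, and the difference pays for
  the round. Where the refill ends, the potential may rise, but only by a constant.\<close>

lemma ok_RLOOP: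
  assumes "v xRP = a" "ds \<noteq> []" "dok (Suc h) ds" "M = add_mset (a, [0, gp ds 0]) (gseg ds 0 + F)"
    "length ds < v xRZ"
  shows "ok I RLOOP v M (\<lambda>\<tau> v' M'. \<exists>d ds'. dok h ((a, d) # ds') \<and> flv d @ dlv ds' = dlv ds \<and>
     M' = gseg ((a, d) # ds') 0 + F \<and> \<tau> + 100 * pot ((a, d) # ds') \<le> 100 * pot ds + 600 \<and>
     v' xRZ + length ds = v xRZ + length ds' \<and> frame 41 46 v v')"
  using assms
proof (induction ds arbitrary: v a h M F)
  case (Cons c ds2)
  obtain b e where c: "c = (b, e)" by force
  have e: "e \<noteq> []" using Cons.prems c by simp
  obtain xa xk cs d where xd: "e = Tr xa xk cs # d" using e by (metis list.exhaust tr.exhaust)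
  have dk: "length d \<le> 3" "fok (Suc h) (ds2 \<noteq> []) (Tr xa xk cs # d)" "dok (Suc (Suc h)) ds2"
    using Cons.prems c xd by auto
  have d2: "fok (Suc h) (ds2 \<noteq> []) d" using dk(2) by (cases "d = []") (simp_all add: fok_Cons)
  have "tok (Suc h) (d \<noteq> [] \<or> ds2 \<noteq> []) (Tr xa xk cs)"
    using dk(2) by (cases "d = []") (simp_all add: fok_Cons fok_single)
  then have cs: "cs \<noteq> []" "length cs \<le> 3" "d \<noteq> [] \<or> ds2 \<noteq> [] \<longrightarrow> 2 \<le> length cs" "fok h (d \<noteq> [] \<or> ds2 \<noteq> []) cs"
    by (simp_all only: tok_Suc tr.sel) auto
  let ?M1 = "add_mset (a, [hdp cs 0, b]) (add_mset (b, [hdp d 0, gp ds2 0]) (fseg cs 0 + fseg d 0 + gseg ds2 0 + F))"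
  let ?v1 = "v(xRN := b, xRX := xa, xRD := hdp d 0)"
  have M: "M = add_mset (a, [0, b]) (add_mset (b, [xa, gp ds2 0]) (add_mset (xa, [xk, hdp cs 0, hdp d 0])
      (fseg cs 0 + fseg d 0 + gseg ds2 0 + F)))"
    using Cons.prems c xd by simp
  have pre: "ok I (seqs (RPRE @ [RPOST])) v M Q" if "ok I RPOST ?v1 ?M1 (\<lambda>t. Q (8 + t))" for Q
    unfolding RPRE_def append.simps seqs.simps
    apply (rule ok_R[where ws="[0, b]"], simp add: Cons.prems(1) M, simp, simp)
    apply (rule ok_R[where ws="[xa, gp ds2 0]"], simp add: M, simp, simp)
    apply (rule ok_R[where ws="[xk, hdp cs 0, hdp d 0]"], simp add: M, simp, simp)
    apply (rule ok_W[where ws="[0, b]"], simp add: Cons.prems(1) M, simp, simp add: Cons.prems(1) M)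
    apply (rule ok_R[where ws="[xk, hdp cs 0, hdp d 0]"], simp add: M, simp, simp)
    apply (rule ok_W[where ws="[xa, gp ds2 0]"], simp add: M, simp, simp add: M)
    apply (rule ok_F[where ws="[xk, hdp cs 0, hdp d 0]"], simp, simp)
    apply (rule ok_C[OF that], simp add: fun_eq_iff, simp add: add_mset_commute)
    apply (rule ok_Skip)
    apply (simp add: eval_nat_numeral)
    done
  show ?case
  proof (rule ok_addr)
    assume pos: "\<And>a ws. (a, ws) \<in># M \<Longrightarrow> 0 < a"
    have a0: "0 < a" "0 < b" using pos[of a] pos[of b] M by auto
    have dz: "(hdp d 0 = 0) = (d = [])"
      by (rule hdp_eq_0[where p = 0 and F="M - fseg d 0"]) (use pos M in auto)
    have gz: "(gp ds2 0 = 0) = (ds2 = [])"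
      by (rule gp_eq_0[where p = 0 and F="M - gseg ds2 0"]) (use pos M in auto)
    have loop: "ok I RLOOP v M Q" if "ok I RPOST ?v1 ?M1 (\<lambda>t v' M'. ok I RLOOP v' M' (\<lambda>t'. Q (9 + t + t')))" for Q
      unfolding RLOOP_def
      apply (rule ok_While)
       apply (rule pre)
       apply (rule ok_mono[OF that[unfolded RLOOP_def]])
      subgoal by (simp add: eval_nat_numeral)
      using a0 Cons.prems(1) by simp
    have stop: "ok I RLOOP v' M' Q" if "v' xRP = 0" "Q 1 v' M'" for v' M' Q
      unfolding RLOOP_def using that by (intro ok_While) auto
    show "ok I RLOOP v M (\<lambda>\<tau> v' M'. \<exists>d ds'. dok h ((a, d) # ds') \<and> flv d @ dlv ds' = dlv (c # ds2) \<and>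
     M' = gseg ((a, d) # ds') 0 + F \<and> \<tau> + 100 * pot ((a, d) # ds') \<le> 100 * pot (c # ds2) + 600 \<and>
     v' xRZ + length (c # ds2) = v xRZ + length ds' \<and> frame 41 46 v v')"
    proof (cases "d = []")
      case False
      show ?thesis
        apply (rule loop)
        unfolding RPOST_def
        apply (rule ok_If)
        using False dz apply simp
        apply (rule ok_Assign)
        apply (rule stop, simp)
        apply (rule exI[of _ cs], rule exI[of _ "(b, d) # ds2"])
        using False cs dk d2 c xd by (auto simp: phi_def lv_kids flv_def)
    next
      case d: True
      show ?thesis
      proof (cases "ds2 = []")
        case True
        show ?thesis
          apply (rule loop)
          unfolding RPOST_def seqs.simps
          apply (rule ok_If)
           apply (rule ok_R[where ws="[hdp d 0, gp ds2 0]"], simp, simp, simp)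
           apply (rule ok_IT, simp add: True)
           apply (rule ok_assoc)
           apply (rule ok_W[where ws="[hdp cs 0, b]"], simp add: Cons.prems(1), simp, simp add: Cons.prems(1))
           apply (rule ok_assoc)
           apply (rule ok_F[where ws="[hdp d 0, gp ds2 0]"], simp, simp)
           apply (rule ok_assoc, rule ok_A, simp)
           apply (rule ok_assoc, rule ok_A, simp)
           apply (rule ok_S)
           apply (rule ok_Skip)
           apply (rule stop, simp)
           apply (rule exI[of _ cs], rule exI[of _ "[]"])
          using True d cs dk c xd Cons.prems(5) dz by (auto simp: phi_def lv_kids flv_def)
      next
        case False
        let ?v2 = "?v1(xRX := gp ds2 0, xRP := b)"
        have ih: "ok I RLOOP ?v2 (add_mset (b, [0, gp ds2 0]) (gseg ds2 0 + (add_mset (a, [hdp cs 0, b]) (fseg cs 0 + F))))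
           (\<lambda>\<tau> v' M'. \<exists>d ds'. dok (Suc h) ((b, d) # ds') \<and> flv d @ dlv ds' = dlv ds2 \<and>
     M' = gseg ((b, d) # ds') 0 + (add_mset (a, [hdp cs 0, b]) (fseg cs 0 + F)) \<and> \<tau> + 100 * pot ((b, d) # ds') \<le> 100 * pot ds2 + 600 \<and>
     v' xRZ + length ds2 = ?v2 xRZ + length ds' \<and> frame 41 46 ?v2 v')"
          by (rule Cons.IH) (use False dk Cons.prems(5) in auto)
        show ?thesis
          apply (rule loop)
          unfolding RPOST_def seqs.simps
          apply (rule ok_If)
           apply (rule ok_R[where ws="[hdp d 0, gp ds2 0]"], simp, simp, simp)
           apply (rule ok_IF, simp add: False gz)
           apply (rule ok_A, simp)
           apply (rule ok_Skip)
           apply (rule ok_conseq[OF ih], simp, simp add: d)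
           apply (elim exE conjE)
          subgoal for \<tau> v' M' d' ds'
            apply (rule exI[of _ cs], rule exI[of _ "(b, d') # ds'"])
            using False d cs dk c xd by (auto simp: phi_def lv_kids flv_def frame_def)
          using d dz by simp
      qed
    qed
  qed
qed simp

definition "REFILL = seqs [Read xRN (Var xRH) (Const 1), If (Equal (Var xRN) (Const 0))
    (seqs [Free (Var xRH), Assign xRH (Const 0), Assign xRZ (Const 0)])
    (Seq (Assign xRP (Var xRH)) RLOOP)]"

text \<open>Restores a spine whose first digit may be empty; if there is no other digit, the cell is
  freed and the spine becomes empty.\<close>

definition "FIX = seqs [Read xRD (Var xRH) (Const 0), If (Equal (Var xRD) (Const 0)) REFILL Skip]"

lemma ok_FIX:
  assumes "v xRH = a" "v xRZ = Suc (length ds)" "fok h (ds \<noteq> []) d" "length d \<le> 4" "dok (Suc h) ds"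
    "M = gseg ((a, d) # ds) 0 + F"
  shows "ok I FIX v M (\<lambda>\<tau> v' M'. \<exists>ds'. dok h ds' \<and> dlv ds' = flv d @ dlv ds \<and> M' = gseg ds' 0 + F \<and>
     \<tau> + 100 * pot ds' \<le> 100 * pot ds + 620 \<and> v' xRH = gp ds' 0 \<and> v' xRZ = length ds' \<and> frame 40 46 v v')"
proof (rule ok_addr)
  assume pos: "\<And>a ws. (a, ws) \<in># M \<Longrightarrow> 0 < a"
  have dz: "(hdp d 0 = 0) = (d = [])"
    by (rule hdp_eq_0[where p = 0 and F="M - fseg d 0"]) (use pos assms(6) in auto)
  have gz: "(gp ds 0 = 0) = (ds = [])"
    by (rule gp_eq_0[where p = 0 and F="M - gseg ds 0"]) (use pos assms(6) in auto)
  have M: "M = add_mset (a, [hdp d 0, gp ds 0]) (fseg d 0 + gseg ds 0 + F)" using assms(6) by simp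
  show "ok I FIX v M (\<lambda>\<tau> v' M'. \<exists>ds'. dok h ds' \<and> dlv ds' = flv d @ dlv ds \<and> M' = gseg ds' 0 + F \<and>
     \<tau> + 100 * pot ds' \<le> 100 * pot ds + 620 \<and> v' xRH = gp ds' 0 \<and> v' xRZ = length ds' \<and> frame 40 46 v v')"
  proof (cases "d = []")
    case False
    show ?thesis
      unfolding FIX_def seqs.simps
      apply (rule ok_R[where ws="[hdp d 0, gp ds 0]"], simp add: assms(1) M, simp, simp)
      apply (rule ok_IF, simp add: False dz)
      apply (rule ok_S, rule ok_Skip)
      apply (rule exI[of _ "(a, d) # ds"])
      using False assms by (auto simp: phi_def)
  next
    case d: True
    show ?thesis
    proof (cases "ds = []")
      case True
      show ?thesis
        unfolding FIX_def REFILL_def seqs.simps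
        apply (rule ok_R[where ws="[hdp d 0, gp ds 0]"], simp add: assms(1) M, simp, simp)
        apply (rule ok_IT, simp add: d)
        apply (rule ok_assoc)
        apply (rule ok_R[where ws="[hdp d 0, gp ds 0]"], simp add: assms(1) M, simp, simp)
        apply (rule ok_assoc)
        apply (rule ok_IT, simp add: True)
        apply (rule ok_assoc)
        apply (rule ok_F[where ws="[hdp d 0, gp ds 0]"], simp add: assms(1) M, simp add: assms(1) M)
        apply (rule ok_assoc, rule ok_A, simp)
        apply (rule ok_assoc, rule ok_A, simp)
        apply (rule ok_S, rule ok_S, rule ok_Skip)
        apply (rule exI[of _ "[]"])
        using True d by auto
    next
      case False
      let ?v = "v(xRD := 0, xRN := gp ds 0, xRP := a)"
      have lp: "ok I RLOOP ?v M (\<lambda>\<tau> v' M'. \<exists>d ds'. dok h ((a, d) # ds') \<and> flv d @ dlv ds' = dlv ds \<and>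
     M' = gseg ((a, d) # ds') 0 + F \<and> \<tau> + 100 * pot ((a, d) # ds') \<le> 100 * pot ds + 600 \<and>
     v' xRZ + length ds = ?v xRZ + length ds' \<and> frame 41 46 ?v v')"
        by (rule ok_RLOOP) (use False assms M d in auto)
      show ?thesis
        unfolding FIX_def REFILL_def seqs.simps
        apply (rule ok_R[where ws="[hdp d 0, gp ds 0]"], simp add: assms(1) M, simp, simp)
        apply (rule ok_IT, simp add: d)
        apply (rule ok_assoc)
        apply (rule ok_R[where ws="[hdp d 0, gp ds 0]"], simp add: assms(1) M, simp, simp)
        apply (rule ok_assoc)
        apply (rule ok_IF, simp add: False gz)
        apply (rule ok_assoc, rule ok_A, simp)
        apply (rule ok_C[OF lp], simp add: d assms(1), simp)
        apply (elim exE conjE)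
        apply (rule ok_S, rule ok_Skip)
        subgoal for \<tau> v' M' d' ds'
          apply (rule exI[of _ "(a, d') # ds'"])
          using d assms(1,2) by (auto simp: frame_def)
        done
    qed
  qed
qed

definition "POP = seqs [Read xRX (Var xRH) (Const 0), Read xRD (Var xRX) (Const 2),
   Write (Var xRH) (Const 0) (Var xRD), Free (Var xRX), FIX]"

lemma ok_POP:
  assumes "v xRH = gp ds 0" "v xRZ = length ds" "dok 0 ds" "ds \<noteq> []" "M = gseg ds 0 + F"
  shows "ok I POP v M (\<lambda>\<tau> v' M'. \<exists>ds'. dok 0 ds' \<and> dlv ds = hd (dlv ds) # dlv ds' \<and> M' = gseg ds' 0 + F \<and>
     \<tau> + 100 * pot ds' \<le> 100 * pot ds + 630 \<and> v' xRH = gp ds' 0 \<and> v' xRZ = length ds' \<and> frame 40 46 v v')"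
proof -
  obtain a e ds2 where c: "ds = (a, e) # ds2" using assms(4) by (metis list.exhaust surj_pair)
  have e: "e \<noteq> []" using assms(3) c by simp
  obtain xa xk cs d where xd: "e = Tr xa xk cs # d" using e by (metis list.exhaust tr.exhaust)
  have dk: "length d \<le> 3" "fok 0 (ds2 \<noteq> []) (Tr xa xk cs # d)" "dok (Suc 0) ds2"
    using assms(3) c xd by auto
  have d2: "fok 0 (ds2 \<noteq> []) d" using dk(2) by (cases "d = []") (simp_all add: fok_Cons)
  have cs: "cs = []" using fok_tok[OF dk(2), of "Tr xa xk cs"] by simp
  have M: "M = add_mset (a, [xa, gp ds2 0]) (add_mset (xa, [xk, 0, hdp d 0]) (fseg d 0 + gseg ds2 0 + F))"
    using assms(5) c xd cs by simp
  let ?v = "v(xRX := xa, xRD := hdp d 0)"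
  have fx: "ok I FIX ?v (gseg ((a, d) # ds2) 0 + F) (\<lambda>\<tau> v' M'. \<exists>ds'. dok 0 ds' \<and> dlv ds' = flv d @ dlv ds2 \<and> M' = gseg ds' 0 + F \<and>
     \<tau> + 100 * pot ds' \<le> 100 * pot ds2 + 620 \<and> v' xRH = gp ds' 0 \<and> v' xRZ = length ds' \<and> frame 40 46 ?v v')"
    by (rule ok_FIX) (use assms c dk d2 in auto)
  show ?thesis
    unfolding POP_def seqs.simps
    apply (rule ok_R[where ws="[xa, gp ds2 0]"], simp add: assms(1) c M, simp, simp)
    apply (rule ok_R[where ws="[xk, 0, hdp d 0]"], simp add: M, simp, simp)
    apply (rule ok_W[where ws="[xa, gp ds2 0]"], simp add: assms(1) c M, simp, simp add: assms(1) c M)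
    apply (rule ok_F[where ws="[xk, 0, hdp d 0]"], simp, simp)
    apply (rule ok_C[OF fx], simp, simp)
    apply (elim exE conjE)
    apply (rule ok_Skip)
    subgoal for \<tau> v' M' ds'
      apply (rule exI[of _ ds'])
      using c xd cs by (auto simp: frame_def)
    done
qed

abbreviation (input) "xSF \<equiv> 46::nat"
abbreviation (input) "xSL \<equiv> 47::nat"
abbreviation (input) "xJ \<equiv> 48::nat"
abbreviation (input) "xST \<equiv> 50::nat"
abbreviation (input) "xX \<equiv> 51::nat"
abbreviation (input) "xKID \<equiv> 52::nat"
abbreviation (input) "xT \<equiv> 53::nat"
abbreviation (input) "xQ \<equiv> 54::nat"

section \<open>Cutting a finger tree\<close>

text \<open>Keys of trees are least keys. With the bound \<open>J + 1\<close> the walk stops at the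
  last tree whose least key is at most \<open>J\<close>, the only tree that can hold keys on both
  sides of the cut.\<close>

definition "SPLITF = seqs [Assign xBD (Plus (Var xJ) (Const 1)), Assign xE (Var xSF), WALK,
   Write (Var xE) (Const 2) (Const 0),
   If (Equal (Var xPE) (Const 0)) (Assign xSL (Const 0))
     (Seq (Write (Var xPE) (Const 2) (Const 0)) (Assign xSL (Var xSF)))]"

lemma ok_SPLITF:
  assumes "f \<noteq> []" "v xSF = hdp f 0" "M = fseg f 0 + F" "key (hd f) \<le> v xJ"
  shows "ok I SPLITF v M (\<lambda>\<tau> v' M'. \<exists>l x r. f = l @ x # r \<and> key x \<le> v xJ \<and> (r \<noteq> [] \<longrightarrow> v xJ < key (hd r)) \<and>
     M' = fseg l 0 + fseg [x] 0 + fseg r 0 + F \<and> v' xE = adr x \<and> v' xSL = hdp l 0 \<and> v' xNX = hdp r 0 \<and>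
     \<tau> \<le> 8 * length f + 9 \<and> (\<forall>z. 16 \<le> z \<and> z \<noteq> xSL \<longrightarrow> v' z = v z))"
proof (rule ok_addr)
  assume pos: "\<And>a ws. (a, ws) \<in># M \<Longrightarrow> 0 < a"
  let ?v = "v(xBD := Suc (v xJ), xE := v xSF)"
  have wk: "ok I WALK ?v M (\<lambda>\<tau> v' M'. M' = M \<and> (\<exists>as bs. f = as @ bs \<and> as \<noteq> [] \<and>
     (\<forall>x\<in>set (tl as). key x < ?v xBD) \<and> (bs \<noteq> [] \<longrightarrow> ?v xBD \<le> key (hd bs)) \<and>
     v' xE = adr (last as) \<and>
     v' xPE = (if butlast as = [] then 0 else adr (last (butlast as))) \<and> v' xNX = hdp bs 0 \<and>
     v' xCN + 1 = ?v xCN + length as \<and> same 16 ?v v' \<and> \<tau> \<le> 8 * length as))"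
    by (rule ok_WALK[where F=F]) (use assms in auto)
  show "ok I SPLITF v M (\<lambda>\<tau> v' M'. \<exists>l x r. f = l @ x # r \<and> key x \<le> v xJ \<and> (r \<noteq> [] \<longrightarrow> v xJ < key (hd r)) \<and>
     M' = fseg l 0 + fseg [x] 0 + fseg r 0 + F \<and> v' xE = adr x \<and> v' xSL = hdp l 0 \<and> v' xNX = hdp r 0 \<and>
     \<tau> \<le> 8 * length f + 9 \<and> (\<forall>z. 16 \<le> z \<and> z \<noteq> xSL \<longrightarrow> v' z = v z))"
    unfolding SPLITF_def seqs.simps
    apply (rule ok_A, simp)
    apply (rule ok_A, simp)
    apply (rule ok_C[OF wk], simp, simp)
    apply (elim conjE exE)
    subgoal premises q for \<tau>2 v2 M2 as r
    proof -
      obtain l x where as: "as = l @ [x]" using q(3) by (metis rev_exhaust)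
      obtain xa xk xc where x: "x = Tr xa xk xc" by (cases x)
      have f: "f = l @ x # r" using q(2) as by simp
      have kx: "key x \<le> v xJ"
      proof (cases l)
        case Nil
        then show ?thesis using assms(4) f by simp
      next
        case (Cons t l')
        then have "x \<in> set (tl as)" using as by simp
        then show ?thesis using q(4) by auto
      qed
      have rr: "r \<noteq> [] \<longrightarrow> v xJ < key (hd r)" using q(5) by auto
      have M2: "M2 = fseg l xa + add_mset (xa, [xk, hdp xc 0, hdp r 0]) (fseg xc 0 + fseg r 0 + F)"
        using q(1) assms(3) f x by (simp add: fseg_append)
      have v2: "v2 xE = xa" "v2 xPE = (if l = [] then 0 else adr (last l))" "v2 xNX = hdp r 0"
        "\<forall>z. 16 \<le> z \<longrightarrow> v2 z = v z"
        using q(6-10) as x by (auto simp: same_def)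
      have t2: "\<tau>2 \<le> 8 * length f" using q(11) f as by simp
      show ?thesis
      proof (cases l rule: rev_cases)
        case Nil
        show ?thesis
          apply (rule ok_W[where ws="[xk, hdp xc 0, hdp r 0]"], simp add: v2 M2, simp, simp add: v2 M2)
          apply (rule ok_IT, simp add: v2 Nil)
          apply (rule ok_A, simp)
          apply (rule ok_Skip)
          apply (rule exI[of _ l], rule exI[of _ x], rule exI[of _ r])
          using f kx rr Nil v2 t2 x by simp
      next
        case (snoc l0 y)
        obtain ya yk yc where y: "y = Tr ya yk yc" by (cases y)
        have "y \<in> set f" using f snoc by simp
        then obtain ws where "(adr y, ws) \<in># fseg f 0" using adr_in_fseg by blast
        then have ya: "0 < ya" using pos[of ya ws] assms(3) y by simp
        have hl: "hdp l 0 = hdp f 0" using f snoc by (cases l0) auto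
        show ?thesis
          apply (rule ok_W[where ws="[xk, hdp xc 0, hdp r 0]"], simp add: v2 M2, simp, simp add: v2 M2)
          apply (rule ok_IF, simp add: v2 snoc y ya)
          apply (rule ok_assoc)
          apply (rule ok_W[where ws="[yk, hdp yc 0, xa]"], simp add: v2 snoc y fseg_append, simp, simp add: v2 snoc y fseg_append)
          apply (rule ok_A, simp)
          apply (rule ok_Skip)
          apply (rule exI[of _ l], rule exI[of _ x], rule exI[of _ r])
          using f kx rr v2 t2 x snoc y hl assms(2) by (simp add: fseg_append)
      qed
    qed
    done
qed

text \<open>The stack of the parts left of the path of descent, the lowest on top. They are what
  precedes one of at most three children, hence at most two trees, and never touch the right
  spine.\<close>

fun sok :: "nat \<Rightarrow> spine \<Rightarrow> bool" where
  "sok h [] \<longleftrightarrow> True"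
| "sok h ((a, l) # s) \<longleftrightarrow> fok h True l \<and> length l \<le> 2 \<and> sok (Suc h) s"

lemma sok_append: "sok h (s @ s') \<longleftrightarrow> sok h s \<and> sok (h + length s) s'"
  by (induction h s rule: sok.induct) auto

text \<open>Parts pushed earlier come from higher up and hold smaller keys, hence the
  reversal.\<close>

definition slv :: "spine \<Rightarrow> nat list" where
  "slv s = concat (rev (map (flv \<circ> snd) s))"

lemma slv_simps [simp]: "slv [] = []" "slv ((a, l) # s) = slv s @ flv l" "slv (s @ [(a, l)]) = flv l @ slv s"
  by (simp_all add: slv_def)

lemma flv_eq_Nil: "fok h b f \<Longrightarrow> flv f = [] \<longleftrightarrow> f = []"
  using flv_hd[of h b f] by (cases f) auto

lemma dlv_eq_Nil: "dok h ds \<Longrightarrow> dlv ds = [] \<longleftrightarrow> ds = []"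
  by (cases ds) (auto simp: flv_eq_Nil)

text \<open>The part right of the path becomes a new first digit of the remainder. If it is empty,
  \<open>FIX\<close> refills it, so that the remainder is a proper spine after every round.\<close>

definition "DBODY = seqs [Assign xSF (Var xKID), Free (Var xX), SPLITF, Assign xX (Var xE),
   New xT (Const 2), Write (Var xT) (Const 0) (Var xSL), Write (Var xT) (Const 1) (Var xST), Assign xST (Var xT),
   New xT (Const 2), Write (Var xT) (Const 0) (Var xNX), Write (Var xT) (Const 1) (Var xRH), Assign xRH (Var xT),
   Assign xRZ (Plus (Var xRZ) (Const 1)), FIX, Read xKID (Var xX) (Const 1)]"

definition "DLOOP = While (Less (Const 0) (Var xKID)) DBODY"

text \<open>The children of a tree of height \<open>Suc h\<close> have just the height of a digit in
  front of a spine that begins at \<open>Suc h\<close>. So the remainder grows downwards along the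
  path and reaches height 0 together with it. Each height costs a constant, including the potential
  of the digits created.\<close>

lemma ok_DLOOP:
  assumes "tok h (ds \<noteq> []) x" "v xX = adr x" "v xKID = hdp (kids x) 0" "v xST = gp sk 0"
    "v xRH = gp ds 0" "v xRZ = length ds" "dok h ds" "M = fseg [x] 0 + gseg ds 0 + gseg sk 0 + F"
    "key x \<le> v xJ" "dlv ds \<noteq> [] \<longrightarrow> v xJ < hd (dlv ds)"
  shows "ok I DLOOP v M (\<lambda>\<tau> v' M'. \<exists>y new ds'. kids y = [] \<and> length new = h \<and> sok 0 new \<and> dok 0 ds' \<and>
     lv x @ dlv ds = slv new @ key y # dlv ds' \<and> key y \<le> v xJ \<and> (dlv ds' \<noteq> [] \<longrightarrow> v xJ < hd (dlv ds')) \<and>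
     M' = fseg [y] 0 + gseg ds' 0 + gseg (new @ sk) 0 + F \<and> v' xX = adr y \<and> v' xST = gp (new @ sk) 0 \<and>
     v' xRH = gp ds' 0 \<and> v' xRZ = length ds' \<and> \<tau> + 100 * pot ds' \<le> 100 * pot ds + 700 * h + 1 \<and>
     (\<forall>z. 16 \<le> z \<and> z < 40 \<or> z = xJ \<or> 54 \<le> z \<longrightarrow> v' z = v z))"
  using assms
proof (induction h arbitrary: x ds sk v M)
  case 0
  then show ?case unfolding DLOOP_def
    apply (intro ok_While)
     apply simp
    apply (rule exI[of _ x], rule exI[of _ "[]"], rule exI[of _ ds])
    by (simp add: lv_kids)
next
  case (Suc h)
  obtain xa xk cs where x: "x = Tr xa xk cs" by (cases x)
  have cs: "cs \<noteq> []" "length cs \<le> 3" "key (hd cs) = xk" "fok h (ds \<noteq> []) cs"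
    using Suc.prems(1) unfolding tok_Suc x by auto
  show ?case
  proof (rule ok_addr)
    assume pos: "\<And>a ws. (a, ws) \<in># M \<Longrightarrow> 0 < a"
    have kz: "(hdp cs 0 = 0) = (cs = [])"
      by (rule hdp_eq_0[where p = 0 and F="M - fseg cs 0"]) (use pos Suc.prems(8) x in auto)
    let ?F = "gseg ds 0 + gseg sk 0 + F"
    let ?v = "v(xSF := hdp cs 0)"
    have sp: "ok I SPLITF ?v (fseg cs 0 + ?F) (\<lambda>\<tau> v' M'. \<exists>l x r. cs = l @ x # r \<and> key x \<le> ?v xJ \<and> (r \<noteq> [] \<longrightarrow> ?v xJ < key (hd r)) \<and>
     M' = fseg l 0 + fseg [x] 0 + fseg r 0 + ?F \<and> v' xE = adr x \<and> v' xSL = hdp l 0 \<and> v' xNX = hdp r 0 \<and>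
     \<tau> \<le> 8 * length cs + 9 \<and> (\<forall>z. 16 \<le> z \<and> z \<noteq> xSL \<longrightarrow> v' z = ?v z))"
      by (rule ok_SPLITF) (use cs Suc.prems(9) x in auto)
    show "ok I DLOOP v M (\<lambda>\<tau> v' M'. \<exists>y new ds'. kids y = [] \<and> length new = Suc h \<and> sok 0 new \<and> dok 0 ds' \<and>
     lv x @ dlv ds = slv new @ key y # dlv ds' \<and> key y \<le> v xJ \<and> (dlv ds' \<noteq> [] \<longrightarrow> v xJ < hd (dlv ds')) \<and>
     M' = fseg [y] 0 + gseg ds' 0 + gseg (new @ sk) 0 + F \<and> v' xX = adr y \<and> v' xST = gp (new @ sk) 0 \<and>
     v' xRH = gp ds' 0 \<and> v' xRZ = length ds' \<and> \<tau> + 100 * pot ds' \<le> 100 * pot ds + 700 * Suc h + 1 \<and>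
     (\<forall>z. 16 \<le> z \<and> z < 40 \<or> z = xJ \<or> 54 \<le> z \<longrightarrow> v' z = v z))"
      apply (subst DLOOP_def)
      apply (rule ok_While)
       prefer 2
      using kz cs(1) Suc.prems(3) x apply simp
      apply (subst DBODY_def)
      unfolding seqs.simps
      apply (rule ok_A, simp add: Suc.prems(3) x)
      apply (rule ok_F[where ws="[xk, hdp cs 0, 0]"], simp add: Suc.prems(2,8) x, simp add: Suc.prems(2,8) x)
      apply (rule ok_C[OF sp], simp, simp)
      apply (elim conjE exE)
      subgoal premises q for \<tau>1 v1 M1 l x' r
      proof -
        note q = q(2-)
        have v1: "v1 xE = adr x'" "v1 xSL = hdp l 0" "v1 xNX = hdp r 0" "v1 xST = gp sk 0" "v1 xRH = gp ds 0"
          "v1 xRZ = length ds" "v1 xJ = v xJ" "\<forall>z. 16 \<le> z \<and> z < 40 \<or> z = xJ \<or> 54 \<le> z \<longrightarrow> v1 z = v z"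
          using q(5-9) Suc.prems(4-6) by auto
        obtain xa' xk' xc' where x': "x' = Tr xa' xk' xc'" by (cases x')
        have fl: "fok h True l" "fok h (ds \<noteq> []) r" "tok h (r \<noteq> [] \<or> ds \<noteq> []) x'"
        proof -
          have "fok h True l \<and> fok h (ds \<noteq> []) (x' # r)" using cs(4) q(1) by (simp add: fok_append)
          then show "fok h True l" "fok h (ds \<noteq> []) r" "tok h (r \<noteq> [] \<or> ds \<noteq> []) x'"
            by (cases "r = []"; simp add: fok_Cons fok_single)+
        qed
        have ln: "length l \<le> 2" "length r \<le> 4" using cs(2) q(1) by auto
        have M1: "M1 = fseg l 0 + fseg [x'] 0 + fseg r 0 + ?F" using q(4) by simp
        have fx: "ok I FIX v2 (gseg ((c, r) # ds) 0 + FX) (\<lambda>\<tau> v' M'. \<exists>ds'. dok h ds' \<and> dlv ds' = flv r @ dlv ds \<and> M' = gseg ds' 0 + FX \<and>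
     \<tau> + 100 * pot ds' \<le> 100 * pot ds + 620 \<and> v' xRH = gp ds' 0 \<and> v' xRZ = length ds' \<and> frame 40 46 v2 v')"
          if "v2 xRH = c" "v2 xRZ = Suc (length ds)" for v2 c FX
          by (rule ok_FIX) (use that fl ln Suc.prems(7) in auto)
        show ?thesis
          apply (rule ok_A, simp add: v1)
          apply (rule ok_N, simp, simp add: numeral_2_eq_2)
          subgoal for t1
            apply (rule ok_W[where ws="[0, 0]"], simp, simp, simp add: v1)
            apply (rule ok_W[where ws="[hdp l 0, 0]"], simp, simp, simp add: v1)
            apply (rule ok_A, simp)
            apply (rule ok_N, simp, simp add: numeral_2_eq_2)
            subgoal for t2
              apply (rule ok_W[where ws="[0, 0]"], simp, simp, simp add: v1)
              apply (rule ok_W[where ws="[hdp r 0, 0]"], simp, simp, simp add: v1)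
              apply (rule ok_A, simp)
              apply (rule ok_A, simp add: v1)
              apply (rule ok_C[OF fx[where FX="fseg [x'] 0 + gseg ((t1, l) # sk) 0 + F" and c=t2]])
                  prefer 3
                  apply (rule refl)
                 apply simp
                apply simp
               apply (simp add: M1)
              apply (elim exE conjE)
              subgoal premises r2 for \<tau>3 v3 M3 ds1
              proof -
                have v3: "v3 xX = xa'" "v3 xST = t1" "v3 xRH = gp ds1 0" "v3 xRZ = length ds1"
                  "\<forall>z. 16 \<le> z \<and> z < 40 \<or> z = xJ \<or> 54 \<le> z \<longrightarrow> v3 z = v z"
                  using r2(7-9) v1(8) x' by (auto simp: frame_def)
                have M3: "M3 = fseg [x'] 0 + gseg ds1 0 + gseg ((t1, l) # sk) 0 + F"
                  using r2(5) by (simp add: ac_simps)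
                \<comment> \<open>If nothing remains behind \<open>x'\<close>, its right edge is the
                  right spine and unary nodes are allowed. Otherwise there was something behind it
                  already, and it is strict.\<close>
                have tk: "tok h (ds1 \<noteq> []) x'"
                proof (cases "r \<noteq> [] \<or> ds \<noteq> []")
                  case True
                  then show ?thesis using fl(3) tok_mono by (cases "ds1 = []") auto
                next
                  case False
                  then have "dlv ds1 = []" using r2(4) by simp
                  then show ?thesis using fl(3) False dlv_eq_Nil[OF r2(3)] by simp
                qed
                have hj: "dlv ds1 \<noteq> [] \<longrightarrow> v xJ < hd (dlv ds1)"
                proof (cases "r = []")
                  case True
                  then show ?thesis using r2(4) Suc.prems(10) by simp
                next
                  case False
                  then show ?thesis using r2(4) q(3) flv_hd[OF fl(2) False] by auto
                qed
                let ?v4 = "v3(xKID := hdp xc' 0)"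
                have ih: "ok I DLOOP ?v4 M3 (\<lambda>\<tau> v' M'. \<exists>y new ds'. kids y = [] \<and> length new = h \<and> sok 0 new \<and> dok 0 ds' \<and>
     lv x' @ dlv ds1 = slv new @ key y # dlv ds' \<and> key y \<le> ?v4 xJ \<and> (dlv ds' \<noteq> [] \<longrightarrow> ?v4 xJ < hd (dlv ds')) \<and>
     M' = fseg [y] 0 + gseg ds' 0 + gseg (new @ ((t1, l) # sk)) 0 + F \<and> v' xX = adr y \<and> v' xST = gp (new @ ((t1, l) # sk)) 0 \<and>
     v' xRH = gp ds' 0 \<and> v' xRZ = length ds' \<and> \<tau> + 100 * pot ds' \<le> 100 * pot ds1 + 700 * h + 1 \<and>
     (\<forall>z. 16 \<le> z \<and> z < 40 \<or> z = xJ \<or> 54 \<le> z \<longrightarrow> v' z = ?v4 z))"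
                  by (rule Suc.IH[OF tk]) (use v3 x' r2(3) M3 q(2) hj in auto)
                show ?thesis
                  apply (rule ok_R[where ws="[xk', hdp xc' 0, 0]"], simp add: v3 M3 x', simp, simp)
                  apply (rule ok_Skip)
                  apply (rule ok_conseq[OF ih[unfolded DLOOP_def]], simp, simp)
                  apply (elim exE conjE)
                  subgoal premises s for \<tau> v' M' y new ds'
                  proof (rule exI[of _ y], rule exI[of _ "new @ [(t1, l)]"], rule exI[of _ ds'], intro conjI)
                    show "lv x @ dlv ds = slv (new @ [(t1, l)]) @ key y # dlv ds'"
                    proof -
                      have "lv x = flv l @ lv x' @ flv r" using x q(1) by (simp add: flv_def)
                      then show ?thesis using s(5) r2(4) by simp
                    qed
                    show "sok 0 (new @ [(t1, l)])" using s(2,3) fl(1) ln by (simp add: sok_append)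
                    show "\<forall>z. 16 \<le> z \<and> z < 40 \<or> z = xJ \<or> 54 \<le> z \<longrightarrow> v' z = v z"
                      using s(14) v3(5) by auto
                    show "dlv ds' \<noteq> [] \<longrightarrow> v xJ < hd (dlv ds')" using s(7) v3(5) by simp
                  qed (use s v3(5) r2(6) q(8) cs(2) in \<open>simp_all\<close>)
                  done
              qed
              done
            done
          done
      qed
      done
  qed
qed

section \<open>Climbing back: joining the stack with a second spine\<close>

abbreviation (input) "xA \<equiv> 56::nat"
abbreviation (input) "xWC \<equiv> 57::nat"
abbreviation (input) "xWP \<equiv> 58::nat"
abbreviation (input) "xWN \<equiv> 59::nat"
abbreviation (input) "xUK \<equiv> 60::nat"
abbreviation (input) "xTH \<equiv> 61::nat"
abbreviation (input) "xR1 \<equiv> 62::nat"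
abbreviation (input) "xR2 \<equiv> 63::nat"

definition "PREP = If (Equal (Var xSL) (Const 0)) Skip
   (seqs [Assign xD (Var xFF), Assign xFF (Var xSL), JOIN])"

lemma ok_PREP:
  assumes "fok h b l" "\<forall>x\<in>set (flv l). x \<le> length (fst I)" "v xSL = hdp l 0" "v xFF = hdp w 0"
    "M = fseg l 0 + fseg w 0 + F"
  shows "ok I PREP v M (\<lambda>\<tau> v' M'. \<tau> \<le> 8 * length l + 8 \<and> M' = fseg (l @ w) 0 + F \<and> v' xFF = hdp (l @ w) 0 \<and>
     (\<forall>z. 16 \<le> z \<and> z \<noteq> xFF \<and> z \<noteq> xD \<longrightarrow> v' z = v z))"
proof (rule ok_addr)
  assume pos: "\<And>a ws. (a, ws) \<in># M \<Longrightarrow> 0 < a"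
  have lz: "(hdp l 0 = 0) = (l = [])"
    by (rule hdp_eq_0[where p = 0 and F="fseg w 0 + F"]) (use pos assms(5) in auto)
  show "ok I PREP v M (\<lambda>\<tau> v' M'. \<tau> \<le> 8 * length l + 8 \<and> M' = fseg (l @ w) 0 + F \<and> v' xFF = hdp (l @ w) 0 \<and>
     (\<forall>z. 16 \<le> z \<and> z \<noteq> xFF \<and> z \<noteq> xD \<longrightarrow> v' z = v z))"
  proof (cases "l = []")
    case True
    show ?thesis unfolding PREP_def
      apply (rule ok_If)
       apply (rule ok_Skip)
      using True assms by auto
  next
    case False
    let ?v = "v(xD := hdp w 0, xFF := hdp l 0)"
    have jn: "ok I JOIN ?v M (\<lambda>\<tau> v' M'. \<tau> \<le> 8 * length l + 4 \<and> M' = fseg (l @ w) 0 + F \<and> same 16 ?v v')"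
      by (rule ok_JOIN[OF assms(1) False assms(2)]) (use assms in auto)
    show ?thesis unfolding PREP_def seqs.simps
      apply (rule ok_If)
      using False lz assms(3) apply simp
      apply (rule ok_A, simp)
      apply (rule ok_A, simp)
      apply (rule ok_C[OF jn], simp add: assms, simp)
      apply (elim conjE)
      apply (rule ok_Skip)
      using False by (auto simp: same_def neq_Nil_conv)
  qed
qed

text \<open>\<open>xZ\<close> becomes the number of digits of the result. It starts with the digits
  of \<open>Q\<close>; a round that finds no digit left in \<open>Q\<close> passes a height not yet
  counted and adds one.\<close>

definition "TAKEQ = If (Equal (Var xQ) (Const 0)) (Assign xZ (Plus (Var xZ) (Const 1)))
   (seqs [Read xD (Var xQ) (Const 0), Read xT (Var xQ) (Const 1), Free (Var xQ), Assign xQ (Var xT), JOIN])"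

lemma ok_TAKEQ:
  assumes "fok h b w" "w \<noteq> []" "\<forall>x\<in>set (flv w). x \<le> length (fst I)" "v xQ = gp Q 0" "v xFF = hdp w 0"
    "M = fseg w 0 + gseg Q 0 + F"
  shows "ok I TAKEQ v M (\<lambda>\<tau> v' M'. \<exists>g Q'. \<tau> \<le> 8 * length w + 11 \<and>
     (if Q = [] then g = w \<and> Q' = [] else (\<exists>a d. Q = (a, d) # Q' \<and> g = w @ d)) \<and>
     M' = fseg g 0 + gseg Q' 0 + F \<and> v' xFF = hdp g 0 \<and> v' xQ = gp Q' 0 \<and>
     v' xZ + length Q = v xZ + 1 + length Q' \<and>
     (\<forall>z. 16 \<le> z \<and> z \<noteq> xFF \<and> z \<noteq> xD \<and> z \<noteq> xT \<and> z \<noteq> xQ \<and> z \<noteq> xZ \<longrightarrow> v' z = v z))"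
proof (rule ok_addr)
  assume pos: "\<And>a ws. (a, ws) \<in># M \<Longrightarrow> 0 < a"
  have qz: "(gp Q 0 = 0) = (Q = [])"
    by (rule gp_eq_0[where p = 0 and F="fseg w 0 + F"]) (use pos assms(6) in auto)
  show "ok I TAKEQ v M (\<lambda>\<tau> v' M'. \<exists>g Q'. \<tau> \<le> 8 * length w + 11 \<and>
     (if Q = [] then g = w \<and> Q' = [] else (\<exists>a d. Q = (a, d) # Q' \<and> g = w @ d)) \<and>
     M' = fseg g 0 + gseg Q' 0 + F \<and> v' xFF = hdp g 0 \<and> v' xQ = gp Q' 0 \<and>
     v' xZ + length Q = v xZ + 1 + length Q' \<and>
     (\<forall>z. 16 \<le> z \<and> z \<noteq> xFF \<and> z \<noteq> xD \<and> z \<noteq> xT \<and> z \<noteq> xQ \<and> z \<noteq> xZ \<longrightarrow> v' z = v z))"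
  proof (cases Q)
    case Nil
    show ?thesis unfolding TAKEQ_def
      apply (rule ok_If)
       apply (rule ok_Assign)
      using Nil assms by auto
  next
    case (Cons c Q2)
    obtain a d where c: "c = (a, d)" by force
    let ?v = "v(xD := hdp d 0, xT := gp Q2 0, xQ := gp Q2 0)"
    let ?M = "fseg w 0 + fseg d 0 + (gseg Q2 0 + F)"
    have jn: "ok I JOIN ?v ?M (\<lambda>\<tau> v' M'. \<tau> \<le> 8 * length w + 4 \<and> M' = fseg (w @ d) 0 + (gseg Q2 0 + F) \<and> same 16 ?v v')"
      by (rule ok_JOIN[OF assms(1-3)]) (use assms in auto)
    show ?thesis unfolding TAKEQ_def seqs.simps
      apply (rule ok_If)
      using Cons qz assms(4) apply simp
      apply (rule ok_R[where ws="[hdp d 0, gp Q2 0]"], simp add: assms(4,6) Cons c, simp, simp)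
      apply (rule ok_R[where ws="[hdp d 0, gp Q2 0]"], simp add: assms(4,6) Cons c, simp, simp)
      apply (rule ok_F[where ws="[hdp d 0, gp Q2 0]"], simp add: assms(4,6) Cons c, simp add: assms(4,6) Cons c)
      apply (rule ok_A, simp)
      apply (rule ok_C[OF jn], simp, simp)
      apply (elim conjE)
      apply (rule ok_Skip)
      apply (rule exI[of _ "w @ d"], rule exI[of _ Q2])
      using Cons c assms(2,5) by (auto simp: same_def neq_Nil_conv)
  qed
qed

definition "CBODY = seqs [Read xSL (Var xST) (Const 0), Read xT (Var xST) (Const 1), Free (Var xST), Assign xST (Var xT),
   PREP, TAKEQ, Assign xF (Var xFF), GROUP, Assign xFF (Var xOH)]"

definition "CLOOP = While (Less (Const 0) (Var xST)) CBODY"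

text \<open>The bound 5 is invariant: at most two trees from the stack, five carried along and four
  of the digit are at most eleven, and grouping turns them into at most five. So every height costs
  a constant, and no potential is created.\<close>

lemma ok_CLOOP:
  assumes "sok h sk" "fok h (Q \<noteq> []) w" "w \<noteq> []" "length w \<le> 5" "dok h Q"
    "\<forall>x\<in>set (slv sk @ flv w @ dlv Q). x \<le> length (fst I)"
    "v xST = gp sk 0" "v xFF = hdp w 0" "v xQ = gp Q 0" "M = gseg sk 0 + fseg w 0 + gseg Q 0 + F"
  shows "ok I CLOOP v M (\<lambda>\<tau> v' M'. \<exists>w' Q'. fok (h + length sk) (Q' \<noteq> []) w' \<and> w' \<noteq> [] \<and> length w' \<le> 5 \<and>
     dok (h + length sk) Q' \<and> flv w' @ dlv Q' = slv sk @ flv w @ dlv Q \<and> M' = fseg w' 0 + gseg Q' 0 + F \<and>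
     v' xFF = hdp w' 0 \<and> v' xQ = gp Q' 0 \<and> v' xZ + length Q = v xZ + length sk + length Q' \<and>
     pot Q' \<le> pot Q \<and> \<tau> \<le> 400 * length sk + 1 \<and> (\<forall>z. z = xRH \<or> z = xRZ \<or> 55 \<le> z \<longrightarrow> v' z = v z))"
  using assms
proof (induction sk arbitrary: h Q w v M)
  case Nil
  show ?case unfolding CLOOP_def
    apply (rule ok_While)
    using Nil(7) apply simp
    apply (rule exI[of _ w], rule exI[of _ Q])
    using Nil by simp
next
  case (Cons c sk)
  obtain a l where c: "c = (a, l)" by force
  have l: "fok h True l" "length l \<le> 2" "sok (Suc h) sk" using Cons.prems(1) c by auto
  have bl: "\<forall>x\<in>set (flv l). x \<le> length (fst I)" "\<forall>x\<in>set (flv (l @ w)). x \<le> length (fst I)"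
    using Cons.prems(6) c by auto
  have fw: "fok h (Q \<noteq> []) (l @ w)" "l @ w \<noteq> []" "length (l @ w) \<le> 7"
    using l Cons.prems(2-4) by (simp_all add: fok_append)
  have M: "M = add_mset (a, [hdp l 0, gp sk 0]) (fseg l 0 + fseg w 0 + (gseg sk 0 + gseg Q 0 + F))"
    using Cons.prems(10) c by simp
  show ?case
  proof (rule ok_addr)
    assume pos: "\<And>a ws. (a, ws) \<in># M \<Longrightarrow> 0 < a"
    have a0: "0 < a" using pos[of a] M by auto
    let ?v1 = "v(xSL := hdp l 0, xT := gp sk 0, xST := gp sk 0)"
    have pr: "ok I PREP ?v1 (fseg l 0 + fseg w 0 + (gseg sk 0 + gseg Q 0 + F)) (\<lambda>\<tau> v' M'. \<tau> \<le> 8 * length l + 8 \<and>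
      M' = fseg (l @ w) 0 + (gseg sk 0 + gseg Q 0 + F) \<and> v' xFF = hdp (l @ w) 0 \<and>
     (\<forall>z. 16 \<le> z \<and> z \<noteq> xFF \<and> z \<noteq> xD \<longrightarrow> v' z = ?v1 z))"
      by (rule ok_PREP[OF l(1) bl(1)]) (use Cons.prems(8) in auto)
    show "ok I CLOOP v M (\<lambda>\<tau> v' M'. \<exists>w' Q'. fok (h + length (c # sk)) (Q' \<noteq> []) w' \<and> w' \<noteq> [] \<and> length w' \<le> 5 \<and>
     dok (h + length (c # sk)) Q' \<and> flv w' @ dlv Q' = slv (c # sk) @ flv w @ dlv Q \<and> M' = fseg w' 0 + gseg Q' 0 + F \<and>
     v' xFF = hdp w' 0 \<and> v' xQ = gp Q' 0 \<and> v' xZ + length Q = v xZ + length (c # sk) + length Q' \<and>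
     pot Q' \<le> pot Q \<and> \<tau> \<le> 400 * length (c # sk) + 1 \<and> (\<forall>z. z = xRH \<or> z = xRZ \<or> 55 \<le> z \<longrightarrow> v' z = v z))"
      apply (subst CLOOP_def)
      apply (rule ok_While)
       prefer 2
      using a0 Cons.prems(7) c apply simp
      apply (subst CBODY_def)
      unfolding seqs.simps
      apply (rule ok_R[where ws="[hdp l 0, gp sk 0]"], simp add: Cons.prems(7) c M, simp, simp)
      apply (rule ok_R[where ws="[hdp l 0, gp sk 0]"], simp add: Cons.prems(7) c M, simp, simp)
      apply (rule ok_F[where ws="[hdp l 0, gp sk 0]"], simp add: Cons.prems(7) c M, simp add: Cons.prems(7) c M)
      apply (rule ok_A, simp)
      apply (rule ok_C[OF pr], simp, simp)
      apply (elim conjE)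
      subgoal premises p for \<tau>1 v1 M1
      proof -
        note p = p(2-)
        have v1: "v1 xST = gp sk 0" "v1 xQ = gp Q 0" "v1 xZ = v xZ" "\<forall>z. z = xRH \<or> z = xRZ \<or> 55 \<le> z \<longrightarrow> v1 z = v z"
          using p(4) Cons.prems(9) by auto
        have tq: "ok I TAKEQ v1 (fseg (l @ w) 0 + gseg Q 0 + (gseg sk 0 + F)) (\<lambda>\<tau> v' M'. \<exists>g Q'. \<tau> \<le> 8 * length (l @ w) + 11 \<and>
     (if Q = [] then g = l @ w \<and> Q' = [] else (\<exists>a d. Q = (a, d) # Q' \<and> g = (l @ w) @ d)) \<and>
     M' = fseg g 0 + gseg Q' 0 + (gseg sk 0 + F) \<and> v' xFF = hdp g 0 \<and> v' xQ = gp Q' 0 \<and>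
     v' xZ + length Q = v1 xZ + 1 + length Q' \<and>
     (\<forall>z. 16 \<le> z \<and> z \<noteq> xFF \<and> z \<noteq> xD \<and> z \<noteq> xT \<and> z \<noteq> xQ \<and> z \<noteq> xZ \<longrightarrow> v' z = v1 z))"
          by (rule ok_TAKEQ[OF fw(1,2) bl(2)]) (use v1 p(3) in auto)
        show ?thesis
          apply (rule ok_C[OF tq], simp, simp add: p(2) ac_simps)
          apply (elim exE conjE)
          subgoal premises q for \<tau>2 v2 M2 g Q'
          proof -
            have v2: "v2 xST = gp sk 0" "\<forall>z. z = xRH \<or> z = xRZ \<or> 55 \<le> z \<longrightarrow> v2 z = v z"
              "v2 xZ + length Q = v xZ + 1 + length Q'"
              using q(6,7) v1 by auto
            have g: "fok h (Q' \<noteq> []) g" "g \<noteq> []" "length g \<le> 11" "dok (Suc h) Q'" "flv g @ dlv Q' = flv l @ flv w @ dlv Q"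
              "pot Q' \<le> pot Q"
              using q(2) fw Cons.prems(3,5) by (auto simp: fok_append split: if_splits)
            \<comment> \<open>A single tree would become a unary node away from the right spine. It
              cannot occur: if \<open>Q\<close> continues, the digit just taken and \<open>w\<close>
              contribute one tree each.\<close>
            have g7: "Q' \<noteq> [] \<longrightarrow> length g \<noteq> 1"
              using q(2) Cons.prems(3,5) by (auto simp: neq_Nil_conv split: if_splits)
            have gr: "ok I GROUP (v2(xF := hdp g 0)) (fseg g 0 + (gseg Q' 0 + (gseg sk 0 + F))) (\<lambda>\<tau> v' M'. \<tau> \<le> 21 * length g + 4 \<and>
     (\<exists>g'. grouped g g' \<and> M' = fseg g' 0 + (gseg Q' 0 + (gseg sk 0 + F)) \<and> v' xOH = hdp g' 0 \<and> same 28 (v2(xF := hdp g 0)) v'))"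
              by (rule ok_GROUP) simp_all
            show ?thesis
              apply (rule ok_A, simp add: q(4))
              apply (rule ok_C[OF gr], simp, simp add: q(3) ac_simps)
              apply (elim exE conjE)
              subgoal premises r for \<tau>3 v3 M3 g'
              proof -
                have v3: "v3 xST = gp sk 0" "v3 xQ = gp Q' 0" "\<forall>z. z = xRH \<or> z = xRZ \<or> 55 \<le> z \<longrightarrow> v3 z = v z"
                  "v3 xZ + length Q = v xZ + 1 + length Q'" "v3 xOH = hdp g' 0"
                  using r(4,5) v2 q(5) by (auto simp: same_def)
                have lg: "length g' \<le> 5" "g' \<noteq> []"
                proof -
                  have a: "length g' = length (groups g)" using grouped_props(3)[OF r(2)] .
                  then show "g' \<noteq> []" using g(2) by (metis groups_eq_Nil length_0_conv)
                  show "length g' \<le> 5" using a length_groups[of g] length_groups'(2)[of g] g(3) by linarith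
                qed
                have fg: "fok (Suc h) (Q' \<noteq> []) g'" using grouped_props(2)[OF r(2) g(1)] g7 by simp
                have lv: "flv g' = flv g" using grouped_props(1)[OF r(2)] .
                let ?v4 = "v3(xFF := hdp g' 0)"
                have bd: "\<forall>x\<in>set (slv sk @ flv g' @ dlv Q'). x \<le> length (fst I)"
                  unfolding lv g(5) using Cons.prems(6) c by auto
                have ih: "ok I CLOOP ?v4 (gseg sk 0 + fseg g' 0 + gseg Q' 0 + F) (\<lambda>\<tau> v' M'. \<exists>w' Q''. fok (Suc h + length sk) (Q'' \<noteq> []) w' \<and> w' \<noteq> [] \<and> length w' \<le> 5 \<and>
     dok (Suc h + length sk) Q'' \<and> flv w' @ dlv Q'' = slv sk @ flv g' @ dlv Q' \<and> M' = fseg w' 0 + gseg Q'' 0 + F \<and>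
     v' xFF = hdp w' 0 \<and> v' xQ = gp Q'' 0 \<and> v' xZ + length Q' = ?v4 xZ + length sk + length Q'' \<and>
     pot Q'' \<le> pot Q' \<and> \<tau> \<le> 400 * length sk + 1 \<and> (\<forall>z. z = xRH \<or> z = xRZ \<or> 55 \<le> z \<longrightarrow> v' z = ?v4 z))"
                  by (rule Cons.IH[OF l(3) fg lg(2,1) g(4) bd]) (use v3 in auto)
                show ?thesis
                  apply (rule ok_A, simp add: v3)
                  apply (rule ok_Skip)
                  apply (rule ok_conseq[OF ih[unfolded CLOOP_def]], simp, simp add: r(3) ac_simps)
                  apply (elim exE conjE)
                  subgoal premises s for \<tau> v' M' w' Q''
                    apply (rule exI[of _ w'], rule exI[of _ Q''])
                    using s v3(3,4) lv g(5,6,3) p(1) q(1) r(1) fw(3) l(2) c by auto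
                  done
              qed
              done
          qed
          done
      qed
      done
  qed
qed

section \<open>Locating the cut on the spine\<close>

definition "UPKEY = If (Equal (Var xWN) (Const 0)) (Assign xUK (Plus (Var xJ) (Const 1)))
   (Seq (Read xT (Var xWN) (Const 0)) (Read xUK (Var xT) (Const 0)))"

lemma ok_UPKEY:
  assumes "v xWN = gp ds 0" "\<forall>x\<in>set ds. snd x \<noteq> []" "M = gseg ds 0 + F"
  shows "ok I UPKEY v M (\<lambda>\<tau> v' M'. \<tau> \<le> 3 \<and> M' = M \<and> v' xUK = (if ds = [] then Suc (v xJ) else key (hd (snd (hd ds)))) \<and>
     (\<forall>z. z \<noteq> xT \<and> z \<noteq> xUK \<longrightarrow> v' z = v z))"
proof (rule ok_addr)
  assume pos: "\<And>a ws. (a, ws) \<in># M \<Longrightarrow> 0 < a"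
  have gz: "(gp ds 0 = 0) = (ds = [])"
    by (rule gp_eq_0[where p = 0 and F=F]) (use pos assms(3) in auto)
  show "ok I UPKEY v M (\<lambda>\<tau> v' M'. \<tau> \<le> 3 \<and> M' = M \<and> v' xUK = (if ds = [] then Suc (v xJ) else key (hd (snd (hd ds)))) \<and>
     (\<forall>z. z \<noteq> xT \<and> z \<noteq> xUK \<longrightarrow> v' z = v z))"
  proof (cases ds)
    case Nil
    then show ?thesis unfolding UPKEY_def using assms by (intro ok_If ok_Assign) auto
  next
    case (Cons c ds')
    obtain a d where c: "c = (a, d)" by force
    have "d \<noteq> []" using assms(2) Cons c by auto
    then obtain xa xk xc d' where d: "d = Tr xa xk xc # d'" by (metis list.exhaust tr.exhaust)
    show ?thesis unfolding UPKEY_def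
      apply (rule ok_If)
      using gz Cons assms(1) apply simp
      apply (rule ok_R[where ws="[xa, gp ds' 0]"], simp add: assms(1,3) Cons c d, simp, simp)
      apply (rule ok_Read[where ws="[xk, hdp xc 0, hdp d' 0]"])
      by (auto simp: assms(1,3) Cons c d)
  qed
qed

text \<open>A missing digit ends the loop because \<open>UPKEY\<close> then returns
  \<open>J + 1\<close>. The length \<open>xRZ\<close> is counted down so that it ends as the length
  of the spine from the current cell on.\<close>

definition "UPLOOP = While (Less (Var xUK) (Plus (Var xJ) (Const 1)))
   (seqs [Assign xWP (Var xWC), Assign xWC (Var xWN), Assign xRZ (Minus (Var xRZ) (Const 1)),
      Read xWN (Var xWC) (Const 1), UPKEY])"

lemma ok_UPLOOP:
  assumes "v xWC = c" "v xWN = gp ds 0" "v xUK = (if ds = [] then Suc (v xJ) else key (hd (snd (hd ds))))"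
    "v xRZ = Suc (length ds)" "\<forall>x\<in>set ds. snd x \<noteq> []" "M = gseg ds 0 + F" "key (hd d) \<le> v xJ"
  shows "ok I UPLOOP v M (\<lambda>\<tau> v' M'. \<exists>pre c' d' post. (c, d) # ds = pre @ (c', d') # post \<and> M' = M \<and> v' xWC = c' \<and>
     v' xWP = (if pre = [] then v xWP else fst (last pre)) \<and> v' xRZ = Suc (length post) \<and> key (hd d') \<le> v xJ \<and>
     (post \<noteq> [] \<longrightarrow> v xJ < key (hd (snd (hd post)))) \<and> \<tau> \<le> 10 * length pre + 1 \<and>
     (\<forall>z. z < 41 \<or> 41 < z \<and> z < 53 \<or> 53 < z \<and> z < 57 \<or> 61 \<le> z \<longrightarrow> v' z = v z))"
  using assms
proof (induction ds arbitrary: c d v F)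
  case Nil
  show ?case unfolding UPLOOP_def
    apply (rule ok_While)
    using Nil apply simp
    apply (rule exI[of _ "[]"], rule exI[of _ c], rule exI[of _ d], rule exI[of _ "[]"])
    using Nil by simp
next
  case (Cons e ds)
  obtain b d2 where e: "e = (b, d2)" by force
  show ?case
  proof (cases "key (hd d2) \<le> v xJ")
    case False
    show ?thesis unfolding UPLOOP_def
      apply (rule ok_While)
      using Cons.prems False e apply simp
      apply (rule exI[of _ "[]"], rule exI[of _ c], rule exI[of _ d], rule exI[of _ "e # ds"])
      using Cons.prems False e by simp
  next
    case True
    let ?G = "add_mset (b, [hdp d2 0, gp ds 0]) (fseg d2 0 + F)"
    let ?v1 = "v(xWP := c, xWC := b, xRZ := length ds + 1, xWN := gp ds 0)"
    have M: "M = gseg ds 0 + ?G" using Cons.prems(6) e by simp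
    have uk: "ok I UPKEY ?v1 M (\<lambda>\<tau> v' M'. \<tau> \<le> 3 \<and> M' = M \<and> v' xUK = (if ds = [] then Suc (?v1 xJ) else key (hd (snd (hd ds)))) \<and>
     (\<forall>z. z \<noteq> xT \<and> z \<noteq> xUK \<longrightarrow> v' z = ?v1 z))"
      by (rule ok_UPKEY) (use M Cons.prems in auto)
    show ?thesis
      apply (subst UPLOOP_def)
      apply (rule ok_While)
       prefer 2
      using Cons.prems True e apply simp
      unfolding seqs.simps
      apply (rule ok_A, simp add: Cons.prems)
      apply (rule ok_A, simp add: Cons.prems e)
      apply (rule ok_A, simp add: Cons.prems)
      apply (rule ok_R[where ws="[hdp d2 0, gp ds 0]"], simp add: M, simp, simp)
      apply (rule ok_C[OF uk], simp, simp)
      apply (elim conjE)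
      subgoal premises p for \<tau>1 v1 M1
      proof -
        note p = p(2-)
        have v1: "v1 xWC = b" "v1 xWN = gp ds 0" "v1 xRZ = Suc (length ds)" "v1 xWP = c" "v1 xJ = v xJ"
          "v1 xUK = (if ds = [] then Suc (v1 xJ) else key (hd (snd (hd ds))))"
          "\<forall>z. z < 41 \<or> 41 < z \<and> z < 53 \<or> 53 < z \<and> z < 57 \<or> 61 \<le> z \<longrightarrow> v1 z = v z"
          using p(3,4) by auto
        have ih: "ok I UPLOOP v1 M (\<lambda>\<tau> v' M'. \<exists>pre c' d' post. (b, d2) # ds = pre @ (c', d') # post \<and> M' = M \<and> v' xWC = c' \<and>
     v' xWP = (if pre = [] then v1 xWP else fst (last pre)) \<and> v' xRZ = Suc (length post) \<and> key (hd d') \<le> v1 xJ \<and>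
     (post \<noteq> [] \<longrightarrow> v1 xJ < key (hd (snd (hd post)))) \<and> \<tau> \<le> 10 * length pre + 1 \<and>
     (\<forall>z. z < 41 \<or> 41 < z \<and> z < 53 \<or> 53 < z \<and> z < 57 \<or> 61 \<le> z \<longrightarrow> v' z = v1 z))"
          by (rule Cons.IH[where F="?G"]) (use v1 Cons.prems(5) M p(2) True in auto)
        show ?thesis
          apply (rule ok_Skip)
          apply (rule ok_conseq[OF ih[unfolded UPLOOP_def seqs.simps]], simp, simp add: p(2))
          apply (elim exE conjE)
          subgoal premises s for \<tau> v' M' pre c' d' post
            apply (rule exI[of _ "(c, d) # pre"], rule exI[of _ c'], rule exI[of _ d'], rule exI[of _ post])
            using s v1 p(1,2) e by auto
          done
      qed
      done
  qed
qed

text \<open>Proper initial segments of a spine: every digit is strict, as the right spine lies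
  further on.\<close>

fun pok :: "nat \<Rightarrow> spine \<Rightarrow> bool" where
  "pok h [] \<longleftrightarrow> True"
| "pok h ((a, d) # ds) \<longleftrightarrow> d \<noteq> [] \<and> length d \<le> 4 \<and> fok h True d \<and> pok (Suc h) ds"

lemma dok_append: "ds' \<noteq> [] \<Longrightarrow> dok h (ds @ ds') \<longleftrightarrow> pok h ds \<and> dok (h + length ds) ds'"
  by (induction h ds rule: pok.induct) auto

lemma tok_leaves: "tok h True t \<Longrightarrow> 2 ^ h \<le> length (lv t)"
proof (induction h arbitrary: t)
  case 0
  then show ?case by (cases t) simp
next
  case (Suc h)
  have k: "2 \<le> length (kids t)" "fok h True (kids t)" using Suc.prems unfolding tok_Suc by auto
  then obtain x y r where xy: "kids t = x # y # r"
    by (cases "kids t"; cases "tl (kids t)") auto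
  have "tok h True x" "tok h True y" using k(2) xy
    by (cases "r = []"; simp add: fok_Cons fok_single)+
  then have "2 ^ h \<le> length (lv x)" "2 ^ h \<le> length (lv y)" using Suc.IH by auto
  then show ?case using xy by (simp add: lv_kids)
qed

text \<open>A geometric sum: each digit has at least one strict tree, which has at least
  \<open>2 ^ h\<close> leaves. This makes the depth of a cut logarithmic in the number of keys that
  are cut off.\<close>

lemma pok_leaves: "pok h ds \<Longrightarrow> 2 ^ (h + length ds) \<le> length (dlv ds) + 2 ^ h"
proof (induction h ds rule: pok.induct)
  case (2 h a d ds)
  then obtain t d' where d: "d = t # d'" by (cases d) auto
  have "tok h True t" using 2 d by (cases "d' = []") (auto simp: fok_Cons fok_single)
  then have "2 ^ h \<le> length (lv t)" by (rule tok_leaves)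
  then show ?case using 2 d by simp
qed simp

text \<open>The last digit may be degenerate, but it has a leaf, which makes up for the 1 that the
  geometric sum lacks.\<close>

lemma dok_length: "dok 0 ds \<Longrightarrow> ds \<noteq> [] \<Longrightarrow> 2 ^ (length ds - 1) \<le> length (dlv ds)"
proof -
  assume a: "dok 0 ds" "ds \<noteq> []"
  then obtain ds' c where ds: "ds = ds' @ [c]" by (metis rev_exhaust)
  have "pok 0 ds'" "dok (length ds') [c]" using a ds by (simp_all add: dok_append)
  moreover have "dlv [c] \<noteq> []" using calculation(2) dlv_eq_Nil by blast
  ultimately show ?thesis using pok_leaves[of 0 ds'] ds by (cases "dlv [c]") auto
qed

text \<open>The digits before the one that is cut belong to the front part as they stand; only their
  number, the height of the cut, enters the cost. The cell of the cut digit becomes the first cell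
  of the remainder.\<close>

definition "CUT1 = seqs [Assign xWC (Var xA), Assign xWP (Const 0), Read xWN (Var xWC) (Const 1), UPKEY, UPLOOP,
  Read xSF (Var xWC) (Const 0), SPLITF, Write (Var xWC) (Const 0) (Var xNX), Assign xRH (Var xWC), Assign xTH (Var xSL),
  Assign xX (Var xE), FIX, Read xKID (Var xX) (Const 1), Assign xST (Const 0), DLOOP]"

lemma ok_CUT1:
  assumes "dok 0 A" "A \<noteq> []" "v xA = gp A 0" "v xRZ = length A" "hd (dlv A) \<le> v xJ" "M = gseg A 0 + F"
  shows "ok I CUT1 v M (\<lambda>\<tau> v' M'. \<exists>pre c l y new ds'. pok 0 pre \<and> fok (length pre) True l \<and> length l \<le> 3 \<and>
     kids y = [] \<and> length new = length pre \<and> sok 0 new \<and> dok 0 ds' \<and>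
     dlv A = dlv pre @ flv l @ slv new @ key y # dlv ds' \<and> key y \<le> v xJ \<and> (dlv ds' \<noteq> [] \<longrightarrow> v xJ < hd (dlv ds')) \<and>
     M' = gseg pre c + fseg l 0 + fseg [y] 0 + gseg ds' 0 + gseg new 0 + F \<and>
     v' xWP = (if pre = [] then 0 else fst (last pre)) \<and> v' xTH = hdp l 0 \<and> v' xX = adr y \<and> v' xST = gp new 0 \<and>
     v' xRH = gp ds' 0 \<and> v' xRZ = length ds' \<and> (pre \<noteq> [] \<longrightarrow> fst (hd pre) = gp A 0) \<and>
     \<tau> + 100 * pot pre + 100 * pot ds' \<le> 100 * pot A + 710 * length pre + 720 \<and>
     (\<forall>z. z = xZ \<or> z = xJ \<or> z = xQ \<or> z = xA \<or> 64 \<le> z \<longrightarrow> v' z = v z))"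
proof -
  obtain a d ds where A: "A = (a, d) # ds" using assms(2) by (metis list.exhaust surj_pair)
  have ne: "\<forall>x\<in>set A. snd x \<noteq> []"
  proof -
    have "dok h A \<Longrightarrow> \<forall>x\<in>set A. snd x \<noteq> []" for h by (induction h A rule: dok.induct) auto
    with assms(1) show ?thesis by blast
  qed
  have d: "d \<noteq> []" "fok 0 (ds \<noteq> []) d" using assms(1) A by auto
  have kd: "key (hd d) \<le> v xJ" using flv_hd[OF d(2,1)] assms(5) A by auto
  let ?v1 = "v(xWC := a, xWP := 0, xWN := gp ds 0)"
  let ?G = "add_mset (a, [hdp d 0, gp ds 0]) (fseg d 0 + F)"
  have M: "M = gseg ds 0 + ?G" using assms(6) A by simp
  have uk: "ok I UPKEY ?v1 M (\<lambda>\<tau> v' M'. \<tau> \<le> 3 \<and> M' = M \<and> v' xUK = (if ds = [] then Suc (?v1 xJ) else key (hd (snd (hd ds)))) \<and>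
     (\<forall>z. z \<noteq> xT \<and> z \<noteq> xUK \<longrightarrow> v' z = ?v1 z))"
    by (rule ok_UPKEY) (use M ne A in auto)
  show ?thesis
    unfolding CUT1_def seqs.simps
    apply (rule ok_A, simp add: assms(3) A)
    apply (rule ok_A, simp)
    apply (rule ok_R[where ws="[hdp d 0, gp ds 0]"], simp add: M, simp, simp)
    apply (rule ok_C[OF uk], simp, simp)
    apply (elim conjE)
    subgoal premises p for \<tau>1 v1 M1
    proof -
      have v1: "v1 xWC = a" "v1 xWN = gp ds 0" "v1 xWP = 0" "v1 xJ = v xJ" "v1 xRZ = Suc (length ds)"
        "v1 xUK = (if ds = [] then Suc (v1 xJ) else key (hd (snd (hd ds))))"
        "\<forall>z. z = xZ \<or> z = xJ \<or> z = xQ \<or> z = xA \<or> 64 \<le> z \<longrightarrow> v1 z = v z"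
        using p(3,4) assms(4) A by auto
      have up: "ok I UPLOOP v1 M (\<lambda>\<tau> v' M'. \<exists>pre c' d' post. (a, d) # ds = pre @ (c', d') # post \<and> M' = M \<and> v' xWC = c' \<and>
     v' xWP = (if pre = [] then v1 xWP else fst (last pre)) \<and> v' xRZ = Suc (length post) \<and> key (hd d') \<le> v1 xJ \<and>
     (post \<noteq> [] \<longrightarrow> v1 xJ < key (hd (snd (hd post)))) \<and> \<tau> \<le> 10 * length pre + 1 \<and>
     (\<forall>z. z < 41 \<or> 41 < z \<and> z < 53 \<or> 53 < z \<and> z < 57 \<or> 61 \<le> z \<longrightarrow> v' z = v1 z))"
        by (rule ok_UPLOOP[where F="?G"]) (use v1 ne A M kd in auto)
      show ?thesis
        apply (rule ok_C[OF up], simp, simp add: p(2))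
        apply (elim exE conjE)
        subgoal premises q for \<tau>2 v2 M2 pre c e post
        proof -
          let ?H = "length pre"
          have v2: "v2 xWC = c" "v2 xWP = (if pre = [] then 0 else fst (last pre))" "v2 xRZ = Suc (length post)" "v2 xJ = v xJ"
            "\<forall>z. z = xZ \<or> z = xJ \<or> z = xQ \<or> z = xA \<or> 64 \<le> z \<longrightarrow> v2 z = v z"
            using q(3,4,5,9) v1 by auto
          have AA: "A = pre @ (c, e) # post" using A q(1) by simp
          have dk: "pok 0 pre" "e \<noteq> []" "length e \<le> 4" "fok ?H (post \<noteq> []) e" "dok (Suc ?H) post"
            using assms(1) AA dok_append[of "(c, e) # post" 0 pre] by auto
          have M2: "M2 = add_mset (c, [hdp e 0, gp post 0]) (fseg e 0 + (gseg pre c + gseg post 0 + F))"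
            using q(2) assms(6) AA by (simp add: gseg_append)
          let ?v3 = "v2(xSF := hdp e 0)"
          let ?F3 = "add_mset (c, [hdp e 0, gp post 0]) (gseg pre c + gseg post 0 + F)"
          have sp: "ok I SPLITF ?v3 (fseg e 0 + ?F3) (\<lambda>\<tau> v' M'. \<exists>l x r. e = l @ x # r \<and> key x \<le> ?v3 xJ \<and> (r \<noteq> [] \<longrightarrow> ?v3 xJ < key (hd r)) \<and>
     M' = fseg l 0 + fseg [x] 0 + fseg r 0 + ?F3 \<and> v' xE = adr x \<and> v' xSL = hdp l 0 \<and> v' xNX = hdp r 0 \<and>
     \<tau> \<le> 8 * length e + 9 \<and> (\<forall>z. 16 \<le> z \<and> z \<noteq> xSL \<longrightarrow> v' z = ?v3 z))"
            by (rule ok_SPLITF) (use dk q(6) v1(4) v2(4) in auto)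
          show ?thesis
            apply (rule ok_R[where ws="[hdp e 0, gp post 0]"], simp add: v2 M2, simp, simp)
            apply (rule ok_C[OF sp], simp, simp add: M2)
            apply (elim exE conjE)
            subgoal premises r for \<tau>3 v3 M3 l x rr
            proof -
              have v3: "v3 xWC = c" "v3 xNX = hdp rr 0" "v3 xSL = hdp l 0" "v3 xE = adr x" "v3 xRZ = Suc (length post)"
                "v3 xWP = v2 xWP" "\<forall>z. z = xZ \<or> z = xJ \<or> z = xQ \<or> z = xA \<or> 64 \<le> z \<longrightarrow> v3 z = v z"
                using r(5-9) v2 by auto
              have fl: "fok ?H True l" "fok ?H (post \<noteq> []) rr" "tok ?H (rr \<noteq> [] \<or> post \<noteq> []) x"
              proof -
                have "fok ?H True l \<and> fok ?H (post \<noteq> []) (x # rr)" using dk(4) r(1) by (simp add: fok_append)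
                then show "fok ?H True l" "fok ?H (post \<noteq> []) rr" "tok ?H (rr \<noteq> [] \<or> post \<noteq> []) x"
                  by (cases "rr = []"; simp add: fok_Cons fok_single)+
              qed
              have ln: "length l \<le> 3" "length rr \<le> 4" using dk(3) r(1) by auto
              obtain xa xk xc where x: "x = Tr xa xk xc" by (cases x)
              let ?v4 = "v3(xRH := c, xTH := hdp l 0, xX := adr x)"
              let ?F4 = "fseg l 0 + fseg [x] 0 + gseg pre c + F"
              have fx: "ok I FIX ?v4 (gseg ((c, rr) # post) 0 + ?F4) (\<lambda>\<tau> v' M'. \<exists>ds'. dok ?H ds' \<and> dlv ds' = flv rr @ dlv post \<and> M' = gseg ds' 0 + ?F4 \<and>
     \<tau> + 100 * pot ds' \<le> 100 * pot post + 620 \<and> v' xRH = gp ds' 0 \<and> v' xRZ = length ds' \<and> frame 40 46 ?v4 v')"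
                by (rule ok_FIX) (use v3 fl ln dk in auto)
              show ?thesis
                apply (rule ok_W[where ws="[hdp e 0, gp post 0]"], simp add: v3 r(4), simp, simp add: v3 r(4))
                apply (rule ok_A, simp add: v3)
                apply (rule ok_A, simp add: v3)
                apply (rule ok_A, simp add: v3)
                apply (rule ok_C[OF fx], simp, simp add: ac_simps)
                apply (elim exE conjE)
                subgoal premises s for \<tau>4 v4 M4 ds1
                proof -
                  have v4: "v4 xX = adr x" "v4 xTH = hdp l 0" "v4 xRH = gp ds1 0" "v4 xRZ = length ds1" "v4 xWP = v2 xWP"
                    "v4 xJ = v xJ" "\<forall>z. z = xZ \<or> z = xJ \<or> z = xQ \<or> z = xA \<or> 64 \<le> z \<longrightarrow> v4 z = v z"
                    using s(5-7) v3 by (auto simp: frame_def)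
                  have tk: "tok ?H (ds1 \<noteq> []) x"
                  proof (cases "rr \<noteq> [] \<or> post \<noteq> []")
                    case True
                    then show ?thesis using fl(3) tok_mono by (cases "ds1 = []") auto
                  next
                    case False
                    then have "dlv ds1 = []" using s(2) by simp
                    then show ?thesis using fl(3) False dlv_eq_Nil[OF s(1)] by simp
                  qed
                  have hj: "dlv ds1 \<noteq> [] \<longrightarrow> v xJ < hd (dlv ds1)"
                  proof (cases "rr = []")
                    case True
                    show ?thesis
                    proof (cases post)
                      case (Cons ce post')
                      obtain c2 e2 where ce: "ce = (c2, e2)" by force
                      have "fok (Suc ?H) (post' \<noteq> []) e2" "e2 \<noteq> []" using dk(5) Cons ce by auto
                      from flv_hd[OF this] show ?thesis using s(2) True q(7) Cons ce v1(4) by auto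
                    qed (use True s(2) in simp)
                  next
                    case False
                    then show ?thesis using s(2) r(3) flv_hd[OF fl(2) False] v2(4) by auto
                  qed
                  let ?v5 = "v4(xKID := hdp xc 0, xST := 0)"
                  let ?F5 = "fseg l 0 + gseg pre c + F"
                  have dl: "ok I DLOOP ?v5 (fseg [x] 0 + gseg ds1 0 + gseg [] 0 + ?F5) (\<lambda>\<tau> v' M'. \<exists>y new ds'. kids y = [] \<and> length new = ?H \<and> sok 0 new \<and> dok 0 ds' \<and>
     lv x @ dlv ds1 = slv new @ key y # dlv ds' \<and> key y \<le> ?v5 xJ \<and> (dlv ds' \<noteq> [] \<longrightarrow> ?v5 xJ < hd (dlv ds')) \<and>
     M' = fseg [y] 0 + gseg ds' 0 + gseg (new @ []) 0 + ?F5 \<and> v' xX = adr y \<and> v' xST = gp (new @ []) 0 \<and>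
     v' xRH = gp ds' 0 \<and> v' xRZ = length ds' \<and> \<tau> + 100 * pot ds' \<le> 100 * pot ds1 + 700 * ?H + 1 \<and>
     (\<forall>z. 16 \<le> z \<and> z < 40 \<or> z = xJ \<or> 54 \<le> z \<longrightarrow> v' z = ?v5 z))"
                    by (rule ok_DLOOP[OF tk]) (use v4 x s(1) r(2) v2(4) hj in auto)
                  show ?thesis
                    apply (rule ok_R[where ws="[xk, hdp xc 0, 0]"], simp add: v4 s(3) x, simp, simp)
                    apply (rule ok_A, simp)
                    apply (rule ok_C[OF dl], simp, simp add: s(3) ac_simps)
                    apply (elim exE conjE)
                    subgoal premises u for \<tau>5 v5 M5 y new ds'
                    proof -
                      have v5: "v5 xWP = v2 xWP" "v5 xTH = hdp l 0" "\<forall>z. z = xZ \<or> z = xJ \<or> z = xQ \<or> z = xA \<or> 64 \<le> z \<longrightarrow> v5 z = v z"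
                        using u(14) v4 by auto
                      have dA: "dlv A = dlv pre @ flv l @ slv new @ key y # dlv ds'"
                        using AA r(1) s(2) u(5) by simp
                      have ph: "100 * pot A = 100 * pot pre + 100 * phi (length e) + 100 * pot post" using AA by simp
                      have pe: "length e \<le> phi (length e)" "1 \<le> length e" using dk(2) by (auto simp: phi_def Suc_le_eq)
                      show ?thesis
                        apply (rule ok_Skip)
                        apply (rule exI[of _ pre], rule exI[of _ c], rule exI[of _ l], rule exI[of _ y], rule exI[of _ new], rule exI[of _ ds'])
                        apply (intro conjI)
                        using dk(1) fl(1) ln(1) u(1-4,6,7) v4(6) apply simp_all[7]
                        using dA apply simp
                        using u(6) v4(6) apply simp
                        using u(7) v4(6) apply simp
                        using u(8) apply (simp add: ac_simps)
                        using v5 v2 u(9-12) apply simp_all[6]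
                        subgoal using AA by (cases pre) auto
                        subgoal using u(13) s(4) r(8) q(8) p(1) ph pe by simp
                        using v5 apply simp
                        done
                    qed
                    done
                qed
                done
            qed
            done
        qed
        done
    qed
    done
qed

section \<open>Putting the front part in front of the second spine\<close>

definition "POPQ = seqs [Assign xR1 (Var xRH), Assign xR2 (Var xRZ), Assign xRH (Var xQ), Assign xRZ (Var xZ), POP,
   Assign xQ (Var xRH), Assign xZ (Var xRZ), Assign xRH (Var xR1), Assign xRZ (Var xR2)]"

lemma ok_POPQ:
  assumes "v xQ = gp Q 0" "v xZ = length Q" "dok 0 Q" "Q \<noteq> []" "M = gseg Q 0 + F"
  shows "ok I POPQ v M (\<lambda>\<tau> v' M'. \<exists>Q'. dok 0 Q' \<and> dlv Q = hd (dlv Q) # dlv Q' \<and> M' = gseg Q' 0 + F \<and>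
     \<tau> + 100 * pot Q' \<le> 100 * pot Q + 640 \<and> v' xQ = gp Q' 0 \<and> v' xZ = length Q' \<and>
     (\<forall>z. z = xRH \<or> z = xRZ \<or> z = xJ \<or> z = xST \<or> z = xX \<or> 55 \<le> z \<and> z < 62 \<or> 64 \<le> z \<longrightarrow> v' z = v z))"
proof -
  let ?v = "v(xR1 := v xRH, xR2 := v xRZ, xRH := v xQ, xRZ := v xZ)"
  have pp: "ok I POP ?v M (\<lambda>\<tau> v' M'. \<exists>ds'. dok 0 ds' \<and> dlv Q = hd (dlv Q) # dlv ds' \<and> M' = gseg ds' 0 + F \<and>
     \<tau> + 100 * pot ds' \<le> 100 * pot Q + 630 \<and> v' xRH = gp ds' 0 \<and> v' xRZ = length ds' \<and> frame 40 46 ?v v')"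
    by (rule ok_POP) (use assms in auto)
  show ?thesis
    unfolding POPQ_def seqs.simps
    apply (rule ok_A, simp)+
    apply (rule ok_C[OF pp], simp, simp)
    apply (elim exE conjE)
    apply (rule ok_A, simp)+
    apply (rule ok_Skip)
    subgoal for \<tau> v' M' ds'
      apply (rule exI[of _ ds'])
      by (auto simp: frame_def)
    done
qed

definition "LINKUP = If (Equal (Var xWP) (Const 0)) (Assign xHD (Var xQ))
   (Seq (Write (Var xWP) (Const 1) (Var xQ)) (Assign xHD (Var xA)))"

lemma ok_LINKUP:
  assumes "v xWP = (if pre = [] then 0 else fst (last pre))" "pre \<noteq> [] \<longrightarrow> fst (hd pre) = v xA"
    "M = gseg pre c + F"
  shows "ok I LINKUP v M (\<lambda>\<tau> v' M'. \<tau> \<le> 3 \<and> M' = gseg pre (v xQ) + F \<and> v' = v(xHD := gp pre (v xQ)))"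
proof (rule ok_addr)
  assume pos: "\<And>a ws. (a, ws) \<in># M \<Longrightarrow> 0 < a"
  show "ok I LINKUP v M (\<lambda>\<tau> v' M'. \<tau> \<le> 3 \<and> M' = gseg pre (v xQ) + F \<and> v' = v(xHD := gp pre (v xQ)))"
  proof (cases pre rule: rev_cases)
    case Nil
    then show ?thesis unfolding LINKUP_def using assms by (intro ok_If ok_Assign) auto
  next
    case (snoc pre' e)
    obtain a d where e: "e = (a, d)" by force
    have m: "(a, [hdp d 0, c]) \<in># M" using assms(3) snoc e by (simp add: gseg_append)
    then have "0 < a" using pos by blast
    moreover have "gp pre (v xQ) = v xA" using assms(2) snoc e by (cases pre') auto
    ultimately show ?thesis unfolding LINKUP_def using assms snoc e m
      by (intro ok_If ok_Seq ok_Write[where ws="[hdp d 0, c]"] ok_Assign) (auto simp: gseg_append)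
  qed
qed

text \<open>If the last key cut off equals the first key of \<open>Q\<close>, its leaf is kept and
  the first leaf of \<open>Q\<close> is removed instead. The keys are the same either way, and the
  forest that \<open>CLOOP\<close> starts with is not empty.\<close>

definition "CUT2 = seqs [Read xT (Var xX) (Const 0), If (Equal (Var xT) (Var xJ)) POPQ Skip,
   Assign xFF (Var xX), CLOOP, Assign xSL (Var xTH), PREP, LINKUP, Assign xC (Var xQ), Assign xPC (Var xWP), NORM]"

text \<open>The stack has one entry for every digit of \<open>pre\<close>, so the climb ends at the
  height of the digit that follows \<open>pre\<close>. There the trees carried along meet
  \<open>l\<close>, which has the same height, and \<open>NORM\<close> inserts both; since they are
  not empty, neither is the new end of the spine.\<close>

lemma ok_CUT2:
  assumes "pok 0 pre" "fok (length pre) True l" "length l \<le> 3" "kids y = []" "length new = length pre" "sok 0 new"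
    "dok 0 Q" "Q \<noteq> []" "hd (dlv Q) = v xJ"
    "\<forall>x\<in>set (flv l @ slv new @ key y # dlv Q). x \<le> length (fst I)"
    "v xWP = (if pre = [] then 0 else fst (last pre))" "pre \<noteq> [] \<longrightarrow> fst (hd pre) = v xA" "v xTH = hdp l 0" "v xX = adr y"
    "v xST = gp new 0" "v xQ = gp Q 0" "v xZ = length Q"
    "M = gseg pre c + fseg l 0 + fseg [y] 0 + gseg new 0 + gseg Q 0 + F"
  shows "ok I CUT2 v M (\<lambda>\<tau> v' M'. \<exists>res. dok 0 res \<and> res \<noteq> [] \<and>
     dlv res = dlv pre @ flv l @ slv new @ (if key y = v xJ then [] else [key y]) @ dlv Q \<and>
     M' = gseg res 0 + F \<and> v' xHD = gp res 0 \<and> v' xZ = length res \<and>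
     \<tau> + 100 * pot res \<le> 100 * pot pre + 100 * pot Q + 400 * length pre + 2100 \<and>
     (\<forall>z. z = xRH \<or> z = xRZ \<or> 64 \<le> z \<longrightarrow> v' z = v z))"
proof -
  obtain ya yk where y: "y = Tr ya yk []" using assms(4) by (cases y) auto
  let ?H = "length pre"
  let ?F1 = "gseg pre c + fseg l 0 + fseg [y] 0 + gseg new 0 + F"
  let ?v1 = "v(xT := yk)"
  have "ok I (If (Equal (Var xT) (Var xJ)) POPQ Skip) ?v1 M (\<lambda>\<tau> v' M'. \<exists>Q'. dok 0 Q' \<and> (Q' \<noteq> [] \<or> yk = v xJ) \<and>
     yk # dlv Q' = (if yk = v xJ then [] else [yk]) @ dlv Q \<and> M' = gseg Q' 0 + ?F1 \<and>
     \<tau> + 100 * pot Q' \<le> 100 * pot Q + 641 \<and> v' xQ = gp Q' 0 \<and> v' xZ = length Q' \<and>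
     (\<forall>z. z = xRH \<or> z = xRZ \<or> z = xJ \<or> z = xST \<or> z = xX \<or> 55 \<le> z \<and> z < 62 \<or> 64 \<le> z \<longrightarrow> v' z = v z))"
  proof (rule ok_If)
    assume b: "bval I ?v1 (Equal (Var xT) (Var xJ))"
    have pq: "ok I POPQ ?v1 (gseg Q 0 + ?F1) (\<lambda>\<tau> v' M'. \<exists>Q'. dok 0 Q' \<and> dlv Q = hd (dlv Q) # dlv Q' \<and> M' = gseg Q' 0 + ?F1 \<and>
     \<tau> + 100 * pot Q' \<le> 100 * pot Q + 640 \<and> v' xQ = gp Q' 0 \<and> v' xZ = length Q' \<and>
     (\<forall>z. z = xRH \<or> z = xRZ \<or> z = xJ \<or> z = xST \<or> z = xX \<or> 55 \<le> z \<and> z < 62 \<or> 64 \<le> z \<longrightarrow> v' z = ?v1 z))"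
      by (rule ok_POPQ) (use assms in auto)
    show "ok I POPQ ?v1 M (\<lambda>t v' M'. \<exists>Q'. dok 0 Q' \<and> (Q' \<noteq> [] \<or> yk = v xJ) \<and>
     yk # dlv Q' = (if yk = v xJ then [] else [yk]) @ dlv Q \<and> M' = gseg Q' 0 + ?F1 \<and>
     1 + t + 100 * pot Q' \<le> 100 * pot Q + 641 \<and> v' xQ = gp Q' 0 \<and> v' xZ = length Q' \<and>
     (\<forall>z. z = xRH \<or> z = xRZ \<or> z = xJ \<or> z = xST \<or> z = xX \<or> 55 \<le> z \<and> z < 62 \<or> 64 \<le> z \<longrightarrow> v' z = v z))"
      apply (rule ok_conseq[OF pq], simp)
      subgoal using assms(18) by (simp add: ac_simps)
      apply (elim exE conjE)
      subgoal for \<tau> v' M' Q'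
        apply (rule exI[of _ Q'])
        using b assms(9) by auto
      done
  next
    assume b: "\<not> bval I ?v1 (Equal (Var xT) (Var xJ))"
    show "ok I Skip ?v1 M (\<lambda>t v' M'. \<exists>Q'. dok 0 Q' \<and> (Q' \<noteq> [] \<or> yk = v xJ) \<and>
     yk # dlv Q' = (if yk = v xJ then [] else [yk]) @ dlv Q \<and> M' = gseg Q' 0 + ?F1 \<and>
     1 + t + 100 * pot Q' \<le> 100 * pot Q + 641 \<and> v' xQ = gp Q' 0 \<and> v' xZ = length Q' \<and>
     (\<forall>z. z = xRH \<or> z = xRZ \<or> z = xJ \<or> z = xST \<or> z = xX \<or> 55 \<le> z \<and> z < 62 \<or> 64 \<le> z \<longrightarrow> v' z = v z))"
      apply (rule ok_Skip)
      apply (rule exI[of _ Q])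
      using b assms(7,8,16-18) by (auto simp: ac_simps)
  qed
  note pq = this
  show ?thesis
    unfolding CUT2_def seqs.simps
    apply (rule ok_R[where ws="[yk, 0, 0]"], simp add: assms(14,18) y, simp, simp)
    apply (rule ok_C[OF pq], simp, simp)
    apply (elim exE conjE)
    subgoal premises p for \<tau>1 v1 M1 Qp
    proof -
      have v1: "v1 xX = adr y" "v1 xST = gp new 0" "v1 xQ = gp Qp 0" "v1 xZ = length Qp" "v1 xTH = hdp l 0"
        "v1 xWP = v xWP" "v1 xA = v xA" "\<forall>z. z = xRH \<or> z = xRZ \<or> 64 \<le> z \<longrightarrow> v1 z = v z"
        using p(6-8) assms(13-15) by auto
      have sub: "set (dlv Qp) \<subseteq> set (dlv Q)"
      proof (cases "yk = v xJ")
        case True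
        then have "dlv Q = yk # dlv Qp" using p(3) by simp
        then show ?thesis by auto
      qed (use p(3) in simp)
      let ?v2 = "v1(xFF := adr y)"
      let ?F2 = "gseg pre c + fseg l 0 + F"
      have cl: "ok I CLOOP ?v2 (gseg new 0 + fseg [y] 0 + gseg Qp 0 + ?F2) (\<lambda>\<tau> v' M'. \<exists>w' Q'. fok (0 + length new) (Q' \<noteq> []) w' \<and> w' \<noteq> [] \<and> length w' \<le> 5 \<and>
     dok (0 + length new) Q' \<and> flv w' @ dlv Q' = slv new @ flv [y] @ dlv Qp \<and> M' = fseg w' 0 + gseg Q' 0 + ?F2 \<and>
     v' xFF = hdp w' 0 \<and> v' xQ = gp Q' 0 \<and> v' xZ + length Qp = ?v2 xZ + length new + length Q' \<and>
     pot Q' \<le> pot Qp \<and> \<tau> \<le> 400 * length new + 1 \<and> (\<forall>z. z = xRH \<or> z = xRZ \<or> 55 \<le> z \<longrightarrow> v' z = ?v2 z))"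
        by (rule ok_CLOOP[OF assms(6)]) (use p(1) v1 assms(10) sub y in \<open>auto simp: fok_single\<close>)
      show ?thesis
        apply (rule ok_A, simp add: v1)
        apply (rule ok_C[OF cl], simp, simp add: p(4) ac_simps)
        apply (elim exE conjE)
        subgoal premises q for \<tau>2 v2 M2 w Q'
        proof -
          have v2: "v2 xTH = hdp l 0" "v2 xWP = v xWP" "v2 xA = v xA" "\<forall>z. z = xRH \<or> z = xRZ \<or> 64 \<le> z \<longrightarrow> v2 z = v z"
            "v2 xZ = ?H + length Q'"
            using q(9,12) v1 assms(5) by auto
          let ?v3 = "v2(xSL := hdp l 0)"
          let ?F3 = "gseg pre c + gseg Q' 0 + F"
          have pr: "ok I PREP ?v3 (fseg l 0 + fseg w 0 + ?F3) (\<lambda>\<tau> v' M'. \<tau> \<le> 8 * length l + 8 \<and> M' = fseg (l @ w) 0 + ?F3 \<and> v' xFF = hdp (l @ w) 0 \<and>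
     (\<forall>z. 16 \<le> z \<and> z \<noteq> xFF \<and> z \<noteq> xD \<longrightarrow> v' z = ?v3 z))"
            by (rule ok_PREP[OF assms(2)]) (use q(7) assms(10) in auto)
          show ?thesis
            apply (rule ok_A, simp add: v2)
            apply (rule ok_C[OF pr], simp, simp add: q(6) ac_simps)
            apply (elim conjE)
            subgoal premises r for \<tau>3 v3 M3
            proof -
              have v3: "v3 xWP = v xWP" "v3 xA = v xA" "v3 xQ = gp Q' 0" "v3 xZ = ?H + length Q'" "\<forall>z. z = xRH \<or> z = xRZ \<or> 64 \<le> z \<longrightarrow> v3 z = v z"
                using r(4) v2 q(8) by auto
              have lk: "ok I LINKUP v3 M3 (\<lambda>\<tau> v' M'. \<tau> \<le> 3 \<and> M' = gseg pre (v3 xQ) + (fseg (l @ w) 0 + gseg Q' 0 + F) \<and> v' = v3(xHD := gp pre (v3 xQ)))"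
                by (rule ok_LINKUP) (use v3 assms(11,12) r(2) in \<open>auto simp: ac_simps\<close>)
              let ?v4 = "v3(xHD := gp pre (v3 xQ), xC := gp Q' 0, xPC := v xWP)"
              have fl: "fok ?H (Q' \<noteq> []) (l @ w)" "dok ?H Q'" using q(1,2,4) assms(2,5) by (simp_all add: fok_append)
              have bd: "\<forall>x\<in>set (flv (l @ w) @ dlv Q'). x \<le> length (fst I)"
              proof -
                have "set (flv w @ dlv Q') \<subseteq> set (slv new) \<union> {key y} \<union> set (dlv Q)"
                  unfolding q(5) using sub y by auto
                then show ?thesis using assms(10) by auto
              qed
              have nm: "ok I NORM ?v4 (gseg (pre @ Q') 0 + fseg (l @ w) 0 + F) (\<lambda>\<tau> v' M'. (\<exists>ds'. dok ?H ds' \<and> dlv ds' = flv (l @ w) @ dlv Q' \<and>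
     \<tau> + 100 * pot ds' \<le> 100 * (length (l @ w) + pot Q') + 500 \<and> length Q' \<le> length ds' \<and> (l @ w \<noteq> [] \<longrightarrow> ds' \<noteq> []) \<and>
     v' xHD = gp (pre @ ds') 0 \<and> M' = gseg (pre @ ds') 0 + F \<and>
     v' xZ + length Q' = ?v4 xZ + length ds' \<and> same 40 ?v4 v'))"
                by (rule ok_NORM[OF fl bd]) (use r(3) v3 assms(11) in \<open>auto simp: gp_append\<close>)
              show ?thesis
                apply (rule ok_C[OF lk], simp, simp)
                apply (elim conjE)
                apply (rule ok_A, simp add: v3)
                apply (rule ok_A, simp add: v3)
                apply (rule ok_C[OF nm])
                  apply (simp add: v3)
                 apply (simp add: v3 gseg_append ac_simps)
                apply (elim exE conjE)
                apply (rule ok_Skip)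
                subgoal premises s for \<tau>4 v4 M4 \<tau>5 v5 M5 ds''
                proof -
                  note s = s(4-)
                  have ne: "ds'' \<noteq> []" using s(5) q(2) by simp
                  show ?thesis
                  proof (rule exI[of _ "pre @ ds''"], intro conjI)
                    show "dok 0 (pre @ ds'')" using s(1) assms(1) ne by (simp add: dok_append)
                    show "pre @ ds'' \<noteq> []" using ne by simp
                    show "dlv (pre @ ds'') = dlv pre @ flv l @ slv new @ (if key y = v xJ then [] else [key y]) @ dlv Q"
                    proof -
                      have "flv w @ dlv Q' = slv new @ (if key y = v xJ then [] else [key y]) @ dlv Q"
                        using q(5) p(3) y by auto
                      then show ?thesis using s(2) by simp
                    qed
                    show "M5 = gseg (pre @ ds'') 0 + F" using s(7) by simp
                    show "v5 xHD = gp (pre @ ds'') 0" using s(6) by simp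
                    show "v5 xZ = length (pre @ ds'')" using s(8) v3(4) by simp
                    show "\<forall>z. z = xRH \<or> z = xRZ \<or> 64 \<le> z \<longrightarrow> v5 z = v z"
                      using s(9) v3(5) by (auto simp: same_def)
                  qed (use s(3) q(3,10,11) p(5) r(1) assms(3,5) \<open>\<tau>4 \<le> 3\<close> in simp)
                qed
                done
            qed
            done
        qed
        done
    qed
    done
qed

definition "CUT = Seq CUT1 CUT2"

text \<open>\<open>H\<close> is the height of the cut. The strict digits below it hold at least
  \<open>2 ^ H - 1\<close> of the keys cut off, and the leaf at which the descent ends is one
  more.\<close>

lemma ok_CUT:
  assumes "dok 0 A" "A \<noteq> []" "dok 0 Q" "Q \<noteq> []" "v xA = gp A 0" "v xRZ = length A" "v xQ = gp Q 0" "v xZ = length Q"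
    "v xJ = hd (dlv Q)" "hd (dlv A) \<le> v xJ" "sorted_wrt (<) (dlv A)"
    "\<forall>x\<in>set (dlv A @ dlv Q). x \<le> length (fst I)" "M = gseg A 0 + gseg Q 0 + F"
  shows "ok I CUT v M (\<lambda>\<tau> v' M'. \<exists>res rest H. dok 0 res \<and> res \<noteq> [] \<and> dok 0 rest \<and>
     dlv res = filter (\<lambda>x. x < v xJ) (dlv A) @ dlv Q \<and> dlv rest = filter (\<lambda>x. v xJ < x) (dlv A) \<and>
     M' = gseg res 0 + gseg rest 0 + F \<and> v' xHD = gp res 0 \<and> v' xZ = length res \<and> v' xRH = gp rest 0 \<and> v' xRZ = length rest \<and>
     2 ^ H \<le> length (filter (\<lambda>x. x \<le> v xJ) (dlv A)) \<and>
     \<tau> + 100 * (pot res + pot rest) \<le> 100 * (pot A + pot Q) + 1110 * H + 2820 \<and>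
     (\<forall>z\<ge>64. v' z = v z))"
  unfolding CUT_def
  apply (rule ok_C[OF ok_CUT1[where F="gseg Q 0 + F"]])
          apply (rule assms(1))
         apply (rule assms(2))
        apply (rule assms(5))
       apply (rule assms(6))
      apply (rule assms(10))
     apply (rule refl)
    apply (rule refl)
   apply (simp add: assms(13))
  apply (elim exE conjE)
  subgoal premises p for \<tau>1 v1 M1 pre c l y new rest
  proof -
    have v1: "v1 xZ = length Q" "v1 xJ = v xJ" "v1 xQ = gp Q 0" "v1 xA = gp A 0" "\<forall>z\<ge>64. v1 z = v z"
      using p(20) assms(5,7,8) by auto
    have bd: "\<forall>x\<in>set (flv l @ slv new @ key y # dlv Q). x \<le> length (fst I)"
      using assms(12) p(8) by auto
    have c2: "ok I CUT2 v1 M1 (\<lambda>\<tau> v' M'. \<exists>res. dok 0 res \<and> res \<noteq> [] \<and>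
     dlv res = dlv pre @ flv l @ slv new @ (if key y = v1 xJ then [] else [key y]) @ dlv Q \<and>
     M' = gseg res 0 + (gseg rest 0 + F) \<and> v' xHD = gp res 0 \<and> v' xZ = length res \<and>
     \<tau> + 100 * pot res \<le> 100 * pot pre + 100 * pot Q + 400 * length pre + 2100 \<and>
     (\<forall>z. z = xRH \<or> z = xRZ \<or> 64 \<le> z \<longrightarrow> v' z = v1 z))"
      by (rule ok_CUT2[OF p(1-6) assms(3,4) _ bd]) (use p(11-18) v1 assms(9) in \<open>auto simp: ac_simps\<close>)
    define X0 where "X0 = dlv pre @ flv l @ slv new"
    have so: "sorted_wrt (<) (X0 @ key y # dlv rest)" using assms(11) p(8) by (simp add: X0_def)
    have X: "\<forall>x\<in>set X0. x < key y" using so by (auto simp: sorted_wrt_append)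
    have XJ: "x < v xJ" if "x \<in> set X0" for x using X p(9) that by (meson less_le_trans)
    have R: "\<forall>x\<in>set (dlv rest). v xJ < x"
    proof
      fix x assume x: "x \<in> set (dlv rest)"
      have "sorted_wrt (<) (dlv rest)" using so by (simp add: sorted_wrt_append)
      from hd_le[OF this x] p(10) x show "v xJ < x" by (cases "dlv rest") auto
    qed
    have dA: "dlv A = X0 @ key y # dlv rest" using p(8) by (simp add: X0_def)
    have f1: "filter (\<lambda>x. x < v xJ) (dlv A) = X0 @ (if key y = v xJ then [] else [key y])"
    proof -
      have "filter (\<lambda>x. x < v xJ) X0 = X0" by (rule filter_all) (rule XJ)
      moreover have "filter (\<lambda>x. x < v xJ) (dlv rest) = []" using R by (intro filter_none) auto
      ultimately show ?thesis unfolding dA using p(9) by simp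
    qed
    have f2: "filter (\<lambda>x. v xJ < x) (dlv A) = dlv rest"
    proof -
      have "filter (\<lambda>x. v xJ < x) X0 = []" by (rule filter_none) (use XJ less_asym in blast)
      moreover have "filter (\<lambda>x. v xJ < x) (dlv rest) = dlv rest" using R by (intro filter_all) auto
      ultimately show ?thesis unfolding dA using p(9) by simp
    qed
    have f3: "filter (\<lambda>x. x \<le> v xJ) (dlv A) = X0 @ [key y]"
    proof -
      have "filter (\<lambda>x. x \<le> v xJ) X0 = X0" by (rule filter_all) (use XJ less_imp_le in blast)
      moreover have "filter (\<lambda>x. x \<le> v xJ) (dlv rest) = []" using R by (intro filter_none) auto
      ultimately show ?thesis unfolding dA using p(9) by simp
    qed
    show ?thesis
      apply (rule ok_mono[OF c2])
      apply (elim exE conjE)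
      subgoal premises q for \<tau>2 v2 M2 res
      proof (rule exI[of _ res], rule exI[of _ rest], rule exI[of _ "length pre"], intro conjI)
        show "dlv res = filter (\<lambda>x. x < v xJ) (dlv A) @ dlv Q" using q(3) v1(2) unfolding f1 X0_def by simp
        show "dlv rest = filter (\<lambda>x. v xJ < x) (dlv A)" unfolding f2 by simp
        show "2 ^ length pre \<le> length (filter (\<lambda>x. x \<le> v xJ) (dlv A))"
          unfolding f3 X0_def using pok_leaves[OF p(1)] by simp
        show "M2 = gseg res 0 + gseg rest 0 + F" using q(4) by simp
        show "v2 xRH = gp rest 0" "v2 xRZ = length rest" using q(8) p(16,17) by auto
        show "\<forall>z\<ge>64. v2 z = v z" using q(8) v1(5) by auto
        show "\<tau>1 + \<tau>2 + 100 * (pot res + pot rest) \<le> 100 * (pot A + pot Q) + 1110 * length pre + 2820"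
          using q(7) p(19) by simp
      qed (use q(1,2,5,6) p(7) in simp_all)
      done
  qed
  done

section \<open>Levels in memory\<close>

text \<open>Address of the block, buffer, and finger tree.\<close>

type_synonym level = "nat \<times> tr list \<times> spine"

fun lkeys :: "level \<Rightarrow> nat list" where
  "lkeys (a, b, ds) = flv b @ dlv ds"

fun lvok :: "level \<Rightarrow> bool" where
  "lvok (a, b, ds) \<longleftrightarrow> fok 0 True b \<and> dok 0 ds"

fun blen :: "level \<Rightarrow> nat" where
  "blen (a, b, ds) = length b"

fun zlen :: "level \<Rightarrow> nat" where
  "zlen (a, b, ds) = length ds"

fun lpot :: "level \<Rightarrow> nat" where
  "lpot (a, b, ds) = pot ds"

fun lp :: "level list \<Rightarrow> nat \<Rightarrow> nat" where
  "lp [] p = p"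
| "lp (l # ls) p = fst l"

text \<open>The first word repeats the head of the level, so that heads are compared without looking
  into buffer or tree. The two lengths are stored because the decision to empty a buffer must take
  constant time.\<close>

fun lseg :: "level list \<Rightarrow> nat \<Rightarrow> cells" where
  "lseg [] p = {#}"
| "lseg ((a, b, ds) # ls) p = add_mset (a, [hd (lkeys (a, b, ds)), hdp b 0, length b, gp ds 0, length ds, lp ls p])
     (fseg b 0 + gseg ds 0 + lseg ls p)"

lemma lp_append: "lp (xs @ ys) p = lp xs (lp ys p)"
  by (cases xs) auto

lemma lseg_append: "lseg (xs @ ys) p = lseg xs (lp ys p) + lseg ys p"
proof (induction xs)
  case (Cons x xs)
  then show ?case by (cases x) (simp add: lp_append)
qed simp

abbreviation "bsum ls \<equiv> sum_list (map blen ls)"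
abbreviation "zsum ls \<equiv> sum_list (map zlen ls)"
abbreviation "psum ls \<equiv> sum_list (map lpot ls)"

abbreviation (input) "xP \<equiv> 64::nat"
abbreviation (input) "xNL \<equiv> 65::nat"
abbreviation (input) "xTR \<equiv> 66::nat"
abbreviation (input) "xPP \<equiv> 68::nat"
abbreviation (input) "xWZ \<equiv> 69::nat"
abbreviation (input) "xKK \<equiv> 70::nat"
abbreviation (input) "xLAM \<equiv> 71::nat"
abbreviation (input) "xROOT \<equiv> 72::nat"
abbreviation (input) "xW \<equiv> 77::nat"

section \<open>Emptying the buffers\<close>

definition "FLUSH = seqs [Read xFF (Var xPP) (Const 1), Read xC (Var xPP) (Const 3), Assign xHD (Var xC), Assign xPC (Const 0),
   Read xZ (Var xPP) (Const 4), NORM, Write (Var xPP) (Const 1) (Const 0), Write (Var xPP) (Const 2) (Const 0),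
   Write (Var xPP) (Const 3) (Var xHD), Write (Var xPP) (Const 4) (Var xZ)]"

lemma ok_FLUSH:
  assumes "v xPP = a" "lvok (a, b, ds)" "\<forall>x\<in>set (flv b @ dlv ds). x \<le> length (fst I)"
    "M = add_mset (a, [th, hdp b 0, n, gp ds 0, length ds, nx]) (fseg b 0 + gseg ds 0 + F)"
  shows "ok I FLUSH v M (\<lambda>\<tau> v' M'. \<exists>ds'. dok 0 ds' \<and> dlv ds' = flv b @ dlv ds \<and> length ds \<le> length ds' \<and>
     M' = add_mset (a, [th, 0, 0, gp ds' 0, length ds', nx]) (gseg ds' 0 + F) \<and>
     \<tau> + 100 * pot ds' \<le> 100 * (length b + pot ds) + 515 \<and> same 40 v v')"
proof -
  let ?ws = "[th, hdp b 0, n, gp ds 0, length ds, nx]"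
  let ?v = "v(xFF := hdp b 0, xC := gp ds 0, xHD := gp ds 0, xPC := 0, xZ := length ds)"
  have fb: "fok 0 (ds \<noteq> []) b" using assms(2) fok_mono by (cases "ds = []") auto
  have nm: "ok I NORM ?v M (\<lambda>\<tau> v' M'. (\<exists>ds'. dok 0 ds' \<and> dlv ds' = flv b @ dlv ds \<and>
     \<tau> + 100 * pot ds' \<le> 100 * (length b + pot ds) + 500 \<and> length ds \<le> length ds' \<and> (b \<noteq> [] \<longrightarrow> ds' \<noteq> []) \<and>
     v' xHD = gp ([] @ ds') 0 \<and> M' = gseg ([] @ ds') 0 + add_mset (a, ?ws) F \<and>
     v' xZ + length ds = ?v xZ + length ds' \<and> same 40 ?v v'))"
    by (rule ok_NORM[OF fb _ assms(3)]) (use assms in auto)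
  show ?thesis
    unfolding FLUSH_def seqs.simps
    apply (rule ok_R[where ws="?ws"], simp add: assms(1,4), simp, simp)
    apply (rule ok_R[where ws="?ws"], simp add: assms(1,4), simp, simp)
    apply (rule ok_A, simp)
    apply (rule ok_A, simp)
    apply (rule ok_R[where ws="?ws"], simp add: assms(1,4), simp, simp)
    apply (rule ok_C[OF nm], simp, simp)
    apply (elim exE conjE)
    subgoal premises p for \<tau> v' M' ds'
    proof -
      have v': "v' xPP = a" "same 40 v v'" "v' xZ = length ds'" using p(9,8) assms(1) by (auto simp: same_def)
      show ?thesis
        apply (rule ok_W[where ws="?ws"], simp add: v' p(7), simp, simp add: v' p(7))
        apply (rule ok_W[where ws="[th, 0, n, gp ds 0, length ds, nx]"], simp add: v', simp, simp add: v')
        apply (rule ok_W[where ws="[th, 0, 0, gp ds 0, length ds, nx]"], simp add: v', simp, simp add: v')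
        apply (rule ok_W[where ws="[th, 0, 0, v' xHD, length ds, nx]"], simp add: v', simp, simp add: v')
        apply (rule ok_Skip)
        apply (rule exI[of _ ds'])
        using p(1-4,6) v' by simp
    qed
    done
qed

lemma dok_pot: "dok h ds \<Longrightarrow> pot ds \<le> 4 * length ds"
  by (induction h ds rule: dok.induct) (auto simp: phi_def)

text \<open>The condition is a parameter: a removal empties every buffer, an append only those
  longer than their spine and only as long as the budget \<open>xW\<close> is positive.\<close>

definition FLUSHLOOP :: "bexp \<Rightarrow> com" where
  "FLUSHLOOP bb = While (Less (Const 0) (Var xPP))
    (seqs [Read xT (Var xPP) (Const 2), Read xWZ (Var xPP) (Const 4),
      If bb (Seq (Assign xW (Minus (Var xW) (Var xT))) FLUSH) Skip, Read xPP (Var xPP) (Const 5)])"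

text \<open>The amortized time bound serves removals. The other one serves appends: if only buffers
  longer than their spine are emptied, the keys emptied also pay for the potential, which is at most
  four per digit. As the budget is tested before a buffer is emptied, it can be exceeded by at most
  one buffer, hence by \<open>N\<close>.\<close>

lemma ok_FLUSHLOOP:
  assumes "\<And>v. bval I v bb \<longleftrightarrow> dec (v xT) (v xWZ) (v xW)" "\<And>b z w. dec b z w \<Longrightarrow> 0 < b"
    "v xPP = lp ls 0" "\<forall>l\<in>set ls. lvok l \<and> lkeys l \<noteq> [] \<and> (\<forall>x\<in>set (lkeys l). x \<le> length (fst I)) \<and> blen l \<le> N" "M = lseg ls 0 + F"
  shows "ok I (FLUSHLOOP bb) v M (\<lambda>\<tau> v' M'. \<exists>ls' f. map lkeys ls' = map lkeys ls \<and> (\<forall>l\<in>set ls'. lvok l) \<and>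
     lp ls' 0 = lp ls 0 \<and> M' = lseg ls' 0 + F \<and> bsum ls' + f = bsum ls \<and> zsum ls \<le> zsum ls' \<and> v' xW = v xW - f \<and>
     \<tau> + 100 * psum ls' \<le> 100 * psum ls + 700 * f + 8 * length ls + 1 \<and>
     ((\<forall>b z w. dec b z w \<longrightarrow> z < b) \<longrightarrow> \<tau> \<le> 1100 * f + 8 * length ls + 1) \<and>
     (\<forall>l\<in>set ls'. blen l = 0 \<or> (\<exists>w\<ge>v' xW. \<not> dec (blen l) (zlen l) w)) \<and>
     ((\<forall>b z w. dec b z w \<longrightarrow> 0 < w) \<longrightarrow> f \<le> v xW + N \<and> (v xW = 0 \<longrightarrow> f = 0)) \<and>
     (\<forall>z. 54 \<le> z \<and> z < 68 \<or> 70 \<le> z \<and> z < 77 \<longrightarrow> v' z = v z))"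
  using assms(3-)
proof (induction ls arbitrary: v M F)
  case Nil
  show ?case unfolding FLUSHLOOP_def
    apply (rule ok_While)
    using Nil apply simp
    apply (rule exI[of _ "[]"], rule exI[of _ 0])
    using Nil by simp
next
  case (Cons l ls)
  obtain a b ds where l: "l = (a, b, ds)" by (cases l) auto
  let ?th = "hd (flv b @ dlv ds)"
  let ?ws = "[?th, hdp b 0, length b, gp ds 0, length ds, lp ls 0]"
  have M: "M = add_mset (a, ?ws) (fseg b 0 + gseg ds 0 + (lseg ls 0 + F))" using Cons.prems(3) l by simp
  show ?case
  proof (rule ok_addr)
    assume pos: "\<And>a ws. (a, ws) \<in># M \<Longrightarrow> 0 < a"
    have a0: "0 < a" using pos[of a] M by auto
    let ?v1 = "v(xT := length b, xWZ := length ds)"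
    have blk: "ok I (If bb (Seq (Assign xW (Minus (Var xW) (Var xT))) FLUSH) Skip) ?v1 M (\<lambda>\<tau> v' M'. \<exists>b' ds' f.
       lvok (a, b', ds') \<and> flv b' @ dlv ds' = flv b @ dlv ds \<and> length b' + f = length b \<and> length ds \<le> length ds' \<and>
       M' = lseg ((a, b', ds') # ls) 0 + F \<and> v' xW = v xW - f \<and> \<tau> + 100 * pot ds' \<le> 100 * pot ds + 700 * f + 2 \<and>
       ((\<forall>b z w. dec b z w \<longrightarrow> z < b) \<longrightarrow> \<tau> \<le> 1100 * f + 2) \<and>
       (b' = [] \<or> \<not> dec (length b') (length ds') (v xW)) \<and> (f > 0 \<longrightarrow> dec (length b) (length ds) (v xW)) \<and>
       (\<forall>z. 54 \<le> z \<and> z < 69 \<or> 70 \<le> z \<and> z < 77 \<longrightarrow> v' z = v z))"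
    proof (rule ok_If)
      assume bv: "bval I ?v1 bb"
      then have dc: "dec (length b) (length ds) (v xW)" using assms(1)[of ?v1] by simp
      have b0: "0 < length b" using assms(2)[OF dc] .
      have b1: "100 * length b + 515 \<le> 700 * length b" using b0 by linarith
      have pd: "pot ds \<le> 4 * length ds" using Cons.prems(2) l dok_pot by auto
      have b2: "1 + (1 + t) \<le> 1100 * length b + 2"
        if "t + 100 * pd' \<le> 100 * (length b + pot ds) + 515" "length ds < length b" for t pd'
      proof -
        have "t \<le> 100 * length b + 100 * pot ds + 515" using that(1) by simp
        moreover have "100 * pot ds \<le> 400 * length b" using pd that(2) by simp
        ultimately show ?thesis using b1 by linarith
      qed
      let ?v2 = "?v1(xW := v xW - length b)"
      have fl: "ok I FLUSH ?v2 M (\<lambda>\<tau> v' M'. \<exists>ds'. dok 0 ds' \<and> dlv ds' = flv b @ dlv ds \<and> length ds \<le> length ds' \<and>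
     M' = add_mset (a, [?th, 0, 0, gp ds' 0, length ds', lp ls 0]) (gseg ds' 0 + (lseg ls 0 + F)) \<and>
     \<tau> + 100 * pot ds' \<le> 100 * (length b + pot ds) + 515 \<and> same 40 ?v2 v')"
        by (rule ok_FLUSH) (use Cons.prems l M in auto)
      show "ok I (Seq (Assign xW (Minus (Var xW) (Var xT))) FLUSH) ?v1 M (\<lambda>t v' M'. \<exists>b' ds' f.
       lvok (a, b', ds') \<and> flv b' @ dlv ds' = flv b @ dlv ds \<and> length b' + f = length b \<and> length ds \<le> length ds' \<and>
       M' = lseg ((a, b', ds') # ls) 0 + F \<and> v' xW = v xW - f \<and> 1 + t + 100 * pot ds' \<le> 100 * pot ds + 700 * f + 2 \<and>
       ((\<forall>b z w. dec b z w \<longrightarrow> z < b) \<longrightarrow> 1 + t \<le> 1100 * f + 2) \<and>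
       (b' = [] \<or> \<not> dec (length b') (length ds') (v xW)) \<and> (f > 0 \<longrightarrow> dec (length b) (length ds) (v xW)) \<and>
       (\<forall>z. 54 \<le> z \<and> z < 69 \<or> 70 \<le> z \<and> z < 77 \<longrightarrow> v' z = v z))"
        apply (rule ok_A, simp)
        apply (rule ok_conseq[OF fl], simp, simp)
        apply (elim exE conjE)
        subgoal premises p for \<tau> v' M' ds'
          apply (rule exI[of _ "[]"], rule exI[of _ ds'], rule exI[of _ "length b"])
          using p b1 dc b2[OF p(5)] by (auto simp: same_def)
        done
    next
      assume bv: "\<not> bval I ?v1 bb"
      then have dc: "\<not> dec (length b) (length ds) (v xW)" using assms(1)[of ?v1] by simp
      show "ok I Skip ?v1 M (\<lambda>t v' M'. \<exists>b' ds' f.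
       lvok (a, b', ds') \<and> flv b' @ dlv ds' = flv b @ dlv ds \<and> length b' + f = length b \<and> length ds \<le> length ds' \<and>
       M' = lseg ((a, b', ds') # ls) 0 + F \<and> v' xW = v xW - f \<and> 1 + t + 100 * pot ds' \<le> 100 * pot ds + 700 * f + 2 \<and>
       ((\<forall>b z w. dec b z w \<longrightarrow> z < b) \<longrightarrow> 1 + t \<le> 1100 * f + 2) \<and>
       (b' = [] \<or> \<not> dec (length b') (length ds') (v xW)) \<and> (f > 0 \<longrightarrow> dec (length b) (length ds) (v xW)) \<and>
       (\<forall>z. 54 \<le> z \<and> z < 69 \<or> 70 \<le> z \<and> z < 77 \<longrightarrow> v' z = v z))"
        apply (rule ok_Skip)
        apply (rule exI[of _ b], rule exI[of _ ds], rule exI[of _ 0])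
        using Cons.prems l M dc by auto
    qed
    show "ok I (FLUSHLOOP bb) v M (\<lambda>\<tau> v' M'. \<exists>ls' f. map lkeys ls' = map lkeys (l # ls) \<and> (\<forall>l\<in>set ls'. lvok l) \<and>
     lp ls' 0 = lp (l # ls) 0 \<and> M' = lseg ls' 0 + F \<and> bsum ls' + f = bsum (l # ls) \<and> zsum (l # ls) \<le> zsum ls' \<and> v' xW = v xW - f \<and>
     \<tau> + 100 * psum ls' \<le> 100 * psum (l # ls) + 700 * f + 8 * length (l # ls) + 1 \<and>
     ((\<forall>b z w. dec b z w \<longrightarrow> z < b) \<longrightarrow> \<tau> \<le> 1100 * f + 8 * length (l # ls) + 1) \<and>
     (\<forall>l\<in>set ls'. blen l = 0 \<or> (\<exists>w\<ge>v' xW. \<not> dec (blen l) (zlen l) w)) \<and>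
     ((\<forall>b z w. dec b z w \<longrightarrow> 0 < w) \<longrightarrow> f \<le> v xW + N \<and> (v xW = 0 \<longrightarrow> f = 0)) \<and>
     (\<forall>z. 54 \<le> z \<and> z < 68 \<or> 70 \<le> z \<and> z < 77 \<longrightarrow> v' z = v z))"
      apply (subst FLUSHLOOP_def)
      apply (rule ok_While)
       prefer 2
      using a0 Cons.prems(1) l apply simp
      unfolding seqs.simps
      apply (rule ok_R[where ws="?ws"], simp add: Cons.prems(1) l M, simp, simp)
      apply (rule ok_R[where ws="?ws"], simp add: Cons.prems(1) l M, simp, simp)
      apply (rule ok_C[OF blk], simp, simp)
      apply (elim exE conjE)
      subgoal premises p for \<tau>1 v1 M1 b' ds' f
      proof -
        note p = p(2-)
        have v1: "v1 xPP = a" using p(11) Cons.prems(1) l by simp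
        let ?ws' = "[hd (flv b' @ dlv ds'), hdp b' 0, length b', gp ds' 0, length ds', lp ls 0]"
        have M1: "M1 = add_mset (a, ?ws') (fseg b' 0 + gseg ds' 0 + lseg ls 0 + F)" using p(5) by simp
        let ?v2 = "v1(xPP := lp ls 0)"
        let ?F = "add_mset (a, ?ws') (fseg b' 0 + gseg ds' 0 + F)"
        have ih: "ok I (FLUSHLOOP bb) ?v2 M1 (\<lambda>\<tau> v' M'. \<exists>ls' f. map lkeys ls' = map lkeys ls \<and> (\<forall>l\<in>set ls'. lvok l) \<and>
     lp ls' 0 = lp ls 0 \<and> M' = lseg ls' 0 + ?F \<and> bsum ls' + f = bsum ls \<and> zsum ls \<le> zsum ls' \<and> v' xW = ?v2 xW - f \<and>
     \<tau> + 100 * psum ls' \<le> 100 * psum ls + 700 * f + 8 * length ls + 1 \<and>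
     ((\<forall>b z w. dec b z w \<longrightarrow> z < b) \<longrightarrow> \<tau> \<le> 1100 * f + 8 * length ls + 1) \<and>
     (\<forall>l\<in>set ls'. blen l = 0 \<or> (\<exists>w\<ge>v' xW. \<not> dec (blen l) (zlen l) w)) \<and>
     ((\<forall>b z w. dec b z w \<longrightarrow> 0 < w) \<longrightarrow> f \<le> ?v2 xW + N \<and> (?v2 xW = 0 \<longrightarrow> f = 0)) \<and>
     (\<forall>z. 54 \<le> z \<and> z < 68 \<or> 70 \<le> z \<and> z < 77 \<longrightarrow> v' z = ?v2 z))"
          by (rule Cons.IH) (use Cons.prems(2) M1 in auto)
        show ?thesis
          apply (rule ok_R[where ws="?ws'"], simp add: v1 M1, simp, simp)
          apply (rule ok_Skip)
          apply (rule ok_conseq[OF ih[unfolded FLUSHLOOP_def seqs.simps]], simp, simp)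
          apply (elim exE conjE)
          subgoal premises q for \<tau>2 v2 M2 ls' f'
          proof (rule exI[of _ "(a, b', ds') # ls'"], rule exI[of _ "f + f'"], intro conjI)
            show "M2 = lseg ((a, b', ds') # ls') 0 + F" using q(3,4) by (simp add: ac_simps)
            show "map lkeys ((a, b', ds') # ls') = map lkeys (l # ls)" using q(1) p(2) l by simp
            show "v2 xW = v xW - (f + f')" using q(7) p(6) by simp
            show "\<forall>l\<in>set ((a, b', ds') # ls'). blen l = 0 \<or> (\<exists>w\<ge>v2 xW. \<not> dec (blen l) (zlen l) w)"
              using q(10) p(9) q(7) p(6) by auto
            show "(\<forall>b z w. dec b z w \<longrightarrow> 0 < w) \<longrightarrow> f + f' \<le> v xW + N \<and> (v xW = 0 \<longrightarrow> f + f' = 0)"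
            proof
              assume d: "\<forall>b z w. dec b z w \<longrightarrow> 0 < w"
              have i: "f' \<le> v xW - f + N" "v xW - f = 0 \<longrightarrow> f' = 0" using q(11) d p(6) by auto
              have fb: "f \<le> N" using p(3) Cons.prems(2) l by auto
              have "f > 0 \<longrightarrow> v xW > 0" using p(10) d by blast
              then show "f + f' \<le> v xW + N \<and> (v xW = 0 \<longrightarrow> f + f' = 0)"
                using i fb by (cases "v xW \<le> f") auto
            qed
            show "\<forall>z. 54 \<le> z \<and> z < 68 \<or> 70 \<le> z \<and> z < 77 \<longrightarrow> v2 z = v z" using q(12) p(11) by auto
          qed (use q(2,3,5,6,8,9) p(1,3,4,7,8) l in auto)
          done
      qed
      done
  qed
qed

text \<open>The cost of a repair along the recursion of \<open>remq\<close>: for every level that is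
  cut, one plus the logarithm of the number of its keys up to the cut.\<close>

fun rcost :: "nat list \<Rightarrow> nat list list \<Rightarrow> nat" where
  "rcost q [] = 1"
| "rcost q (L # Ls) = (if hd q < hd L then 1 else
     Suc (floor_log (length (filter (\<lambda>x. x \<le> hd q) L))) +
     (let r = filter (\<lambda>x. hd q < x) L in if r = [] then 0 else rcost r Ls))"

text \<open>For a missing next level \<open>xTR\<close> is set to \<open>J + 1\<close>, which makes
  this case the same as that of a next level with a larger head.\<close>

definition "RMBODY = seqs [Read xT (Var xRH) (Const 0), Read xJ (Var xT) (Const 0), Read xNL (Var xP) (Const 5),
   If (Equal (Var xNL) (Const 0)) (Assign xTR (Plus (Var xJ) (Const 1))) (Read xTR (Var xNL) (Const 0)),
   If (Less (Var xJ) (Var xTR))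
     (seqs [Write (Var xP) (Const 0) (Var xJ), Write (Var xP) (Const 3) (Var xRH), Write (Var xP) (Const 4) (Var xRZ),
        Assign xP (Const 0)])
     (seqs [Assign xQ (Var xRH), Assign xZ (Var xRZ), Read xA (Var xNL) (Const 3), Read xRZ (Var xNL) (Const 4), CUT,
        Write (Var xP) (Const 0) (Var xTR), Write (Var xP) (Const 3) (Var xHD), Write (Var xP) (Const 4) (Var xZ),
        If (Equal (Var xRH) (Const 0))
          (seqs [Read xT (Var xNL) (Const 5), Write (Var xP) (Const 5) (Var xT), Free (Var xNL),
             Assign xLAM (Minus (Var xLAM) (Const 1)), Assign xP (Const 0)])
          (Assign xP (Var xNL))])]"

definition "RMLOOP = While (Less (Const 0) (Var xP)) RMBODY"

text \<open>At the start of a round the block at \<open>a\<close> is half finished: its tree is held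
  in \<open>xRH\<close> and \<open>xRZ\<close>, and the words \<open>w0\<close>, \<open>w3\<close>
  and \<open>w4\<close> are stale. The next block is left in the same condition after a cut. All
  buffers are empty, as cuts act on trees only. A cut costs 2820 plus 1110 per height, which
  together with the commands around it stays below 3000 per unit of \<open>rcost\<close>.\<close>

lemma ok_RMLOOP:
  assumes "dok 0 Q" "Q \<noteq> []" "v xP = a" "v xRH = gp Q 0" "v xRZ = length Q"
    "\<forall>l\<in>set ls. lvok l \<and> blen l = 0 \<and> (\<forall>x\<in>set (lkeys l). x \<le> length (fst I))"
    "\<forall>x\<in>set (dlv Q). x \<le> length (fst I)" "lok p (map lkeys ls)" "length ls \<le> v xLAM"
    "M = add_mset (a, [w0, 0, 0, w3, w4, lp ls 0]) (gseg Q 0 + lseg ls 0 + F)"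
  shows "ok I RMLOOP v M (\<lambda>\<tau> v' M'. \<exists>ls'. map lkeys ls' = remq (dlv Q) (map lkeys ls) \<and>
     (\<forall>l\<in>set ls'. lvok l \<and> blen l = 0) \<and> lp ls' 0 = a \<and> M' = lseg ls' 0 + F \<and>
     v' xLAM + Suc (length ls) = v xLAM + length ls' \<and>
     \<tau> + 100 * psum ls' \<le> 100 * (pot Q + psum ls) + 3000 * rcost (dlv Q) (map lkeys ls) \<and>
     (\<forall>z. 68 \<le> z \<and> z \<noteq> xLAM \<longrightarrow> v' z = v z))"
  using assms
proof (induction ls arbitrary: Q v a p w0 w3 w4 M F)
  case Nil
  obtain qa qd Q2 where Q: "Q = (qa, qd) # Q2" using Nil.prems(2) by (metis list.exhaust surj_pair)
  have qd: "qd \<noteq> []" "fok 0 (Q2 \<noteq> []) qd" using Nil.prems(1) Q by auto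
  obtain xa xk xc d where xd: "qd = Tr xa xk xc # d" using qd(1) by (metis list.exhaust tr.exhaust)
  have hq: "hd (dlv Q) = xk"
  proof -
    obtain us where "flv qd = key (hd qd) # us" using flv_hd[OF qd(2,1)] by blast
    then have "hd (dlv Q) = key (hd qd)" using Q by simp
    then show ?thesis using xd by simp
  qed
  let ?ws = "[w0, 0, 0, w3, w4, 0]"
  have M: "M = add_mset (a, ?ws) (gseg Q 0 + F)" using Nil.prems(10) by simp
  show ?case
  proof (rule ok_addr)
    assume pos: "\<And>a ws. (a, ws) \<in># M \<Longrightarrow> 0 < a"
    have a0: "0 < a" using pos[of a] M by auto
    show "ok I RMLOOP v M (\<lambda>\<tau> v' M'. \<exists>ls'. map lkeys ls' = remq (dlv Q) (map lkeys []) \<and>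
     (\<forall>l\<in>set ls'. lvok l \<and> blen l = 0) \<and> lp ls' 0 = a \<and> M' = lseg ls' 0 + F \<and>
     v' xLAM + Suc (length []) = v xLAM + length ls' \<and>
     \<tau> + 100 * psum ls' \<le> 100 * (pot Q + psum []) + 3000 * rcost (dlv Q) (map lkeys []) \<and>
     (\<forall>z. 68 \<le> z \<and> z \<noteq> xLAM \<longrightarrow> v' z = v z))"
      unfolding RMLOOP_def
      apply (rule ok_While)
       prefer 2
      using a0 Nil.prems(3) apply simp
      apply (subst RMBODY_def)
      unfolding seqs.simps
      apply (rule ok_R[where ws="[xa, gp Q2 0]"], simp add: Nil.prems(4) M Q xd, simp, simp)
      apply (rule ok_R[where ws="[xk, hdp xc 0, hdp d 0]"], simp add: M Q xd, simp, simp)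
      apply (rule ok_R[where ws="?ws"], simp add: Nil.prems(3) M, simp, simp)
      apply (rule ok_IT, simp)
      apply (rule ok_A, simp)
      apply (rule ok_IT, simp)
      apply (rule ok_assoc)
      apply (rule ok_W[where ws="?ws"], simp add: Nil.prems(3) M, simp, simp add: Nil.prems(3) M)
      apply (rule ok_assoc)
      apply (rule ok_W[where ws="[xk, 0, 0, w3, w4, 0]"], simp add: Nil.prems(3), simp, simp add: Nil.prems(3))
      apply (rule ok_assoc)
      apply (rule ok_W[where ws="[xk, 0, 0, v xRH, w4, 0]"], simp add: Nil.prems(3), simp, simp add: Nil.prems(3))
      apply (rule ok_assoc, rule ok_A, simp)
      apply (rule ok_S, rule ok_Skip)
      apply (rule ok_While, simp)
      apply (rule exI[of _ "[(a, [], Q)]"])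
      using Nil.prems(1,4,5) hq by simp
  qed
next
  case (Cons l ls)
  obtain qa qd Q2 where Q: "Q = (qa, qd) # Q2" using Cons.prems(2) by (metis list.exhaust surj_pair)
  have qd: "qd \<noteq> []" "fok 0 (Q2 \<noteq> []) qd" using Cons.prems(1) Q by auto
  obtain xa xk xc d where xd: "qd = Tr xa xk xc # d" using qd(1) by (metis list.exhaust tr.exhaust)
  have hq: "hd (dlv Q) = xk"
  proof -
    obtain us where "flv qd = key (hd qd) # us" using flv_hd[OF qd(2,1)] by blast
    then have "hd (dlv Q) = key (hd qd)" using Q by simp
    then show ?thesis using xd by simp
  qed
  obtain b ds where l: "l = (b, [], ds)" using Cons.prems(6) by (cases l) auto
  have ds: "dok 0 ds" "ds \<noteq> []" "sorted_wrt (<) (dlv ds)" "lok (hd (dlv ds)) (map lkeys ls)"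
    using Cons.prems(6,8) l by auto
  let ?ws = "[w0, 0, 0, w3, w4, b]"
  let ?wl = "[hd (dlv ds), 0, 0, gp ds 0, length ds, lp ls 0]"
  have M: "M = add_mset (a, ?ws) (add_mset (b, ?wl) (gseg ds 0 + gseg Q 0 + (lseg ls 0 + F)))"
    using Cons.prems(10) l by (simp add: ac_simps)
  show ?case
  proof (rule ok_addr)
    assume pos: "\<And>a ws. (a, ws) \<in># M \<Longrightarrow> 0 < a"
    have a0: "0 < a" "0 < b" using pos[of a] pos[of b] M by auto
    have pre: "ok I RMLOOP v M R" if "ok I (Seq (If (Less (Var xJ) (Var xTR))
     (seqs [Write (Var xP) (Const 0) (Var xJ), Write (Var xP) (Const 3) (Var xRH), Write (Var xP) (Const 4) (Var xRZ),
        Assign xP (Const 0)])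
     (seqs [Assign xQ (Var xRH), Assign xZ (Var xRZ), Read xA (Var xNL) (Const 3), Read xRZ (Var xNL) (Const 4), CUT,
        Write (Var xP) (Const 0) (Var xTR), Write (Var xP) (Const 3) (Var xHD), Write (Var xP) (Const 4) (Var xZ),
        If (Equal (Var xRH) (Const 0))
          (seqs [Read xT (Var xNL) (Const 5), Write (Var xP) (Const 5) (Var xT), Free (Var xNL),
             Assign xLAM (Minus (Var xLAM) (Const 1)), Assign xP (Const 0)])
          (Assign xP (Var xNL))])) Skip) (v(xT := xa, xJ := xk, xNL := b, xTR := hd (dlv ds))) M
         (\<lambda>t v' M'. ok I RMLOOP v' M' (\<lambda>t'. R (6 + t + t')))" for R
      unfolding RMLOOP_def
      apply (rule ok_While)
       prefer 2
      using a0 Cons.prems(3) apply simp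
      apply (subst RMBODY_def)
      apply (subst seqs.simps)+
      apply (rule ok_R[where ws="[xa, gp Q2 0]"], simp add: Cons.prems(4) M Q xd, simp, simp)
      apply (rule ok_R[where ws="[xk, hdp xc 0, hdp d 0]"], simp add: M Q xd, simp, simp)
      apply (rule ok_R[where ws="?ws"], simp add: Cons.prems(3) M, simp, simp)
      apply (rule ok_IF, simp add: a0)
      apply (rule ok_R[where ws="?wl"], simp add: M, simp, simp)
      apply (rule ok_conseq[OF that[unfolded RMLOOP_def seqs.simps]], simp, simp)
      apply (simp add: eval_nat_numeral)
      done
    show "ok I RMLOOP v M (\<lambda>\<tau> v' M'. \<exists>ls'. map lkeys ls' = remq (dlv Q) (map lkeys (l # ls)) \<and>
     (\<forall>l\<in>set ls'. lvok l \<and> blen l = 0) \<and> lp ls' 0 = a \<and> M' = lseg ls' 0 + F \<and>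
     v' xLAM + Suc (length (l # ls)) = v xLAM + length ls' \<and>
     \<tau> + 100 * psum ls' \<le> 100 * (pot Q + psum (l # ls)) + 3000 * rcost (dlv Q) (map lkeys (l # ls)) \<and>
     (\<forall>z. 68 \<le> z \<and> z \<noteq> xLAM \<longrightarrow> v' z = v z))"
    proof (cases "xk < hd (dlv ds)")
      case True
      have stop: "remq (dlv Q) (map lkeys (l # ls)) = dlv Q # map lkeys (l # ls)" "rcost (dlv Q) (map lkeys (l # ls)) = 1"
        using True hq l by simp_all
      show ?thesis
        apply (rule pre)
        unfolding seqs.simps
        apply (rule ok_IT, simp add: True)
        apply (rule ok_assoc)
        apply (rule ok_W[where ws="?ws"], simp add: Cons.prems(3) M, simp, simp add: Cons.prems(3) M)
        apply (rule ok_assoc)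
        apply (rule ok_W[where ws="[xk, 0, 0, w3, w4, b]"], simp add: Cons.prems(3), simp, simp add: Cons.prems(3))
        apply (rule ok_assoc)
        apply (rule ok_W[where ws="[xk, 0, 0, v xRH, w4, b]"], simp add: Cons.prems(3), simp, simp add: Cons.prems(3))
        apply (rule ok_assoc, rule ok_A, simp)
        apply (rule ok_S, rule ok_Skip)
        unfolding RMLOOP_def
        apply (rule ok_While, simp)
        apply (rule exI[of _ "(a, [], Q) # l # ls"])
        unfolding stop
        using Cons.prems(1,4,5,6) hq l by (simp add: ac_simps)
    next
      case False
      let ?v2 = "v(xT := xa, xJ := xk, xNL := b, xTR := hd (dlv ds), xQ := gp Q 0, xZ := length Q, xA := gp ds 0, xRZ := length ds)"
      let ?F2 = "add_mset (a, ?ws) (add_mset (b, ?wl) (lseg ls 0 + F))"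
      have ct: "ok I CUT ?v2 (gseg ds 0 + gseg Q 0 + ?F2) (\<lambda>\<tau> v' M'. \<exists>res rest H. dok 0 res \<and> res \<noteq> [] \<and> dok 0 rest \<and>
     dlv res = filter (\<lambda>x. x < ?v2 xJ) (dlv ds) @ dlv Q \<and> dlv rest = filter (\<lambda>x. ?v2 xJ < x) (dlv ds) \<and>
     M' = gseg res 0 + gseg rest 0 + ?F2 \<and> v' xHD = gp res 0 \<and> v' xZ = length res \<and> v' xRH = gp rest 0 \<and> v' xRZ = length rest \<and>
     2 ^ H \<le> length (filter (\<lambda>x. x \<le> ?v2 xJ) (dlv ds)) \<and>
     \<tau> + 100 * (pot res + pot rest) \<le> 100 * (pot ds + pot Q) + 1110 * H + 2820 \<and>
     (\<forall>z\<ge>64. v' z = ?v2 z))"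
        by (rule ok_CUT[OF ds(1,2) Cons.prems(1,2)]) (use False hq ds(3) Cons.prems(6,7) l in auto)
      show ?thesis
        apply (rule pre)
        unfolding seqs.simps
        apply (rule ok_IF, simp add: False)
        apply (rule ok_assoc, rule ok_A, simp add: Cons.prems(4))
        apply (rule ok_assoc, rule ok_A, simp add: Cons.prems(5))
        apply (rule ok_assoc, rule ok_R[where ws="?wl"], simp add: M, simp, simp)
        apply (rule ok_assoc, rule ok_R[where ws="?wl"], simp add: M, simp, simp)
        apply (rule ok_assoc, rule ok_C[OF ct])
          apply (simp add: fun_eq_iff)
         apply (simp add: M)
        apply (elim exE conjE)
        subgoal premises p for \<tau>1 v1 M1 res rest H
        proof -
          have v1: "v1 xP = a" "v1 xTR = hd (dlv ds)" "v1 xNL = b" "v1 xLAM = v xLAM" "\<forall>z\<ge>68. v1 z = v z"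
            using p(13) Cons.prems(3) by auto
          have r1: "dlv res = filter (\<lambda>x. x < xk) (dlv ds) @ dlv Q" "dlv rest = filter (\<lambda>x. xk < x) (dlv ds)"
            using p(4,5) by auto
          have M1: "M1 = gseg res 0 + gseg rest 0 + ?F2" using p(6) .
          have Hc: "H \<le> floor_log (length (filter (\<lambda>x. x \<le> xk) (dlv ds)))"
          proof -
            have "floor_log (2 ^ H) \<le> floor_log (length (filter (\<lambda>x. x \<le> xk) (dlv ds)))"
              using p(11) by (intro floor_log_le_iff) simp
            then show ?thesis by simp
          qed
          have hr: "hd (dlv res) = hd (dlv ds)"
          proof -
            have "dlv ds \<noteq> []" using dlv_eq_Nil[OF ds(1)] ds(2) by simp
            then show ?thesis unfolding r1 using hd_filter_less[of "dlv ds" "dlv Q"] ds(3) False hq by simp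
          qed
          let ?wr = "[hd (dlv ds), 0, 0, gp res 0, length res, b]"
          have rz: "(gp rest 0 = 0) = (rest = [])" if "\<And>a ws. (a, ws) \<in># M1 \<Longrightarrow> 0 < a"
            by (rule gp_eq_0[where p = 0 and F="gseg res 0 + ?F2"]) (use that M1 in auto)
          define rc where "rc = rcost (dlv Q) (map lkeys (l # ls))"
          have rc: "rc = Suc (floor_log (length (filter (\<lambda>x. x \<le> xk) (dlv ds)))) +
             (if dlv rest = [] then 0 else rcost (dlv rest) (map lkeys ls))"
            using False hq l r1(2) by (simp add: rc_def Let_def)
          have rq: "remq (dlv Q) (map lkeys (l # ls)) = dlv res # (if dlv rest = [] then map lkeys ls else remq (dlv rest) (map lkeys ls))"
            using False hq l r1 by (simp add: Let_def)
          show ?thesis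
            apply (rule ok_addr)
            subgoal premises pos1
          proof -
            have start: "ok I (Seq (Seq (Write (Var xP) (Const 0) (Var xTR)) (Seq (Write (Var xP) (Const 3) (Var xHD)) (Seq (Write (Var xP) (Const 4) (Var xZ)) r))) Skip) v1 M1 R"
              if "ok I (Seq r Skip) v1 (add_mset (a, ?wr) (add_mset (b, ?wl) (gseg res 0 + gseg rest 0 + (lseg ls 0 + F)))) (\<lambda>t. R (Suc (Suc (Suc t))))" for r R
              apply (rule ok_assoc, rule ok_W[where ws="?ws"], simp add: v1 M1, simp, simp add: v1 M1)
              apply (rule ok_assoc, rule ok_W[where ws="[hd (dlv ds), 0, 0, w3, w4, b]"], simp add: v1, simp, simp add: v1)
              apply (rule ok_assoc, rule ok_W[where ws="[hd (dlv ds), 0, 0, v1 xHD, w4, b]"], simp add: v1, simp, simp add: v1)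
              apply (rule ok_conseq[OF that], simp, simp add: p(7,8) ac_simps)
              by simp
            show ?thesis
            proof (cases "rest = []")
              case True
              then have de: "dlv rest = []" by simp
              show ?thesis
                apply (rule start)
                apply (rule ok_assoc)
                apply (rule ok_IT, simp add: p(9) True)
                apply (rule ok_assoc, rule ok_R[where ws="?wl"], simp add: v1, simp, simp)
                apply (rule ok_assoc, rule ok_W[where ws="?wr"], simp add: v1, simp, simp add: v1)
                apply (rule ok_assoc, rule ok_F[where ws="?wl"], simp add: v1, simp add: v1)
                apply (rule ok_assoc, rule ok_A, simp)
                apply (rule ok_assoc, rule ok_A, simp)
                apply (rule ok_S, rule ok_S, rule ok_Skip)
                unfolding RMLOOP_def
                apply (rule ok_While, simp)
                apply (rule exI[of _ "(a, [], res) # ls"])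
                unfolding rq rc_def[symmetric]
                using True de p(1,12) Cons.prems(6,9) hr v1 l rc Hc by (simp add: ac_simps)
            next
              case F2: False
              then have de: "dlv rest \<noteq> []" using dlv_eq_Nil[OF p(3)] by simp
              let ?v3 = "v1(xP := b)"
              let ?FF = "add_mset (a, ?wr) (gseg res 0 + F)"
              have ih: "ok I RMLOOP ?v3 (add_mset (b, ?wl) (gseg rest 0 + lseg ls 0 + ?FF)) (\<lambda>\<tau> v' M'. \<exists>ls'. map lkeys ls' = remq (dlv rest) (map lkeys ls) \<and>
     (\<forall>l\<in>set ls'. lvok l \<and> blen l = 0) \<and> lp ls' 0 = b \<and> M' = lseg ls' 0 + ?FF \<and>
     v' xLAM + Suc (length ls) = ?v3 xLAM + length ls' \<and>
     \<tau> + 100 * psum ls' \<le> 100 * (pot rest + psum ls) + 3000 * rcost (dlv rest) (map lkeys ls) \<and>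
     (\<forall>z. 68 \<le> z \<and> z \<noteq> xLAM \<longrightarrow> v' z = ?v3 z))"
                by (rule Cons.IH[OF p(3) F2]) (use p(9,10) Cons.prems(6,9) l v1 ds(4) r1(2) in auto)
              show ?thesis
                apply (rule start)
                apply (rule ok_assoc)
                apply (rule ok_IF, simp add: p(9) F2 rz[OF pos1])
                apply (rule ok_A, simp add: v1)
                apply (rule ok_S, rule ok_Skip)
                apply (rule ok_conseq[OF ih], simp, simp add: ac_simps)
                apply (elim exE conjE)
                subgoal premises q for \<tau>2 v2 M2 ls'
                  apply (rule exI[of _ "(a, [], res) # ls'"])
                  unfolding rq rc_def[symmetric]
                  using q de p(1,12) hr v1 l rc Hc by (simp add: ac_simps)
                done
            qed
          qed
          done
        qed
        done
    qed
  qed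
qed

section \<open>Removing a letter\<close>

text \<open>The bound on the buffers concerns their sum; a single buffer may be longer than its
  spine if the budget of an append ran out before it was reached.\<close>

definition linv :: "'a list \<Rightarrow> nat \<Rightarrow> 'a list \<Rightarrow> level list \<Rightarrow> (nat \<Rightarrow> nat) \<Rightarrow> cells \<Rightarrow> bool" where
  "linv T k P ls v M \<longleftrightarrow> map lkeys ls = levels T k P \<and> (\<forall>l\<in>set ls. lvok l) \<and> bsum ls \<le> zsum ls \<and>
     M = lseg ls 0 \<and> v xKK = k \<and> v xLAM = length ls \<and> v xROOT = lp ls 0"

lemma lok_ne: "lok p Ls \<Longrightarrow> L \<in> set Ls \<Longrightarrow> L \<noteq> [] \<and> sorted_wrt (<) L"
  by (induction p Ls rule: lok.induct) auto

lemma levels_bound: "L \<in> set (levels T k P) \<Longrightarrow> \<forall>x\<in>set L. k < x \<and> x \<le> length T"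
  using levels_matched[of L T k P] by (auto simp: matched_def)

lemma levels_length: "L \<in> set (levels T k P) \<Longrightarrow> length L \<le> card (matched T k P)"
proof -
  assume a: "L \<in> set (levels T k P)"
  have "distinct L" using lok_ne[OF lok_levels a] strict_sorted_iff by blast
  then have "length L = card (set L)" by (simp add: distinct_card)
  also have "\<dots> \<le> card (matched T k P)" using levels_matched[OF a] by (intro card_mono) auto
  finally show ?thesis .
qed

lemma blen_le: "lvok l \<Longrightarrow> blen l \<le> length (lkeys l)"
proof (cases l)
  case (fields a b ds)
  assume "lvok l"
  then have "\<forall>t\<in>set b. kids t = []" using fields fok_tok[of 0 True b] by auto
  then have "length (flv b) = length b" by (induction b) (auto simp: lv_kids)
  then show ?thesis using fields by simp
qed

lemma lp_eq_0: "(\<And>a ws. (a, ws) \<in># lseg ls p + F \<Longrightarrow> 0 < a) \<Longrightarrow> (lp ls 0 = 0) = (ls = [])"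
proof (cases ls)
  case (Cons l ls')
  assume "\<And>a ws. (a, ws) \<in># lseg ls p + F \<Longrightarrow> 0 < a"
  then show ?thesis using Cons by (cases l) force
qed simp

definition drc :: "nat list list \<Rightarrow> nat" where
  "drc Ls = (if tl (hd Ls) = [] then 1 else rcost (tl (hd Ls)) (tl Ls))"

definition "DOREM = seqs [Assign xPP (Var xROOT), FLUSHLOOP (Less (Const 0) (Var xT)),
   Read xRH (Var xROOT) (Const 3), Read xRZ (Var xROOT) (Const 4), POP,
   If (Equal (Var xRH) (Const 0))
     (seqs [Read xT (Var xROOT) (Const 5), Free (Var xROOT), Assign xROOT (Var xT), Assign xLAM (Minus (Var xLAM) (Const 1))])
     (seqs [Assign xP (Var xROOT), RMLOOP])]"

definition "REMOVE = seqs [If (Equal (Var xROOT) (Const 0)) Skip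
   (seqs [Read xTR (Var xROOT) (Const 0), If (Equal (Var xTR) (Plus (Var xKK) (Const 1))) DOREM Skip]),
   Assign xKK (Plus (Var xKK) (Const 1))]"

text \<open>All buffers are emptied first, so that the pop and the cuts find every key in a finger
  tree. If level 0 had a single key, its block is freed and the next level becomes the root, without
  any cut.\<close>

lemma ok_DOREM:
  fixes T :: "'a list" and I :: "'a input"
  assumes inv: "linv T k P ls v M" and T: "fst I = T" and ne: "ls \<noteq> []" and hk: "hd (hd (levels T k P)) = Suc k"
  shows "ok I DOREM v M (\<lambda>\<tau> v' M'. \<exists>ls'. map lkeys ls' = drop_head (levels T k P) \<and> (\<forall>l\<in>set ls'. lvok l) \<and>
     bsum ls' = 0 \<and> M' = lseg ls' 0 \<and> v' xKK = k \<and> v' xLAM = length ls' \<and> v' xROOT = lp ls' 0 \<and>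
     \<tau> + 100 * psum ls' \<le> 100 * psum ls + 700 * bsum ls + 8 * length ls + 650 + 3000 * drc (levels T k P))"
proof -
  have I: "map lkeys ls = levels T k P" "\<forall>l\<in>set ls. lvok l" "M = lseg ls 0" "v xKK = k" "v xLAM = length ls" "v xROOT = lp ls 0"
    using inv by (auto simp: linv_def)
  have lk: "\<forall>l\<in>set ls. lkeys l \<noteq> [] \<and> (\<forall>x\<in>set (lkeys l). x \<le> length (fst I))"
  proof
    fix l assume "l \<in> set ls"
    then have "lkeys l \<in> set (levels T k P)" using I(1) by (metis imageI set_map)
    then show "lkeys l \<noteq> [] \<and> (\<forall>x\<in>set (lkeys l). x \<le> length (fst I))"
      using lok_ne[OF lok_levels] levels_bound T by blast
  qed
  let ?v = "v(xPP := lp ls 0)"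
  let ?dec = "\<lambda>(b::nat) (z::nat) (w::nat). 0 < b"
  have fl: "ok I (FLUSHLOOP (Less (Const 0) (Var xT))) ?v M (\<lambda>\<tau> v' M'. \<exists>ls' f. map lkeys ls' = map lkeys ls \<and> (\<forall>l\<in>set ls'. lvok l) \<and>
     lp ls' 0 = lp ls 0 \<and> M' = lseg ls' 0 + {#} \<and> bsum ls' + f = bsum ls \<and> zsum ls \<le> zsum ls' \<and> v' xW = ?v xW - f \<and>
     \<tau> + 100 * psum ls' \<le> 100 * psum ls + 700 * f + 8 * length ls + 1 \<and>
     ((\<forall>b z w. ?dec b z w \<longrightarrow> z < b) \<longrightarrow> \<tau> \<le> 1100 * f + 8 * length ls + 1) \<and>
     (\<forall>l\<in>set ls'. blen l = 0 \<or> (\<exists>w\<ge>v' xW. \<not> ?dec (blen l) (zlen l) w)) \<and>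
     ((\<forall>b z w. ?dec b z w \<longrightarrow> 0 < w) \<longrightarrow> f \<le> ?v xW + bsum ls \<and> (?v xW = 0 \<longrightarrow> f = 0)) \<and>
     (\<forall>z. 54 \<le> z \<and> z < 68 \<or> 70 \<le> z \<and> z < 77 \<longrightarrow> v' z = ?v z))"
    by (rule ok_FLUSHLOOP) (use I lk in \<open>auto simp: member_le_sum_list\<close>)
  show ?thesis
    unfolding DOREM_def seqs.simps
    apply (rule ok_A, simp add: I(6))
    apply (rule ok_C[OF fl], simp, simp)
    apply (elim exE conjE)
    subgoal premises p for \<tau>1 v1 M1 ls1 f
    proof -
      have v1: "v1 xKK = k" "v1 xLAM = length ls" "v1 xROOT = lp ls 0" using p(12) I by auto
      have l1: "length ls1 = length ls" "ls1 \<noteq> []" using p(1) ne by (auto dest: map_eq_imp_length_eq)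
      have b0: "\<forall>l\<in>set ls1. blen l = 0" using p(10) by auto
      then obtain a ds ls2 where ls1: "ls1 = (a, [], ds) # ls2"
        using l1(2) by (cases ls1) auto
      have ds: "dok 0 ds" using p(2) ls1 by auto
      have K: "levels T k P = dlv ds # map lkeys ls2" using p(1) I(1) ls1 by simp
      have dsn: "ds \<noteq> []" "dlv ds \<noteq> []" using lok_levels[of k T P] K dlv_eq_Nil[OF ds] by auto
      let ?ws = "[hd (dlv ds), 0, 0, gp ds 0, length ds, lp ls2 0]"
      have M1: "M1 = add_mset (a, ?ws) (gseg ds 0 + lseg ls2 0)" using p(4) ls1 by simp
      have ra: "v1 xROOT = a" using v1(3) p(3) ls1 by simp
      let ?v2 = "v1(xRH := gp ds 0, xRZ := length ds)"
      have pp: "ok I POP ?v2 M1 (\<lambda>\<tau> v' M'. \<exists>ds'. dok 0 ds' \<and> dlv ds = hd (dlv ds) # dlv ds' \<and> M' = gseg ds' 0 + (add_mset (a, ?ws) (lseg ls2 0)) \<and>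
     \<tau> + 100 * pot ds' \<le> 100 * pot ds + 630 \<and> v' xRH = gp ds' 0 \<and> v' xRZ = length ds' \<and> frame 40 46 ?v2 v')"
        by (rule ok_POP) (use ds dsn M1 in auto)
      show ?thesis
        apply (rule ok_R[where ws="?ws"], simp add: ra M1, simp, simp)
        apply (rule ok_R[where ws="?ws"], simp add: ra M1, simp, simp)
        apply (rule ok_C[OF pp], simp, simp)
        apply (elim exE conjE)
        apply (rule ok_addr)
        subgoal premises q for \<tau>2 v2 M2 Q
        proof -
          have v2: "v2 xKK = k" "v2 xLAM = length ls" "v2 xROOT = a" using q(7) v1 ra by (auto simp: frame_def)
          have tq: "tl (hd (levels T k P)) = dlv Q" "tl (levels T k P) = map lkeys ls2" using K q(2) by (simp_all, metis list.sel(3))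
          have qz: "(gp Q 0 = 0) = (Q = [])"
            by (rule gp_eq_0[where p = 0 and F="add_mset (a, ?ws) (lseg ls2 0)"]) (use q(8) q(3) in auto)
          have ps: "psum ls1 = pot ds + psum ls2" using ls1 by simp
          show ?thesis
          proof (cases "Q = []")
            case True
            then have e: "dlv Q = []" by simp
            have dh: "drop_head (levels T k P) = map lkeys ls2" "drc (levels T k P) = 1"
              using tq e by (auto simp: drop_head_def drc_def)
            show ?thesis
              apply (rule ok_IT, simp add: q(5) True)
              apply (rule ok_assoc, rule ok_R[where ws="?ws"], simp add: v2 q(3), simp, simp)
              apply (rule ok_assoc, rule ok_F[where ws="?ws"], simp add: v2 q(3), simp add: v2 q(3))
              apply (rule ok_assoc, rule ok_A, simp)
              apply (rule ok_assoc, rule ok_A, simp)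
              apply (rule ok_S, rule ok_Skip)
              apply (rule exI[of _ ls2])
              unfolding dh
              using True p(2,8) b0 ls1 v2 q(4) l1(1) ps p(5) by simp
          next
            case False
            then have e: "dlv Q \<noteq> []" using dlv_eq_Nil[OF q(1)] by simp
            have dh: "drop_head (levels T k P) = remq (dlv Q) (map lkeys ls2)" "drc (levels T k P) = rcost (dlv Q) (map lkeys ls2)"
              using tq e by (auto simp: drop_head_def drc_def)
            let ?v3 = "v2(xP := a)"
            have lk2: "\<forall>l\<in>set ls2. lvok l \<and> blen l = 0 \<and> (\<forall>x\<in>set (lkeys l). x \<le> length (fst I))"
            proof
              fix l assume l: "l \<in> set ls2"
              then have "lkeys l \<in> set (levels T k P)" using K by auto
              then have "\<forall>x\<in>set (lkeys l). x \<le> length (fst I)" using levels_bound T by blast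
              then show "lvok l \<and> blen l = 0 \<and> (\<forall>x\<in>set (lkeys l). x \<le> length (fst I))" using p(2) b0 ls1 l by auto
            qed
            have bq: "\<forall>x\<in>set (dlv Q). x \<le> length (fst I)"
            proof -
              have "set (dlv Q) \<subseteq> set (dlv ds)" by (subst q(2)) auto
              moreover have "dlv ds \<in> set (levels T k P)" using K by simp
              ultimately show ?thesis using levels_bound T by blast
            qed
            have lk3: "lok (hd (dlv ds)) (map lkeys ls2)" using lok_levels[of k T P] K by simp
            have rm: "ok I RMLOOP ?v3 M2 (\<lambda>\<tau> v' M'. \<exists>ls'. map lkeys ls' = remq (dlv Q) (map lkeys ls2) \<and>
     (\<forall>l\<in>set ls'. lvok l \<and> blen l = 0) \<and> lp ls' 0 = a \<and> M' = lseg ls' 0 + {#} \<and>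
     v' xLAM + Suc (length ls2) = ?v3 xLAM + length ls' \<and>
     \<tau> + 100 * psum ls' \<le> 100 * (pot Q + psum ls2) + 3000 * rcost (dlv Q) (map lkeys ls2) \<and>
     (\<forall>z. 68 \<le> z \<and> z \<noteq> xLAM \<longrightarrow> v' z = ?v3 z))"
              by (rule ok_RMLOOP[OF q(1) False _ _ _ lk2 bq lk3]) (use q(3,5,6) v2 l1(1) ls1 in auto)
            show ?thesis
              apply (rule ok_IF, simp add: q(5) False qz)
              apply (rule ok_assoc, rule ok_A, simp add: v2)
              apply (rule ok_assoc)
              apply (rule ok_C[OF rm], simp, simp)
              apply (elim exE conjE)
              apply (rule ok_S, rule ok_Skip)
              subgoal premises r for \<tau>3 v3 M3 ls'
              proof -
                have bs: "bsum ls' = 0" using r(2) by (induction ls') auto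
                have f: "f \<le> bsum ls" using p(5) by simp
                show ?thesis
                  apply (rule exI[of _ ls'])
                  unfolding dh
                  using r(1-7) bs v2 l1(1) ls1 q(4) ps p(8) f by simp
              qed
              done
          qed
        qed
        done
    qed
    done
qed

lemma ok_REMOVE:
  fixes T :: "'a list" and I :: "'a input"
  assumes inv: "linv T k P ls v M" and T: "fst I = T" and k: "k < length T"
  shows "ok I REMOVE v M (\<lambda>\<tau> v' M'. \<exists>ls'. linv T (Suc k) P ls' v' M' \<and>
     (if Suc k \<in> matched T k P then ls \<noteq> [] \<and> bsum ls' = 0 \<and>
        \<tau> + 100 * psum ls' \<le> 100 * psum ls + 700 * bsum ls + 8 * length ls + 660 + 3000 * drc (levels T k P)
      else ls' = ls \<and> \<tau> \<le> 10))"
proof -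
  have I: "map lkeys ls = levels T k P" "\<forall>l\<in>set ls. lvok l" "M = lseg ls 0" "v xKK = k" "v xLAM = length ls" "v xROOT = lp ls 0"
    using inv by (auto simp: linv_def)
  have mt: "Suc k \<in> matched T k P \<longleftrightarrow> ls \<noteq> [] \<and> hd (hd (levels T k P)) = Suc k"
    using hd_levels_iff[OF k, of P] I(1) by (metis list.map_disc_iff)
  have lS: "levels T (Suc k) P = (if Suc k \<in> matched T k P then drop_head (levels T k P) else levels T k P)"
    using levels_Suc[of T k P] hd_levels_iff[OF k, of P] by simp
  show ?thesis
  proof (rule ok_addr)
    assume pos: "\<And>a ws. (a, ws) \<in># M \<Longrightarrow> 0 < a"
    have lz: "(lp ls 0 = 0) = (ls = [])" by (rule lp_eq_0[where p = 0 and F="{#}"]) (use pos I(3) in auto)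
    show "ok I REMOVE v M (\<lambda>\<tau> v' M'. \<exists>ls'. linv T (Suc k) P ls' v' M' \<and>
     (if Suc k \<in> matched T k P then ls \<noteq> [] \<and> bsum ls' = 0 \<and>
        \<tau> + 100 * psum ls' \<le> 100 * psum ls + 700 * bsum ls + 8 * length ls + 660 + 3000 * drc (levels T k P)
      else ls' = ls \<and> \<tau> \<le> 10))"
    proof (cases ls)
      case Nil
      show ?thesis
        unfolding REMOVE_def seqs.simps
        apply (rule ok_IT, simp add: I(6) Nil)
        apply (rule ok_S)
        apply (rule ok_A, simp)
        apply (rule ok_Skip)
        apply (rule exI[of _ ls])
        using mt Nil inv lS by (simp add: linv_def)
    next
      case (Cons l ls')
      obtain a b ds where l: "l = (a, b, ds)" by (cases l) auto
      let ?ws = "[hd (lkeys l), hdp b 0, length b, gp ds 0, length ds, lp ls' 0]"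
      have rp: "v xROOT \<noteq> 0" using lz I(6) Cons by (metis list.distinct(1))
      have hh: "hd (lkeys l) = hd (hd (levels T k P))" using I(1) Cons by (metis list.sel(1) list.simps(9))
      show ?thesis
      proof (cases "Suc k \<in> matched T k P")
        case False
        then have nk: "hd (lkeys l) \<noteq> Suc k" using mt Cons hh by simp
        show ?thesis
          unfolding REMOVE_def seqs.simps
          apply (rule ok_IF, simp add: rp)
          apply (rule ok_assoc, rule ok_R[where ws="?ws"], simp add: I(3,6) Cons l, simp, simp)
          apply (rule ok_assoc, rule ok_IF)
           apply (simp add: I(4) nk del: lkeys.simps)
          apply (rule ok_S, rule ok_S, rule ok_A, simp)
          apply (rule ok_Skip)
          apply (rule exI[of _ ls])
          using False inv lS by (simp add: linv_def)
      next
        case True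
        then have nk: "hd (lkeys l) = Suc k" using mt hh by simp
        have "linv T k P ls (v(xTR := Suc k)) M" using inv by (simp add: linv_def)
        note dr = ok_DOREM[OF this T, of]
        have dr: "ok I DOREM (v(xTR := Suc k)) M (\<lambda>\<tau> v' M'. \<exists>ls'. map lkeys ls' = drop_head (levels T k P) \<and> (\<forall>l\<in>set ls'. lvok l) \<and>
     bsum ls' = 0 \<and> M' = lseg ls' 0 \<and> v' xKK = k \<and> v' xLAM = length ls' \<and> v' xROOT = lp ls' 0 \<and>
     \<tau> + 100 * psum ls' \<le> 100 * psum ls + 700 * bsum ls + 8 * length ls + 650 + 3000 * drc (levels T k P))"
          by (rule dr) (use mt True in auto)
        show ?thesis
          unfolding REMOVE_def seqs.simps
          apply (rule ok_IF, simp add: rp)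
          apply (rule ok_assoc, rule ok_R[where ws="?ws"], simp add: I(3,6) Cons l, simp, simp)
          apply (rule ok_assoc, rule ok_IT)
           apply (simp add: I(4) nk)
          apply (rule ok_C[OF dr], simp add: nk, simp)
          apply (elim exE conjE)
          apply (rule ok_S, rule ok_A, simp)
          apply (rule ok_Skip)
          subgoal premises p for \<tau> v' M' ls''
          proof -
            have z: "bsum ls'' \<le> zsum ls''" using p(3) by linarith
            show ?thesis
              apply (rule exI[of _ ls''])
              using p z True lS mt by (simp add: linv_def)
          qed
          done
      qed
    qed
  qed
qed

abbreviation (input) "xM \<equiv> 73::nat"
abbreviation (input) "xI \<equiv> 74::nat"
abbreviation (input) "xTP \<equiv> 75::nat"
abbreviation (input) "xPL \<equiv> 76::nat"
abbreviation (input) "xMK \<equiv> 78::nat"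

lemma strict_sorted_unique: "sorted_wrt (<) xs \<Longrightarrow> sorted_wrt (<) ys \<Longrightarrow> set xs = set ys \<Longrightarrow> xs = (ys :: nat list)"
  using strict_sorted_equal by blast

lemma last_occ_occs: "filter (\<lambda>j. last_occ T c < j) (occs T k c) = []" "k < last_occ T c \<Longrightarrow> last_occ T c \<in> set (occs T k c)"
proof -
  let ?A = "insert 0 {i. 1 \<le> i \<and> i \<le> length T \<and> T ! (i - 1) = c}"
  have fin: "finite ?A" by (rule finite_subset[of _ "{..length T}"]) auto
  have "j \<le> last_occ T c" if "j \<in> set (occs T k c)" for j
    unfolding last_occ_def using that by (intro Max_ge[OF fin]) (auto simp: set_occs)
  then show "filter (\<lambda>j. last_occ T c < j) (occs T k c) = []" by (intro filter_none) (simp add: not_less)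
  assume "k < last_occ T c"
  moreover have "last_occ T c \<in> ?A" unfolding last_occ_def by (rule Max_in[OF fin]) auto
  ultimately show "last_occ T c \<in> set (occs T k c)" by (auto simp: set_occs)
qed

text \<open>No occurrence lies between \<open>prev_occ T x\<close> and \<open>x\<close>, so one step
  to the left extends the list of occurrences by exactly one element.\<close>

lemma prev_occ_occs:
  assumes x: "x \<in> set (occs T k c)"
  shows "filter (\<lambda>j. prev_occ T x < j) (occs T k c) = x # filter (\<lambda>j. x < j) (occs T k c)"
    "prev_occ T x < x" "k < prev_occ T x \<Longrightarrow> prev_occ T x \<in> set (occs T k c)"
proof -
  let ?A = "insert 0 {i. 1 \<le> i \<and> i < x \<and> x \<le> length T \<and> T ! (i - 1) = T ! (x - 1)}"
  have fin: "finite ?A" by (rule finite_subset[of _ "{..length T}"]) auto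
  have xx: "k < x" "x \<le> length T" "T ! (x - 1) = c" using x by (auto simp: set_occs)
  have ge: "j \<le> prev_occ T x" if "j \<in> set (occs T k c)" "j < x" for j
    unfolding prev_occ_def using that xx by (intro Max_ge[OF fin]) (auto simp: set_occs)
  have inA: "prev_occ T x \<in> ?A" unfolding prev_occ_def by (rule Max_in[OF fin]) auto
  then show lt: "prev_occ T x < x" using xx by auto
  show "k < prev_occ T x \<Longrightarrow> prev_occ T x \<in> set (occs T k c)" using inA xx by (auto simp: set_occs)
  show "filter (\<lambda>j. prev_occ T x < j) (occs T k c) = x # filter (\<lambda>j. x < j) (occs T k c)"
  proof (rule strict_sorted_unique)
    show "sorted_wrt (<) (filter (\<lambda>j. prev_occ T x < j) (occs T k c))" by (intro sorted_wrt_filter sorted_occs)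
    show "sorted_wrt (<) (x # filter (\<lambda>j. x < j) (occs T k c))"
      using sorted_wrt_filter[OF sorted_occs] by simp
    show "set (filter (\<lambda>j. prev_occ T x < j) (occs T k c)) = set (x # filter (\<lambda>j. x < j) (occs T k c))"
      using lt x ge by (auto simp: not_less[symmetric]) (meson le_less_linear less_le_not_le not_le_imp_less nat_neq_iff)
  qed
qed

section \<open>Appending a letter\<close>

definition leaves :: "tr list \<Rightarrow> bool" where
  "leaves m \<longleftrightarrow> (\<forall>t\<in>set m. kids t = [])"

lemma leaves_flv: "leaves m \<Longrightarrow> flv m = map key m"
  by (induction m) (auto simp: leaves_def lv_kids)

lemma leaves_fok: "leaves m \<Longrightarrow> fok 0 b m"
  by (auto simp: leaves_def fok_def dest: in_set_butlastD)

lemma fok_leaves: "fok 0 b m \<Longrightarrow> leaves m"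
  using fok_tok[of 0 b m] by (auto simp: leaves_def)

text \<open>Occurrences are visited from right to left, so that insertion in front gives an
  ascending list. Its elements are leaf blocks already, which can be spliced into buffers without
  copying.\<close>

definition "MBLOOP = While (Less (Var xKK) (Var xI))
   (seqs [New xT (Const 3), Write (Var xT) (Const 0) (Var xI), Write (Var xT) (Const 2) (Var xM), Assign xM (Var xT),
      Assign xW (Plus (Var xW) (Const 1)), Assign xI (PrevOcc (Var xI))])"

lemma ok_MBLOOP:
  assumes "fst I = T" "v xKK = k" "v xI = x" "k < x \<longrightarrow> x \<in> set (occs T k c)" "leaves m"
    "map key m = filter (\<lambda>j. x < j) (occs T k c)" "v xM = hdp m 0" "v xW = length m" "M = fseg m 0 + F"
  shows "ok I MBLOOP v M (\<lambda>\<tau> v' M'. \<exists>m'. leaves m' \<and> map key m' = occs T k c \<and> v' xM = hdp m' 0 \<and> v' xW = length m' \<and>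
     M' = fseg m' 0 + F \<and> \<tau> + 12 * length m \<le> 12 * length m' + 1 \<and> (\<forall>z. 54 \<le> z \<and> z < 73 \<longrightarrow> v' z = v z))"
  using assms
proof (induction x arbitrary: v m M rule: less_induct)
  case (less x)
  show ?case
  proof (cases "k < x")
    case False
    have "filter (\<lambda>j. x < j) (occs T k c) = occs T k c"
      using False by (intro filter_all) (auto simp: set_occs)
    then show ?thesis unfolding MBLOOP_def
      apply (intro ok_While)
      using less.prems False apply simp
      apply (rule exI[of _ m])
      using less.prems by simp
  next
    case True
    then have xo: "x \<in> set (occs T k c)" using less.prems(4) by simp
    note po = prev_occ_occs[OF xo]
    show ?thesis
      apply (subst MBLOOP_def)
      apply (rule ok_While)
       prefer 2
      using less.prems(2,3) True apply simp
      unfolding seqs.simps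
      apply (rule ok_N, simp, simp add: numeral_3_eq_3)
      subgoal for a
        apply (rule ok_W[where ws="[0,0,0]"], simp, simp, simp)
        apply (rule ok_W[where ws="[v xI,0,0]"], simp, simp, simp)
        apply (rule ok_A, simp)
        apply (rule ok_A, simp)
        apply (rule ok_A, simp)
        apply (rule ok_Skip)
        apply (rule ok_mono, rule less.IH[where y="prev_occ T x" and m="Tr a x [] # m" and v="v(xT := a, xM := a, xW := Suc (v xW), xI := prev_occ (fst I) (v xI))", unfolded MBLOOP_def seqs.simps])
                  apply (rule po(2))
                 apply (rule less.prems(1))
                apply (simp add: less.prems(2))
               apply (simp add: less.prems(1,3))
              using po(3) apply simp
             using less.prems(5) apply (simp add: leaves_def)
            using less.prems(6) po(1) apply simp
           apply simp
          using less.prems(8) apply simp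
         using less.prems(3,7,9) apply simp
        apply (elim exE conjE)
        subgoal for \<tau> v' M' m'
          apply (rule exI[of _ m'])
          by auto
        done
      done
  qed
qed

section \<open>Merging the matches into the levels\<close>

definition "DKEY = If (Equal (Var xM) (Const 0)) (Assign xMK (Plus (Var xTP) (Const 1))) (Read xMK (Var xM) (Const 0))"

text \<open>A match at the previous head itself is discarded too: the next letter of a common
  subsequence needs a later position.\<close>

definition "DRLOOP = While (Less (Var xMK) (Plus (Var xTP) (Const 1)))
   (seqs [Read xT (Var xM) (Const 2), Free (Var xM), Assign xM (Var xT), DKEY])"

definition "DROP = Seq DKEY DRLOOP"

lemma ok_DKEY:
  assumes "v xM = hdp m 0" "M = fseg m 0 + F"
    "Q 2 (v(xMK := (if m = [] then v xTP + 1 else key (hd m)))) M"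
  shows "ok I DKEY v M Q"
  unfolding DKEY_def
proof (rule ok_addr)
  assume pos: "\<And>a ws. (a, ws) \<in># M \<Longrightarrow> 0 < a"
  have z: "(hdp m 0 = 0) = (m = [])" by (rule hdp_eq_0[where p = 0 and F=F]) (use pos assms(2) in auto)
  show "ok I (If (Equal (Var xM) (Const 0)) (Assign xMK (Plus (Var xTP) (Const 1))) (Read xMK (Var xM) (Const 0))) v M Q"
  proof (cases m)
    case Nil
    then show ?thesis using assms by (intro ok_If ok_Assign) (auto simp: numeral_2_eq_2)
  next
    case (Cons t m')
    obtain a k cs where t: "t = Tr a k cs" by (cases t)
    show ?thesis using assms Cons t z
      by (intro ok_If ok_Assign ok_Read[where ws="[k, hdp cs 0, hdp m' 0]"]) (auto simp: numeral_2_eq_2)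
  qed
qed

lemma ok_DRLOOP:
  assumes "leaves m" "v xM = hdp m 0" "v xMK = (if m = [] then v xTP + 1 else key (hd m))" "M = fseg m 0 + F"
  shows "ok I DRLOOP v M (\<lambda>\<tau> v' M'. v' xM = hdp (dropWhile (\<lambda>t. key t \<le> v xTP) m) 0 \<and>
     v' xMK = (if dropWhile (\<lambda>t. key t \<le> v xTP) m = [] then v xTP + 1 else key (hd (dropWhile (\<lambda>t. key t \<le> v xTP) m))) \<and>
     M' = fseg (dropWhile (\<lambda>t. key t \<le> v xTP) m) 0 + F \<and>
     \<tau> + 8 * length (dropWhile (\<lambda>t. key t \<le> v xTP) m) \<le> 8 * length m + 1 \<and>
     (\<forall>z. z \<noteq> xT \<and> z \<noteq> xM \<and> z \<noteq> xMK \<longrightarrow> v' z = v z))"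
  using assms
proof (induction m arbitrary: v M)
  case Nil
  then show ?case unfolding DRLOOP_def by (intro ok_While) auto
next
  case (Cons t m)
  obtain a k where t: "t = Tr a k []" using Cons.prems(1) by (cases t) (auto simp: leaves_def)
  have lm: "leaves m" using Cons.prems(1) by (simp add: leaves_def)
  show ?case
  proof (cases "k \<le> v xTP")
    case False
    show ?thesis unfolding DRLOOP_def
      apply (rule ok_While)
      using Cons.prems False t by simp_all
  next
    case True
    let ?v = "v(xT := hdp m 0, xM := hdp m 0, xMK := (if m = [] then v xTP + 1 else key (hd m)))"
    let ?d = "dropWhile (\<lambda>t. key t \<le> v xTP) m"
    have ih: "ok I DRLOOP ?v (fseg m 0 + F) (\<lambda>\<tau> v' M'. v' xM = hdp ?d 0 \<and>
       v' xMK = (if ?d = [] then v xTP + 1 else key (hd ?d)) \<and>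
       M' = fseg ?d 0 + F \<and> \<tau> + 8 * length ?d \<le> 8 * length m + 1 \<and>
       (\<forall>z. z \<noteq> xT \<and> z \<noteq> xM \<and> z \<noteq> xMK \<longrightarrow> v' z = ?v z))"
    proof -
      have e: "?v xTP = v xTP" by simp
      show ?thesis by (rule Cons.IH[OF lm, of ?v "fseg m 0 + F", unfolded e]) simp_all
    qed
    have d: "dropWhile (\<lambda>t. key t \<le> v xTP) (t # m) = ?d" using True t by simp
    show ?thesis unfolding d
      apply (subst DRLOOP_def)
      apply (rule ok_While)
       prefer 2
      using Cons.prems True t apply simp
      unfolding seqs.simps
      apply (rule ok_R[where ws="[k, 0, hdp m 0]"], simp add: Cons.prems t, simp, simp)
      apply (rule ok_F[where ws="[k, 0, hdp m 0]"], simp add: Cons.prems t, simp add: Cons.prems t)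
      apply (rule ok_A, simp)
      apply (rule ok_Seq, rule ok_DKEY[where m = m and F=F], simp, simp)
      apply (rule ok_Skip)
      apply (rule ok_conseq[OF ih[unfolded DRLOOP_def seqs.simps]])
        apply (simp add: fun_eq_iff)
       apply simp
      apply (elim conjE)
      apply (intro conjI)
          apply assumption+
       apply simp
      apply simp
      done
  qed
qed

lemma ok_DROP:
  assumes "leaves m" "v xM = hdp m 0" "M = fseg m 0 + F"
  shows "ok I DROP v M (\<lambda>\<tau> v' M'. v' xM = hdp (dropWhile (\<lambda>t. key t \<le> v xTP) m) 0 \<and>
     v' xMK = (if dropWhile (\<lambda>t. key t \<le> v xTP) m = [] then v xTP + 1 else key (hd (dropWhile (\<lambda>t. key t \<le> v xTP) m))) \<and>
     M' = fseg (dropWhile (\<lambda>t. key t \<le> v xTP) m) 0 + F \<and>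
     \<tau> + 8 * length (dropWhile (\<lambda>t. key t \<le> v xTP) m) \<le> 8 * length m + 3 \<and>
     (\<forall>z. z \<noteq> xT \<and> z \<noteq> xM \<and> z \<noteq> xMK \<longrightarrow> v' z = v z))"
  unfolding DROP_def
  apply (rule ok_Seq, rule ok_DKEY[where m = m and F=F])
    apply (rule assms(2))
   apply (rule assms(3))
  apply (rule ok_conseq[OF ok_DRLOOP[where m = m and F=F and v="v(xMK := (if m = [] then v xTP + 1 else key (hd m)))" and M = M]])
  using assms by auto

lemma dropWhile_filter: "sorted_wrt (<) (map key m) \<Longrightarrow>
   map key (dropWhile (\<lambda>t. key t \<le> p) m) = filter (\<lambda>x. p < x) (map key m)"
proof (induction m)
  case (Cons t m)
  show ?case
  proof (cases "key t \<le> p")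
    case True
    with Cons show ?thesis by simp
  next
    case False
    then have "filter (\<lambda>x. p < x) (map key m) = map key m" using Cons.prems by (intro filter_all) auto
    with False show ?thesis by simp
  qed
qed simp

text \<open>\<open>WALK\<close> does not count the first tree, hence the counter starts with the old
  length of the buffer plus one.\<close>

definition "PUSH = If (Conj (Less (Const 0) (Var xM)) (Less (Var xMK) (Var xTR)))
  (seqs [Read xCN (Var xP) (Const 2), Assign xCN (Plus (Var xCN) (Const 1)), Assign xE (Var xM), Assign xBD (Var xTR), WALK,
     Read xT (Var xP) (Const 1), Write (Var xE) (Const 2) (Var xT), Write (Var xP) (Const 1) (Var xM), Write (Var xP) (Const 2) (Var xCN),
     Write (Var xP) (Const 0) (Var xMK), Assign xM (Var xNX)]) Skip"

lemma ok_PUSH: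
  assumes "leaves m" "v xM = hdp m 0" "m \<noteq> [] \<longrightarrow> v xMK = key (hd m)" "v xP = a" "v xTR = hd (lkeys (a, b, ds))"
    "lkeys (a, b, ds) \<noteq> []"
    "M = lseg [(a, b, ds)] nx + fseg m 0 + F"
  shows "ok I PUSH v M (\<lambda>\<tau> v' M'. \<exists>as bs. m = as @ bs \<and> (\<forall>t\<in>set as. key t < v xTR) \<and> (bs \<noteq> [] \<longrightarrow> v xTR \<le> key (hd bs)) \<and>
     v' xM = hdp bs 0 \<and> M' = lseg [(a, as @ b, ds)] nx + fseg bs 0 + F \<and> \<tau> \<le> 8 * length as + 14 \<and>
     (\<forall>z. 16 \<le> z \<and> z \<noteq> xT \<and> z \<noteq> xM \<longrightarrow> v' z = v z))"
proof (rule ok_addr)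
  assume pos: "\<And>a ws. (a, ws) \<in># M \<Longrightarrow> 0 < a"
  have z: "(hdp m 0 = 0) = (m = [])"
    by (rule hdp_eq_0[where p = 0 and F="lseg [(a, b, ds)] nx + F"]) (use pos assms(7) in auto)
  let ?th = "hd (lkeys (a, b, ds))"
  let ?ws = "[?th, hdp b 0, length b, gp ds 0, length ds, nx]"
  have M: "M = add_mset (a, ?ws) (fseg b 0 + gseg ds 0 + fseg m 0 + F)" using assms(7) by simp
  show "ok I PUSH v M (\<lambda>\<tau> v' M'. \<exists>as bs. m = as @ bs \<and> (\<forall>t\<in>set as. key t < v xTR) \<and> (bs \<noteq> [] \<longrightarrow> v xTR \<le> key (hd bs)) \<and>
     v' xM = hdp bs 0 \<and> M' = lseg [(a, as @ b, ds)] nx + fseg bs 0 + F \<and> \<tau> \<le> 8 * length as + 14 \<and>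
     (\<forall>z. 16 \<le> z \<and> z \<noteq> xT \<and> z \<noteq> xM \<longrightarrow> v' z = v z))"
  proof (cases "m \<noteq> [] \<and> key (hd m) < ?th")
    case False
    show ?thesis unfolding PUSH_def
      apply (rule ok_If)
      using False assms(2,3,5) z apply auto[1]
      apply (rule ok_Skip)
      apply (rule exI[of _ "[]"], rule exI[of _ m])
      using False assms by auto
  next
    case True
    let ?v = "v(xCN := length b + 1, xE := hdp m 0, xBD := ?th)"
    have wk: "ok I WALK ?v M (\<lambda>\<tau> v' M'. M' = M \<and> (\<exists>as bs. m = as @ bs \<and> as \<noteq> [] \<and>
     (\<forall>x\<in>set (tl as). key x < ?v xBD) \<and> (bs \<noteq> [] \<longrightarrow> ?v xBD \<le> key (hd bs)) \<and>
     v' xE = adr (last as) \<and>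
     v' xPE = (if butlast as = [] then 0 else adr (last (butlast as))) \<and> v' xNX = hdp bs 0 \<and>
     v' xCN + 1 = ?v xCN + length as \<and> same 16 ?v v' \<and> \<tau> \<le> 8 * length as))"
      by (rule ok_WALK[where F="add_mset (a, ?ws) (fseg b 0 + gseg ds 0 + F)"]) (use True M in auto)
    show ?thesis unfolding PUSH_def seqs.simps
      apply (rule ok_If)
       prefer 2
      using True assms(2,3,5) z apply auto[1]
      apply (rule ok_R[where ws="?ws"], simp add: assms(4) M, simp, simp)
      apply (rule ok_A, simp)
      apply (rule ok_A, simp)
      apply (rule ok_A, simp)
      apply (rule ok_C[OF wk], simp add: assms(2,5) fun_eq_iff, simp)
      apply (elim exE conjE)
      subgoal premises q for \<tau>2 v2 M2 as bs
      proof -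
        note q = q(2-)
        obtain l x where as: "as = l @ [x]" using q(3) by (metis rev_exhaust)
        obtain xa xk where x: "x = Tr xa xk []" using assms(1) q(2) as by (cases x) (auto simp: leaves_def)
        have v2: "v2 xP = a" "v2 xE = xa" "v2 xM = hdp m 0" "v2 xMK = key (hd m)" "v2 xNX = hdp bs 0" "v2 xCN = length b + length as"
          "\<forall>z. 16 \<le> z \<longrightarrow> v2 z = v z"
          using q(6-10) as x assms(2,3,4) True by (auto simp: same_def)
        have hm: "hdp m 0 = hdp as 0" "hd m = hd as" using q(2,3) by (cases as; simp)+
        have M2: "M2 = add_mset (a, ?ws) (add_mset (xa, [xk, 0, hdp bs 0]) (fseg l xa + fseg bs 0 + (fseg b 0 + gseg ds 0 + F)))"
          using q(1,2) M as x by (simp add: fseg_append)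
        have key: "\<forall>t\<in>set as. key t < ?th"
          using q(4) True hm(2) q(3) by (cases as) auto
        have ky: "hd (lkeys (a, as @ b, ds)) = key (hd as)"
        proof -
          have "leaves as" using assms(1) q(2) by (auto simp: leaves_def)
          then have "flv as = map key as" by (rule leaves_flv)
          then have "lkeys (a, as @ b, ds) = map key as @ flv b @ dlv ds" by simp
          then show ?thesis using q(3) by (cases as) (simp_all del: lkeys.simps)
        qed
        show ?thesis
          apply (rule ok_R[where ws="?ws"], simp add: v2 M2, simp, simp)
          apply (rule ok_W[where ws="[xk, 0, hdp bs 0]"], simp add: v2 M2, simp, simp add: v2 M2)
          apply (rule ok_W[where ws="?ws"], simp add: v2, simp, simp add: v2)
          apply (rule ok_W[where ws="[?th, hdp m 0, length b, gp ds 0, length ds, nx]"], simp add: v2, simp, simp add: v2)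
          apply (rule ok_W[where ws="[?th, hdp m 0, length b + length as, gp ds 0, length ds, nx]"], simp add: v2, simp, simp add: v2)
          apply (rule ok_A, simp)
          apply (rule ok_Skip)
          apply (rule exI[of _ as], rule exI[of _ bs])
          apply (intro conjI)
          subgoal using q(2) .
          subgoal using key assms(5) by simp
          subgoal using q(5) assms(5) by simp
          subgoal using v2 by simp
          subgoal
            apply (subst lseg.simps(2))
            apply (subst ky)
            using as x hm by (simp add: fseg_append hdp_append add.commute ac_simps)
          subgoal using q(11) by simp
          subgoal using v2(7) by simp
          done
      qed
      done
  qed
qed

definition "MLOOP = While (Less (Const 0) (Var xP))
   (seqs [DROP, Read xTR (Var xP) (Const 0), PUSH, Assign xTP (Var xTR), Assign xPL (Var xP), Read xP (Var xP) (Const 5)])"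

lemma leaves_append [simp]: "leaves (xs @ ys) \<longleftrightarrow> leaves xs \<and> leaves ys"
  by (auto simp: leaves_def)

lemma leaves_dropWhile: "leaves m \<Longrightarrow> leaves (dropWhile p m)"
  by (auto simp: leaves_def dest: set_dropWhileD)

lemma sorted_dropWhile: "sorted_wrt (<) (map key m) \<Longrightarrow> sorted_wrt (<) (map key (dropWhile (\<lambda>t. key t \<le> p) m))"
  by (simp add: dropWhile_filter sorted_wrt_filter)

lemma lp_fst: "map fst xs = map fst ys \<Longrightarrow> lp xs p = lp ys p"
  by (cases xs; cases ys) auto

lemma sorted_split:
  assumes "sorted_wrt (<) (xs @ ys)" "\<forall>x\<in>set xs. x < h" "ys \<noteq> [] \<longrightarrow> h \<le> hd ys" "0 < (h::nat)"
  shows "filter (\<lambda>x. x < h) (xs @ ys) = xs" "filter (\<lambda>x. h - 1 < x) (xs @ ys) = ys"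
proof -
  have y: "h \<le> y" if "y \<in> set ys" for y
    using assms(1,3) that hd_le[of ys y] by (cases ys) (auto simp: sorted_wrt_append)
  have y': "h - 1 < y" if "y \<in> set ys" for y using y[OF that] assms(4) by linarith
  have "filter (\<lambda>x. x < h) xs = xs" using assms(2) by (intro filter_all) auto
  moreover have "filter (\<lambda>x. h - 1 < x) ys = ys" using y' by (intro filter_all)
  moreover have "filter (\<lambda>x. x < h) ys = []" using y by (intro filter_none) (auto simp: not_less)
  moreover have "filter (\<lambda>x. h - 1 < x) xs = []" using assms(2) by (intro filter_none) (auto simp: not_less)
  ultimately show "filter (\<lambda>x. x < h) (xs @ ys) = xs" "filter (\<lambda>x. h - 1 < x) (xs @ ys) = ys" by auto
qed

text \<open>\<open>app\<close> hands the whole list of matches down, the program only the rest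
  \<open>ys\<close>. This makes no difference because the later levels ignore everything up to
  \<open>hd L\<close>. The rest may begin with \<open>hd L\<close> itself, hence the filter with
  \<open>hd L - 1\<close>.\<close>

lemma app_merge_step:
  assumes "lok tp (L # Ls)" "sorted_wrt (<) M" "filter (\<lambda>x. tp < x) M = xs @ ys" "\<forall>x\<in>set xs. x < hd L"
    "ys \<noteq> [] \<longrightarrow> hd L \<le> hd ys"
  shows "app tp (L # Ls) M = (xs @ L) # app (hd L) Ls ys"
proof -
  have L: "tp < hd L" "lok (hd L) Ls" using assms(1) by auto
  have s: "sorted_wrt (<) (xs @ ys)" using assms(2,3) by (metis sorted_wrt_filter)
  have h: "0 < hd L" using L(1) by simp
  note sp = sorted_split[OF s assms(4,5) h]
  have 1: "filter (\<lambda>m. tp < m \<and> m < hd L) M = xs"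
    using sp(1) unfolding assms(3)[symmetric] by (simp add: conj_commute)
  have "app (hd L) Ls ys = app (hd L) Ls (filter (\<lambda>x. hd L - 1 < x) (filter (\<lambda>x. tp < x) M))"
    using sp(2) unfolding assms(3) by simp
  also have "\<dots> = app (hd L) Ls (filter (\<lambda>x. tp < x) M)" by (rule app_filter_ge[OF L(2)]) simp
  also have "\<dots> = app (hd L) Ls M" by (rule app_filter_ge[OF L(2)]) (use L(1) in simp)
  finally show ?thesis using 1 by simp
qed

text \<open>The matches left over have not yet been compared with the last head. This is why the
  conclusion contains \<open>app\<close> on an empty list of levels, which the following
  \<open>DROP\<close> and \<open>NEWL\<close> carry out.\<close>

lemma ok_MLOOP:
  assumes "leaves m" "sorted_wrt (<) (map key m)" "lok (v xTP) (map lkeys ls)" "\<forall>l\<in>set ls. lvok l"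
    "v xM = hdp m 0" "v xP = lp ls 0" "M = lseg ls 0 + fseg m 0 + F"
  shows "ok I MLOOP v M (\<lambda>\<tau> v' M'. \<exists>ls' m'. leaves m' \<and> sorted_wrt (<) (map key m') \<and>
     app (v xTP) (map lkeys ls) (map key m) = map lkeys ls' @ app (v' xTP) [] (map key m') \<and> set m' \<subseteq> set m \<and>
     map fst ls' = map fst ls \<and> (\<forall>l\<in>set ls'. lvok l) \<and> zsum ls' = zsum ls \<and>
     bsum ls' + length m' \<le> bsum ls + length m \<and> v' xM = hdp m' 0 \<and>
     v' xPL = (if ls = [] then v xPL else fst (last ls)) \<and> M' = lseg ls' 0 + fseg m' 0 + F \<and>
     \<tau> + 8 * length m' \<le> 8 * length m + 30 * length ls + 1 \<and>
     v' xKK = v xKK \<and> v' xLAM = v xLAM \<and> v' xROOT = v xROOT \<and> v' xW = v xW)"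
  using assms
proof (induction ls arbitrary: v m M F)
  case Nil
  show ?case unfolding MLOOP_def
    apply (rule ok_While)
    using Nil.prems(6) apply simp
    apply (rule exI[of _ "[]"], rule exI[of _ m])
    using Nil.prems by simp
next
  case (Cons l ls)
  obtain a b ds where l: "l = (a, b, ds)" by (cases l) auto
  define L where "L = lkeys l"
  have lk: "lok (v xTP) (L # map lkeys ls)" using Cons.prems(3) by (simp add: L_def)
  then have L: "L \<noteq> []" "v xTP < hd L" "lok (hd L) (map lkeys ls)" by auto
  have lvl: "lvok (a, b, ds)" "\<forall>l\<in>set ls. lvok l" using Cons.prems(4) l by auto
  have xPa: "v xP = a" using Cons.prems(6) l by simp
  define m1 where "m1 = dropWhile (\<lambda>t. key t \<le> v xTP) m"
  have m1: "leaves m1" "map key m1 = filter (\<lambda>x. v xTP < x) (map key m)"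
    "sorted_wrt (<) (map key m1)" "set m1 \<subseteq> set m"
    using leaves_dropWhile[OF Cons.prems(1)] dropWhile_filter[OF Cons.prems(2)] sorted_dropWhile[OF Cons.prems(2)]
    by (auto simp: m1_def dest: set_dropWhileD)
  have Lcell: "lseg [(a, b, ds)] nx = add_mset (a, [hd L, hdp b 0, length b, gp ds 0, length ds, nx]) (fseg b 0 + gseg ds 0)" for nx
    by (simp add: L_def l)
  have Mc: "M = fseg m 0 + (lseg [(a, b, ds)] (lp ls 0) + (lseg ls 0 + F))" using Cons.prems(7) l by simp
  have dr: "ok I DROP v M (\<lambda>\<tau> v' M'. v' xM = hdp m1 0 \<and> v' xMK = (if m1 = [] then v xTP + 1 else key (hd m1)) \<and>
     M' = fseg m1 0 + (lseg [(a, b, ds)] (lp ls 0) + (lseg ls 0 + F)) \<and> \<tau> + 8 * length m1 \<le> 8 * length m + 3 \<and>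
     (\<forall>z. z \<noteq> xT \<and> z \<noteq> xM \<and> z \<noteq> xMK \<longrightarrow> v' z = v z))"
    unfolding m1_def by (rule ok_DROP) (use Cons.prems(1,5) Mc in blast)+
  show ?case
  proof (rule ok_addr)
    assume pos: "\<And>a ws. (a, ws) \<in># M \<Longrightarrow> 0 < a"
    have a0: "0 < a" using pos[of a] Mc by auto
    show "ok I MLOOP v M (\<lambda>\<tau> v' M'. \<exists>ls' m'. leaves m' \<and> sorted_wrt (<) (map key m') \<and>
     app (v xTP) (map lkeys (l # ls)) (map key m) = map lkeys ls' @ app (v' xTP) [] (map key m') \<and> set m' \<subseteq> set m \<and>
     map fst ls' = map fst (l # ls) \<and> (\<forall>l\<in>set ls'. lvok l) \<and> zsum ls' = zsum (l # ls) \<and>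
     bsum ls' + length m' \<le> bsum (l # ls) + length m \<and> v' xM = hdp m' 0 \<and>
     v' xPL = (if l # ls = [] then v xPL else fst (last (l # ls))) \<and> M' = lseg ls' 0 + fseg m' 0 + F \<and>
     \<tau> + 8 * length m' \<le> 8 * length m + 30 * length (l # ls) + 1 \<and>
     v' xKK = v xKK \<and> v' xLAM = v xLAM \<and> v' xROOT = v xROOT \<and> v' xW = v xW)"
      apply (subst MLOOP_def)
      apply (rule ok_While)
       prefer 2
       apply (simp add: xPa a0)
      unfolding seqs.simps
      apply (rule ok_C[OF dr], simp, simp)
      apply (elim conjE)
      subgoal premises q for \<tau>1 v1 M1
      proof -
        note q = q(2-)
        have v1: "v1 xP = a" using q(5) xPa by simp
        let ?ws = "[hd L, hdp b 0, length b, gp ds 0, length ds, lp ls 0]"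
        have c1: "(a, ?ws) \<in># M1" unfolding q(3) Lcell by simp
        let ?v2 = "v1(xTR := hd L)"
        have pu: "ok I PUSH ?v2 M1 (\<lambda>\<tau> v' M'. \<exists>as bs. m1 = as @ bs \<and> (\<forall>t\<in>set as. key t < ?v2 xTR) \<and> (bs \<noteq> [] \<longrightarrow> ?v2 xTR \<le> key (hd bs)) \<and>
           v' xM = hdp bs 0 \<and> M' = lseg [(a, as @ b, ds)] (lp ls 0) + fseg bs 0 + (lseg ls 0 + F) \<and> \<tau> \<le> 8 * length as + 14 \<and>
           (\<forall>z. 16 \<le> z \<and> z \<noteq> xT \<and> z \<noteq> xM \<longrightarrow> v' z = ?v2 z))"
          apply (rule ok_PUSH[OF m1(1)])
               apply (simp add: q(1))
              apply (simp add: q(2))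
             apply (simp add: v1)
            apply (simp add: L_def l)
           using L(1) apply (simp add: L_def l)
          apply (simp add: q(3) del: lseg.simps add: ac_simps)
          done
        show ?thesis
          apply (rule ok_R[where ws="?ws"], simp add: v1 c1, simp, simp)
          apply (rule ok_C[OF pu], simp, simp)
          apply (elim exE conjE)
          subgoal premises r for \<tau>2 v2 M2 as bs
          proof -
            have e16: "v2 z = ?v2 z" if "16 \<le> z" "z \<noteq> xT" "z \<noteq> xM" for z using r(7) that by blast
            have v2: "v2 xP = a" "v2 xTR = hd L" "v2 xKK = v xKK" "v2 xLAM = v xLAM" "v2 xROOT = v xROOT" "v2 xW = v xW"
              using e16[of xP] e16[of xTR] e16[of xKK] e16[of xLAM] e16[of xROOT] e16[of xW] v1 q(5) by simp_all
            have r2: "\<forall>t\<in>set as. key t < hd L" "bs \<noteq> [] \<longrightarrow> hd L \<le> key (hd bs)" using r(2,3) by simp_all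
            have lab: "leaves as" "leaves bs" using m1(1) r(1) by auto
            have sbs: "sorted_wrt (<) (map key bs)" using m1(3) r(1) by (simp add: sorted_wrt_append)
            let ?l = "(a, as @ b, ds)"
            have lkl: "lkeys ?l = map key as @ L" using leaves_flv[OF lab(1)] by (simp add: L_def l)
            have lvl': "lvok ?l" using lvl(1) lab(1) fok_leaves[of True b] leaves_fok[of "as @ b" True] by simp
            have ap: "app (v xTP) (L # map lkeys ls) (map key m) = (map key as @ L) # app (hd L) (map lkeys ls) (map key bs)"
            proof (rule app_merge_step[OF lk Cons.prems(2)])
              show "filter (\<lambda>x. v xTP < x) (map key m) = map key as @ map key bs" using m1(2) r(1) by simp
              show "\<forall>x\<in>set (map key as). x < hd L" using r2(1) by auto
              show "map key bs \<noteq> [] \<longrightarrow> hd L \<le> hd (map key bs)" using r2(2) by (cases bs) auto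
            qed
            let ?ws2 = "[hd (lkeys ?l), hdp (as @ b) 0, length (as @ b), gp ds 0, length ds, lp ls 0]"
            have c2: "(a, ?ws2) \<in># M2" unfolding r(5) by simp
            let ?v3 = "v2(xTP := hd L, xPL := a, xP := lp ls 0)"
            have e3: "?v3 xTP = hd L" "?v3 xPL = a" by simp_all
            have ih: "ok I MLOOP ?v3 M2 (\<lambda>\<tau> v' M'. \<exists>ls' m'. leaves m' \<and> sorted_wrt (<) (map key m') \<and>
               app (hd L) (map lkeys ls) (map key bs) = map lkeys ls' @ app (v' xTP) [] (map key m') \<and> set m' \<subseteq> set bs \<and>
               map fst ls' = map fst ls \<and> (\<forall>l\<in>set ls'. lvok l) \<and> zsum ls' = zsum ls \<and>
               bsum ls' + length m' \<le> bsum ls + length bs \<and> v' xM = hdp m' 0 \<and>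
               v' xPL = (if ls = [] then a else fst (last ls)) \<and> M' = lseg ls' 0 + fseg m' 0 + (lseg [?l] (lp ls 0) + F) \<and>
               \<tau> + 8 * length m' \<le> 8 * length bs + 30 * length ls + 1 \<and>
               v' xKK = ?v3 xKK \<and> v' xLAM = ?v3 xLAM \<and> v' xROOT = ?v3 xROOT \<and> v' xW = ?v3 xW)"
              apply (rule Cons.IH[OF lab(2) sbs, of ?v3 M2 "lseg [?l] (lp ls 0) + F", unfolded e3])
                  apply (rule L(3))
                 apply (rule lvl(2))
                apply (simp add: r(4))
               apply simp
              unfolding r(5) by (simp only: ac_simps)
            show ?thesis
              apply (rule ok_A, simp add: v2)
              apply (rule ok_A, simp add: v2)
              apply (rule ok_R[where ws="?ws2"], simp add: v2 c2[simplified], simp, simp)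
              apply (rule ok_Skip)
              apply (rule ok_conseq[OF ih[unfolded MLOOP_def seqs.simps]])
                apply (simp add: v2)
               apply simp
              apply (elim exE conjE)
              subgoal premises w for \<tau>3 v4 M4 ls' m'
              proof -
                have len: "length m1 = length as + length bs" using r(1) by simp
                have ml: "length m1 \<le> length m" unfolding m1_def by (rule length_dropWhile_le)
                have lpp: "lp ls' 0 = lp ls 0" using lp_fst[OF w(5)] .
                show ?thesis
                  apply (rule exI[of _ "?l # ls'"], rule exI[of _ m'])
                  apply (intro conjI)
                  subgoal using w(1) .
                  subgoal using w(2) .
                  subgoal using ap w(3) lkl by (simp add: L_def[symmetric] del: lkeys.simps app.simps)
                  subgoal using w(4) r(1) m1(4) by auto
                  subgoal using w(5) l by simp
                  subgoal using w(6) lvl' by simp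
                  subgoal using w(7) l by simp
                  subgoal using w(8) l len ml by simp
                  subgoal using w(9) .
                  subgoal using w(10) l by simp
                  subgoal using w(11) lpp by (simp add: ac_simps)
                  subgoal using w(12) q(4) r(6) len by simp
                  subgoal using w(13) v2 by simp
                  subgoal using w(14) v2 by simp
                  subgoal using w(15) v2 by simp
                  subgoal using w(16) v2 by simp
                  done
              qed
              done
          qed
          done
      qed
      done
  qed
qed

text \<open>The remaining matches form the buffer of a new level with an empty tree. The walk with
  bound \<open>TextLength + 1\<close> reaches their end and is there to count them.\<close>

definition "NEWL = If (Less (Const 0) (Var xM))
  (seqs [New xT (Const 6), Write (Var xT) (Const 0) (Var xMK), Write (Var xT) (Const 1) (Var xM),
     Assign xCN (Const 1), Assign xE (Var xM), Assign xBD (Plus TextLength (Const 1)), WALK,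
     Write (Var xT) (Const 2) (Var xCN),
     If (Equal (Var xPL) (Const 0)) (Assign xROOT (Var xT)) (Write (Var xPL) (Const 5) (Var xT)),
     Assign xLAM (Plus (Var xLAM) (Const 1))]) Skip"

lemma ok_NEWL:
  assumes "leaves m" "\<forall>t\<in>set m. key t \<le> length (fst I)" "v xM = hdp m 0" "m \<noteq> [] \<longrightarrow> v xMK = key (hd m)"
    "v xPL = (if ls = [] then 0 else fst (last ls))" "v xROOT = lp ls 0" "v xLAM = length ls" "M = lseg ls 0 + fseg m 0"
  shows "ok I NEWL v M (\<lambda>\<tau> v' M'. \<exists>a. let ls' = ls @ (if m = [] then [] else [(a, m, [])]) in
     M' = lseg ls' 0 \<and> v' xROOT = lp ls' 0 \<and> v' xLAM = length ls' \<and> v' xKK = v xKK \<and> v' xW = v xW \<and>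
     \<tau> \<le> 8 * length m + 20)"
proof (rule ok_addr)
  assume pos: "\<And>a ws. (a, ws) \<in># M \<Longrightarrow> 0 < a"
  have z: "(hdp m 0 = 0) = (m = [])"
    by (rule hdp_eq_0[where p = 0 and F="lseg ls 0"]) (use pos assms(8) in auto)
  let ?Q = "\<lambda>\<tau> v' M'. \<exists>a. let ls' = ls @ (if m = [] then [] else [(a, m, [])]) in
     M' = lseg ls' 0 \<and> v' xROOT = lp ls' 0 \<and> v' xLAM = length ls' \<and> v' xKK = v xKK \<and> v' xW = v xW \<and>
     \<tau> \<le> 8 * length m + 20"
  show "ok I NEWL v M ?Q"
  proof (cases "m = []")
    case True
    show ?thesis unfolding NEWL_def
      apply (rule ok_If)
      using True assms(3) apply simp
      apply (rule ok_Skip)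
      using True assms by (simp add: Let_def)
  next
    case False
    have key: "flv m = map key m" by (rule leaves_flv[OF assms(1)])
    have hk: "hd (flv m @ dlv []) = key (hd m)" using False key by (cases m) auto
    show ?thesis unfolding NEWL_def seqs.simps
      apply (rule ok_If)
       prefer 2
      using False assms(3) z apply simp
      apply (rule ok_N[where ws="[0,0,0,0,0,0]"], simp, simp add: numeral_eq_Suc)
      subgoal for a
        apply (rule ok_W[where ws="[0,0,0,0,0,0]"], simp, simp, simp)
        apply (rule ok_W[where ws="[v xMK,0,0,0,0,0]"], simp, simp, simp)
        apply (rule ok_A, simp)
        apply (rule ok_A, simp)
        apply (rule ok_A, simp)
        subgoal premises a0
        proof -
          let ?M1 = "add_mset (a, [v xMK, v xM, 0, 0, 0, 0]) M"
          let ?v1 = "v(xT := a, xCN := 1, xE := v xM, xBD := Suc (length (fst I)))"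
          have wk: "ok I WALK ?v1 ?M1 (\<lambda>\<tau> v' M'. M' = ?M1 \<and> (\<exists>as bs. m = as @ bs \<and> as \<noteq> [] \<and>
             (\<forall>x\<in>set (tl as). key x < ?v1 xBD) \<and> (bs \<noteq> [] \<longrightarrow> ?v1 xBD \<le> key (hd bs)) \<and>
             v' xE = adr (last as) \<and>
             v' xPE = (if butlast as = [] then 0 else adr (last (butlast as))) \<and> v' xNX = hdp bs 0 \<and>
             v' xCN + 1 = ?v1 xCN + length as \<and> same 16 ?v1 v' \<and> \<tau> \<le> 8 * length as))"
            by (rule ok_WALK[where F="add_mset (a, [v xMK, v xM, 0, 0, 0, 0]) (lseg ls 0)"]) (use False assms(3,8) in auto)
          show ?thesis
            apply (rule ok_C[OF wk])
              apply (simp add: fun_eq_iff)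
             apply simp
            apply (elim exE conjE)
            subgoal premises q for \<tau> v2 M2 as bs
            proof -
              have bs: "bs = []"
              proof (rule ccontr)
                assume b: "bs \<noteq> []"
                then have "hd bs \<in> set m" using q(2) by simp
                then have "key (hd bs) \<le> length (fst I)" using assms(2) by blast
                then show False using q(5) b by simp
              qed
              then have as: "as = m" using q(2) by simp
              have v2: "v2 xT = a" "v2 xCN = length m" "v2 xPL = v xPL" "v2 xROOT = v xROOT" "v2 xLAM = v xLAM" "v2 xKK = v xKK" "v2 xW = v xW"
                using q(9,10) as by (auto simp: same_def)
              let ?new = "[(a, m, [])] :: level list"
              have new: "lseg ?new 0 = add_mset (a, [v xMK, v xM, length m, 0, 0, 0]) (fseg m 0)"
                using hk assms(3,4) False by simp
              have t: "\<tau> \<le> 8 * length m" using q(11) as by simp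
              show ?thesis
              proof (cases "ls = []")
                case True
                then have v20: "v2 xPL = 0" "v xROOT = 0" "v xLAM = 0" using v2(3) assms(5,6,7) by simp_all
                have M: "M = fseg m 0" using assms(8) True by simp
                show ?thesis
                  apply (rule ok_W[where ws="[v xMK, v xM, 0, 0, 0, 0]"], simp add: v2 q(1), simp, simp add: v2 q(1))
                  apply (rule ok_IT, simp add: v20)
                  apply (rule ok_A, simp add: v2)
                  apply (rule ok_A, simp add: v2)
                  apply (rule ok_Skip)
                  apply (rule exI[of _ a])
                  using True False t v20 v2 M new by simp
              next
                case ne: False
                obtain ls0 l where ls0: "ls = ls0 @ [l]" using ne by (metis rev_exhaust)
                obtain pa b ds where l: "l = (pa, b, ds)" by (cases l) auto
                have pl: "v xPL = pa" using assms(5) ls0 l by simp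
                let ?ws = "\<lambda>x. [hd (lkeys (pa, b, ds)), hdp b 0, length b, gp ds 0, length ds, x]"
                let ?F = "lseg ls0 pa + (fseg b 0 + gseg ds 0)"
                have sg: "lseg (ls @ xs) 0 = add_mset (pa, ?ws (lp xs 0)) (?F + lseg xs 0)" for xs
                  using ls0 l by (simp add: lseg_append lp_append)
                have M: "M = add_mset (pa, ?ws 0) (?F + fseg m 0)" using assms(8) sg[of "[]"] by simp
                have pa: "0 < pa" using pos[of pa] M by auto
                have rt: "lp (ls @ xs) 0 = lp ls 0" for xs using ls0 by (cases ls0) (auto simp: lp_append)
                have sn: "lseg (ls @ ?new) 0 = add_mset (pa, ?ws a) (?F + add_mset (a, [v xMK, v xM, length m, 0, 0, 0]) (fseg m 0))"
                  unfolding sg new by simp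
                show ?thesis
                  apply (rule ok_W[where ws="[v xMK, v xM, 0, 0, 0, 0]"], simp add: v2 q(1), simp, simp add: v2 q(1))
                  apply (rule ok_IF, simp add: v2 pl pa)
                  apply (rule ok_W[where ws="?ws 0"], simp add: v2 pl M, simp, simp add: v2 pl M)
                  apply (rule ok_A, simp add: v2)
                  apply (rule ok_Skip)
                  apply (rule exI[of _ a])
                  using False t v2 assms(6,7) rt sn by (simp add: ac_simps)
              qed
            qed
            done
        qed
        done
      done
  qed
qed

text \<open>The number of matches that \<open>MBLOOP\<close> leaves in \<open>xW\<close> is the
  budget of the final \<open>FLUSHLOOP\<close>.\<close>

definition "APPEND = seqs [Assign xM (Const 0), Assign xW (Const 0), Assign xI LastOcc, MBLOOP,
   Assign xP (Var xROOT), Assign xTP (Var xKK), Assign xPL (Const 0), MLOOP, DROP, NEWL, Assign xPP (Var xROOT),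
   FLUSHLOOP (Conj (Less (Var xWZ) (Var xT)) (Less (Const 0) (Var xW)))]"

text \<open>\<open>f\<close> is the number of keys emptied from buffers. Its first bound, jointly
  with the new buffers, is amortized over a sequence of appends; the second one bounds a single
  append, where a buffer of old keys may be emptied at a time when only few keys are
  inserted.\<close>

lemma ok_APPEND:
  fixes T :: "'a list"
  assumes inv: "linv T k P ls v M"
  shows "ok (T, Some c) APPEND v M (\<lambda>\<tau> v' M'. \<exists>ls' f. linv T k (P @ [c]) ls' v' M' \<and>
     \<tau> \<le> 1100 * f + 50 * length ls' + 50 * length (occs T k c) + 60 \<and>
     f + bsum ls' \<le> bsum ls + length (occs T k c) \<and> f \<le> length (occs T k c) + card (matched T k (P @ [c])))"
proof -
  let ?I = "(T, Some c)"
  let ?oc = "occs T k c"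
  have I: "map lkeys ls = levels T k P" "\<forall>l\<in>set ls. lvok l" "bsum ls \<le> zsum ls" "M = lseg ls 0"
    "v xKK = k" "v xLAM = length ls" "v xROOT = lp ls 0"
    using inv by (auto simp: linv_def)
  let ?v0 = "v(xM := 0, xW := 0, xI := last_occ T c)"
  have mb: "ok ?I MBLOOP ?v0 M (\<lambda>\<tau> v' M'. \<exists>m'. leaves m' \<and> map key m' = ?oc \<and> v' xM = hdp m' 0 \<and> v' xW = length m' \<and>
     M' = fseg m' 0 + lseg ls 0 \<and> \<tau> + 12 * length ([]::tr list) \<le> 12 * length m' + 1 \<and> (\<forall>z. 54 \<le> z \<and> z < 73 \<longrightarrow> v' z = ?v0 z))"
    by (rule ok_MBLOOP[where x="last_occ T c" and m="[]" and T=T]) (use I(4,5) last_occ_occs(1)[of T c k] last_occ_occs(2)[of k T c] in \<open>auto simp: leaves_def\<close>)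
  show ?thesis
    unfolding APPEND_def seqs.simps
    apply (rule ok_A, simp)
    apply (rule ok_A, simp)
    apply (rule ok_A, simp)
    apply (rule ok_C[OF mb], simp, simp)
    apply (elim exE conjE)
    subgoal premises p for \<tau>1 v1 M1 m
    proof -
      have lm: "length m = length ?oc" using p(2) by (metis length_map)
      have v1: "v1 xROOT = lp ls 0" "v1 xKK = k" "v1 xLAM = length ls" using p(7) I(5,6,7) by simp_all
      let ?v2 = "v1(xP := lp ls 0, xTP := k, xPL := 0)"
      have e2: "?v2 xTP = k" "?v2 xPL = 0" by simp_all
      have ml: "ok ?I MLOOP ?v2 M1 (\<lambda>\<tau> v' M'. \<exists>ls' m'. leaves m' \<and> sorted_wrt (<) (map key m') \<and>
         app k (map lkeys ls) (map key m) = map lkeys ls' @ app (v' xTP) [] (map key m') \<and> set m' \<subseteq> set m \<and>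
         map fst ls' = map fst ls \<and> (\<forall>l\<in>set ls'. lvok l) \<and> zsum ls' = zsum ls \<and>
         bsum ls' + length m' \<le> bsum ls + length m \<and> v' xM = hdp m' 0 \<and>
         v' xPL = (if ls = [] then 0 else fst (last ls)) \<and> M' = lseg ls' 0 + fseg m' 0 + {#} \<and>
         \<tau> + 8 * length m' \<le> 8 * length m + 30 * length ls + 1 \<and>
         v' xKK = ?v2 xKK \<and> v' xLAM = ?v2 xLAM \<and> v' xROOT = ?v2 xROOT \<and> v' xW = ?v2 xW)"
        apply (rule ok_MLOOP[where v="?v2", unfolded e2])
              apply (rule p(1))
             apply (simp add: p(2) sorted_occs)
            apply (simp add: I(1) lok_levels)
           apply (rule I(2))
          apply (simp add: p(3))
         apply simp
        apply (simp add: p(5))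
        done
      show ?thesis
        apply (rule ok_A, simp add: v1)
        apply (rule ok_A, simp add: v1)
        apply (rule ok_A, simp)
        apply (rule ok_C[OF ml], simp, simp)
        apply (elim exE conjE)
        subgoal premises q for \<tau>2 v2 M2 ls2 m2
        proof -
          have v2: "v2 xKK = k" "v2 xLAM = length ls" "v2 xROOT = lp ls 0" "v2 xW = length m"
            using q(13-16) v1 p(4) by simp_all
          have l2: "length ls2 = length ls" using q(5) by (metis length_map)
          have lp2: "lp ls2 0 = lp ls 0" by (rule lp_fst[OF q(5)])
          have la: "(if ls2 = [] then 0 else fst (last ls2)) = (if ls = [] then 0 else fst (last ls))"
            using q(5) l2 by (metis last_map length_0_conv)
          define m3 where "m3 = dropWhile (\<lambda>t. key t \<le> v2 xTP) m2"
          have m3: "leaves m3" "map key m3 = filter (\<lambda>x. v2 xTP < x) (map key m2)" "set m3 \<subseteq> set m2"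
            using leaves_dropWhile[OF q(1)] dropWhile_filter[OF q(2)]
            by (auto simp: m3_def dest: set_dropWhileD)
          have m3l: "length m3 \<le> length m2" unfolding m3_def by (rule length_dropWhile_le)
          have m2l: "length m2 \<le> length m" using q(12) q(8) q(4)
          proof -
            have "distinct (map key m2)" using q(2) strict_sorted_iff by blast
            then have "distinct m2" by (simp add: distinct_map)
            then have "length m2 = card (set m2)" by (simp add: distinct_card)
            also have "\<dots> \<le> card (set m)" using q(4) by (intro card_mono) auto
            also have "\<dots> \<le> length m" by (rule card_length)
            finally show ?thesis .
          qed
          have dr: "ok ?I DROP v2 M2 (\<lambda>\<tau> v' M'. v' xM = hdp m3 0 \<and> v' xMK = (if m3 = [] then v2 xTP + 1 else key (hd m3)) \<and>
             M' = fseg m3 0 + lseg ls2 0 \<and> \<tau> + 8 * length m3 \<le> 8 * length m2 + 3 \<and>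
             (\<forall>z. z \<noteq> xT \<and> z \<noteq> xM \<and> z \<noteq> xMK \<longrightarrow> v' z = v2 z))"
            unfolding m3_def by (rule ok_DROP) (use q(1,9,11) in \<open>simp_all add: ac_simps\<close>)
          show ?thesis
            apply (rule ok_C[OF dr], simp, simp)
            apply (elim conjE)
            subgoal premises r for \<tau>3 v3 M3
            proof -
              have v3: "v3 xKK = k" "v3 xLAM = length ls2" "v3 xROOT = lp ls2 0" "v3 xW = length m"
                "v3 xPL = (if ls2 = [] then 0 else fst (last ls2))"
                using r(5) v2 q(10) l2 lp2 la by simp_all
              have nl: "ok ?I NEWL v3 M3 (\<lambda>\<tau> v' M'. \<exists>a. let ls' = ls2 @ (if m3 = [] then [] else [(a, m3, [])]) in
                 M' = lseg ls' 0 \<and> v' xROOT = lp ls' 0 \<and> v' xLAM = length ls' \<and> v' xKK = v3 xKK \<and> v' xW = v3 xW \<and>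
                 \<tau> \<le> 8 * length m3 + 20)"
              proof (rule ok_NEWL)
                show "\<forall>t\<in>set m3. key t \<le> length (fst ?I)"
                proof
                  fix t assume "t \<in> set m3"
                  then have "key t \<in> set (map key m)" using m3(3) q(4) by auto
                  then show "key t \<le> length (fst ?I)" unfolding p(2) set_occs by simp
                qed
                show "m3 \<noteq> [] \<longrightarrow> v3 xMK = key (hd m3)" using r(2) by simp
                show "M3 = lseg ls2 0 + fseg m3 0" using r(3) by (simp add: add.commute)
              qed (use m3(1) r(1) v3 in simp_all)
              show ?thesis
                apply (rule ok_C[OF nl], simp, simp)
                apply (erule exE)
                subgoal premises s for \<tau>4 v4 M4 a
                proof -
                  define l4 where "l4 = ls2 @ (if m3 = [] then [] else [(a, m3, [])])"
                  have s4: "M4 = lseg l4 0" "v4 xROOT = lp l4 0" "v4 xLAM = length l4" "v4 xKK = k" "v4 xW = length m"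
                     "\<tau>4 \<le> 8 * length m3 + 20"
                    using s v3(1,4) by (simp_all add: Let_def l4_def)
                  have k4: "map lkeys l4 = levels T k (P @ [c])"
                  proof -
                    have "levels T k (P @ [c]) = map lkeys ls2 @ app (v2 xTP) [] (map key m2)"
                      using q(3) I(1) p(2) by simp
                    moreover have "app (v2 xTP) [] (map key m2) = (if m3 = [] then [] else [map key m3])"
                      using m3(2) by (auto simp: Let_def)
                    moreover have "lkeys (a, m3, []) = map key m3" using leaves_flv[OF m3(1)] by simp
                    ultimately show ?thesis by (simp add: l4_def del: app.simps lkeys.simps)
                  qed
                  have lv4: "\<forall>l\<in>set l4. lvok l" using q(6) leaves_fok[OF m3(1)] by (simp add: l4_def)
                  have z4: "zsum l4 = zsum ls" using q(7) by (simp add: l4_def)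
                  have b4: "bsum l4 \<le> bsum ls + length m" using q(8) m3l by (simp add: l4_def)
                  have len4: "length ls \<le> length l4" using l2 by (simp add: l4_def)
                  let ?N = "card (matched T k (P @ [c]))"
                  have lk: "\<forall>l\<in>set l4. lvok l \<and> lkeys l \<noteq> [] \<and> (\<forall>x\<in>set (lkeys l). x \<le> length (fst ?I)) \<and> blen l \<le> ?N"
                  proof
                    fix l assume l: "l \<in> set l4"
                    then have "lkeys l \<in> set (levels T k (P @ [c]))" using k4 by (metis imageI set_map)
                    moreover from this have "length (lkeys l) \<le> ?N" by (rule levels_length)
                    ultimately show "lvok l \<and> lkeys l \<noteq> [] \<and> (\<forall>x\<in>set (lkeys l). x \<le> length (fst ?I)) \<and> blen l \<le> ?N"
                      using lok_ne[OF lok_levels] levels_bound lv4 l blen_le[of l] by (metis fst_conv le_trans)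
                  qed
                  let ?dec = "\<lambda>(b::nat) (z::nat) (w::nat). z < b \<and> 0 < w"
                  let ?v5 = "v4(xPP := lp l4 0)"
                  have fl: "ok ?I (FLUSHLOOP (Conj (Less (Var xWZ) (Var xT)) (Less (Const 0) (Var xW)))) ?v5 M4 (\<lambda>\<tau> v' M'. \<exists>ls' f. map lkeys ls' = map lkeys l4 \<and> (\<forall>l\<in>set ls'. lvok l) \<and>
                     lp ls' 0 = lp l4 0 \<and> M' = lseg ls' 0 + {#} \<and> bsum ls' + f = bsum l4 \<and> zsum l4 \<le> zsum ls' \<and> v' xW = ?v5 xW - f \<and>
                     \<tau> + 100 * psum ls' \<le> 100 * psum l4 + 700 * f + 8 * length l4 + 1 \<and>
                     ((\<forall>b z w. ?dec b z w \<longrightarrow> z < b) \<longrightarrow> \<tau> \<le> 1100 * f + 8 * length l4 + 1) \<and>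
                     (\<forall>l\<in>set ls'. blen l = 0 \<or> (\<exists>w\<ge>v' xW. \<not> ?dec (blen l) (zlen l) w)) \<and>
                     ((\<forall>b z w. ?dec b z w \<longrightarrow> 0 < w) \<longrightarrow> f \<le> ?v5 xW + ?N \<and> (?v5 xW = 0 \<longrightarrow> f = 0)) \<and>
                     (\<forall>z. 54 \<le> z \<and> z < 68 \<or> 70 \<le> z \<and> z < 77 \<longrightarrow> v' z = ?v5 z))"
                    apply (rule ok_FLUSHLOOP)
                        apply simp
                       apply simp
                      apply simp
                     apply (rule lk)
                    apply (simp add: s4(1))
                    done
                  show ?thesis
                    apply (rule ok_A, simp add: s4)
                    apply (rule ok_C[OF fl], simp, simp)
                    apply (elim exE conjE)
                    apply (rule ok_Skip)
                    subgoal premises u for \<tau>5 v6 M6 l6 f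
                    proof -
                      have len6: "length l6 = length l4" using u(1) by (metis length_map)
                      have v6: "v6 xKK = k" "v6 xLAM = length l6" "v6 xROOT = lp l6 0" using u(12) s4 len6 u(3) by simp_all
                      have w6: "v6 xW = length m - f" using u(7) s4(5) by simp
                      have f: "f \<le> length m + ?N" using u(11) s4(5) by simp
                      have t5: "\<tau>5 \<le> 1100 * f + 8 * length l4 + 1" using u(9) by simp
                      \<comment> \<open>If the budget is used up, at least as many keys have left
                        the buffers as have entered them, while the number of digits has not
                        decreased. Otherwise every buffer was examined with budget left, and each is
                        at most as long as its spine.\<close>
                      have bz: "bsum l6 \<le> zsum l6"
                      proof (cases "v6 xW = 0")
                        case True
                        then have "length m \<le> f" using w6 by simp
                        then have "bsum l6 \<le> bsum ls" using u(5) b4 by linarith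
                        also have "\<dots> \<le> zsum l6" using I(3) z4 u(6) by linarith
                        finally show ?thesis .
                      next
                        case False
                        have "blen l \<le> zlen l" if "l \<in> set l6" for l
                        proof -
                          have "blen l = 0 \<or> (\<exists>w\<ge>v6 xW. \<not> ?dec (blen l) (zlen l) w)" using u(10) that by blast
                          then show ?thesis using False by auto
                        qed
                        then show ?thesis by (rule sum_list_mono)
                      qed
                      have li: "linv T k (P @ [c]) l6 v6 M6"
                        unfolding linv_def using u(1,2,4) k4 bz v6 by simp
                      have fb: "f + bsum l6 \<le> bsum ls + length ?oc" using u(5) b4 lm by linarith
                      have ff: "f \<le> length ?oc + ?N" using f lm by simp
                      have t1: "\<tau>1 \<le> 12 * length ?oc + 1" using p(6) lm by simp
                      have t2: "\<tau>2 \<le> 8 * length ?oc + 30 * length l6 + 1" using q(12) lm len6 len4 by linarith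
                      have t3: "\<tau>3 \<le> 8 * length ?oc + 3" using r(4) m2l lm by linarith
                      have t4: "\<tau>4 \<le> 8 * length ?oc + 20" using s4(6) m3l m2l lm by linarith
                      show ?thesis
                        apply (rule exI[of _ l6], rule exI[of _ f])
                        apply (intro conjI)
                           apply (rule li)
                          using t1 t2 t3 t4 t5 len6 apply linarith
                         apply (rule fb)
                        apply (rule ff)
                        done
                    qed
                    done
                qed
                done
            qed
            done
        qed
        done
    qed
    done
qed

section \<open>Word size and space\<close>

text \<open>Expressions whose value exceeds neither the largest word present nor the length of the
  text nor 6, the length of the block of a level.\<close>

fun small :: "aexp \<Rightarrow> bool" where
  "small (Const n) = (n \<le> 6)"
| "small (Var x) = True"
| "small (Minus a b) = small a"
| "small TextLength = True"
| "small LastOcc = True"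
| "small (PrevOcc a) = True"
| "small _ = False"

fun tame :: "com \<Rightarrow> bool" where
  "tame (Assign x (Plus a b)) = (small a \<and> b = Const 1)"
| "tame (Assign x a) = small a"
| "tame (New x a) = small a"
| "tame (Write b i a) = small a"
| "tame (Seq p q) = (tame p \<and> tame q)"
| "tame (If b p q) = (tame p \<and> tame q)"
| "tame (While b p) = tame p"
| "tame _ = True"

definition bounded_by :: "nat \<Rightarrow> state \<Rightarrow> bool" where
  "bounded_by V s \<longleftrightarrow> (\<forall>x. vars s x \<le> V) \<and> (\<forall>a ws. heap s a = Some ws \<longrightarrow> (\<forall>w\<in>set ws. w \<le> V)) \<and> fresh s \<le> V"

lemma bounded_by_mono: "bounded_by V s \<Longrightarrow> V \<le> W \<Longrightarrow> bounded_by W s"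
  unfolding bounded_by_def by (meson le_trans)

lemma last_occ_le: "last_occ T c \<le> length T"
  unfolding last_occ_def by (intro Max.boundedI) (auto intro: finite_subset[of _ "{..length T}"])

lemma prev_occ_le: "prev_occ T j \<le> length T"
  unfolding prev_occ_def by (intro Max.boundedI) (auto intro: finite_subset[of _ "{..length T}"])

lemma small_le: "small a \<Longrightarrow> (\<And>x. v x \<le> V) \<Longrightarrow> length (fst I) \<le> V \<Longrightarrow> 6 \<le> V \<Longrightarrow> aval I v a \<le> V"
  by (induction a rule: small.induct)
    (auto intro: le_trans last_occ_le prev_occ_le split: option.split simp: le_diff_conv)

lemma tame_Assign: "tame (Assign x a) \<Longrightarrow> (\<And>x. v x \<le> V) \<Longrightarrow> length (fst I) \<le> V \<Longrightarrow> 6 \<le> V \<Longrightarrow> aval I v a \<le> Suc V"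
  by (cases a) (auto dest!: small_le[where v=v and V=V and I=I] intro: le_trans last_occ_le prev_occ_le simp: le_SucI split: option.split)

text \<open>Every step increases the largest word by at most one.\<close>

lemma exec_tame:
  assumes "exec I N p s t s'" "tame p" "bounded_by V s" "length (fst I) \<le> V" "6 \<le> V"
  shows "bounded_by (V + t) s' \<and> (\<forall>N' \<ge> V + t. exec I N' p s t s')"
  using assms
proof (induction arbitrary: V rule: exec.induct)
  case (Skip s)
  then have "bounded_by (V + 1) s" using bounded_by_mono[of V s "V + 1"] by simp
  then show ?case using exec.Skip by blast
next
  case (Assign s a x)
  then have a: "aval I (vars s) a \<le> Suc V" by (intro tame_Assign) (auto simp: bounded_by_def)
  have "exec I N' (Assign x a) s 1 (s\<lparr>vars := (vars s)(x := aval I (vars s) a)\<rparr>)" if "V + 1 \<le> N'" for N'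
    by (rule exec.Assign) (use a that in simp)
  with a Assign.prems show ?case by (auto simp: bounded_by_def le_SucI)
next
  case (New n s a x)
  have n: "n \<le> V" unfolding New.hyps(1) by (rule small_le) (use New.prems in \<open>auto simp: bounded_by_def\<close>)
  have v: "vars s z \<le> V" for z using New.prems by (auto simp: bounded_by_def)
  have f: "fresh s \<le> V" using New.prems by (auto simp: bounded_by_def)
  have w: "w \<le> V" if "heap s b = Some ws" "w \<in> set ws" for b ws w using New.prems that by (auto simp: bounded_by_def)
  have "exec I N' (New x a) s (1 + n) \<lparr>vars = (vars s)(x := fresh s), heap = (heap s)(fresh s \<mapsto> replicate n 0),
        fresh = Suc (fresh s)\<rparr>" if "V + (1 + n) \<le> N'" for N'
    by (rule exec.New) (use n f that New.hyps(1) in auto)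
  moreover have "bounded_by (V + (1 + n)) \<lparr>vars = (vars s)(x := fresh s), heap = (heap s)(fresh s \<mapsto> replicate n 0),
        fresh = Suc (fresh s)\<rparr>"
    using v f w unfolding bounded_by_def by (auto simp: trans_le_add1 le_SucI)
  ultimately show ?case by blast
next
  case (Read s b ws i x)
  then have w: "ws ! aval I (vars s) i \<le> V" by (auto simp: bounded_by_def)
  have "exec I N' (Read x b i) s 1 (s\<lparr>vars := (vars s)(x := ws ! aval I (vars s) i)\<rparr>)" for N'
    by (rule exec.Read) (use Read in auto)
  with w Read.prems show ?case by (auto simp: bounded_by_def le_SucI)
next
  case (Write s b ws i a)
  have a: "aval I (vars s) a \<le> V" by (rule small_le) (use Write.prems in \<open>auto simp: bounded_by_def\<close>)
  have ws: "\<forall>w\<in>set ws. w \<le> V" using Write by (auto simp: bounded_by_def)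
  let ?ws = "ws[aval I (vars s) i := aval I (vars s) a]"
  have ws': "\<forall>w\<in>set ?ws. w \<le> V"
    using a ws set_update_subset_insert[of ws "aval I (vars s) i" "aval I (vars s) a"] by blast
  have "exec I N' (Write b i a) s 1 (s\<lparr>heap := (heap s)(aval I (vars s) b \<mapsto> ?ws)\<rparr>)" if "V + 1 \<le> N'" for N'
    by (rule exec.Write) (use Write a that in auto)
  with ws' Write.prems show ?case by (auto simp: bounded_by_def le_SucI)
next
  case (Free s b ws)
  have "exec I N' (Free b) s 1 (s\<lparr>heap := (heap s)(aval I (vars s) b := None)\<rparr>)" for N'
    by (rule exec.Free) (use Free in auto)
  with Free.prems show ?case by (auto simp: bounded_by_def le_SucI)
next
  case (Seq p s t s' q t' s'')
  have 1: "bounded_by (V + t) s' \<and> (\<forall>N' \<ge> V + t. exec I N' p s t s')" using Seq by simp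
  have 2: "bounded_by (V + t + t') s'' \<and> (\<forall>N' \<ge> V + t + t'. exec I N' q s' t' s'')"
    by (rule Seq.IH(2)) (use Seq.prems 1 in auto)
  have "exec I N' (Seq p q) s (t + t') s''" if "V + (t + t') \<le> N'" for N'
    by (rule exec.Seq[of _ _ _ _ _ s']) (use 1 2 that in auto)
  with 2 show ?case by (simp add: add.assoc)
next
  case (IfTrue s b p t s' q)
  then have 1: "bounded_by (V + t) s' \<and> (\<forall>N' \<ge> V + t. exec I N' p s t s')" by simp
  have "exec I N' (If b p q) s (1 + t) s'" if "V + (1 + t) \<le> N'" for N'
    by (rule exec.IfTrue) (use 1 that IfTrue.hyps(1) in auto)
  with 1 bounded_by_mono[of "V + t" s' "V + (1 + t)"] show ?case by auto
next
  case (IfFalse s b q t s' p)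
  then have 1: "bounded_by (V + t) s' \<and> (\<forall>N' \<ge> V + t. exec I N' q s t s')" by simp
  have "exec I N' (If b p q) s (1 + t) s'" if "V + (1 + t) \<le> N'" for N'
    by (rule exec.IfFalse) (use 1 that IfFalse.hyps(1) in auto)
  with 1 bounded_by_mono[of "V + t" s' "V + (1 + t)"] show ?case by auto
next
  case (WhileFalse s b p)
  then have "bounded_by (V + 1) s" using bounded_by_mono[of V s "V + 1"] by simp
  then show ?case using exec.WhileFalse[OF WhileFalse.hyps(1)] by blast
next
  case (WhileTrue s b p t s' t' s'')
  have 1: "bounded_by (V + t) s' \<and> (\<forall>N' \<ge> V + t. exec I N' p s t s')" using WhileTrue by simp
  have 2: "bounded_by (V + t + t') s'' \<and> (\<forall>N' \<ge> V + t + t'. exec I N' (While b p) s' t' s'')"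
    by (rule WhileTrue.IH(2)) (use WhileTrue.prems 1 in auto)
  show ?case
  proof (intro conjI allI impI)
    show "bounded_by (V + (1 + t + t')) s''" using 2 bounded_by_mono by auto
    fix N' assume "N' \<ge> V + (1 + t + t')"
    then show "exec I N' (While b p) s (1 + t + t') s''"
      using 1 2 WhileTrue.hyps(1) by (intro exec.WhileTrue[of _ _ _ _ _ _ s']) auto
  qed
qed

lemma tame_seqs [simp]: "tame (seqs ps) \<longleftrightarrow> (\<forall>p\<in>set ps. tame p)"
  by (induction ps) auto

lemmas program_defs = KEYOR_def WALKLOOP_def WALK_def SIB_def GBODY_def GROUP_def NEWCELL_def JOIN_def OVERFLOW_def NSPLIT_def NBODY_def NORM_def RPRE_def RPOST_def RLOOP_def REFILL_def FIX_def POP_def SPLITF_def DBODY_def DLOOP_def PREP_def TAKEQ_def CBODY_def CLOOP_def UPKEY_def UPLOOP_def CUT1_def POPQ_def LINKUP_def CUT2_def CUT_def FLUSH_def FLUSHLOOP_def RMBODY_def RMLOOP_def DOREM_def REMOVE_def MBLOOP_def DKEY_def DRLOOP_def DROP_def PUSH_def MLOOP_def NEWL_def APPEND_def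

lemma tame_REMOVE: "tame REMOVE"
  by (simp add: program_defs)

lemma tame_APPEND: "tame APPEND"
  by (simp add: program_defs)

section \<open>Space\<close>

definition wsize :: "cells \<Rightarrow> nat" where
  "wsize M = (\<Sum>x\<in>#M. 1 + length (snd x))"

lemma wsize_simps [simp]: "wsize {#} = 0" "wsize (add_mset x M) = 1 + length (snd x) + wsize M"
  "wsize (M + M') = wsize M + wsize M'"
  by (simp_all add: wsize_def)

text \<open>Addresses are unique, so the multiset of cells is a set and can be indexed by the
  addresses.\<close>

lemma space_st:
  assumes "st s v M"
  shows "space s = wsize M"
proof -
  have h: "heap s a = Some ws \<longleftrightarrow> (a, ws) \<in># M" for a ws using assms by (simp add: st_def)
  have c: "count (image_mset fst M) a \<le> 1" for a using assms by (simp add: st_def)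
  have u: "M = mset_set (set_mset M)"
  proof (rule multiset_eqI)
    fix x
    show "count M x = count (mset_set (set_mset M)) x"
    proof (cases "x \<in># M")
      case True
      then obtain M0 where M0: "M = add_mset x M0" by (metis mset_add)
      have "count (image_mset fst M) (fst x) = Suc (count (image_mset fst M0) (fst x))" unfolding M0 by simp
      then have "count (image_mset fst M0) (fst x) = 0" using c[of "fst x"] by linarith
      then have "fst x \<notin># image_mset fst M0" by (rule not_in_iff[THEN iffD2])
      then have "x \<notin># M0" by auto
      then have "count M x = 1" unfolding M0 by (simp add: not_in_iff)
      then show ?thesis using True by simp
    qed (simp add: not_in_iff)
  qed
  have "wsize M = (\<Sum>x\<in>set_mset M. 1 + length (snd x))"
    unfolding wsize_def by (subst u) (simp add: sum_unfold_sum_mset)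
  also have "\<dots> = (\<Sum>b\<in>dom (heap s). 1 + length (the (heap s b)))"
    by (rule sum.reindex_bij_witness[where i="\<lambda>b. (b, the (heap s b))" and j=fst]) (auto simp: h[symmetric])
  finally show ?thesis by (simp add: space_def)
qed

text \<open>A tree block takes four words, and every tree keeps a reserve of four more. The reserves
  of two children pay for the block and the reserve of their parent. A unary node, at most one per
  height and only on the right spine, adds the term \<open>4 * h\<close>. The bound for single trees
  is an assumption because it is available for one height only when \<open>tok_size\<close> calls
  this lemma in its induction.\<close>

lemma fok_size:
  assumes "\<And>b t p. tok h b t \<Longrightarrow> wsize (fseg [t] p) + 4 \<le> 8 * length (lv t) + (if b then 0 else 4 * h)"
  shows "fok h b f \<Longrightarrow> wsize (fseg f p) + 4 * length f \<le> 8 * length (flv f) + (if b then 0 else 4 * h)"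
proof (induction f)
  case (Cons t f)
  have sp: "wsize (fseg (t # f) p) = wsize (fseg [t] p) + wsize (fseg f p)" by (cases t) simp
  show ?case
  proof (cases "f = []")
    case True
    then show ?thesis using Cons.prems assms[of b t p] by (simp add: fok_single)
  next
    case False
    then have "tok h True t" "fok h b f" using Cons.prems by (auto simp: fok_Cons)
    then show ?thesis using Cons.IH assms[of True t p] sp by simp
  qed
qed simp

lemma tok_size: "tok h b t \<Longrightarrow> wsize (fseg [t] p) + 4 \<le> 8 * length (lv t) + (if b then 0 else 4 * h)"
proof (induction h arbitrary: b t p)
  case 0
  then show ?case by (cases t) simp
next
  case (Suc h)
  obtain a k cs where t: "t = Tr a k cs" by (cases t)
  have k: "cs \<noteq> []" "b \<longrightarrow> 2 \<le> length cs" "fok h b cs" using Suc.prems t unfolding tok_Suc by auto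
  have lc: "1 \<le> length cs" using k(1) by (cases cs) auto
  have "wsize (fseg cs 0) + 4 * length cs \<le> 8 * length (flv cs) + (if b then 0 else 4 * h)"
    by (rule fok_size[OF Suc.IH k(3)])
  moreover have "wsize (fseg [t] p) = 4 + wsize (fseg cs 0)" using t by simp
  moreover have "lv t = flv cs" using t k(1) by (simp add: flv_def)
  ultimately show ?case using k(2) lc by (cases b) auto
qed

text \<open>Eight words per key for the trees and three for the cell of a digit, which holds at
  least one key. The extra term comes from the right spine in the last digit.\<close>

lemma dok_size: "dok h ds \<Longrightarrow> wsize (gseg ds p) \<le> 11 * length (dlv ds) + (if ds = [] then 0 else 4 * (h + length ds)) \<and> length ds \<le> length (dlv ds)"
proof (induction h ds rule: dok.induct)
  case (2 h a d ds)
  have d: "d \<noteq> []" "fok h (ds \<noteq> []) d" "dok (Suc h) ds" using 2 by auto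
  have "1 \<le> length (flv d)" using flv_hd[OF d(2,1)] by auto
  moreover have "wsize (fseg d 0) + 4 * length d \<le> 8 * length (flv d) + (if ds \<noteq> [] then 0 else 4 * h)"
    by (rule fok_size[OF tok_size d(2)])
  ultimately show ?case using 2(1)[OF d(3)] by (cases "ds = []") auto
qed simp

text \<open>Seven words for the block, at most eleven per key and four per digit; the number of
  digits is at most the number of keys, and there is at least one key.\<close>

lemma level_size: "lvok l \<Longrightarrow> lkeys l \<noteq> [] \<Longrightarrow> wsize (lseg [l] p) \<le> 22 * length (lkeys l)"
proof (cases l)
  case (fields a b ds)
  assume l: "lvok l" "lkeys l \<noteq> []"
  have "1 \<le> length (lkeys l)" using l(2) by (cases "lkeys l") auto
  moreover have "wsize (fseg b 0) + 4 * length b \<le> 8 * length (flv b)"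
    using fok_size[OF tok_size, of 0 True b 0] l fields by auto
  moreover have "wsize (gseg ds 0) \<le> 11 * length (dlv ds) + 4 * length ds" "length ds \<le> length (dlv ds)"
    using dok_size[of 0 ds 0] l fields by (auto split: if_splits)
  ultimately show ?thesis using fields by auto
qed

lemma lseg_size: "\<forall>l\<in>set ls. lvok l \<and> lkeys l \<noteq> [] \<Longrightarrow> wsize (lseg ls p) \<le> 22 * sum_list (map length (map lkeys ls))"
proof (induction ls)
  case (Cons l ls)
  have "wsize (lseg (l # ls) p) = wsize (lseg [l] (lp ls p)) + wsize (lseg ls p)"
    using lseg_append[of "[l]" ls p] by simp
  with Cons level_size[of l "lp ls p"] show ?case by simp
qed simp

section \<open>Time bounds\<close>

text \<open>The common measure for a removal: it bounds the number of levels and of digits, hence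
  the potential and the buffers, and the cost of the repair.\<close>

definition logsum :: "nat list list \<Rightarrow> nat" where
  "logsum Ls = sum_list (map (\<lambda>L. Suc (floor_log (length L))) Ls)"

lemma logsum_simps [simp]: "logsum [] = 0" "logsum (L # Ls) = Suc (floor_log (length L)) + logsum Ls"
  by (simp_all add: logsum_def)

lemma length_le_logsum: "length Ls \<le> logsum Ls"
  by (induction Ls) auto

lemma floor_log_le: "floor_log n \<le> n"
proof (cases "n = 0")
  case False
  have "floor_log n < 2 ^ floor_log n" by (rule less_exp)
  also have "\<dots> \<le> n" using False by (intro floor_log_exp2_le) simp
  finally show ?thesis by simp
qed simp

lemma logsum_le: "(\<And>L. L \<in> set Ls \<Longrightarrow> length L \<le> n) \<Longrightarrow> logsum Ls \<le> length Ls * Suc n"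
proof (induction Ls)
  case (Cons L Ls)
  have "floor_log (length L) \<le> n" using floor_log_le[of "length L"] Cons.prems[of L] by simp
  then show ?case using Cons by simp
qed simp

lemma zlen_le: "lvok l \<Longrightarrow> zlen l \<le> Suc (floor_log (length (lkeys l)))"
proof (cases l)
  case (fields a b ds)
  assume l: "lvok l"
  show ?thesis
  proof (cases "ds = []")
    case False
    have "2 ^ (length ds - 1) \<le> length (dlv ds)" by (rule dok_length) (use l fields False in auto)
    then have "2 ^ (length ds - 1) \<le> length (lkeys l)" using fields by simp
    then have "floor_log (2 ^ (length ds - 1)) \<le> floor_log (length (lkeys l))" by (rule floor_log_le_iff)
    then have "length ds - 1 \<le> floor_log (length (lkeys l))" by (simp only: floor_log_power)
    then show ?thesis using fields by simp
  qed (simp add: fields)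
qed

lemma zsum_le: "\<forall>l\<in>set ls. lvok l \<Longrightarrow> zsum ls \<le> logsum (map lkeys ls)"
proof (induction ls)
  case (Cons l ls)
  with zlen_le[of l] show ?case by simp
qed simp

lemma psum_le: "\<forall>l\<in>set ls. lvok l \<Longrightarrow> psum ls \<le> 4 * zsum ls"
proof (induction ls)
  case (Cons l ls)
  have "lpot l \<le> 4 * zlen l" using Cons.prems dok_pot by (cases l) auto
  with Cons show ?case by simp
qed simp

lemma rcost_le: "rcost q Ls \<le> Suc (logsum Ls)"
proof (induction q Ls rule: rcost.induct)
  case (2 q L Ls)
  have "floor_log (length (filter (\<lambda>x. x \<le> hd q) L)) \<le> floor_log (length L)"
    by (intro floor_log_le_iff length_filter_le)
  with 2 show ?case by (auto simp: Let_def)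
qed simp

lemma drc_le: "Ls \<noteq> [] \<Longrightarrow> drc Ls \<le> logsum Ls"
  using rcost_le[of "tl (hd Ls)" "tl Ls"] by (cases Ls) (auto simp: drc_def)

text \<open>The heads are strictly increasing, so there is at most one level per position.\<close>

lemma lok_length: "lok p Ls \<Longrightarrow> (\<And>L. L \<in> set Ls \<Longrightarrow> hd L \<le> n) \<Longrightarrow> p \<le> n \<Longrightarrow> length Ls + p \<le> n"
proof (induction p Ls rule: lok.induct)
  case (2 p L Ls)
  have "length Ls + hd L \<le> n" using 2 by auto
  with 2 show ?case by simp
qed simp

lemma length_levels: "k \<le> length T \<Longrightarrow> length (levels T k P) + k \<le> length T"
proof (rule lok_length[OF lok_levels])
  fix L assume L: "L \<in> set (levels T k P)"
  then have "hd L \<in> set L" using lok_ne[OF lok_levels L] by simp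
  then show "hd L \<le> length T" using levels_bound[OF L] by auto
qed

lemma card_matched_le: "card (matched T k P) \<le> length T - k"
proof -
  have "matched T k P \<subseteq> {k<..length T}" by (auto simp: matched_def)
  then have "card (matched T k P) \<le> card {k<..length T}" by (intro card_mono) auto
  then show ?thesis by simp
qed

lemma length_occs_le: "length (occs T k c) \<le> length T - k"
  unfolding occs_def by (rule order_trans[OF length_filter_le]) (simp del: upt_Suc)

text \<open>\<open>p + k\<close> is the number of updates made so far, and the last factor bounds
  the time of each, hence by how much it can enlarge a word. The start \<open>6 + n\<close> covers
  the constants of the programs and the length of the text, as \<open>exec_tame\<close>
  demands.\<close>

definition word_level :: "nat \<Rightarrow> nat \<Rightarrow> nat \<Rightarrow> nat" where
  "word_level p k n = 6 + n + (p + k) * (5000 * (n + 1)\<^sup>2)"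

text \<open>The words are at most cubic in \<open>X = p + n + 2\<close>. As
  \<open>2 \<le> X\<close>, the constant factor 5004 is at most \<open>X ^ 13\<close>, which
  explains the exponent 16.\<close>

lemma word_level_le:
  assumes "k \<le> n"
  shows "word_level p k n \<le> (p + n + 2) ^ 16"
proof -
  let ?X = "p + n + 2"
  have X: "2 \<le> ?X" by simp
  have "(p + k) * (5000 * (n + 1)\<^sup>2) \<le> ?X * (5000 * ?X\<^sup>2)"
    using assms by (intro mult_mono power_mono) auto
  also have "\<dots> = 5000 * ?X ^ 3" by (simp only: power2_eq_square power3_eq_cube mult.assoc mult.left_commute)
  finally have 1: "(p + k) * (5000 * (n + 1)\<^sup>2) \<le> 5000 * ?X ^ 3" .
  have "6 + n \<le> 4 * ?X" by simp
  also have "\<dots> \<le> 4 * ?X ^ 3" using self_le_power[of ?X 3] by simp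
  finally have "word_level p k n \<le> 5004 * ?X ^ 3" unfolding word_level_def using 1 by linarith
  also have "\<dots> \<le> ?X ^ 13 * ?X ^ 3"
  proof (rule mult_right_mono)
    have "5004 \<le> (2::nat) ^ 13" by simp
    also have "\<dots> \<le> ?X ^ 13" using X by (rule power_mono) simp
    finally show "5004 \<le> ?X ^ 13" .
  qed simp
  also have "\<dots> = ?X ^ 16" by (simp only: power_add[symmetric]) simp
  finally show ?thesis .
qed

section \<open>States that represent two strings\<close>

definition LCS :: lcs_structure where
  "LCS = \<lparr>append_prog = APPEND, remove_prog = REMOVE, query_prog = Skip, result_var = xLAM, word_exponent = 16\<rparr>"

text \<open>The bound on the words belongs to the invariant because the word size allowed for the
  next operation depends on all operations before it.\<close>

definition rep :: "'a list \<Rightarrow> nat \<Rightarrow> 'a list \<Rightarrow> level list \<Rightarrow> state \<Rightarrow> bool" where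
  "rep T k P ls s \<longleftrightarrow> k \<le> length T \<and> st s (vars s) (lseg ls 0) \<and> linv T k P ls (vars s) (lseg ls 0) \<and>
     bounded_by (word_level (length P) k (length T)) s"

text \<open>Replaces the unknown word size of \<open>ok\<close> by an explicit one, the largest word
  at the start plus the running time.\<close>

lemma ok_run:
  assumes "ok I p v M Q" "st s v M" "tame p" "bounded_by V s" "length (fst I) \<le> V" "6 \<le> V"
  obtains t s' v' M' where "\<And>N. V + t \<le> N \<Longrightarrow> exec I N p s t s'" "st s' v' M'" "Q t v' M'" "bounded_by (V + t) s'"
proof -
  obtain N t s' v' M' where 1: "exec I N p s t s'" "st s' v' M'" "Q t v' M'"
    using assms(1,2) unfolding ok_def by blast
  show ?thesis using that[OF _ 1(2,3)] exec_tame[OF 1(1) assms(3-6)] by blast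
qed

lemma rep_append:
  fixes T :: "'a list"
  assumes r: "rep T k P ls s"
  obtains t s' ls' f where "append_step LCS T P c s t s'" "rep T k (P @ [c]) ls' s'"
    "t \<le> 1100 * f + 50 * length ls' + 50 * length (occs T k c) + 60"
    "f + bsum ls' \<le> bsum ls + length (occs T k c)" "f \<le> length (occs T k c) + card (matched T k (P @ [c]))"
proof -
  let ?n = "length T"
  let ?V = "word_level (length P) k ?n"
  have R: "k \<le> ?n" "st s (vars s) (lseg ls 0)" "linv T k P ls (vars s) (lseg ls 0)" "bounded_by ?V s"
    using r by (auto simp: rep_def)
  have V: "length (fst (T, Some c)) \<le> ?V" "6 \<le> ?V" by (simp_all add: word_level_def)
  obtain t s' v' M' where s': "\<And>N. ?V + t \<le> N \<Longrightarrow> exec (T, Some c) N APPEND s t s'" "st s' v' M'"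
    "\<exists>ls' f. linv T k (P @ [c]) ls' v' M' \<and>
     t \<le> 1100 * f + 50 * length ls' + 50 * length (occs T k c) + 60 \<and>
     f + bsum ls' \<le> bsum ls + length (occs T k c) \<and> f \<le> length (occs T k c) + card (matched T k (P @ [c]))" "bounded_by (?V + t) s'"
    by (rule ok_run[OF ok_APPEND[OF R(3), of c] R(2) tame_APPEND R(4) V]) (rule that; assumption)
  obtain ls' f where f: "linv T k (P @ [c]) ls' v' M'" "t \<le> 1100 * f + 50 * length ls' + 50 * length (occs T k c) + 60"
    "f + bsum ls' \<le> bsum ls + length (occs T k c)" "f \<le> length (occs T k c) + card (matched T k (P @ [c]))"
    using s'(3) by blast
  have v': "v' = vars s'" using s'(2) by (simp add: st_def)
  have M': "M' = lseg ls' 0" "length ls' = length (levels T k (P @ [c]))"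
    using f(1) by (auto simp: linv_def dest: arg_cong[of _ _ length])
  have "t \<le> 5000 * (?n + 1)"
  proof -
    have a: "length (occs T k c) \<le> ?n" using length_occs_le[of T k c] by linarith
    have b: "card (matched T k (P @ [c])) \<le> ?n" using card_matched_le[of T k "P @ [c]"] by linarith
    have c: "length ls' \<le> ?n" using length_levels[OF R(1), of "P @ [c]"] M'(2) by linarith
    have "1100 * f \<le> 2200 * ?n" using f(4) a b by simp
    moreover have "50 * length ls' \<le> 50 * ?n" "50 * length (occs T k c) \<le> 50 * ?n" using a c by simp_all
    ultimately have "t \<le> 2300 * ?n + 60" using f(2) by linarith
    then show ?thesis by simp
  qed
  also have "\<dots> \<le> 5000 * (?n + 1)\<^sup>2" by (simp add: power2_eq_square)
  finally have t: "?V + t \<le> word_level (length (P @ [c])) k ?n" by (simp add: word_level_def)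
  show ?thesis
  proof (rule that)
    show "append_step LCS T P c s t s'" unfolding append_step_def word_bound_def
      using s'(1)[OF order_trans[OF t word_level_le[OF R(1)]]] by (simp add: LCS_def)
    show "rep T k (P @ [c]) ls' s'" unfolding rep_def
      using R(1) s'(2) f(1) v' M'(1) bounded_by_mono[OF s'(4) t] by simp
  qed (rule f)+
qed

lemma rep_remove:
  fixes T :: "'a list"
  assumes r: "rep T k P ls s" and k: "k < length T"
  obtains t s' ls' where "remove_step LCS T P s t s'" "rep T (Suc k) P ls' s'"
    "if Suc k \<in> matched T k P then ls \<noteq> [] \<and> bsum ls' = 0 \<and>
       t + 100 * psum ls' \<le> 100 * psum ls + 700 * bsum ls + 8 * length ls + 660 + 3000 * drc (levels T k P)
     else ls' = ls \<and> t \<le> 10"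
    "t \<le> 4768 * logsum (levels T k P) + 10"
proof -
  let ?n = "length T"
  let ?V = "word_level (length P) k ?n"
  have R: "k \<le> ?n" "st s (vars s) (lseg ls 0)" "linv T k P ls (vars s) (lseg ls 0)" "bounded_by ?V s"
    using r by (auto simp: rep_def)
  have T: "fst (T, None) = T" by simp
  have V: "length (fst (T, None)) \<le> ?V" "6 \<le> ?V" by (simp_all add: word_level_def)
  obtain t s' v' M' where s': "\<And>N. ?V + t \<le> N \<Longrightarrow> exec (T, None) N REMOVE s t s'" "st s' v' M'"
    "\<exists>ls'. linv T (Suc k) P ls' v' M' \<and> (if Suc k \<in> matched T k P then ls \<noteq> [] \<and> bsum ls' = 0 \<and>
       t + 100 * psum ls' \<le> 100 * psum ls + 700 * bsum ls + 8 * length ls + 660 + 3000 * drc (levels T k P)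
     else ls' = ls \<and> t \<le> 10)" "bounded_by (?V + t) s'"
    by (rule ok_run[OF ok_REMOVE[OF R(3) T k] R(2) tame_REMOVE R(4) V]) (rule that; assumption)
  obtain ls' where f: "linv T (Suc k) P ls' v' M'" "if Suc k \<in> matched T k P then ls \<noteq> [] \<and> bsum ls' = 0 \<and>
       t + 100 * psum ls' \<le> 100 * psum ls + 700 * bsum ls + 8 * length ls + 660 + 3000 * drc (levels T k P)
     else ls' = ls \<and> t \<le> 10"
    using s'(3) by blast
  have v': "v' = vars s'" using s'(2) by (simp add: st_def)
  have M': "M' = lseg ls' 0" using f(1) by (auto simp: linv_def)
  have I: "map lkeys ls = levels T k P" "\<forall>l\<in>set ls. lvok l" "bsum ls \<le> zsum ls" using R(3) by (auto simp: linv_def)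
  let ?W = "logsum (levels T k P)"
  have len: "length ls = length (levels T k P)" using I(1) by (metis length_map)
  \<comment> \<open>4768 is 400 + 700 + 8 + 660 + 3000: the potential is at most four per digit, the
    buffers hold at most one key per digit, and then follow the pass over the levels, the fixed cost
    and the cuts.\<close>
  have t1: "t \<le> 4768 * ?W + 10"
  proof (cases "Suc k \<in> matched T k P")
    case True
    then have ne: "levels T k P \<noteq> []" using f(2) len by auto
    have z: "zsum ls \<le> ?W" using zsum_le[OF I(2)] I(1) by simp
    have p: "psum ls \<le> 4 * zsum ls" by (rule psum_le[OF I(2)])
    have d: "drc (levels T k P) \<le> ?W" by (rule drc_le[OF ne])
    have l: "length ls \<le> ?W" using length_le_logsum[of "levels T k P"] len by simp
    have o: "1 \<le> ?W" using ne by (cases "levels T k P") auto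
    have "t \<le> 100 * psum ls + 700 * bsum ls + 8 * length ls + 660 + 3000 * drc (levels T k P)" using True f(2) by simp
    then show ?thesis using z p d l o I(3) by linarith
  qed (use f(2) in simp)
  \<comment> \<open>A crude bound, quadratic in the length of the text, is enough for the size of
    the words.\<close>
  have "?W \<le> length (levels T k P) * Suc ?n"
  proof (rule logsum_le)
    fix L assume "L \<in> set (levels T k P)"
    then have "length L \<le> card (matched T k P)" by (rule levels_length)
    then show "length L \<le> ?n" using card_matched_le[of T k P] by linarith
  qed
  also have "\<dots> \<le> ?n * Suc ?n" using length_levels[OF R(1), of P] by (intro mult_right_mono) auto
  finally have "t \<le> 4768 * (?n * Suc ?n) + 10" using t1 by linarith
  also have "\<dots> \<le> 5000 * (?n + 1)\<^sup>2" by (simp add: power2_eq_square)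
  finally have t: "?V + t \<le> word_level (length P) (Suc k) ?n" by (simp add: word_level_def)
  have ks: "Suc k \<le> ?n" using k by simp
  show ?thesis
  proof (rule that)
    show "remove_step LCS T P s t s'" unfolding remove_step_def word_bound_def
      using s'(1)[OF order_trans[OF t word_level_le[OF ks]]] by (simp add: LCS_def)
    show "rep T (Suc k) P ls' s'" unfolding rep_def
      using ks s'(2) f(1) v' M' bounded_by_mono[OF s'(4) t] by simp
  qed (rule f t1)+
qed

lemma rep_empty: "rep T 0 [] [] empty_state"
  by (simp add: rep_def st_def linv_def bounded_by_def empty_state_def word_level_def)

lemma query_step_LCS: "query_step LCS T P s t s' \<longleftrightarrow> t = 1 \<and> s' = s"
  unfolding query_step_def by (auto simp: LCS_def elim: SkipE intro: exec.Skip[unfolded One_nat_def])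

text \<open>The run that \<open>represents\<close> speaks of is arbitrary; as execution is
  deterministic, it is the run constructed for \<open>rep\<close>.\<close>

lemma represents_rep: "represents LCS T P S s \<Longrightarrow> \<exists>k ls. S = drop k T \<and> rep T k P ls s"
proof (induction rule: represents.induct)
  case empty
  show ?case using rep_empty by (intro exI[of _ 0] exI[of _ "[]"]) simp
next
  case (append P S s c t s')
  then obtain k ls where k: "S = drop k T" "rep T k P ls s" by blast
  from rep_append[OF k(2), of c] obtain t1 s1 ls1 where 1: "append_step LCS T P c s t1 s1" "rep T k (P @ [c]) ls1 s1"
    by metis
  have "s1 = s'" using 1(1) append.hyps(2) unfolding append_step_def by (metis exec_deterministic)
  with 1 k show ?case by blast
next
  case (remove P c S s t s')
  then obtain k ls where k: "c # S = drop k T" "rep T k P ls s" by blast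
  have kl: "k < length T" using k(1) by (metis drop_all list.distinct(1) not_le)
  from rep_remove[OF k(2) kl] obtain t1 s1 ls1 where 1: "remove_step LCS T P s t1 s1" "rep T (Suc k) P ls1 s1"
    by metis
  have "s1 = s'" using 1(1) remove.hyps(2) unfolding remove_step_def by (metis exec_deterministic)
  moreover have "S = drop (Suc k) T" using k(1) by (metis drop_Suc list.sel(3) tl_drop)
  ultimately show ?case using 1 by blast
next
  case (query P S s t s')
  then show ?case by (simp add: query_step_LCS)
qed

lemma rep_length: "rep T k P ls s \<Longrightarrow> length ls = lcs_length P (drop k T)"
  unfolding rep_def linv_def lcs_length_levels by (metis length_map)

lemma rep_result: "rep T k P ls s \<Longrightarrow> vars s (result_var LCS) = lcs_length P (drop k T)"
  using rep_length[of T k P ls s] by (simp add: rep_def linv_def LCS_def)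

lemma rep_space: 
  assumes "rep T k P ls s"
  shows "space s \<le> 22 * num_matches P (drop k T)"
proof -
  have I: "map lkeys ls = levels T k P" "\<forall>l\<in>set ls. lvok l" "st s (vars s) (lseg ls 0)"
    using assms by (auto simp: linv_def rep_def)
  have "\<forall>l\<in>set ls. lvok l \<and> lkeys l \<noteq> []"
  proof
    fix l assume l: "l \<in> set ls"
    then have "lkeys l \<in> set (levels T k P)" using I(1) by (metis imageI set_map)
    then show "lvok l \<and> lkeys l \<noteq> []" using lok_ne[OF lok_levels] I(2) l by blast
  qed
  then have "wsize (lseg ls 0) \<le> 22 * sum_list (map length (levels T k P))"
    using lseg_size[of ls 0] I(1) by simp
  then show ?thesis using space_st[OF I(3)] levels_size[of T k P] by linarith
qed

section \<open>Concavity of the logarithm\<close>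

lemma inverse_ln_2_le: "1 / ln 2 \<le> (2::real)"
proof -
  have "ln (1 / 2 :: real) \<le> 1 / 2 - 1" by (rule ln_le_minus_one) simp
  then have "1 / 2 \<le> ln (2::real)" by (simp add: ln_div)
  then show ?thesis by (simp add: field_simps)
qed

text \<open>The tangent of the logarithm at \<open>y\<close>: summing it over all levels replaces Jensen's inequality.\<close>

lemma floor_log_tangent:
  assumes "1 \<le> (y::real)"
  shows "real (floor_log n) \<le> log 2 y + 2 * (real n / y)"
proof (cases "n = 0")
  case True
  then show ?thesis using assms by simp
next
  case False
  then have n: "0 < real n" by simp
  have "real (floor_log n) = log 2 (2 ^ floor_log n)" by simp
  also have "\<dots> \<le> log 2 (real n)"
  proof -
    have "2 ^ floor_log n \<le> n" using False by (intro floor_log_exp2_le) simp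
    then have "real (2 ^ floor_log n) \<le> real n" by (rule of_nat_mono)
    then show ?thesis using n by (subst log_le_cancel_iff) auto
  qed
  finally have 1: "real (floor_log n) \<le> log 2 (real n)" .
  have 2: "log 2 (real n) = log 2 y + ln (real n / y) / ln 2"
    using n assms by (simp add: log_def ln_div diff_divide_distrib)
  have "ln (real n / y) \<le> real n / y - 1" using n assms by (intro ln_le_minus_one) simp
  then have "ln (real n / y) / ln 2 \<le> (real n / y) / ln 2" by (intro divide_right_mono) auto
  also have "\<dots> = (real n / y) * (1 / ln 2)" by simp
  also have "\<dots> \<le> (real n / y) * 2" using inverse_ln_2_le assms by (intro mult_left_mono) auto
  also have "\<dots> = 2 * (real n / y)" by (rule mult.commute)
  finally have "log 2 (real n) \<le> log 2 y + 2 * (real n / y)" unfolding 2 by (rule add_left_mono)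
  with 1 show ?thesis by (rule order_trans)
qed

lemma logsum_tangent:
  assumes "1 \<le> (y::real)"
  shows "real (logsum Ls) \<le> real (length Ls) * (1 + log 2 y) + 2 * (real (sum_list (map length Ls)) / y)"
proof (induction Ls)
  case (Cons L Ls)
  have "real (logsum (L # Ls)) = 1 + real (floor_log (length L)) + real (logsum Ls)" by simp
  also have "\<dots> \<le> 1 + (log 2 y + 2 * (real (length L) / y)) +
      (real (length Ls) * (1 + log 2 y) + 2 * (real (sum_list (map length Ls)) / y))"
    using floor_log_tangent[OF assms, of "length L"] Cons.IH by linarith
  also have "\<dots> = real (length (L # Ls)) * (1 + log 2 y) + 2 * (real (sum_list (map length (L # Ls))) / y)"
    by (simp add: algebra_simps add_divide_distrib)
  finally show ?case .
qed simp

text \<open>The tangent point is \<open>l / lam\<close>, a bound on the average length of a level in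
  the extreme case; there the linear terms add up to at most \<open>2 * lam\<close>.\<close>

lemma logsum_bound:
  fixes lam l :: nat
  assumes "length Ls \<le> lam" "sum_list (map length Ls) \<le> l" "0 < lam" "lam \<le> l"
  shows "real (logsum Ls) \<le> real lam * (3 + log 2 (real l / real lam))"
proof -
  let ?y = "real l / real lam"
  have y: "1 \<le> ?y" using assms by simp
  then have y0: "0 \<le> 1 + log 2 ?y" by simp
  have "real (logsum Ls) \<le> real (length Ls) * (1 + log 2 ?y) + 2 * (real (sum_list (map length Ls)) / ?y)"
    by (rule logsum_tangent[OF y])
  also have "\<dots> \<le> real lam * (1 + log 2 ?y) + 2 * (real l / ?y)"
    using assms y y0 by (intro add_mono mult_right_mono mult_left_mono divide_right_mono) auto
  also have "real l / ?y = real lam" using assms by simp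
  finally show ?thesis by (simp add: algebra_simps)
qed

section \<open>Keys that are moved, and the weight of the levels\<close>

fun moved :: "nat list \<Rightarrow> nat list list \<Rightarrow> nat" where
  "moved q [] = 0"
| "moved q (L # Ls) = (if hd q < hd L then 0
    else length (filter (\<lambda>x. x \<le> hd q) L) + (let r = filter (\<lambda>x. hd q < x) L in if r = [] then 0 else moved r Ls))"

text \<open>The tangent again, at a point \<open>y\<close> that is still free. For a sequence of
  removals it will be \<open>lam\<close>: the logarithm becomes that of \<open>lam\<close>, and the
  linear term is paid by the fall of the weight.\<close>

lemma rcost_moved:
  assumes "1 \<le> (y::real)"
  shows "real (rcost q Ls) \<le> (1 + real (length Ls)) * (1 + log 2 y) + 2 * (real (moved q Ls) / y)"
proof (induction q Ls rule: rcost.induct)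
  case (1 q)
  then show ?case using assms by simp
next
  case (2 q L Ls)
  let ?r = "filter (\<lambda>x. hd q < x) L" and ?m = "filter (\<lambda>x. x \<le> hd q) L"
  have l0: "0 \<le> log 2 y" using assms by simp
  show ?case
  proof (cases "hd q < hd L")
    case True
    have "1 \<le> (1 + real (length (L # Ls))) * (1 + log 2 y)"
      using mult_mono[of 1 "1 + real (length (L # Ls))" 1 "1 + log 2 y"] l0 by simp
    then show ?thesis using True by simp
  next
    case F: False
    note fl = floor_log_tangent[OF assms, of "length ?m"]
    show ?thesis
    proof (cases "?r = []")
      case True
      have "real (rcost q (L # Ls)) = 1 + real (floor_log (length ?m))" using F True by simp
      also have "\<dots> \<le> 1 * (1 + log 2 y) + 2 * (real (length ?m) / y)" using fl by simp
      also have "\<dots> \<le> (1 + real (length (L # Ls))) * (1 + log 2 y) + 2 * (real (moved q (L # Ls)) / y)"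
        using F True l0 by (intro add_mono mult_right_mono) auto
      finally show ?thesis .
    next
      case False
      have ih: "real (rcost ?r Ls) \<le> (1 + real (length Ls)) * (1 + log 2 y) + 2 * (real (moved ?r Ls) / y)"
        by (rule 2) (use F False in auto)
      have "real (rcost q (L # Ls)) = 1 + real (floor_log (length ?m)) + real (rcost ?r Ls)" using F False by (simp add: Let_def)
      also have "\<dots> \<le> (1 + log 2 y + 2 * (real (length ?m) / y)) + ((1 + real (length Ls)) * (1 + log 2 y) + 2 * (real (moved ?r Ls) / y))"
        using fl ih by linarith
      also have "\<dots> = (1 + real (length (L # Ls))) * (1 + log 2 y) + 2 * (real (moved q (L # Ls)) / y)"
        using F False by (simp add: algebra_simps add_divide_distrib Let_def)
      finally show ?thesis .
    qed
  qed
qed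

fun weight :: "nat \<Rightarrow> nat list list \<Rightarrow> nat" where
  "weight i [] = 0"
| "weight i (L # Ls) = i * length L + weight (Suc i) Ls"

lemma weight_mono: "weight i Ls \<le> weight (Suc i) Ls"
  by (induction Ls arbitrary: i) (auto intro: trans_le_add2)

lemma weight_le: "(\<And>L. L \<in> set Ls \<Longrightarrow> length L \<le> n) \<Longrightarrow> weight i Ls \<le> length Ls * ((i + length Ls) * n)"
proof (induction Ls arbitrary: i)
  case (Cons L Ls)
  have "weight (Suc i) Ls \<le> length Ls * ((Suc i + length Ls) * n)" by (rule Cons.IH) (use Cons.prems in auto)
  moreover have "i * length L \<le> (i + length (L # Ls)) * n" using Cons.prems[of L] by (intro mult_mono) auto
  ultimately show ?case by simp
qed simp

text \<open>Every key that is moved ends up one level closer to the front, or disappears.\<close>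

lemma weight_remq: "weight i (remq q Ls) + moved q Ls \<le> weight i (q # Ls)"
proof (induction q Ls arbitrary: i rule: remq.induct)
  case (2 q L Ls)
  let ?r = "filter (\<lambda>x. hd q < x) L" and ?m = "filter (\<lambda>x. x \<le> hd q) L" and ?f = "filter (\<lambda>x. x < hd q) L"
  show ?case
  proof (cases "hd q < hd L")
    case F: False
    have L: "length L = length ?m + length ?r"
      using sum_length_filter_compl[of "\<lambda>x. x \<le> hd q" L] by (simp add: not_le)
    have f: "length ?f \<le> length ?m"
    proof -
      have "?f = filter (\<lambda>x. x < hd q) ?m" by (auto simp: filter_filter intro!: filter_cong)
      then show ?thesis by (metis length_filter_le)
    qed
    then have if_: "i * length ?f \<le> i * length ?m" by simp
    have iL: "i * length L = i * length ?m + i * length ?r" unfolding L by (rule add_mult_distrib2)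
    have w: "weight i (q # L # Ls) = i * length q + (i * length L + length L + weight (Suc (Suc i)) Ls)" by simp
    show ?thesis
    proof (cases "?r = []")
      case True
      have "weight i (remq q (L # Ls)) = i * length ?f + i * length q + weight (Suc i) Ls" "moved q (L # Ls) = length ?m"
        using F True by (simp_all add: add_mult_distrib2)
      then show ?thesis using L if_ iL w weight_mono[of "Suc i" Ls] by linarith
    next
      case False
      have "weight (Suc i) (remq ?r Ls) + moved ?r Ls \<le> weight (Suc i) (?r # Ls)"
        using 2(1)[OF F refl False] .
      moreover have "weight (Suc i) (?r # Ls) = i * length ?r + length ?r + weight (Suc (Suc i)) Ls" by simp
      moreover have "weight i (remq q (L # Ls)) = i * length ?f + i * length q + weight (Suc i) (remq ?r Ls)"
        "moved q (L # Ls) = length ?m + moved ?r Ls"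
        using F False by (simp_all add: Let_def add_mult_distrib2)
      ultimately show ?thesis using L if_ iL w by linarith
    qed
  qed simp
qed simp

lemma length_remq: "length (remq q Ls) \<le> Suc (length Ls)"
  by (induction q Ls rule: remq.induct) (auto simp: Let_def)

lemma sum_length_remq: "sum_list (map length (remq q Ls)) \<le> length q + sum_list (map length Ls)"
proof (induction q Ls rule: remq.induct)
  case (2 q L Ls)
  let ?r = "filter (\<lambda>x. hd q < x) L" and ?f = "filter (\<lambda>x. x < hd q) L"
  have L: "length ?f + length ?r \<le> length L"
  proof -
    have "length ?f \<le> length (filter (\<lambda>x. \<not> hd q < x) L)"
    proof -
      have "?f = filter (\<lambda>x. x < hd q) (filter (\<lambda>x. \<not> hd q < x) L)" by (auto simp: filter_filter intro!: filter_cong)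
      then show ?thesis by (metis length_filter_le)
    qed
    then show ?thesis using sum_length_filter_compl[of "\<lambda>x. hd q < x" L] by linarith
  qed
  show ?case
  proof (cases "hd q < hd L \<or> ?r = []")
    case True
    then show ?thesis using L by auto
  next
    case False
    then have "sum_list (map length (remq ?r Ls)) \<le> length ?r + sum_list (map length Ls)" using 2 by blast
    then show ?thesis using False L by (auto simp: Let_def)
  qed
qed simp

text \<open>The cost of one removal in amortized form, with \<open>2 / y\<close> times the weight as
  potential. The first two parts keep the hypotheses of \<open>rep_remove_run\<close> alive along a
  sequence of removals.\<close>

lemma drop_head_props:
  assumes "Ls \<noteq> []" "1 \<le> (y::real)"
  shows "length (drop_head Ls) \<le> length Ls" "sum_list (map length (drop_head Ls)) \<le> sum_list (map length Ls)"
    "real (drc Ls) + 2 * (real (weight 0 (drop_head Ls)) / y) \<le>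
       (1 + real (length Ls)) * (1 + log 2 y) + 2 * (real (weight 0 Ls) / y)"
proof -
  obtain L Ls' where Ls: "Ls = L # Ls'" using assms(1) by (cases Ls) auto
  let ?q = "tl L"
  show "length (drop_head Ls) \<le> length Ls" using length_remq[of ?q Ls'] Ls by (simp add: drop_head_def)
  show "sum_list (map length (drop_head Ls)) \<le> sum_list (map length Ls)"
    using sum_length_remq[of ?q Ls'] Ls by (auto simp: drop_head_def)
  have l0: "0 \<le> log 2 y" using assms(2) by simp
  show "real (drc Ls) + 2 * (real (weight 0 (drop_head Ls)) / y) \<le>
       (1 + real (length Ls)) * (1 + log 2 y) + 2 * (real (weight 0 Ls) / y)"
  proof (cases "?q = []")
    case True
    have "weight 0 (drop_head Ls) \<le> weight 0 Ls" using True Ls weight_mono[of 0 Ls'] by (simp add: drop_head_def)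
    then have "real (weight 0 (drop_head Ls)) / y \<le> real (weight 0 Ls) / y" using assms(2) by (intro divide_right_mono) auto
    moreover have "1 \<le> (1 + real (length Ls)) * (1 + log 2 y)"
      using mult_mono[of 1 "1 + real (length Ls)" 1 "1 + log 2 y"] l0 by simp
    ultimately show ?thesis using True Ls by (simp add: drc_def)
  next
    case False
    have "weight 0 (drop_head Ls) + moved ?q Ls' \<le> weight 0 Ls"
      using weight_remq[of 0 ?q Ls'] False Ls by (simp add: drop_head_def)
    then have "real (weight 0 (drop_head Ls)) + real (moved ?q Ls') \<le> real (weight 0 Ls)" by linarith
    then have "(real (weight 0 (drop_head Ls)) + real (moved ?q Ls')) / y \<le> real (weight 0 Ls) / y"
      using assms(2) by (intro divide_right_mono) auto
    then have w: "2 * (real (weight 0 (drop_head Ls)) / y) + 2 * (real (moved ?q Ls') / y) \<le> 2 * (real (weight 0 Ls) / y)"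
      by (simp add: add_divide_distrib)
    have "real (drc Ls) \<le> (1 + real (length Ls')) * (1 + log 2 y) + 2 * (real (moved ?q Ls') / y)"
      using rcost_moved[OF assms(2), of ?q Ls'] False Ls by (simp add: drc_def)
    moreover have "(1 + real (length Ls')) * (1 + log 2 y) \<le> (1 + real (length Ls)) * (1 + log 2 y)"
      using Ls l0 by (intro mult_right_mono) auto
    ultimately show ?thesis using w by linarith
  qed
qed

lemma card_matched_num_matches: "card (matched T k P) \<le> num_matches P (drop k T)"
proof (induction P rule: rev_induct)
  case Nil
  then show ?case by (simp add: matched_def)
next
  case (snoc c P)
  have "matched T k (P @ [c]) = matched T k P \<union> set (occs T k c)" by (auto simp: matched_def set_occs)
  then have "card (matched T k (P @ [c])) \<le> card (matched T k P) + card (set (occs T k c))" by (simp add: card_Un_le)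
  also have "\<dots> \<le> num_matches P (drop k T) + length (occs T k c)" using snoc card_length by (intro add_mono)
  finally show ?case by (simp add: num_matches_occs)
qed

lemma matched_Suc: "matched T k P = (if Suc k \<in> matched T k P then insert (Suc k) (matched T (Suc k) P) else matched T (Suc k) P)"
  by (auto simp: matched_def intro: Suc_lessI)

lemma card_matched_Suc: "card (matched T k P) = (if Suc k \<in> matched T k P then Suc (card (matched T (Suc k) P)) else card (matched T (Suc k) P))"
proof -
  have n: "Suc k \<notin> matched T (Suc k) P" by (simp add: matched_def)
  show ?thesis by (subst matched_Suc) (use n in simp)
qed

section \<open>Sequences of operations\<close>

lemma length_levels_mono: "length (levels T k P) \<le> length (levels T k (P @ cs))"
proof (induction cs rule: rev_induct)
  case (snoc c cs)
  have "length (levels T k (P @ cs)) \<le> length (levels T k ((P @ cs) @ [c]))"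
    unfolding levels_snoc by (rule app_length_mono)
  with snoc show ?case by simp
qed simp

text \<open>Every key in a buffer carries 1100 units of credit for being emptied later. With the 50
  units for its own handling, an inserted match pays 1150 in total. The number of levels only grows
  under appends, so the final one bounds the pass over the levels in every step.\<close>

lemma rep_append_run:
  assumes "rep T k P ls s"
  shows "\<exists>t s' ls'. append_run LCS T P cs s t s' \<and> rep T k (P @ cs) ls' s' \<and>
    t + 1100 * bsum ls' + 1150 * num_matches P (drop k T) \<le>
      1100 * bsum ls + 1150 * num_matches (P @ cs) (drop k T) + length cs * (50 * length (levels T k (P @ cs)) + 60)"
  using assms
proof (induction cs arbitrary: P ls s)
  case Nil
  then show ?case by auto
next
  case (Cons c cs)
  obtain t1 s1 ls1 f where 1: "append_step LCS T P c s t1 s1" "rep T k (P @ [c]) ls1 s1"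
    "t1 \<le> 1100 * f + 50 * length ls1 + 50 * length (occs T k c) + 60"
    "f + bsum ls1 \<le> bsum ls + length (occs T k c)"
    by (rule rep_append[OF Cons.prems, of c])
  obtain t2 s2 ls2 where 2: "append_run LCS T (P @ [c]) cs s1 t2 s2" "rep T k ((P @ [c]) @ cs) ls2 s2"
    "t2 + 1100 * bsum ls2 + 1150 * num_matches (P @ [c]) (drop k T) \<le>
      1100 * bsum ls1 + 1150 * num_matches ((P @ [c]) @ cs) (drop k T) + length cs * (50 * length (levels T k ((P @ [c]) @ cs)) + 60)"
    using Cons.IH[OF 1(2)] by blast
  let ?n = "50 * length (levels T k (P @ c # cs)) + 60"
  have e: "(P @ [c]) @ cs = P @ c # cs" by simp
  have nm: "num_matches (P @ [c]) (drop k T) = num_matches P (drop k T) + length (occs T k c)" by (rule num_matches_occs)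
  have "length ls1 = length (levels T k (P @ [c]))" using 1(2) by (auto simp: rep_def linv_def dest: arg_cong[of _ _ length])
  then have l1: "50 * length ls1 + 60 \<le> ?n" using length_levels_mono[of T k "P @ [c]" cs] by simp
  have "1100 * f + 1100 * bsum ls1 \<le> 1100 * bsum ls + 1100 * length (occs T k c)" using 1(4) by linarith
  then have "t1 + t2 + 1100 * bsum ls2 + 1150 * num_matches P (drop k T) \<le>
      1100 * bsum ls + 1150 * num_matches (P @ c # cs) (drop k T) + (length cs * ?n + ?n)"
    using 2(3)[unfolded e] 1(3) l1 nm by linarith
  then have "t1 + t2 + 1100 * bsum ls2 + 1150 * num_matches P (drop k T) \<le>
      1100 * bsum ls + 1150 * num_matches (P @ c # cs) (drop k T) + length (c # cs) * ?n"
    by simp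
  moreover have "append_run LCS T P (c # cs) s (t1 + t2) s2" using 1(1) 2(1) by auto
  ultimately show ?case using 2(2) unfolding e by blast
qed

lemma rep_levels: "rep T k P ls s \<Longrightarrow> map lkeys ls = levels T k P \<and> (\<forall>l\<in>set ls. lvok l) \<and> bsum ls \<le> zsum ls"
  by (simp add: rep_def linv_def)

text \<open>The first bound adds up the cost of the single operations, the second one is amortized over the
  potential of the finger trees and the weight of the levels.\<close>

lemma rep_remove_run:
  fixes lam l :: nat
  assumes "rep T k P ls s" "length (levels T k P) \<le> lam" "sum_list (map length (levels T k P)) \<le> l"
    "0 < lam" "lam \<le> l"
  shows "\<exists>t s'. remove_run LCS T P (length T - k) s t s' \<and>
    real t \<le> real (card (matched T k P)) * (4768 * (real lam * (3 + log 2 (real l / real lam)))) + 10 * real (length T - k) \<and>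
    real t \<le> 100 * real (psum ls) + 700 * real (bsum ls) + 3000 * (2 * (real (weight 0 (levels T k P)) / real lam)) +
      real (card (matched T k P)) * (8 * real lam + 660 + 3000 * ((1 + real lam) * (1 + log 2 (real lam)))) +
      10 * real (length T - k)"
  using assms(1-3)
proof (induction "length T - k" arbitrary: k ls s)
  case 0
  then have "card (matched T k P) = 0" using card_matched_le[of T k P] by linarith
  with 0 show ?case by (simp del: card_eq_0_iff)
next
  case (Suc d)
  have k: "k < length T" and d: "d = length T - Suc k" using Suc.hyps(2) by linarith+
  let ?L = "levels T k P" and ?L' = "levels T (Suc k) P"
  define A where "A = 4768 * (real lam * (3 + log 2 (real l / real lam)))"
  define B where "B = 8 * real lam + 660 + 3000 * ((1 + real lam) * (1 + log 2 (real lam)))"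
  define \<mu> where "\<mu> = real (card (matched T (Suc k) P))"
  obtain t1 s1 ls1 where 1: "remove_step LCS T P s t1 s1" "rep T (Suc k) P ls1 s1"
    "if Suc k \<in> matched T k P then ls \<noteq> [] \<and> bsum ls1 = 0 \<and>
       t1 + 100 * psum ls1 \<le> 100 * psum ls + 700 * bsum ls + 8 * length ls + 660 + 3000 * drc ?L
     else ls1 = ls \<and> t1 \<le> 10"
    "t1 \<le> 4768 * logsum ?L + 10"
    by (rule rep_remove[OF Suc.prems(1) k])
  have len: "length ls = length ?L" using rep_levels[OF Suc.prems(1)] by (metis length_map)
  have y: "1 \<le> real lam" using assms(4) by simp
  have dk: "real (length T - k) = 1 + real (length T - Suc k)" using k by simp
  then have dk10: "10 * real (length T - k) = 10 + 10 * real (length T - Suc k)" by simp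
  have ls: "?L' = (if Suc k \<in> matched T k P then drop_head ?L else ?L)"
    unfolding levels_Suc using hd_levels_iff[OF k, of P] by auto
  have ne: "?L \<noteq> []" if "Suc k \<in> matched T k P" using that hd_levels_iff[OF k, of P] by blast
  have L': "length ?L' \<le> lam" "sum_list (map length ?L') \<le> l"
    using drop_head_props(1,2)[of ?L 1] ne ls Suc.prems(2,3) by (auto split: if_splits)
  obtain t2 s2 where 2: "remove_run LCS T P (length T - Suc k) s1 t2 s2"
    "real t2 \<le> \<mu> * A + 10 * real (length T - Suc k)"
    "real t2 \<le> 100 * real (psum ls1) + 700 * real (bsum ls1) + 3000 * (2 * (real (weight 0 ?L') / real lam)) +
      \<mu> * B + 10 * real (length T - Suc k)"
    using Suc.hyps(1)[OF d 1(2) L'] unfolding A_def B_def \<mu>_def by blast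
  have "length T - k = Suc (length T - Suc k)" using k by simp
  then have run: "remove_run LCS T P (length T - k) s (t1 + t2) s2" using 1(1) 2(1) by auto
  have "real (t1 + t2) \<le> real (card (matched T k P)) * A + 10 * real (length T - k) \<and>
    real (t1 + t2) \<le> 100 * real (psum ls) + 700 * real (bsum ls) + 3000 * (2 * (real (weight 0 ?L) / real lam)) +
      real (card (matched T k P)) * B + 10 * real (length T - k)"
  proof (cases "Suc k \<in> matched T k P")
    case True
    have c: "real (card (matched T k P)) * z = \<mu> * z + z" for z
      using True card_matched_Suc[of T k P] by (simp add: \<mu>_def algebra_simps)
    have lb: "real (logsum ?L) \<le> real lam * (3 + log 2 (real l / real lam))"
      by (rule logsum_bound) (use Suc.prems assms in auto)
    have "real t1 \<le> real (4768 * logsum ?L + 10)" using 1(4) by (rule of_nat_mono)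
    also have "\<dots> \<le> A + 10" unfolding A_def using lb by simp
    finally have a: "real t1 \<le> A + 10" .
    have s: "bsum ls1 = 0" "t1 + 100 * psum ls1 \<le> 100 * psum ls + 700 * bsum ls + 8 * length ls + 660 + 3000 * drc ?L"
      using 1(3) True by auto
    have "real (t1 + 100 * psum ls1) \<le> real (100 * psum ls + 700 * bsum ls + 8 * length ls + 660 + 3000 * drc ?L)"
      using s(2) by (rule of_nat_mono)
    then have t1: "real t1 + 100 * real (psum ls1) \<le> 100 * real (psum ls) + 700 * real (bsum ls) + 8 * real (length ls) + 660 + 3000 * real (drc ?L)"
      by simp
    have "real (drc ?L) + 2 * (real (weight 0 (drop_head ?L)) / real lam) \<le>
       (1 + real (length ?L)) * (1 + log 2 (real lam)) + 2 * (real (weight 0 ?L) / real lam)"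
      by (rule drop_head_props(3)[OF ne[OF True] y])
    moreover have "(1 + real (length ?L)) * (1 + log 2 (real lam)) \<le> (1 + real lam) * (1 + log 2 (real lam))"
      using Suc.prems(2) y by (intro mult_right_mono) auto
    ultimately have dr: "3000 * real (drc ?L) + 3000 * (2 * (real (weight 0 ?L') / real lam)) \<le>
       3000 * ((1 + real lam) * (1 + log 2 (real lam))) + 3000 * (2 * (real (weight 0 ?L) / real lam))"
      using True ls by simp
    have l8: "8 * real (length ls) \<le> 8 * real lam" using len Suc.prems(2) by simp
    have b0: "real (bsum ls1) = 0" using s(1) by simp
    have "real t1 + real t2 \<le> 100 * real (psum ls) + 700 * real (bsum ls) + 3000 * (2 * (real (weight 0 ?L) / real lam)) +
       (\<mu> * B + B) + 10 * real (length T - k)"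
    proof -
      \<comment> \<open>The arithmetic is separated from the concrete terms. Here \<open>c1\<close>
        stands for the total length of the buffers, which a removal that changes something leaves at
        0, so that buffers are charged only once.\<close>
      have "a + b \<le> p + 700 * c + 3000 * (2 * w) + (u + (8 * m + 660 + 3000 * z)) + 10 * (1 + d)"
        if "b \<le> p1 + 700 * c1 + 3000 * (2 * w1) + u + 10 * d" "a + p1 \<le> p + 700 * c + 8 * q + 660 + 3000 * e"
          "3000 * e + 3000 * (2 * w1) \<le> 3000 * z + 3000 * (2 * w)" "8 * q \<le> 8 * m" "c1 = 0"
        for a b p c w u m z d p1 c1 w1 q e :: real
        using that by simp
      from this[OF 2(3) t1 dr l8 b0] show ?thesis unfolding dk B_def .
    qed
    moreover have "real t1 + real t2 \<le> (\<mu> * A + A) + 10 * real (length T - k)"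
      using dk10 2(2) a by linarith
    ultimately show ?thesis unfolding c of_nat_add by blast
  next
    case False
    then have c: "real (card (matched T k P)) = \<mu>" using card_matched_Suc[of T k P] by (simp add: \<mu>_def)
    have e: "ls1 = ls" "real t1 \<le> 10" "?L' = ?L" using 1(3) False ls by auto
    show ?thesis unfolding c of_nat_add using dk10 2(2,3)[unfolded e] e(2) by linarith
  qed
  with run show ?case unfolding A_def B_def by blast
qed

section \<open>The bounds in terms of the two strings\<close>

lemma levels_positive:
  assumes "levels T k P \<noteq> []"
  shows "length (levels T k P) \<le> num_matches P (drop k T)" "0 < card (matched T k P)"
proof -
  have "length Ls \<le> sum_list (map length Ls)" if "\<And>L. L \<in> set Ls \<Longrightarrow> L \<noteq> []" for Ls :: "nat list list"
    using that
  proof (induction Ls)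
    case (Cons L Ls)
    then have "length Ls \<le> sum_list (map length Ls)" "L \<noteq> []" by auto
    then show ?case by (cases L) auto
  qed simp
  then have "length (levels T k P) \<le> sum_list (map length (levels T k P))" using lok_ne[OF lok_levels] by blast
  then show "length (levels T k P) \<le> num_matches P (drop k T)" using levels_size[of T k P] by linarith
  have h: "hd (levels T k P) \<in> set (levels T k P)" using assms by simp
  then have "length (hd (levels T k P)) \<le> card (matched T k P)" by (rule levels_length)
  moreover have "hd (levels T k P) \<noteq> []" using lok_ne[OF lok_levels h] by simp
  ultimately show "0 < card (matched T k P)" by (cases "hd (levels T k P)") auto
qed

lemma remove_bound:
  assumes r: "rep T k P ls s" and k: "k < length T" and lam: "2 \<le> lcs_length P (drop k T)"
    and step: "remove_step LCS T P s t s'"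
  shows "real t \<le> 20000 * (real (lcs_length P (drop k T)) *
    (1 + log 2 (real (num_matches P (drop k T)) / real (lcs_length P (drop k T)))))"
proof -
  obtain t1 s1 where 1: "remove_step LCS T P s t1 s1" "t1 \<le> 4768 * logsum (levels T k P) + 10"
    using rep_remove[OF r k] by metis
  have t: "t1 = t" using 1(1) step unfolding remove_step_def by (metis exec_deterministic)
  let ?lam = "lcs_length P (drop k T)" and ?l = "num_matches P (drop k T)"
  have ll: "length (levels T k P) = ?lam" by (simp add: lcs_length_levels)
  have ne: "levels T k P \<noteq> []" using ll lam by auto
  have le: "?lam \<le> ?l" using levels_positive(1)[OF ne] ll by simp
  have lb: "real (logsum (levels T k P)) \<le> real ?lam * (3 + log 2 (real ?l / real ?lam))"
    by (rule logsum_bound) (use ll levels_size le lam in auto)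
  have g: "0 \<le> log 2 (real ?l / real ?lam)" using le lam by simp
  define x where "x = real ?lam * log 2 (real ?l / real ?lam)"
  have x: "0 \<le> x" unfolding x_def using g by simp
  have "real t \<le> real (4768 * logsum (levels T k P) + 10)" using 1(2) t by simp
  also have "\<dots> \<le> 4768 * (3 * real ?lam + x) + 10" using lb by (simp add: x_def algebra_simps)
  \<comment> \<open>The factor of \<open>lam\<close> is 3 times 4768, that is 14304; the additive 10
    is absorbed since \<open>lam\<close> is at least 2.\<close>
  also have "\<dots> \<le> 20000 * (real ?lam + x)" using x lam by simp
  also have "real ?lam + x = real ?lam * (1 + log 2 (real ?l / real ?lam))" by (simp add: x_def algebra_simps)
  finally show ?thesis .
qed

lemma append_bound:
  assumes r: "rep T k P ls s" and lam: "2 \<le> lcs_length P (drop k T)" and step: "append_step LCS T P c s t s'"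
  shows "real t \<le> 20000 * (real (lcs_length P (drop k T)) + real (length (drop k T)))"
proof -
  obtain t1 s1 ls1 f where 1: "append_step LCS T P c s t1 s1" "rep T k (P @ [c]) ls1 s1"
    "t1 \<le> 1100 * f + 50 * length ls1 + 50 * length (occs T k c) + 60" "f \<le> length (occs T k c) + card (matched T k (P @ [c]))"
    using rep_append[OF r, of c] by metis
  have t: "t1 = t" using 1(1) step unfolding append_step_def by (metis exec_deterministic)
  let ?n = "length (drop k T)"
  have kT: "k \<le> length T" using r by (simp add: rep_def)
  have a: "length (occs T k c) \<le> ?n" "card (matched T k (P @ [c])) \<le> ?n"
    using length_occs_le[of T k c] card_matched_le[of T k "P @ [c]"] by simp_all
  have "length ls1 = length (levels T k (P @ [c]))" using rep_levels[OF 1(2)] by (metis length_map)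
  then have b: "length ls1 \<le> ?n" using length_levels[OF kT, of "P @ [c]"] by simp
  have "1100 * f \<le> 2200 * ?n" using 1(4) a by linarith
  moreover have "50 * length ls1 \<le> 50 * ?n" "50 * length (occs T k c) \<le> 50 * ?n" using a b by linarith+
  ultimately have "t \<le> 2300 * ?n + 60" using 1(3) t by linarith
  also have "\<dots> \<le> 20000 * (lcs_length P (drop k T) + ?n)" using lam by simp
  finally have "real t \<le> real (20000 * (lcs_length P (drop k T) + ?n))" by (rule of_nat_mono)
  then show ?thesis by simp
qed

lemma append_run_bound:
  assumes r: "rep T k [] ls s" and lam: "2 \<le> lcs_length P (drop k T)"
  shows "\<exists>t s'. append_run LCS T [] P s t s' \<and>
    real t \<le> 20000 * (real (length P) * real (lcs_length P (drop k T)) + real (num_matches P (drop k T)))"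
proof -
  let ?lam = "lcs_length P (drop k T)" and ?l = "num_matches P (drop k T)"
  have "ls = []" using rep_levels[OF r] by simp
  then obtain t s' where t: "append_run LCS T [] P s t s'" "t \<le> 1150 * ?l + length P * (50 * ?lam + 60)"
    using rep_append_run[OF r, of P] by (auto simp: lcs_length_levels)
  \<comment> \<open>\<open>60 \<le> 30 * lam\<close> because \<open>lam\<close> is at least
    2.\<close>
  have "length P * (50 * ?lam + 60) \<le> length P * (80 * ?lam)" using lam by (intro mult_left_mono) auto
  also have "\<dots> = 80 * (length P * ?lam)" by simp
  finally have "t \<le> 1150 * ?l + 80 * (length P * ?lam)" using t(2) by linarith
  then have "t \<le> 20000 * (length P * ?lam + ?l)" by simp
  then have "real t \<le> real (20000 * (length P * ?lam + ?l))" by (rule of_nat_mono)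
  with t(1) show ?thesis by auto
qed

text \<open>The two bounds of \<open>rep_remove_run\<close> correspond to the two arguments of the
  inner minimum. The factor in front is the number of matched positions, which is bounded by both
  arguments of the outer one.\<close>

lemma remove_run_bound:
  assumes r: "rep T k P ls s" and lam: "2 \<le> lcs_length P (drop k T)"
  shows "\<exists>t s'. remove_run LCS T P (length (drop k T)) s t s' \<and>
    real t \<le> 20000 * (min (real (length (drop k T))) (real (num_matches P (drop k T))) * real (lcs_length P (drop k T)) *
      (1 + log 2 (min (real (lcs_length P (drop k T))) (real (num_matches P (drop k T)) / real (lcs_length P (drop k T)))))
      + real (length (drop k T)))"
proof -
  let ?lam = "lcs_length P (drop k T)" and ?l = "num_matches P (drop k T)" and ?n = "length (drop k T)"
  let ?L = "levels T k P" and ?\<mu> = "card (matched T k P)"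
  have ll: "length ?L = ?lam" by (simp add: lcs_length_levels)
  have ne: "?L \<noteq> []" using ll lam by auto
  have le: "?lam \<le> ?l" using levels_positive(1)[OF ne] ll by simp
  have lam0: "0 < ?lam" using lam by simp
  obtain t s' where t: "remove_run LCS T P (length T - k) s t s'"
    "real t \<le> real ?\<mu> * (4768 * (real ?lam * (3 + log 2 (real ?l / real ?lam)))) + 10 * real (length T - k)"
    "real t \<le> 100 * real (psum ls) + 700 * real (bsum ls) + 3000 * (2 * (real (weight 0 ?L) / real ?lam)) +
      real ?\<mu> * (8 * real ?lam + 660 + 3000 * ((1 + real ?lam) * (1 + log 2 (real ?lam)))) + 10 * real (length T - k)"
    using rep_remove_run[OF r eq_imp_le[OF ll] levels_size lam0 le] by blast
  have Ll: "length L \<le> ?\<mu>" if "L \<in> set ?L" for L using levels_length[OF that] .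
  have \<mu>0: "1 \<le> ?\<mu>" using levels_positive(2)[OF ne] by simp
  have \<mu>: "real ?\<mu> \<le> min (real ?n) (real ?l)"
    using card_matched_le[of T k P] card_matched_num_matches[of T k P] by simp
  define A where "A = log 2 (real ?l / real ?lam)"
  define B where "B = log 2 (real ?lam)"
  define X where "X = real ?\<mu> * real ?lam"
  have A0: "0 \<le> A" and B0: "0 \<le> B" using le lam by (simp_all add: A_def B_def)
  have X0: "0 \<le> X" by (simp add: X_def)
  have nk: "real (length T - k) = real ?n" by simp
  have t1: "real t \<le> 20000 * (X * (1 + A) + real ?n)"
  proof -
    have "real t \<le> 4768 * (X * (3 + A)) + 10 * real ?n" using t(2) by (simp add: A_def X_def mult.assoc)
    also have "\<dots> \<le> 4768 * (X * (3 * (1 + A))) + 10 * real ?n" using A0 X0 by (intro add_right_mono mult_left_mono) auto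
    also have "\<dots> = 14304 * (X * (1 + A)) + 10 * real ?n" by simp
    also have "\<dots> \<le> 20000 * (X * (1 + A) + real ?n)" using A0 X0 by simp
    finally show ?thesis .
  qed
  have t2: "real t \<le> 20000 * (X * (1 + B) + real ?n)"
  proof -
    have zb: "bsum ls \<le> zsum ls" "psum ls \<le> 4 * zsum ls" "zsum ls \<le> logsum ?L"
      using rep_levels[OF r] psum_le[of ls] zsum_le[of ls] by auto
    have "logsum ?L \<le> length ?L * Suc ?\<mu>" using Ll by (rule logsum_le)
    \<comment> \<open>Removals may start with a full potential and filled buffers. This initial
      credit is of order \<open>lam\<close> times the number of matched positions; there is at least
      one of these, so \<open>Suc\<close> costs only a factor 2.\<close>
    also have "\<dots> \<le> ?lam * (2 * ?\<mu>)" using \<mu>0 ll by (intro mult_mono) auto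
    finally have "100 * psum ls + 700 * bsum ls \<le> 1100 * (?lam * (2 * ?\<mu>))" using zb by linarith
    then have "real (100 * psum ls + 700 * bsum ls) \<le> real (1100 * (?lam * (2 * ?\<mu>)))" by (rule of_nat_mono)
    then have 1: "100 * real (psum ls) + 700 * real (bsum ls) \<le> 2200 * X" by (simp add: X_def mult.commute)
    \<comment> \<open>There are \<open>lam\<close> levels, their indices are below
      \<open>lam\<close>, and each has at most as many keys as there are matched positions. Division
      by the tangent point \<open>lam\<close> brings the initial weight down to
      \<open>X\<close>.\<close>
    have "weight 0 ?L \<le> ?lam * (?lam * ?\<mu>)" using weight_le[of ?L ?\<mu> 0] Ll ll by simp
    then have "real (weight 0 ?L) \<le> real (?lam * (?lam * ?\<mu>))" by (rule of_nat_mono)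
    then have "real (weight 0 ?L) / real ?lam \<le> real (?lam * (?lam * ?\<mu>)) / real ?lam" by (rule divide_right_mono) simp
    also have "\<dots> = X" using lam0 by (simp add: X_def mult.commute)
    finally have 2: "real (weight 0 ?L) / real ?lam \<le> X" .
    have "real ?\<mu> * (8 * real ?lam + 660 + 3000 * ((1 + real ?lam) * (1 + B))) \<le>
        real ?\<mu> * (8 * real ?lam + 330 * real ?lam + 3000 * ((2 * real ?lam) * (1 + B)))"
      using lam B0 by (intro mult_left_mono add_mono mult_right_mono) auto
    also have "\<dots> = 338 * X + 6000 * (X * (1 + B))" by (simp add: X_def algebra_simps)
    finally have 3: "real ?\<mu> * (8 * real ?lam + 660 + 3000 * ((1 + real ?lam) * (1 + B))) \<le> 338 * X + 6000 * (X * (1 + B))" .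
    have 4: "X \<le> X * (1 + B)" using X0 B0 by (simp add: algebra_simps)
    have "real t \<le> 2200 * X + 6000 * X + (338 * X + 6000 * (X * (1 + B))) + 10 * real ?n"
      using t(3)[folded B_def] 1 2 3 nk by linarith
    then show ?thesis using 4 X0 by simp
  qed
  define C where "C = log 2 (min (real ?lam) (real ?l / real ?lam))"
  \<comment> \<open>The minimum is one of its two arguments, and a bound has been proved for
    either.\<close>
  have C: "C = A \<or> C = B" by (auto simp: C_def A_def B_def min_def)
  have C0: "0 \<le> 1 + C" using C A0 B0 by auto
  have "X * (1 + C) \<le> min (real ?n) (real ?l) * real ?lam * (1 + C)"
    unfolding X_def using \<mu> C0 by (intro mult_right_mono) auto
  moreover have "real t \<le> 20000 * (X * (1 + C) + real ?n)" using C t1 t2 by auto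
  ultimately have "real t \<le> 20000 * (min (real ?n) (real ?l) * real ?lam * (1 + C) + real ?n)" by simp
  moreover have "remove_run LCS T P ?n s t s'" using t(1) by simp
  ultimately show ?thesis unfolding C_def by blast
qed

theorem theorem3:
  shows "\<exists>(D :: lcs_structure) (K :: real). \<forall>T :: 'a list.
    (\<forall>P S s. represents D T P S s \<longrightarrow>
       (\<exists>t s'. query_step D T P s t s' \<and> real t \<le> K \<and>
          vars s' (result_var D) = lcs_length P S) \<and>
       (\<forall>c. \<exists>t s'. append_step D T P c s t s') \<and>
       (S \<noteq> [] \<longrightarrow> (\<exists>t s'. remove_step D T P s t s'))) \<and>
    (\<forall>P S s. represents D T P S s \<and> lcs_length P S \<ge> 2 \<longrightarrow>
       (let lam = real (lcs_length P S); l = real (num_matches P S) in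
         real (space s) \<le> K * l \<and>
         (\<forall>c t s'. append_step D T P c s t s' \<longrightarrow>
            real t \<le> K * (lam + real (length S))) \<and>
         (\<forall>c S' t s'. S = c # S' \<and> remove_step D T P s t s' \<longrightarrow>
            real t \<le> K * (lam * (1 + log 2 (l / lam)))))) \<and>
    (\<forall>P S s. represents D T [] S s \<and> lcs_length P S \<ge> 2 \<longrightarrow>
       (let lam = real (lcs_length P S); l = real (num_matches P S) in
         \<exists>t s'. append_run D T [] P s t s' \<and>
            real t \<le> K * (real (length P) * lam + l))) \<and>
    (\<forall>P S s. represents D T P S s \<and> lcs_length P S \<ge> 2 \<longrightarrow>
       (let lam = real (lcs_length P S); l = real (num_matches P S) in
         \<exists>t s'. remove_run D T P (length S) s t s' \<and>
            real t \<le> K * (min (real (length S)) l * lam * (1 + log 2 (min lam (l / lam)))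
                          + real (length S))))"
  unfolding Let_def
\<comment> \<open>20000 exceeds every constant obtained so far. The largest come from removals:
  14304 from adding up single removals and 14538 = 2200 + 6000 + 338 + 6000 from the amortized
  bound.\<close>
proof (intro exI[of _ LCS] exI[of _ "20000 :: real"] allI conjI impI)
  fix T P S :: "'a list" and s
  assume "represents LCS T P S s"
  then obtain k ls where k: "S = drop k T" "rep T k P ls s" using represents_rep by blast
  show "\<exists>t s'. query_step LCS T P s t s' \<and> real t \<le> 20000 \<and> vars s' (result_var LCS) = lcs_length P S"
    using rep_result[OF k(2)] k(1) by (intro exI[of _ 1] exI[of _ s]) (simp add: query_step_LCS)
next
  fix T P S :: "'a list" and s c
  assume "represents LCS T P S s"
  then obtain k ls where "rep T k P ls s" using represents_rep by blast
  then show "\<exists>t s'. append_step LCS T P c s t s'" by (metis rep_append)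
next
  fix T P S :: "'a list" and s
  assume "represents LCS T P S s" and ne: "S \<noteq> []"
  then obtain k ls where k: "S = drop k T" "rep T k P ls s" using represents_rep by blast
  then have "k < length T" using ne by simp
  with k(2) show "\<exists>t s'. remove_step LCS T P s t s'" by (metis rep_remove)
next
  fix T P S :: "'a list" and s
  assume "represents LCS T P S s \<and> 2 \<le> lcs_length P S"
  then obtain k ls where k: "S = drop k T" "rep T k P ls s" and lam: "2 \<le> lcs_length P (drop k T)"
    using represents_rep by blast
  have "real (space s) \<le> real (22 * num_matches P S)" using rep_space[OF k(2)] k(1) by (intro of_nat_mono) simp
  then show "real (space s) \<le> 20000 * real (num_matches P S)" by simp
next
  fix T P S :: "'a list" and s c t s'
  assume "represents LCS T P S s \<and> 2 \<le> lcs_length P S" and st: "append_step LCS T P c s t s'"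
  then obtain k ls where k: "S = drop k T" "rep T k P ls s" and lam: "2 \<le> lcs_length P (drop k T)"
    using represents_rep by blast
  show "real t \<le> 20000 * (real (lcs_length P S) + real (length S))"
    using append_bound[OF k(2) lam st] unfolding k(1) .
next
  fix T P S :: "'a list" and s c S' t s'
  assume r: "represents LCS T P S s \<and> 2 \<le> lcs_length P S" and st: "S = c # S' \<and> remove_step LCS T P s t s'"
  from r obtain k ls where k: "S = drop k T" "rep T k P ls s" and lam: "2 \<le> lcs_length P (drop k T)"
    using represents_rep by blast
  have "k < length T" using st k(1) by (metis drop_all list.distinct(1) not_le)
  from remove_bound[OF k(2) this lam conjunct2[OF st]]
  show "real t \<le> 20000 * (real (lcs_length P S) * (1 + log 2 (real (num_matches P S) / real (lcs_length P S))))"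
    unfolding k(1) .
next
  fix T P S :: "'a list" and s
  assume "represents LCS T [] S s \<and> 2 \<le> lcs_length P S"
  then obtain k ls where k: "S = drop k T" "rep T k [] ls s" and lam: "2 \<le> lcs_length P (drop k T)"
    using represents_rep by blast
  show "\<exists>t s'. append_run LCS T [] P s t s' \<and>
      real t \<le> 20000 * (real (length P) * real (lcs_length P S) + real (num_matches P S))"
    using append_run_bound[OF k(2) lam] unfolding k(1) .
next
  fix T P S :: "'a list" and s
  assume "represents LCS T P S s \<and> 2 \<le> lcs_length P S"
  then obtain k ls where k: "S = drop k T" "rep T k P ls s" and lam: "2 \<le> lcs_length P (drop k T)"
    using represents_rep by blast
  show "\<exists>t s'. remove_run LCS T P (length S) s t s' \<and>
      real t \<le> 20000 * (min (real (length S)) (real (num_matches P S)) * real (lcs_length P S) *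
        (1 + log 2 (min (real (lcs_length P S)) (real (num_matches P S) / real (lcs_length P S)))) + real (length S))"
    using remove_run_bound[OF k(2) lam] unfolding k(1) .
qed

end
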